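(* Let $m\in\mathbb N$, $F\in C^2(\mathbb R^m)$ and $\varphi_1,\dots,\varphi_m\in C^2(\mathbb R^d)$ be such that $\partial_iF$, $\partial_i\partial_jF$ ($1\le i,j\le m$) are bounded on $\mathbb R^m$ and $\partial_k\partial_l\varphi_i$ ($1\le k,l\le d$, $1\le i\le m$) are bounded on $\mathbb R^d$. Let $$u:\mathscr P_2\to\mathbb R,\qquad u(\mu):=F\big(\mu(\varphi_1),\dots,\mu(\varphi_m)\big).$$ Then $u\in\mathscr D(L_{G,\lambda})$ and, for $\Lambda$-a.e. $\mu\in\mathscr P_2$, $$L_{G,\lambda}u(\mu)=\sum_{i=1}^m\partial_iF\big(\mu(\varphi_1),\dots,\mu(\varphi_m)\big)\Big(\mathbb E_G[a(\varphi_i)\,|\,\Psi_\lambda=\mu]-\langle \mathrm{id}_{\mathbb R^d},\nabla^{\mathrm{euc}}\varphi_i\rangle_{T_\mu}\Big)+\sum_{i,j=1}^m\partial_i\partial_jF\big(\mu(\varphi_1),\dots,\mu(\varphi_m)\big)\,\mathbb E_G[b(\varphi_i,\varphi_j)\,|\,\Psi_\lambda=\mu].$$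
   Context: Setting. Fix $d\in\mathbb N$; $\langle x,y\rangle_{\mathrm{euc}}=x^{T}y$, $|x|_{\mathrm{euc}}=\sqrt{x^Tx}$ on $\mathbb R^d$. $\mathscr P_2$ is the space of Borel probability measures on $\mathbb R^d$ with finite second moment, with the $2$-Wasserstein metric and its Borel $\sigma$-algebra. For $\mu\in\mathscr P_2$ let $T_\mu:=L^2(\mathbb R^d,\mu;\mathbb R^d)$ with $\langle f,g\rangle_{T_\mu}=\int\langle f,g\rangle_{\mathrm{euc}}\,d\mu$, and $\mu(\varphi):=\int\varphi\,d\mu$. Fix $\lambda\in\mathscr P_2$ absolutely continuous w.r.t. Lebesgue measure, and let $\Psi_\lambda:T_\lambda\to\mathscr P_2$, $\Psi_\lambda(f)=\lambda\circ f^{-1}$ (push-forward). Let $(A,\mathscr D(A))$ be a self-adjoint, strictly positive operator on $T_\lambda$ whose inverse $A^{-1}:T_\lambda\to T_\lambda$ is trace class, and let $G$ be the centered Gaussian measure on $T_\lambda$ with covariance operator $A^{-1}$, i.e. $\int_{T_\lambda}\langle f_1,g\rangle_{T_\lambda}\langle f_2,g\rangle_{T_\lambda}G(dg)=\langle f_1,A^{-1}f_2\rangle_{T_\lambda}$. Put $\Lambda:=G\circ\Psi_\lambda^{-1}$, a Borel probability measure on $\mathscr P_2$. Class $C_b^1(\mathscr P_2)$. A continuous $u:\mathscr P_2\to\mathbb R$ is intrinsically differentiable if for every $\mu\in\mathscr P_2$ the map $T_\mu\ni f\mapsto D_fu(\mu):=\lim_{\varepsilon\to0}\varepsilon^{-1}\big(u(\mu\circ(\mathrm{id}+\varepsilon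 f)^{-1})-u(\mu)\big)$ is a well-defined bounded linear functional; then $Du(\mu)\in T_\mu$ is defined by $D_fu(\mu)=\langle Du(\mu),f\rangle_{T_\mu}$. $u\in C^1(\mathscr P_2)$ if moreover $|u(\mu\circ(\mathrm{id}+f_n)^{-1})-u(\mu)-D_{f_n}u(\mu)|/\|f_n\|_{T_\mu}\to0$ for all $\mu$ and all (nonzero) $f_n\to0$ in $T_\mu$, and there are $\mu$-versions $\widetilde{Du}(\mu)$ of $Du(\mu)$ such that $(\mu,x)\mapsto\widetilde{Du}(\mu)(x)$ is continuous on $\mathscr P_2\times\mathbb R^d$. $u\in C^1_b(\mathscr P_2)$ if additionally $\sup_{\mu,x}(|u(\mu)|+|\widetilde{Du}(\mu)(x)|_{\mathrm{euc}})<\infty$. Dirichlet form. $(\mathscr E^{G,\lambda},\mathscr D(\mathscr E^{G,\lambda}))$ is the Dirichlet form on $L^2(\mathscr P_2,\Lambda)$ obtained as the closure of the (closable) form $$\mathscr E^{G,\lambda}(u,v)=\int_{T_\lambda}\big\langle Du(\lambda\circ f^{-1})\circ f,\,A^{-1}\big(Dv(\lambda\circ f^{-1})\circ f\big)\big\rangle_{T_\lambda}G(df),\quad u,v\in C_b^1(\mathscr P_2).$$ Its generator $(L_{G,\lambda},\mathscr D(L_{G,\lambda}))$ is the non-positive self-adjoint operator on $L^2(\mathscr P_2,\Lambda)$ with $\mathscr E^{G,\lambda}(u,v)=-\int (L_{G,\lambda}u)\,v\,d\Lambda$ for $u\in\mathscr D(L_{G,\lambda})$, $v\in\mathscr D(\mathscr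 E^{G,\lambda})$. Further notation. $\nabla^{\mathrm{euc}}\varphi$ and $\nabla^{2,\mathrm{euc}}\varphi$ are the Euclidean gradient and Hessian matrix of $\varphi:\mathbb R^d\to\mathbb R$. For $\varphi,\varphi'\in C^2(\mathbb R^d)$ with bounded second partial derivatives, define $b(\varphi,\varphi'),a(\varphi)\in L^2(T_\lambda,G)$ by $$b(\varphi,\varphi')(f)=\langle\nabla^{\mathrm{euc}}\varphi\circ f,A^{-1}(\nabla^{\mathrm{euc}}\varphi'\circ f)\rangle_{T_\lambda},\qquad a(\varphi)(f)=\sum_{n=1}^\infty\langle A^{-1}g_n,(\nabla^{2,\mathrm{euc}}\varphi\circ f)g_n\rangle_{T_\lambda},$$ where $(g_n)_n$ is any orthonormal basis of $T_\lambda$ and $(\nabla^{2,\mathrm{euc}}\varphi\circ f)g_n$ is the pointwise matrix-vector product $x\mapsto\nabla^{2,\mathrm{euc}}\varphi(f(x))g_n(x)$ (so $a(\varphi)(f)$ is the trace of the operator $g\mapsto A^{-1}(\nabla^{2,\mathrm{euc}}\varphi\circ f)g$ on $T_\lambda$). For $w\in L^2(T_\lambda,G)$, $\mu\mapsto\mathbb E_G[w|\Psi_\lambda=\mu]$ is the ($\Lambda$-a.e. unique) measurable function on $\mathscr P_2$ whose composition with $\Psi_\lambda$ is $G$-a.e. equal to the conditional expectation of $w$ under $G$ given the $\sigma$-algebra generated by $\Psi_\lambda$. *)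

theory Defs
  imports "HOL-Probability.Probability"
begin

section \<open>Differentiable functions on Euclidean space\<close>

definition partial :: "'n \<Rightarrow> (real^'n \<Rightarrow> real) \<Rightarrow> real^'n \<Rightarrow> real" where
  "partial k f x = frechet_derivative f (at x) (axis k 1)"

definition C1_fun :: "(real^'n \<Rightarrow> real) \<Rightarrow> bool" where
  "C1_fun f \<longleftrightarrow> (\<forall>x. f differentiable (at x)) \<and> (\<forall>k. continuous_on UNIV (partial k f))"

definition C2_fun :: "(real^'n \<Rightarrow> real) \<Rightarrow> bool" where
  "C2_fun f \<longleftrightarrow> C1_fun f \<and> (\<forall>k. C1_fun (partial k f))"

definition grad :: "(real^'n \<Rightarrow> real) \<Rightarrow> real^'n \<Rightarrow> real^'n" where
  "grad f x = (\<chi> k. partial k f x)"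

definition hessian :: "(real^'n \<Rightarrow> real) \<Rightarrow> real^'n \<Rightarrow> real^'n^'n" where
  "hessian f x = (\<chi> k l. partial k (partial l f) x)"


section \<open>Pseudometric spaces with an explicit carrier\<close>

text \<open>
  The Wasserstein space and the spaces \<open>L\<^sup>2(\<mu>; \<real>\<^sup>d)\<close> depend on parameters and are therefore
  represented by explicit carrier sets. Elements of \<open>L\<^sup>2\<close> are represented by square-integrable
  functions that are not identified when they agree almost everywhere, so that the \<open>L\<^sup>2\<close>-distance
  is only a pseudometric on the carrier. The sets that are open for it are saturated with respect to
  a.e. equality. Hence measures on the \<open>\<sigma>\<close>-algebra below are the same as Borel measures on the
  quotient, and measurable functions the same as Borel functions on the quotient.
\<close>

definition metric_borel :: "'a set \<Rightarrow> ('a \<Rightarrow> 'a \<Rightarrow> real) \<Rightarrow> 'a measure" where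
  "metric_borel S d = sigma S {U. U \<subseteq> S \<and> (\<forall>x\<in>U. \<exists>r>0. \<forall>y\<in>S. d x y < r \<longrightarrow> y \<in> U)}"


section \<open>The Wasserstein space\<close>

definition P2 :: "(real^'d) measure set" where
  "P2 = {\<mu>. prob_space \<mu> \<and> sets \<mu> = sets borel \<and> integrable \<mu> (\<lambda>x. (norm x)\<^sup>2)}"

definition couplings :: "(real^'d) measure \<Rightarrow> (real^'d) measure \<Rightarrow> ((real^'d) \<times> (real^'d)) measure set" where
  "couplings \<mu> \<nu> = {\<pi>. sets \<pi> = sets borel \<and> distr \<pi> borel fst = \<mu> \<and> distr \<pi> borel snd = \<nu>}"

definition W2 :: "(real^'d) measure \<Rightarrow> (real^'d) measure \<Rightarrow> real" where
  "W2 \<mu> \<nu> = sqrt (INF \<pi>\<in>couplings \<mu> \<nu>. \<integral>z. (dist (fst z) (snd z))\<^sup>2 \<partial>\<pi>)"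

definition P2_borel :: "(real^'d) measure measure" where
  "P2_borel = metric_borel P2 W2"


section \<open>Tangent spaces and push-forwards\<close>

definition tangent :: "(real^'d) measure \<Rightarrow> (real^'d \<Rightarrow> real^'d) set" where
  "tangent \<mu> = {f. f \<in> borel_measurable borel \<and> integrable \<mu> (\<lambda>x. (norm (f x))\<^sup>2)}"

definition l2_inner :: "(real^'d) measure \<Rightarrow> (real^'d \<Rightarrow> real^'d) \<Rightarrow> (real^'d \<Rightarrow> real^'d) \<Rightarrow> real" where
  "l2_inner \<mu> f g = (\<integral>x. f x \<bullet> g x \<partial>\<mu>)"

definition l2_norm :: "(real^'d) measure \<Rightarrow> (real^'d \<Rightarrow> real^'d) \<Rightarrow> real" where
  "l2_norm \<mu> f = sqrt (l2_inner \<mu> f f)"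

definition tangent_borel :: "(real^'d) measure \<Rightarrow> (real^'d \<Rightarrow> real^'d) measure" where
  "tangent_borel \<mu> = metric_borel (tangent \<mu>) (\<lambda>f g. l2_norm \<mu> (\<lambda>x. f x - g x))"

definition orthonormal_basis :: "(real^'d) measure \<Rightarrow> (nat \<Rightarrow> real^'d \<Rightarrow> real^'d) \<Rightarrow> bool" where
  "orthonormal_basis \<mu> g \<longleftrightarrow>
     (\<forall>n. g n \<in> tangent \<mu>) \<and>
     (\<forall>i j. l2_inner \<mu> (g i) (g j) = (if i = j then 1 else 0)) \<and>
     (\<forall>f\<in>tangent \<mu>. (\<lambda>N. l2_norm \<mu> (\<lambda>x. f x - (\<Sum>n<N. l2_inner \<mu> f (g n) *\<^sub>R g n x))) \<longlonglongrightarrow> 0)"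

definition push :: "(real^'d) measure \<Rightarrow> (real^'d \<Rightarrow> real^'d) \<Rightarrow> (real^'d) measure" where
  "push \<mu> f = distr \<mu> borel f"


section \<open>Operators on the tangent space\<close>

text \<open>
  An unbounded operator consists of a domain and a map acting on representatives; all operator
  identities hold up to a.e. equality.
\<close>

definition densely_defined_operator ::
  "(real^'d) measure \<Rightarrow> (real^'d \<Rightarrow> real^'d) set \<Rightarrow> ((real^'d \<Rightarrow> real^'d) \<Rightarrow> real^'d \<Rightarrow> real^'d) \<Rightarrow> bool" where
  "densely_defined_operator \<mu> DA A \<longleftrightarrow>
     DA \<subseteq> tangent \<mu> \<and> (\<lambda>x. 0) \<in> DA \<and>
     (\<forall>f\<in>DA. \<forall>g\<in>DA. (\<lambda>x. f x + g x) \<in> DA \<and>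
        (AE x in \<mu>. A (\<lambda>x. f x + g x) x = A f x + A g x)) \<and>
     (\<forall>f\<in>DA. \<forall>c. (\<lambda>x. c *\<^sub>R f x) \<in> DA \<and> (AE x in \<mu>. A (\<lambda>x. c *\<^sub>R f x) x = c *\<^sub>R A f x)) \<and>
     (\<forall>f\<in>DA. \<forall>g\<in>tangent \<mu>. (AE x in \<mu>. f x = g x) \<longrightarrow> g \<in> DA \<and> (AE x in \<mu>. A f x = A g x)) \<and>
     (\<forall>f\<in>DA. A f \<in> tangent \<mu>) \<and>
     (\<forall>f\<in>tangent \<mu>. \<forall>e>0. \<exists>g\<in>DA. l2_norm \<mu> (\<lambda>x. f x - g x) < e)"

text \<open>\<open>A\<close> coincides with its adjoint: the right-hand side of the equivalence says that \<open>f\<close> is in the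
  domain of the adjoint and is mapped to \<open>h\<close> by it.\<close>

definition self_adjoint ::
  "(real^'d) measure \<Rightarrow> (real^'d \<Rightarrow> real^'d) set \<Rightarrow> ((real^'d \<Rightarrow> real^'d) \<Rightarrow> real^'d \<Rightarrow> real^'d) \<Rightarrow> bool" where
  "self_adjoint \<mu> DA A \<longleftrightarrow>
     densely_defined_operator \<mu> DA A \<and>
     (\<forall>f\<in>tangent \<mu>. \<forall>h\<in>tangent \<mu>.
        f \<in> DA \<and> (AE x in \<mu>. A f x = h x) \<longleftrightarrow> (\<forall>g\<in>DA. l2_inner \<mu> (A g) f = l2_inner \<mu> g h))"

definition strictly_positive ::
  "(real^'d) measure \<Rightarrow> (real^'d \<Rightarrow> real^'d) set \<Rightarrow> ((real^'d \<Rightarrow> real^'d) \<Rightarrow> real^'d \<Rightarrow> real^'d) \<Rightarrow> bool" where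
  "strictly_positive \<mu> DA A \<longleftrightarrow>
     (\<forall>f\<in>DA. \<not> (AE x in \<mu>. f x = 0) \<longrightarrow> 0 < l2_inner \<mu> (A f) f)"

definition surjective_operator ::
  "(real^'d) measure \<Rightarrow> (real^'d \<Rightarrow> real^'d) set \<Rightarrow> ((real^'d \<Rightarrow> real^'d) \<Rightarrow> real^'d \<Rightarrow> real^'d) \<Rightarrow> bool" where
  "surjective_operator \<mu> DA A \<longleftrightarrow> (\<forall>h\<in>tangent \<mu>. \<exists>f\<in>DA. AE x in \<mu>. A f x = h x)"

text \<open>A strictly positive operator is injective up to a.e. equality, so its inverse is determined up
  to a.e. equality on its range.\<close>

definition inverse_op ::
  "(real^'d) measure \<Rightarrow> (real^'d \<Rightarrow> real^'d) set \<Rightarrow> ((real^'d \<Rightarrow> real^'d) \<Rightarrow> real^'d \<Rightarrow> real^'d)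
     \<Rightarrow> (real^'d \<Rightarrow> real^'d) \<Rightarrow> real^'d \<Rightarrow> real^'d" where
  "inverse_op \<mu> DA A h = (SOME f. f \<in> DA \<and> (AE x in \<mu>. A f x = h x))"

text \<open>Trace class operators as nuclear operators: \<open>B = \<Sum>\<^sub>j \<langle>b\<^sub>j, \<cdot>\<rangle> a\<^sub>j\<close> with
  \<open>\<Sum>\<^sub>j \<parallel>a\<^sub>j\<parallel> \<parallel>b\<^sub>j\<parallel> < \<infinity>\<close>.\<close>

definition trace_class ::
  "(real^'d) measure \<Rightarrow> ((real^'d \<Rightarrow> real^'d) \<Rightarrow> real^'d \<Rightarrow> real^'d) \<Rightarrow> bool" where
  "trace_class \<mu> B \<longleftrightarrow>
     (\<exists>a b. (\<forall>j::nat. a j \<in> tangent \<mu> \<and> b j \<in> tangent \<mu>) \<and>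
        summable (\<lambda>j. l2_norm \<mu> (a j) * l2_norm \<mu> (b j)) \<and>
        (\<forall>f\<in>tangent \<mu>. B f \<in> tangent \<mu> \<and>
           (\<lambda>N. l2_norm \<mu> (\<lambda>x. B f x - (\<Sum>j<N. l2_inner \<mu> (b j) f *\<^sub>R a j x))) \<longlonglongrightarrow> 0))"


section \<open>Gaussian measures on the tangent space\<close>

text \<open>All continuous linear functionals have a centered normal law, where the point mass at \<open>0\<close> is
  the normal law with variance \<open>0\<close>.\<close>

definition centered_gaussian ::
  "(real^'d) measure \<Rightarrow> (real^'d \<Rightarrow> real^'d) measure \<Rightarrow> bool" where
  "centered_gaussian \<mu> G \<longleftrightarrow>
     prob_space G \<and> sets G = sets (tangent_borel \<mu>) \<and>
     (\<forall>f\<in>tangent \<mu>. distr G borel (\<lambda>g. l2_inner \<mu> f g) = return borel 0 \<or>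
        (\<exists>\<sigma>>0. distr G borel (\<lambda>g. l2_inner \<mu> f g) = density lborel (normal_density 0 \<sigma>)))"

definition has_covariance ::
  "(real^'d) measure \<Rightarrow> (real^'d \<Rightarrow> real^'d) measure \<Rightarrow> ((real^'d \<Rightarrow> real^'d) \<Rightarrow> real^'d \<Rightarrow> real^'d) \<Rightarrow> bool" where
  "has_covariance \<mu> G Q \<longleftrightarrow>
     (\<forall>f1\<in>tangent \<mu>. \<forall>f2\<in>tangent \<mu>.
        integrable G (\<lambda>g. l2_inner \<mu> f1 g * l2_inner \<mu> f2 g) \<and>
        (\<integral>g. l2_inner \<mu> f1 g * l2_inner \<mu> f2 g \<partial>G) = l2_inner \<mu> f1 (Q f2))"

definition image_law :: "(real^'d) measure \<Rightarrow> (real^'d \<Rightarrow> real^'d) measure \<Rightarrow> (real^'d) measure measure" where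
  "image_law lam G = distr G P2_borel (push lam)"


section \<open>Intrinsic differentiability\<close>

text \<open>Functions on \<open>P2\<close> are total functions on measures of which only the values on \<open>P2\<close> matter.\<close>

definition diff_quotient ::
  "((real^'d) measure \<Rightarrow> real) \<Rightarrow> (real^'d) measure \<Rightarrow> (real^'d \<Rightarrow> real^'d) \<Rightarrow> real \<Rightarrow> real" where
  "diff_quotient u \<mu> f \<epsilon> = (u (push \<mu> (\<lambda>x. x + \<epsilon> *\<^sub>R f x)) - u \<mu>) / \<epsilon>"

definition dir_deriv ::
  "((real^'d) measure \<Rightarrow> real) \<Rightarrow> (real^'d) measure \<Rightarrow> (real^'d \<Rightarrow> real^'d) \<Rightarrow> real" where
  "dir_deriv u \<mu> f = Lim (at 0) (diff_quotient u \<mu> f)"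

definition P2_continuous :: "((real^'d) measure \<Rightarrow> real) \<Rightarrow> bool" where
  "P2_continuous u \<longleftrightarrow>
     (\<forall>\<mu>\<in>P2. \<forall>e>0. \<exists>\<delta>>0. \<forall>\<nu>\<in>P2. W2 \<mu> \<nu> < \<delta> \<longrightarrow> \<bar>u \<nu> - u \<mu>\<bar> < e)"

definition intrinsically_differentiable :: "((real^'d) measure \<Rightarrow> real) \<Rightarrow> bool" where
  "intrinsically_differentiable u \<longleftrightarrow>
     P2_continuous u \<and>
     (\<forall>\<mu>\<in>P2.
        (\<forall>f\<in>tangent \<mu>. \<exists>l. (diff_quotient u \<mu> f \<longlongrightarrow> l) (at 0)) \<and>
        (\<forall>f\<in>tangent \<mu>. \<forall>g\<in>tangent \<mu>.
           dir_deriv u \<mu> (\<lambda>x. f x + g x) = dir_deriv u \<mu> f + dir_deriv u \<mu> g) \<and>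
        (\<forall>f\<in>tangent \<mu>. \<forall>c. dir_deriv u \<mu> (\<lambda>x. c *\<^sub>R f x) = c * dir_deriv u \<mu> f) \<and>
        (\<exists>C. \<forall>f\<in>tangent \<mu>. \<bar>dir_deriv u \<mu> f\<bar> \<le> C * l2_norm \<mu> f))"

definition is_intrinsic_grad ::
  "((real^'d) measure \<Rightarrow> real) \<Rightarrow> (real^'d) measure \<Rightarrow> (real^'d \<Rightarrow> real^'d) \<Rightarrow> bool" where
  "is_intrinsic_grad u \<mu> h \<longleftrightarrow>
     h \<in> tangent \<mu> \<and> (\<forall>f\<in>tangent \<mu>. dir_deriv u \<mu> f = l2_inner \<mu> h f)"

definition intrinsic_grad ::
  "((real^'d) measure \<Rightarrow> real) \<Rightarrow> (real^'d) measure \<Rightarrow> real^'d \<Rightarrow> real^'d" where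
  "intrinsic_grad u \<mu> = (SOME h. is_intrinsic_grad u \<mu> h)"

definition continuous_grad_version ::
  "((real^'d) measure \<Rightarrow> real) \<Rightarrow> ((real^'d) measure \<Rightarrow> real^'d \<Rightarrow> real^'d) \<Rightarrow> bool" where
  "continuous_grad_version u v \<longleftrightarrow>
     (\<forall>\<mu>\<in>P2. is_intrinsic_grad u \<mu> (v \<mu>)) \<and>
     (\<forall>\<mu>\<in>P2. \<forall>x. \<forall>e>0. \<exists>\<delta>>0. \<forall>\<nu>\<in>P2. \<forall>y. W2 \<mu> \<nu> < \<delta> \<and> dist x y < \<delta> \<longrightarrow> dist (v \<mu> x) (v \<nu> y) < e)"

definition C1_P2 :: "((real^'d) measure \<Rightarrow> real) set" where
  "C1_P2 = {u. intrinsically_differentiable u \<and>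
     (\<forall>\<mu>\<in>P2. \<forall>f :: nat \<Rightarrow> real^'d \<Rightarrow> real^'d.
        (\<forall>n. f n \<in> tangent \<mu> \<and> l2_norm \<mu> (f n) \<noteq> 0) \<and> (\<lambda>n. l2_norm \<mu> (f n)) \<longlonglongrightarrow> 0 \<longrightarrow>
        (\<lambda>n. \<bar>u (push \<mu> (\<lambda>x. x + f n x)) - u \<mu> - dir_deriv u \<mu> (f n)\<bar> / l2_norm \<mu> (f n)) \<longlonglongrightarrow> 0) \<and>
     (\<exists>v. continuous_grad_version u v)}"

definition C1b_P2 :: "((real^'d) measure \<Rightarrow> real) set" where
  "C1b_P2 = {u\<in>C1_P2. \<exists>v. continuous_grad_version u v \<and>
     (\<exists>C. \<forall>\<mu>\<in>P2. \<forall>x. \<bar>u \<mu>\<bar> + norm (v \<mu> x) \<le> C)}"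


section \<open>The Dirichlet form and its generator\<close>

text \<open>In this section \<open>B\<close> stands for the inverse of the operator \<open>A\<close>.\<close>

definition pre_form ::
  "(real^'d) measure \<Rightarrow> ((real^'d \<Rightarrow> real^'d) \<Rightarrow> real^'d \<Rightarrow> real^'d) \<Rightarrow> (real^'d \<Rightarrow> real^'d) measure
     \<Rightarrow> ((real^'d) measure \<Rightarrow> real) \<Rightarrow> ((real^'d) measure \<Rightarrow> real) \<Rightarrow> real" where
  "pre_form lam B G u v =
     (\<integral>f. l2_inner lam (intrinsic_grad u (push lam f) \<circ> f) (B (intrinsic_grad v (push lam f) \<circ> f)) \<partial>G)"

definition L2_fun :: "'a measure \<Rightarrow> ('a \<Rightarrow> real) set" where
  "L2_fun M = {u. u \<in> borel_measurable M \<and> integrable M (\<lambda>x. (u x)\<^sup>2)}"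

text \<open>The closure of the pre-form: \<open>u\<close> belongs to its domain if some form-Cauchy sequence in
  \<open>C1b_P2\<close> converges to \<open>u\<close> in \<open>L\<^sup>2\<close>; the values of the form are the limits along such
  sequences. That these limits do not depend on the sequences is the closability of the pre-form.\<close>

definition approximating ::
  "(real^'d) measure \<Rightarrow> ((real^'d \<Rightarrow> real^'d) \<Rightarrow> real^'d \<Rightarrow> real^'d) \<Rightarrow> (real^'d \<Rightarrow> real^'d) measure
     \<Rightarrow> (nat \<Rightarrow> (real^'d) measure \<Rightarrow> real) \<Rightarrow> ((real^'d) measure \<Rightarrow> real) \<Rightarrow> bool" where
  "approximating lam B G s u \<longleftrightarrow>
     (\<forall>n. s n \<in> C1b_P2) \<and>
     (\<lambda>n. \<integral>\<mu>. (s n \<mu> - u \<mu>)\<^sup>2 \<partial>image_law lam G) \<longlonglongrightarrow> 0 \<and>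
     (\<forall>e>0. \<exists>N. \<forall>n\<ge>N. \<forall>k\<ge>N. pre_form lam B G (\<lambda>\<mu>. s n \<mu> - s k \<mu>) (\<lambda>\<mu>. s n \<mu> - s k \<mu>) < e)"

definition form_domain ::
  "(real^'d) measure \<Rightarrow> ((real^'d \<Rightarrow> real^'d) \<Rightarrow> real^'d \<Rightarrow> real^'d) \<Rightarrow> (real^'d \<Rightarrow> real^'d) measure
     \<Rightarrow> ((real^'d) measure \<Rightarrow> real) set" where
  "form_domain lam B G = {u\<in>L2_fun (image_law lam G). \<exists>s. approximating lam B G s u}"

definition dirichlet_form ::
  "(real^'d) measure \<Rightarrow> ((real^'d \<Rightarrow> real^'d) \<Rightarrow> real^'d \<Rightarrow> real^'d) \<Rightarrow> (real^'d \<Rightarrow> real^'d) measure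
     \<Rightarrow> ((real^'d) measure \<Rightarrow> real) \<Rightarrow> ((real^'d) measure \<Rightarrow> real) \<Rightarrow> real" where
  "dirichlet_form lam B G u v =
     (THE r. \<forall>s t. approximating lam B G s u \<and> approximating lam B G t v \<longrightarrow>
        (\<lambda>n. pre_form lam B G (s n) (t n)) \<longlonglongrightarrow> r)"

text \<open>The generator is the operator with the largest domain that represents the form.\<close>

definition generator_value ::
  "(real^'d) measure \<Rightarrow> ((real^'d \<Rightarrow> real^'d) \<Rightarrow> real^'d \<Rightarrow> real^'d) \<Rightarrow> (real^'d \<Rightarrow> real^'d) measure
     \<Rightarrow> ((real^'d) measure \<Rightarrow> real) \<Rightarrow> ((real^'d) measure \<Rightarrow> real) \<Rightarrow> bool" where
  "generator_value lam B G u w \<longleftrightarrow>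
     w \<in> L2_fun (image_law lam G) \<and>
     (\<forall>v\<in>form_domain lam B G. dirichlet_form lam B G u v = - (\<integral>\<mu>. w \<mu> * v \<mu> \<partial>image_law lam G))"

definition generator_domain ::
  "(real^'d) measure \<Rightarrow> ((real^'d \<Rightarrow> real^'d) \<Rightarrow> real^'d \<Rightarrow> real^'d) \<Rightarrow> (real^'d \<Rightarrow> real^'d) measure
     \<Rightarrow> ((real^'d) measure \<Rightarrow> real) set" where
  "generator_domain lam B G = {u\<in>form_domain lam B G. \<exists>w. generator_value lam B G u w}"

definition generator ::
  "(real^'d) measure \<Rightarrow> ((real^'d \<Rightarrow> real^'d) \<Rightarrow> real^'d \<Rightarrow> real^'d) \<Rightarrow> (real^'d \<Rightarrow> real^'d) measure
     \<Rightarrow> ((real^'d) measure \<Rightarrow> real) \<Rightarrow> (real^'d) measure \<Rightarrow> real" where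
  "generator lam B G u = (SOME w. generator_value lam B G u w)"


section \<open>The coefficients and conditional expectations given the push-forward\<close>

definition coeff_b ::
  "(real^'d) measure \<Rightarrow> ((real^'d \<Rightarrow> real^'d) \<Rightarrow> real^'d \<Rightarrow> real^'d) \<Rightarrow> (real^'d \<Rightarrow> real) \<Rightarrow> (real^'d \<Rightarrow> real)
     \<Rightarrow> (real^'d \<Rightarrow> real^'d) \<Rightarrow> real" where
  "coeff_b lam B \<phi> \<psi> f = l2_inner lam (grad \<phi> \<circ> f) (B (grad \<psi> \<circ> f))"

definition coeff_a ::
  "(real^'d) measure \<Rightarrow> ((real^'d \<Rightarrow> real^'d) \<Rightarrow> real^'d \<Rightarrow> real^'d) \<Rightarrow> (nat \<Rightarrow> real^'d \<Rightarrow> real^'d)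
     \<Rightarrow> (real^'d \<Rightarrow> real) \<Rightarrow> (real^'d \<Rightarrow> real^'d) \<Rightarrow> real" where
  "coeff_a lam B g \<phi> f = (\<Sum>n. l2_inner lam (B (g n)) (\<lambda>x. hessian \<phi> (f x) *v g n x))"

definition cond_exp_push ::
  "(real^'d) measure \<Rightarrow> (real^'d \<Rightarrow> real^'d) measure \<Rightarrow> ((real^'d \<Rightarrow> real^'d) \<Rightarrow> real)
     \<Rightarrow> (real^'d) measure \<Rightarrow> real" where
  "cond_exp_push lam G w =
     (SOME h. h \<in> borel_measurable P2_borel \<and>
        (AE f in G. h (push lam f) =
           real_cond_exp G (vimage_algebra (space G) (push lam) P2_borel) w f))"

end

theory Submission
  imports Defs
begin

text \<open>
  The Gaussian measure satisfies an integration by parts formula along \<open>B g\<^sub>m\<close>: resampling the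
  coordinate of \<open>f\<close> in this direction leaves \<open>G\<close> invariant, which reduces the formula to dimension one.
  Summed over \<open>m\<close> and applied to \<open>v \<circ> \<Psi>\<close> times the coordinates of the gradient field \<open>U\<close> of the cylinder
  function, it gives \<open>E(u, v) = - \<integral> w v\<close> for all \<open>v\<close> in \<open>C\<^sub>b\<^sup>1\<close>, with \<open>w\<close> the claimed expression before
  conditioning on \<open>\<Psi>\<close>. The same formula tested against smooth cylinder fields on the tangent space shows
  that the form is closable. Bounded cylinder functions, obtained from \<open>F\<close> and the \<open>\<phi>\<^sub>i\<close> by cutting off with
  \<open>c sin (t / c)\<close>, approximate \<open>u\<close> in form norm, and they are dense in \<open>L\<^sup>2\<close>, which determines the generator.
\<close>

text \<open>Three obstacles shape the proof. The intrinsic derivative of v is given only along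
  directions that are functions of the position, whereas partial integration needs
  \<open>v o Psi\<close> to be differentiable along every fixed direction; simple functions bridge
  this gap, as h is a function of X + s h for all but finitely many s. Next, neither u nor its
  gradient is bounded: u grows quadratically and the gradient linearly in the L2 norm, so square
  integrability rests on the fourth moment of the Gaussian norm, which is finite because the
  variances in an orthonormal basis have a finite sum. Finally, density arguments need generators of
  the Borel sets: the coordinates on the tangent space, and the masses of Borel sets on
  \<open>P2\<close>. The latter requires a neighbourhood in the Wasserstein distance to be described
  by finitely many cell masses and one tail of the second moment, through an explicit coupling. The
  trace in a(phi) is handled by the nuclear representation of \<open>B\<close>, which bounds partial
  sums over basis directions uniformly in their number.\<close>

abbreviation (input) limseq :: "(nat => 'a::topological_space) => 'a => bool" ("((_)/ ~~> (_))" [60, 60] 60) where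
 "X ~~> l \<equiv> X \<longlonglongrightarrow> l"

abbreviation "bm \<equiv> borel_measurable"

section \<open>The tangent spaces\<close>

text \<open>Common source of the Cauchy-Schwarz inequalities below: each is this bound for the
  quadratic in t given by the square of x + t y. The leading coefficient may vanish, which covers
  degenerate forms.\<close>

lemma discriminant_bound:
 fixes a b c :: real
 assumes "!!t. 0 <= a + 2 * t * b + t^2 * c"
 shows "b^2 <= a * c"
proof (cases "c = 0")
 case True
 have "b = 0"
 proof (rule ccontr)
  assume "b ~= 0"
  have "0 <= a + 2 * (- (a + 1) / (2 * b)) * b" using assms[of "- (a + 1) / (2 * b)"] True by simp
  also have "... = -1" using \<open>b ~= 0\<close> by (simp add: field_simps)
  finally show False by simp
 qed
 then show ?thesis using True by simp
next
 case False
 have "0 <= c"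
 proof (rule ccontr)
  assume "~ 0 <= c"
  then have c: "c < 0" by simp
  \<comment> \<open>For negative \<open>c\<close> any t with t (-c) above |a| + 2 |b| makes the
    value negative; the final 1 ensures t >= 1, so that |a| <= t |a|.\<close>
  define t where "t = (abs a + abs b * 2 + 1) / (- c) + 1"
  have t1: "t >= 1" unfolding t_def using c by (simp add: divide_nonneg_neg divide_nonneg_pos)
  have tc: "t * (-c) >= abs a + 2 * abs b + 1" unfolding t_def using c by (simp add: field_simps)
  have "a + 2 * t * b + t^2 * c <= t * abs a + 2 * t * abs b - t * (t * (-c))"
  proof -
   have "a <= t * abs a" using t1 mult_right_mono[of 1 t "abs a"] by linarith
   moreover have "2 * t * b <= 2 * t * abs b" using t1 by simp
   ultimately show ?thesis by (simp add: power2_eq_square)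
  qed
  also have "... <= t * abs a + 2 * t * abs b - t * (abs a + 2 * abs b + 1)"
   using mult_left_mono[OF tc, of t] t1 by linarith
  also have "... < 0" using t1 by (simp add: algebra_simps)
  finally show False using assms[of t] by linarith
 qed
 then have c: "c > 0" using False by simp
 have "0 <= a + 2 * (- b / c) * b + (- b / c)^2 * c" by (rule assms)
 also have "... = a - b^2 / c" using c by (simp add: power2_eq_square field_simps)
 finally show ?thesis using c by (simp add: field_simps)
qed

locale l2_space =
 fixes lam :: "(real^'d) measure"
 assumes lam: "lam : P2"
begin

abbreviation "T \<equiv> tangent lam"
abbreviation "ip \<equiv> l2_inner lam"
abbreviation "Psi \<equiv> push lam"
abbreviation "nm \<equiv> l2_norm lam"

lemma prob: "prob_space lam" and sets_lam [measurable_cong]: "sets lam = sets borel"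
 and second_moment: "integrable lam (%x. (norm x)^2)"
 using lam by (auto simp: P2_def)

sublocale prob_space lam by (rule prob)

lemma space_lam [simp]: "space lam = UNIV"
 using sets_eq_imp_space_eq[OF sets_lam] by simp

lemma T_measurable: "f : T ==> f : bm borel"
 and T_measurable_lam: "f : T ==> f : bm lam"
 and T_integrable: "f : T ==> integrable lam (%x. (norm (f x))^2)"
 by (auto simp: tangent_def measurable_cong_sets[OF sets_lam refl])

lemma T_I: "f : bm borel ==> integrable lam (%x. (norm (f x))^2) ==> f : T"
 by (simp add: tangent_def)

lemma T_dominated:
 assumes "f : bm borel" "integrable lam k" "!!x. (norm (f x))^2 <= k x"
 shows "f : T"
proof (rule T_I[OF assms(1)])
 have [measurable]: "f : bm lam" using assms(1) measurable_cong_sets[OF sets_lam refl] by auto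
 have "norm ((norm (f x))^2) <= norm (k x)" for x using assms(3)[of x] zero_le_power2[of "norm (f x)"] by (auto simp: abs_le_iff)
 then show "integrable lam (%x. (norm (f x))^2)"
  using Bochner_Integration.integrable_bound[OF assms(2), of "%x. (norm (f x))^2"] by simp
qed

lemma T_bounded:
 assumes "f : bm borel" "!!x. norm (f x) <= C"
 shows "f : T"
proof (rule T_dominated[OF assms(1)])
 show "integrable lam (%x. C^2)" by simp
 show "(norm (f x))^2 <= C^2" for x using assms(2)[of x] by (simp add: power_mono)
qed

lemma T_id: "(%x. x) : T" using second_moment by (simp add: T_I)

lemma T_zero [simp]: "(%x. 0) : T" by (simp add: T_I)

lemma T_scale: "f : T ==> (%x. c *\<^sub>R f x) : T"
 by (auto simp: tangent_def power_mult_distrib)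

lemma T_add: assumes "f : T" "h : T" shows "(%x. f x + h x) : T"
proof (rule T_dominated)
 show "(%x. f x + h x) : bm borel" using assms[THEN T_measurable] by measurable
 show "integrable lam (%x. 2 * (norm (f x))^2 + 2 * (norm (h x))^2)"
  using assms[THEN T_integrable] by simp
 show "(norm (f x + h x))^2 <= 2 * (norm (f x))^2 + 2 * (norm (h x))^2" for x
 proof -
  have "(norm (f x + h x))^2 <= (norm (f x) + norm (h x))^2" by (simp add: norm_triangle_ineq power_mono)
  also have "... <= 2 * (norm (f x))^2 + 2 * (norm (h x))^2"
   using sum_squares_bound[of "norm (f x)" "norm (h x)"] by (simp add: power2_sum)
  finally show ?thesis .
 qed
qed

lemma T_uminus: "f : T ==> (%x. - f x) : T" using T_scale[of f "-1"] by simp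

lemma T_diff: "f : T ==> h : T ==> (%x. f x - h x) : T"
 using T_add[of f "%x. - h x"] T_uminus[of h] by simp

lemma T_sum: "(!!i. i : I ==> f i : T) ==> (%x. \<Sum>i\<in>I. f i x) : T"
 by (induction I rule: infinite_finite_induct) (auto intro: T_add)

lemma inner_integrable:
 assumes "f : T" "h : T" shows "integrable lam (%x. f x \<bullet> h x)"
proof (rule Bochner_Integration.integrable_bound)
 show "integrable lam (%x. (norm (f x))^2 + (norm (h x))^2)" using assms[THEN T_integrable] by simp
 show "(%x. f x \<bullet> h x) : bm lam" using assms[THEN T_measurable_lam] by measurable
 show "AE x in lam. norm (f x \<bullet> h x) <= norm ((norm (f x))^2 + (norm (h x))^2)"
 proof (rule AE_I2)
  fix x
  have "abs (f x \<bullet> h x) <= norm (f x) * norm (h x)" by (rule Cauchy_Schwarz_ineq2)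
  also have "... <= (norm (f x))^2 + (norm (h x))^2"
   using sum_squares_bound[of "norm (f x)" "norm (h x)"] mult_nonneg_nonneg[OF norm_ge_zero[of "f x"] norm_ge_zero[of "h x"]]
   by linarith
  finally show "norm (f x \<bullet> h x) <= norm ((norm (f x))^2 + (norm (h x))^2)" by simp
 qed
qed

section \<open>Inner product and norm of the tangent space\<close>

lemma ip_sym: "ip f h = ip h f" by (simp add: l2_inner_def inner_commute)

lemma ip_add_left: "f : T ==> f' : T ==> h : T ==> ip (%x. f x + f' x) h = ip f h + ip f' h"
 by (simp add: l2_inner_def inner_add_left inner_integrable)

lemma ip_diff_left: "f : T ==> f' : T ==> h : T ==> ip (%x. f x - f' x) h = ip f h - ip f' h"
 by (simp add: l2_inner_def inner_diff_left inner_integrable)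

lemma ip_scale_left: "ip (%x. c *\<^sub>R f x) h = c * ip f h"
 by (simp add: l2_inner_def)

lemma ip_sum_left:
 "(!!i. i : I ==> f i : T) ==> h : T ==> ip (%x. \<Sum>i\<in>I. f i x) h = (\<Sum>i\<in>I. ip (f i) h)"
 by (simp add: l2_inner_def inner_sum_left inner_integrable)

lemma ip_add_right: "f : T ==> f' : T ==> h : T ==> ip h (%x. f x + f' x) = ip h f + ip h f'"
 unfolding ip_sym[of h] by (rule ip_add_left)

lemma ip_diff_right: "f : T ==> f' : T ==> h : T ==> ip h (%x. f x - f' x) = ip h f - ip h f'"
 unfolding ip_sym[of h] by (rule ip_diff_left)

lemma ip_scale_right: "ip h (%x. c *\<^sub>R f x) = c * ip h f"
 unfolding ip_sym[of h] by (rule ip_scale_left)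

lemma ip_sum_right:
 "(!!i. i : I ==> f i : T) ==> h : T ==> ip h (%x. \<Sum>i\<in>I. f i x) = (\<Sum>i\<in>I. ip h (f i))"
 unfolding ip_sym[of h] by (rule ip_sum_left)

lemma ip_zero_left [simp]: "ip (%x. 0) h = 0" and ip_zero_right [simp]: "ip h (%x. 0) = 0"
 by (simp_all add: l2_inner_def)

lemma ip_cong_AE:
 assumes "AE x in lam. f x = f' x" "AE x in lam. h x = h' x" "f : T" "f' : T" "h : T" "h' : T"
 shows "ip f h = ip f' h'"
 unfolding l2_inner_def
proof (rule integral_cong_AE)
 show "(%x. f x \<bullet> h x) : bm lam" using assms(3,5)[THEN T_measurable_lam] by measurable
 show "(%x. f' x \<bullet> h' x) : bm lam" using assms(4,6)[THEN T_measurable_lam] by measurable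
 show "AE x in lam. f x \<bullet> h x = f' x \<bullet> h' x" using assms(1,2) by eventually_elim simp
qed

lemma ip_self_nonneg: "0 <= ip f f" by (simp add: l2_inner_def)

lemma ip_self: "ip f f = (LINT x|lam. (norm (f x))^2)"
 by (simp add: l2_inner_def power2_norm_eq_inner)

lemma nm_nonneg [simp]: "0 <= nm f" by (simp add: l2_norm_def ip_self_nonneg)

lemma nm_power2: "(nm f)^2 = ip f f" by (simp add: l2_norm_def ip_self_nonneg)

lemma nm_power2_integral: "(nm f)^2 = (LINT x|lam. (norm (f x))^2)" by (simp add: nm_power2 ip_self)

lemma ip_bound:
 assumes "f : T" "h : T" shows "abs (ip f h) <= nm f * nm h"
proof -
 have "0 <= ip f f + 2 * t * ip f h + t^2 * ip h h" for t
 proof -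
  have "ip f f + 2 * t * ip f h + t^2 * ip h h = ip (%x. f x + t *\<^sub>R h x) (%x. f x + t *\<^sub>R h x)"
   using assms by (simp add: ip_add_left ip_add_right ip_scale_left ip_scale_right T_add T_scale
    ip_sym[of h f] power2_eq_square algebra_simps)
  then show ?thesis by (simp add: ip_self_nonneg)
 qed
 then have "(ip f h)^2 <= ip f f * ip h h" by (rule discriminant_bound)
 then have "abs (ip f h) <= sqrt (ip f f * ip h h)" by (metis real_sqrt_abs real_sqrt_le_iff)
 then show ?thesis by (simp add: l2_norm_def real_sqrt_mult)
qed

lemma nm_scale: "nm (%x. c *\<^sub>R f x) = abs c * nm f"
 by (simp add: l2_norm_def ip_scale_left ip_scale_right real_sqrt_mult flip: mult.assoc)

lemma nm_minus_commute: "nm (%x. f x - h x) = nm (%x. h x - f x)"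
 using nm_scale[of "-1" "%x. f x - h x"] by simp

lemma nm_zero [simp]: "nm (%x. 0) = 0" by (simp add: l2_norm_def)

lemma nm_triangle:
 assumes "f : T" "h : T" shows "nm (%x. f x + h x) <= nm f + nm h"
proof (rule power2_le_imp_le)
 have "(nm (%x. f x + h x))^2 = (nm f)^2 + 2 * ip f h + (nm h)^2"
  using assms by (simp add: nm_power2 ip_add_left ip_add_right T_add ip_sym[of h f])
 also have "... <= (nm f)^2 + 2 * (nm f * nm h) + (nm h)^2" using ip_bound[OF assms] by simp
 finally show "(nm (%x. f x + h x))^2 <= (nm f + nm h)^2" by (simp add: power2_sum)
qed simp

lemma nm_diff_triangle:
 assumes "f : T" "h : T" shows "nm (%x. f x - h x) <= nm f + nm h"
 using nm_triangle[OF assms(1) T_uminus[OF assms(2)]] nm_scale[of "-1" h] by simp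

lemma nm_triangle_diff:
 assumes "f : T" "h : T" shows "nm f <= nm h + nm (%x. f x - h x)"
 using nm_triangle[OF assms(2) T_diff[OF assms]] by simp

lemma nm_triangle_abs:
 assumes "f : T" "h : T" shows "abs (nm f - nm h) <= nm (%x. f x - h x)"
 using nm_triangle_diff[OF assms] nm_triangle_diff[OF assms(2,1)] nm_minus_commute[of f h] by linarith

lemma nm_mono:
 assumes "h : T" "f : bm borel" "!!x. norm (f x) <= C * norm (h x)" "C >= 0"
 shows "f : T" "nm f <= C * nm h"
proof -
 have *: "(norm (f x))^2 <= C^2 * (norm (h x))^2" for x
  using power_mono[OF assms(3)[of x] norm_ge_zero, of 2] by (simp add: power_mult_distrib)
 show T: "f : T" by (rule T_dominated[OF assms(2) _ *]) (use T_integrable[OF assms(1)] in simp)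
 have "(nm f)^2 <= (C * nm h)^2"
  unfolding power_mult_distrib nm_power2_integral
  using integral_mono[OF T_integrable[OF T], of "%x. C^2 * (norm (h x))^2"] * T_integrable[OF assms(1)] by simp
 then show "nm f <= C * nm h" using assms(4) by (meson nm_nonneg mult_nonneg_nonneg power2_le_imp_le)
qed

text \<open>The comparison is with a constant unit field, whose norm is 1 because \<open>lam\<close>
  is a probability measure. Here and below \<open>axis undefined 1\<close> serves as an arbitrary
  unit vector.\<close>

lemma nm_bounded:
 assumes "f : bm borel" "!!x. norm (f x) <= C" "C >= 0"
 shows "nm f <= C"
proof -
 have "nm f <= C * nm (%x. axis undefined 1)"
  by (rule nm_mono) (use assms in \<open>auto simp: norm_axis_1 intro: T_bounded[where C=1]\<close>)
 also have "nm (%x. axis undefined 1) = 1"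
  using prob_space by (simp add: l2_norm_def l2_inner_def inner_axis_axis)
 finally show ?thesis by simp
qed

text \<open>Cauchy-Schwarz against the constant unit field; the scalar \<open>norm (f x)\<close> is
  first turned into a field along a fixed unit vector.\<close>

lemma integral_norm_bound: assumes "f : T" shows "integrable lam (%x. norm (f x))" "(LINT x|lam. norm (f x)) <= nm f"
proof -
 let ?a = "%x. norm (f x) *\<^sub>R axis undefined 1"
 have T: "?a : T" "(%x. axis undefined 1) : T"
  using assms by (auto simp: tangent_def norm_axis_1)
 have eq: "(%x. norm (f x)) = (%x. (norm (f x) *\<^sub>R axis undefined 1) \<bullet> (axis undefined 1 :: real^'d))"
  by (simp add: inner_axis_axis)
 show "integrable lam (%x. norm (f x))" unfolding eq by (rule inner_integrable[OF T])
 have "(LINT x|lam. norm (f x)) <= nm ?a * nm (%x. axis undefined 1 :: real^'d)"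
  using ip_bound[OF T] unfolding l2_inner_def eq[symmetric] by simp
 also have "... = nm f" by (simp add: l2_norm_def l2_inner_def inner_axis_axis power2_norm_eq_inner prob_space[unfolded space_lam] flip: power2_eq_square)
 finally show "(LINT x|lam. norm (f x)) <= nm f" .
qed

lemma AE_zero_of_ip: assumes "f : T" "ip f f = 0" shows "AE x in lam. f x = 0"
proof -
 have "AE x in lam. (norm (f x))^2 = 0"
  using assms integral_nonneg_eq_0_iff_AE[OF T_integrable[OF assms(1)]] by (simp add: ip_self)
 then show ?thesis by simp
qed

end

subsection \<open>Orthonormal bases\<close>

locale l2_basis = l2_space lam for lam :: "(real^'d) measure" +
 fixes g :: "nat => real^'d => real^'d"
 assumes onb: "orthonormal_basis lam g"
begin

lemma g_T [simp]: "g n : T" using onb by (simp add: orthonormal_basis_def)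

lemma g_ortho: "ip (g i) (g j) = (if i = j then 1 else 0)" using onb by (simp add: orthonormal_basis_def)

definition proj :: "nat => (real^'d => real^'d) => real^'d => real^'d" where
 "proj N f = (%x. \<Sum>n<N. ip f (g n) *\<^sub>R g n x)"

lemma proj_T [simp]: "proj N f : T" unfolding proj_def by (intro T_sum T_scale) simp

lemma proj_tendsto: "f : T ==> (%N. nm (%x. f x - proj N f x)) ~~> 0"
 using onb by (simp add: orthonormal_basis_def proj_def)

lemma ip_proj_left: "h : T ==> ip (proj N f) h = (\<Sum>n<N. ip f (g n) * ip h (g n))"
 unfolding proj_def by (subst ip_sum_left) (auto intro: T_scale simp: ip_scale_left ip_sym[of h])

lemma ip_proj_proj: "ip (proj N f) (proj N f) = (\<Sum>n<N. (ip f (g n))^2)"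
proof -
 have "ip (proj N f) (g n) = ip f (g n)" if "n < N" for n
  using that by (simp add: ip_proj_left g_ortho if_distrib sum.delta cong: if_cong)
 then show ?thesis by (simp add: ip_proj_left power2_eq_square)
qed

lemma parseval: assumes "f : T" "h : T" shows "(%n. ip f (g n) * ip h (g n)) sums ip f h"
 unfolding sums_def
proof (rule LIMSEQ_I)
 fix r :: real assume "0 < r"
 then have "0 < r / (nm h + 1)" by (simp add: add_nonneg_pos)
 with proj_tendsto[OF assms(1)] obtain M where M: "!!N. N >= M ==> nm (%x. f x - proj N f x) < r / (nm h + 1)"
  unfolding LIMSEQ_def dist_real_def by (metis abs_of_nonneg diff_zero nm_nonneg)
 let ?a = "%N. (\<Sum>n<N. ip f (g n) * ip h (g n)) - ip f h"
 show "EX no. ALL N>=no. norm (?a N) < r"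
 proof (intro exI allI impI)
  fix N assume "M <= N"
  have "norm (?a N) = abs (ip (%x. f x - proj N f x) h)"
   using assms by (simp add: ip_diff_left ip_proj_left)
  also have "... <= nm (%x. f x - proj N f x) * nm h" using assms by (intro ip_bound T_diff) auto
  also have "... <= r / (nm h + 1) * nm h" using M[OF \<open>M <= N\<close>] by (intro mult_right_mono) auto
  also have "... < r" using \<open>0 < r\<close> by (simp add: field_simps add_nonneg_pos add_pos_nonneg)
  finally show "norm (?a N) < r" .
 qed
qed

lemma bessel: assumes "f : T" shows "(\<Sum>n<N. (ip f (g n))^2) <= (nm f)^2"
 using sum_le_suminf[OF sums_summable[OF parseval[OF assms assms]], of "{..<N}"]
  sums_unique[OF parseval[OF assms assms]] by (simp add: nm_power2) (simp add: power2_eq_square)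

text \<open>Absolute values inside the sum and a bound free of \<open>N\<close>: this is the form in
  which sums over basis directions are dominated later.\<close>

lemma bessel2: assumes "f : T" "h : T" shows "(\<Sum>n<N. abs (ip f (g n) * ip h (g n))) <= nm f * nm h"
proof -
 have "(\<Sum>n<N. abs (ip f (g n)) * abs (ip h (g n))) <= L2_set (%n. ip f (g n)) {..<N} * L2_set (%n. ip h (g n)) {..<N}"
  by (rule L2_set_mult_ineq)
 also have "... <= nm f * nm h"
  unfolding L2_set_def using bessel[OF assms(1)] bessel[OF assms(2)]
  by (intro mult_mono) (auto intro!: real_le_lsqrt sum_nonneg)
 finally show ?thesis by (simp add: abs_mult)
qed

lemma norm_tail: assumes "f : T" shows "(nm (%x. f x - proj N f x))^2 = (nm f)^2 - (\<Sum>n<N. (ip f (g n))^2)"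
proof -
 have "(nm (%x. f x - proj N f x))^2 = ip f f - ip (proj N f) f - (ip f (proj N f) - ip (proj N f) (proj N f))"
  unfolding nm_power2 using assms by (simp only: ip_diff_left ip_diff_right T_diff proj_T)
 also have "ip f (proj N f) = ip (proj N f) f" by (rule ip_sym)
 also have "ip (proj N f) f = (\<Sum>n<N. (ip f (g n))^2)" using assms by (simp add: ip_proj_left power2_eq_square)
 finally show ?thesis by (simp add: ip_proj_proj nm_power2)
qed

end

lemma tendsto_by_bound:
 fixes f :: "nat => 'a::real_normed_vector"
 assumes "!!n. norm (f n - l) <= c n" "c ~~> 0"
 shows "f ~~> l"
proof -
 have "(%n. f n - l) ~~> 0"
  by (rule Lim_null_comparison[OF _ assms(2)]) (simp add: assms(1))
 then show ?thesis by (simp add: LIM_zero_iff)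
qed

section \<open>Borel \<open>\<sigma>\<close>-algebras of pseudometric carriers\<close>

text \<open>The open sets in question are preimages of open sets under a measurable map into a countable
 power of the real line.\<close>

lemma sets_of_countable_topology:
 fixes \<phi> :: "'i::countable => 'a => real"
 assumes meas: "!!i. \<phi> i : bm N" and sub: "U \<subseteq> space N"
  and nb: "!!x. x : U ==> EX I. EX dl>0. finite I & (ALL y:space N. (ALL i:I. abs (\<phi> i y - \<phi> i x) < dl) --> y : U)"
 shows "U : sets N"
proof -
 obtain I dl where I: "!!x. x : U ==> finite (I x) & dl x > 0 & (ALL y:space N. (ALL i:I x. abs (\<phi> i y - \<phi> i x) < dl x) --> y : U)"
  using nb by metis
 define V where "V = (\<Union>x\<in>U. {\<psi> :: 'i => real. ALL i:I x. abs (\<psi> i - \<phi> i x) < dl x})"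
 have "open V"
  unfolding V_def
 proof (intro open_UN ballI)
  fix x assume x: "x : U"
  have "{\<psi> :: 'i => real. ALL i:I x. abs (\<psi> i - \<phi> i x) < dl x} = (\<Inter>i\<in>I x. (%\<psi>. \<psi> i) -` ball (\<phi> i x) (dl x))"
   by (auto simp: dist_real_def abs_minus_commute)
  then show "open {\<psi> :: 'i => real. ALL i:I x. abs (\<psi> i - \<phi> i x) < dl x}"
   using I[OF x] by (auto intro!: open_INT open_vimage)
 qed
 let ?a = "%y i. \<phi> i y"
 \<comment> \<open>Countability of the index type makes the Borel sets of the product generated by
   the coordinates.\<close>
 have "?a : measurable N borel"
  by (rule measurable_coordinatewise_then_product) (rule meas)
 from measurable_sets[OF this borel_open[OF \<open>open V\<close>]]
 have "?a -` V \<inter> space N : sets N" .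
 also have "?a -` V \<inter> space N = U"
 proof (intro equalityI subsetI)
  fix y assume "y : ?a -` V \<inter> space N"
  then obtain x where "x : U" "ALL i:I x. abs (\<phi> i y - \<phi> i x) < dl x" "y : space N" unfolding V_def by blast
  then show "y : U" using I by blast
 next
  fix y assume y: "y : U"
  then have "ALL i:I y. abs (\<phi> i y - \<phi> i y) < dl y" using I[OF y] by simp
  then show "y : ?a -` V \<inter> space N" using y sub unfolding V_def by blast
 qed
 finally show ?thesis .
qed

text \<open>\<open>N\<close> is the largest sigma-algebra on \<open>S\<close> for which
  \<open>h\<close> is measurable. Measurability of \<open>h\<close> into a generated sigma-algebra
  thereby becomes an inclusion in \<open>N\<close>.\<close>

lemma pullback_sigma:
 fixes h :: "'a => 'b"
 assumes h: "h : space M \<rightarrow> S"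
 defines "N \<equiv> sigma S {A. A \<subseteq> S & h -` A \<inter> space M : sets M}"
 shows "sets N = {A. A \<subseteq> S & h -` A \<inter> space M : sets M}" "space N = S" "h : measurable M N"
proof -
 have alg: "sigma_algebra S {A. A \<subseteq> S & h -` A \<inter> space M : sets M}"
 proof (rule sigma_algebra_iff2[THEN iffD2], intro conjI ballI allI impI)
  show "{} : {A. A \<subseteq> S & h -` A \<inter> space M : sets M}" by simp
  fix A assume "A : {A. A \<subseteq> S & h -` A \<inter> space M : sets M}"
  moreover have "h -` (S - A) \<inter> space M = space M - (h -` A \<inter> space M)" using h by auto
  ultimately show "S - A : {A. A \<subseteq> S & h -` A \<inter> space M : sets M}" by auto
 next
  fix A :: "nat => 'b set" assume A: "range A \<subseteq> {A. A \<subseteq> S & h -` A \<inter> space M : sets M}"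
  have "h -` (\<Union>i. A i) \<inter> space M = (\<Union>i. h -` A i \<inter> space M)" by auto
  moreover have "(\<Union>i. h -` A i \<inter> space M) : sets M" using A by (intro sets.countable_UN) auto
  ultimately show "(\<Union>i. A i) : {A. A \<subseteq> S & h -` A \<inter> space M : sets M}"
   using A by (simp only: mem_Collect_eq) auto
 qed auto
 show *: "sets N = {A. A \<subseteq> S & h -` A \<inter> space M : sets M}"
  unfolding N_def by (subst sets_measure_of) (auto simp: sigma_algebra.sigma_sets_eq[OF alg])
 show sp: "space N = S" unfolding N_def by (rule space_measure_of) auto
 show "h : measurable M N"
  using h by (intro measurableI) (auto simp: * sp)
qed

lemma space_metric_borel [simp]: "space (metric_borel S d) = S"
 unfolding metric_borel_def by (rule space_measure_of) auto

lemma sets_metric_borel: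
 "sets (metric_borel S d) = sigma_sets S {U. U \<subseteq> S & (ALL x:U. EX r>0. ALL y:S. d x y < r --> y : U)}"
 unfolding metric_borel_def by (rule sets_measure_of) auto

lemma metric_borel_openI:
 "U \<subseteq> S ==> (!!x. x : U ==> EX r>0. ALL y:S. d x y < r --> y : U) ==> U : sets (metric_borel S d)"
 unfolding sets_metric_borel by (rule sigma_sets.Basic) blast

lemma metric_borel_subsetI:
 assumes "space N = S"
  and "!!U. U \<subseteq> S ==> (!!x. x : U ==> EX r>0. ALL y:S. d x y < r --> y : U) ==> U : sets N"
 shows "sets (metric_borel S d) \<subseteq> sets N"
proof -
 have "{U. U \<subseteq> S & (ALL x:U. EX r>0. ALL y:S. d x y < r --> y : U)} \<subseteq> sets N"
  using assms(2) by blast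
 from sets.sigma_sets_subset[OF this] show ?thesis unfolding sets_metric_borel assms(1) .
qed

lemma metric_borel_measurableI:
 fixes f :: "'a => 'b::metric_space"
 assumes "!!x e. x : S ==> e > 0 ==> EX r>0. ALL y:S. d x y < r --> dist (f y) (f x) < e"
 shows "f : bm (metric_borel S d)"
proof (rule borel_measurableI)
 fix W :: "'b set" assume W: "open W"
 let ?a = "metric_borel S d"
 show "f -` W \<inter> space ?a : sets ?a"
 proof (rule metric_borel_openI)
  fix x assume "x : f -` W \<inter> space ?a"
  then have x: "x : S" "f x : W" by auto
  then obtain e where e: "e > 0" "!!z. dist z (f x) < e ==> z : W" using W by (auto simp: open_dist)
  from assms[OF x(1) e(1)] obtain r where "r > 0" "ALL y:S. d x y < r --> dist (f y) (f x) < e" by blast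
  then show "EX r>0. ALL y:S. d x y < r --> y : f -` W \<inter> space ?a"
   using e(2) by auto
 qed auto
qed

subsection \<open>Sequential continuity on the tangent space\<close>

context l2_space
begin

abbreviation "TB \<equiv> tangent_borel lam"

lemma space_TB [simp]: "space TB = T" by (simp add: tangent_borel_def)

definition conv :: "(nat => real^'d => real^'d) => (real^'d => real^'d) => bool" where
 "conv F f \<longleftrightarrow> (ALL n. F n : T) & f : T & (%n. nm (%x. F n x - f x)) ~~> 0"

text \<open>Continuity is phrased with sequences because the limits come from dominated convergence
  and almost everywhere convergent subsequences.\<close>

definition seqcont :: "((real^'d => real^'d) => 'b::metric_space) => bool" where
 "seqcont q \<longleftrightarrow> (ALL F f. conv F f --> (%n. q (F n)) ~~> q f)"

lemma seqcontD: "seqcont q ==> conv F f ==> (%n. q (F n)) ~~> q f"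
 by (simp add: seqcont_def)

lemma conv_T: "conv F f ==> F n : T" "conv F f ==> f : T"
 by (auto simp: conv_def)

lemma conv_bound: assumes "f : T" "!!n. F n : T" "!!n. nm (%x. F n x - f x) <= c n" "c ~~> 0"
 shows "conv F f"
proof -
 have "(%n. nm (%x. F n x - f x)) ~~> 0"
  by (rule tendsto_sandwich[OF _ _ tendsto_const assms(4)]) (auto simp: assms(3))
 then show ?thesis using assms by (simp add: conv_def)
qed

text \<open>A failure at all radii 1/(n+1) yields a sequence that converges to \<open>f\<close>
  while \<open>q\<close> stays away from \<open>q f\<close>. This links sequential continuity to the
  open sets that generate \<open>tangent_borel\<close>.\<close>

lemma seqcont_dist:
 assumes "seqcont q" "f : T" "e > 0"
 shows "EX r>0. ALL y:T. nm (%x. f x - y x) < r --> dist (q y) (q f) < e"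
proof (rule ccontr)
 assume "~ ?thesis"
 moreover have "0 < inverse (real (Suc n))" for n by simp
 ultimately have "ALL n::nat. EX y:T. nm (%x. f x - y x) < inverse (real (Suc n)) & ~ dist (q y) (q f) < e"
  by meson
 then obtain Y where Y: "!!n. Y n : T" "!!n. nm (%x. f x - Y n x) < inverse (real (Suc n))" "!!n. ~ dist (q (Y n)) (q f) < e"
  by metis
 have "conv Y f"
  by (rule conv_bound[OF assms(2) Y(1) _ LIMSEQ_inverse_real_of_nat])
   (use Y(2) nm_minus_commute in \<open>auto intro: less_imp_le simp: nm_minus_commute[of _ f]\<close>)
 then have "(%n. q (Y n)) ~~> q f" using assms(1) by (simp add: seqcont_def)
 then obtain n where "dist (q (Y n)) (q f) < e" using assms(3) by (meson LIMSEQ_def le_refl)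
 then show False using Y(3) by blast
qed

lemma seqcont_measurable [measurable (raw)]: "seqcont q ==> q : bm TB"
 unfolding tangent_borel_def by (rule metric_borel_measurableI) (auto dest: seqcont_dist)

lemma conv_subseq: "conv F f ==> strict_mono r ==> conv (%n. F (r n)) f"
 unfolding conv_def using LIMSEQ_subseq_LIMSEQ[of "%n. nm (%x. F n x - f x)" 0 r] by (auto simp: o_def)

lemma conv_AE_subseq:
 assumes "conv F f" shows "EX r. strict_mono r & (AE x in lam. (%n. F (r n) x) ~~> f x)"
proof -
 have T: "!!n. (%x. F n x - f x) : T" using assms by (auto simp: conv_def intro: T_diff)
 have "(%n. (nm (%x. F n x - f x))^2) ~~> 0\<^sup>2"
  using assms by (intro tendsto_power) (auto simp: conv_def)
 then have "(%n. LINT x|lam. norm ((norm (F n x - f x))^2)) ~~> 0"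
  unfolding nm_power2_integral by simp
 from tendsto_L1_AE_subseq[OF T_integrable[OF T] this]
 obtain r where r: "strict_mono r" "AE x in lam. (%n. (norm (F (r n) x - f x))^2) ~~> 0" by auto
 have "AE x in lam. (%n. F (r n) x) ~~> f x"
  using r(2)
 proof eventually_elim
  case (elim x)
  then have "(%n. sqrt ((norm (F (r n) x - f x))^2)) ~~> sqrt 0" by (rule tendsto_real_sqrt)
  then show ?case by (simp add: tendsto_norm_zero_iff LIM_zero_iff)
 qed
 with r(1) show ?thesis by auto
qed

text \<open>Subsequence principle: every subsequence of an L2-convergent sequence has a further
  subsequence converging almost everywhere, so a counterexample could be thinned to one of that
  kind.\<close>

lemma seqcontI_AE:
 assumes "!!F f. conv F f ==> (AE x in lam. (%n. F n x) ~~> f x) ==> (%n. q (F n)) ~~> q f"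
 shows "seqcont q"
 unfolding seqcont_def
proof (intro allI impI, rule ccontr)
 fix F f assume c: "conv F f" and n: "~ (%n. q (F n)) ~~> q f"
 then obtain e where e: "e > 0" "\<exists>\<^sub>F n in sequentially. ~ dist (q (F n)) (q f) < e"
  unfolding tendsto_iff by (auto simp: frequently_def)
 then have "infinite {n. ~ dist (q (F n)) (q f) < e}"
  by (simp add: frequently_cofinite cofinite_eq_sequentially[symmetric])
 then obtain r :: "nat => nat" where r: "strict_mono r" "!!n. r n : {n. ~ dist (q (F n)) (q f) < e}"
  using infinite_enumerate by blast
 obtain s where s: "strict_mono s" "AE x in lam. (%n. F (r (s n)) x) ~~> f x"
  using conv_AE_subseq[OF conv_subseq[OF c r(1)]] by auto
 have "(%n. q (F (r (s n)))) ~~> q f"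
  using assms[OF conv_subseq[OF conv_subseq[OF c r(1)] s(1)] s(2)] .
 then obtain n where "dist (q (F (r (s n)))) (q f) < e" using e(1) by (meson LIMSEQ_def le_refl)
 then show False using r(2)[of "s n"] by simp
qed

lemma seqcont_ip: "k : T ==> seqcont (%f. ip f k)"
proof (unfold seqcont_def, intro allI impI)
 fix F f assume k: "k : T" and c: "conv F f"
 have "abs (ip (F n) k - ip f k) <= nm (%x. F n x - f x) * nm k" for n
  using ip_bound[OF T_diff[OF conv_T[OF c]] k] k conv_T[OF c] by (simp add: ip_diff_left)
 moreover have "(%n. nm (%x. F n x - f x) * nm k) ~~> 0"
  using c by (auto simp: conv_def intro: tendsto_mult_left_zero)
 ultimately show "(%n. ip (F n) k) ~~> ip f k"
  by (intro tendsto_by_bound[where c="%n. nm (%x. F n x - f x) * nm k" and f="%n. ip (F n) k"]) auto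
qed

lemma seqcont_nm: "seqcont nm"
proof (unfold seqcont_def, intro allI impI)
 fix F f assume c: "conv F f"
 have "abs (nm (F n) - nm f) <= nm (%x. F n x - f x)" for n
  using nm_triangle_abs conv_T[OF c] by blast
 then show "(%n. nm (F n)) ~~> nm f"
  using c by (intro tendsto_by_bound[where c="%n. nm (%x. F n x - f x)" and f="%n. nm (F n)"]) (auto simp: conv_def)
qed

lemma measurable_ip [measurable]: "k : T ==> (%f. ip f k) : bm TB"
 "k : T ==> (%f. ip k f) : bm TB"
proof -
 show "k : T ==> (%f. ip f k) : bm TB" by (rule seqcont_measurable[OF seqcont_ip])
 then show "k : T ==> (%f. ip k f) : bm TB" by (simp add: ip_sym[of k])
qed

lemma measurable_nm [measurable]: "nm : bm TB"
 by (rule seqcont_measurable[OF seqcont_nm])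

lemma conv_line: assumes "f : T" "h : T" "t ~~> s"
 shows "conv (%n x. f x + t n *\<^sub>R h x) (%x. f x + s *\<^sub>R h x)"
proof (rule conv_bound)
 show "nm (%x. f x + t n *\<^sub>R h x - (f x + s *\<^sub>R h x)) <= abs (t n - s) * nm h" for n
  using nm_scale[of "t n - s" h] by (simp add: scaleR_diff_left)
 show "(%n. abs (t n - s) * nm h) ~~> 0"
  using assms(3) by (intro tendsto_mult_left_zero tendsto_rabs_zero) (simp add: LIM_zero)
qed (use assms in \<open>auto intro: T_add T_scale\<close>)

lemma seqcont_line:
 assumes "seqcont q" "f : T" "h : T"
 shows "continuous_on UNIV (%t. q (%x. f x + t *\<^sub>R h x))"
 unfolding continuous_on_sequentially
 using assms conv_line[OF assms(2,3)] by (auto simp: o_def seqcont_def)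

lemma T_line: "f : T ==> h : T ==> (%x. f x + t *\<^sub>R h x) : T"
 by (intro T_add T_scale)

lemma conv_dominated:
 assumes F: "!!n. F n : bm borel" and f: "f : bm borel"
  and lim: "AE x in lam. (%n. F n x) ~~> f x"
  and k: "integrable lam k" and b: "!!n x. (norm (F n x))^2 <= k x" "!!x. (norm (f x))^2 <= k x"
 shows "conv F f"
proof -
 have FT: "F n : T" for n by (rule T_dominated[OF F k b(1)])
 have fT: "f : T" by (rule T_dominated[OF f k b(2)])
 have bd: "(norm (F n x - f x))^2 <= 4 * k x" for n x
 proof -
  have "(norm (F n x - f x))^2 <= (norm (F n x) + norm (f x))^2" by (simp add: norm_triangle_ineq4 power_mono)
  also have "... <= 2 * (norm (F n x))^2 + 2 * (norm (f x))^2"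
   using sum_squares_bound[of "norm (F n x)" "norm (f x)"] by (simp add: power2_sum)
  finally show ?thesis using b(1)[of n x] b(2)[of x] by simp
 qed
 have "(%n. LINT x|lam. (norm (F n x - f x))^2) ~~> (LINT x|lam. 0)"
 proof (rule integral_dominated_convergence[where w="%x. 4 * k x"])
  show "(%x. (norm (F n x - f x))^2) : bm lam" for n
   using T_measurable_lam[OF FT[of n]] T_measurable_lam[OF fT] by measurable
  show "AE x in lam. (%n. (norm (F n x - f x))^2) ~~> 0"
   using lim
  proof eventually_elim
   case (elim x)
   then have "(%n. (norm (F n x - f x))^2) ~~> 0\<^sup>2"
    by (intro tendsto_power tendsto_norm_zero) (simp add: LIM_zero)
   then show ?case by simp
  qed
 qed (use k bd in auto)
 then have "(%n. (nm (%x. F n x - f x))^2) ~~> 0" by (simp add: nm_power2_integral)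
 then have "(%n. sqrt ((nm (%x. F n x - f x))^2)) ~~> sqrt 0" by (rule tendsto_real_sqrt)
 then show ?thesis using FT fT by (simp add: conv_def)
qed

end

subsection \<open>Cylinder sets\<close>

context l2_basis
begin

text \<open>In a Hilbert space, convergence of all coordinates together with convergence of the norm
  is norm convergence. Hence a ball around \<open>f\<close> contains a neighbourhood given by
  finitely many coordinates and the squared norm, which is itself a countable sum of squared
  coordinates.\<close>

lemma tangent_borel_subset:
 assumes sp: "space N = T" and meas: "!!n. (%f. ip f (g n)) : bm N"
 shows "sets TB \<subseteq> sets N"
 unfolding tangent_borel_def
proof (rule metric_borel_subsetI[OF sp])
 let ?a = "%f y. %x. f x - y x"
 fix U assume U: "U \<subseteq> T" and nb: "!!f. f : U ==> EX r>0. ALL y:T. nm (?a f y) < r --> y : U"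
 define \<phi> where "\<phi> n f = (case n of 0 => (nm f)\<^sup>2 | Suc k => ip f (g k))" for n f
 let ?b = "%f M. %x. f x - proj M f x"
 let ?c = "%f. \<Sum>k. ip f (g k) * ip f (g k)"
 show "U : sets N"
 proof (rule sets_of_countable_topology)
  show "\<phi> n : bm N" for n
  proof (cases n)
   case 0
   have "?c : bm N" using meas by measurable
   also have "?c : bm N \<longleftrightarrow> (%f. (nm f)^2) : bm N"
    using parseval by (intro measurable_cong) (auto simp: sp nm_power2 sums_iff)
   finally show ?thesis using 0 by (simp add: \<phi>_def[abs_def])
  qed (use meas in \<open>simp add: \<phi>_def[abs_def]\<close>)
  show "U \<subseteq> space N" using U sp by simp
  fix f assume f: "f : U"
  then have fT: "f : T" using U by auto
  obtain r where r: "r > 0" "!!y. y : T ==> nm (?a f y) < r ==> y : U" using nb[OF f] by auto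
  \<comment> \<open>\<open>K\<close> bounds \<open>nm f + nm y\<close> for every \<open>y\<close>
    whose squared norm differs from that of \<open>f\<close> by at most 1.\<close>
  define K where "K = nm f + sqrt ((nm f)^2 + 1)"
  have K: "K > 0" unfolding K_def by (intro add_nonneg_pos nm_nonneg) (simp add: add_nonneg_pos)
  obtain M where M: "nm (?b f M) < r^2 / (4 * K)"
  proof -
   have "r^2 / (4 * K) > 0" using r(1) K by simp
   from LIMSEQ_D[OF proj_tendsto[OF fT] this] that show ?thesis by auto
  qed
  define A where "A = (\<Sum>n<M. abs (ip f (g n)))"
  have A0: "A >= 0" by (simp add: A_def sum_nonneg)
  \<comment> \<open>Budget for the squared distance: half of \<open>r^2\<close> goes to the tail of
    \<open>f\<close>; the other half covers the norm difference \<open>dl\<close> and twice the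
    coordinate error \<open>A * dl\<close>.\<close>
  define dl where "dl = min 1 (r^2 / (2 * (1 + 2 * A)))"
  have dl: "dl > 0" "dl <= 1" "dl * (1 + 2 * A) <= r^2 / 2"
  proof -
   show "dl > 0" "dl <= 1" unfolding dl_def using r(1) A0 by (auto simp: add_pos_nonneg)
   have "dl <= r^2 / (2 * (1 + 2 * A))" by (simp add: dl_def)
   then have "dl * (1 + 2 * A) <= r^2 / (2 * (1 + 2 * A)) * (1 + 2 * A)" using A0 by (intro mult_right_mono) auto
   also have "... = r^2 / 2" using A0 by (simp add: field_simps add_pos_nonneg)
   finally show "dl * (1 + 2 * A) <= r^2 / 2" .
  qed
  show "EX I. EX dl>0. finite I & (ALL y:space N. (ALL i:I. abs (\<phi> i y - \<phi> i f) < dl) --> y : U)"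
  proof (intro exI[of _ "{..M}"] exI[of _ dl] conjI ballI impI)
   fix y assume "y : space N" and *: "ALL i:{..M}. abs (\<phi> i y - \<phi> i f) < dl"
   then have yT: "y : T" by (simp add: sp)
   have y0: "abs ((nm y)\<^sup>2 - (nm f)^2) < dl" using *[rule_format, of 0] by (simp add: \<phi>_def)
   have yn: "abs (ip y (g n) - ip f (g n)) < dl" if "n < M" for n using *[rule_format, of "Suc n"] that by (simp add: \<phi>_def)
   have nmy: "nm y <= sqrt ((nm f)^2 + 1)" using y0 dl(2) by (intro real_le_rsqrt) linarith
   have dT: "(?a f y) : T" by (rule T_diff[OF fT yT])
   \<comment> \<open>Expansion around \<open>f\<close> leaves a difference of squared norms and one
     pairing of \<open>f\<close> with f - y, which is then split at the projection of
     \<open>f\<close> onto \<open>M\<close> basis vectors.\<close>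
   have "(nm (?a f y))^2 = (nm y)^2 - (nm f)^2 + 2 * ip f (?a f y)"
    using fT yT dT unfolding nm_power2 by (simp add: ip_diff_left ip_diff_right ip_sym[of y f])
   also have "ip f (?a f y) = ip (proj M f) (?a f y) + ip (?b f M) (?a f y)"
    using fT dT by (simp add: ip_diff_left)
   also have "ip (proj M f) (?a f y) <= A * dl"
   proof -
    have "ip (proj M f) (?a f y) = (\<Sum>n<M. ip f (g n) * (ip f (g n) - ip y (g n)))"
    using fT yT dT by (simp add: ip_proj_left ip_diff_left)
    also have "... <= (\<Sum>n<M. abs (ip f (g n)) * dl)"
    proof (rule sum_mono)
    fix n assume "n : {..<M}"
    then have *: "abs (ip f (g n) - ip y (g n)) <= dl" using yn[of n] by (simp add: abs_minus_commute)
    then show "ip f (g n) * (ip f (g n) - ip y (g n)) <= abs (ip f (g n)) * dl"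
    using mult_left_mono[OF * abs_ge_zero[of "ip f (g n)"]]
    abs_ge_self[of "ip f (g n) * (ip f (g n) - ip y (g n))"] unfolding abs_mult by linarith
    qed
    finally show ?thesis by (simp add: A_def sum_distrib_right)
   qed
   also have "ip (?b f M) (?a f y) <= r^2 / 4"
   proof -
    have "ip (?b f M) (?a f y) <= nm (?b f M) * nm (?a f y)"
    using ip_bound[OF T_diff[OF fT proj_T[of M f]] dT] by linarith
    also have "... <= r^2 / (4 * K) * K"
    using M nm_diff_triangle[OF fT yT] nmy by (intro mult_mono) (auto simp: K_def)
    also have "... = r^2 / 4" using K by simp
    finally show ?thesis .
   qed
   finally have "(nm (?a f y))^2 <= ((nm y)^2 - (nm f)^2) + 2 * (A * dl) + r^2 / 2" by simp
   also have "... < dl * (1 + 2 * A) + r^2 / 2" using y0 by (simp add: algebra_simps)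
   also have "... <= r^2" using dl(3) by simp
   finally have "nm (?a f y) < r" using r(1) by (simp add: power_less_imp_less_base)
   then show "y : U" by (rule r(2)[OF yT])
  qed (use dl in auto)
 qed
qed

text \<open>The largest sigma-algebra that makes \<open>h\<close> measurable measures every
  coordinate, so the preceding inclusion applies to it.\<close>

lemma measurable_TB_I:
 assumes "!!x. x : space M ==> h x : T" and "!!n. (%x. ip (h x) (g n)) : bm M"
 shows "h : measurable M TB"
proof -
 define N where "N = sigma T {A. A \<subseteq> T & h -` A \<inter> space M : sets M}"
 have h: "h : space M \<rightarrow> T" using assms(1) by auto
 note N = pullback_sigma[OF h, folded N_def]
 have "sets TB \<subseteq> sets N"
 proof (rule tangent_borel_subset[OF N(2)])
  fix n
  show "(%f. ip f (g n)) : bm N"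
  proof (rule measurableI)
   fix A :: "real set" assume "A : sets borel"
   from measurable_sets[OF assms(2) this, of n]
   have "(%x. ip (h x) (g n)) -` A \<inter> space M : sets M" .
   also have "(%x. ip (h x) (g n)) -` A \<inter> space M = h -` ((%f. ip f (g n)) -` A \<inter> T) \<inter> space M"
    using assms(1) by auto
   finally show "(%f. ip f (g n)) -` A \<inter> space N : sets N" by (simp add: N)
  qed simp
 qed
 then show ?thesis
  using N(3) h by (intro measurableI) (auto dest: measurable_sets)
qed

end

section \<open>Characteristic functionals\<close>

text \<open>Levy's uniqueness theorem concerns probability measures, so both measures are divided by
  their common total mass, which is read off at \<open>t = 0\<close>. Mass zero is treated
  apart.\<close>

lemma finite_char_unique:
 fixes N1 N2 :: "real measure"
 assumes fin: "finite_measure N1" "finite_measure N2" and s: "sets N1 = sets borel" "sets N2 = sets borel"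
  and ch: "!!t. (LINT x|N1. iexp (t * x)) = (LINT x|N2. iexp (t * x))"
 shows "N1 = N2"
proof -
 interpret N1: finite_measure N1 by fact
 interpret N2: finite_measure N2 by fact
 have sp: "space N1 = UNIV" "space N2 = UNIV" using sets_eq_imp_space_eq[OF s(1)] sets_eq_imp_space_eq[OF s(2)] by simp_all
 have "complex_of_real (measure N1 UNIV) = complex_of_real (measure N2 UNIV)"
  using ch[of 0] by (simp add: sp scaleR_conv_of_real)
 then have m: "measure N1 UNIV = measure N2 UNIV" by simp
 let ?a = "%m. %_. ennreal (1 / m)"
 let ?b = "%N m. density N (?a m)"
 show ?thesis
 proof (cases "measure N1 UNIV = 0")
  case True
  then have z: "emeasure N1 UNIV = 0" "emeasure N2 UNIV = 0"
   using m by (simp_all add: N1.emeasure_eq_measure N2.emeasure_eq_measure)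
  show ?thesis
  proof (rule measure_eqI)
   fix A assume "A : sets N1"
   then show "emeasure N1 A = emeasure N2 A"
    using z emeasure_mono[of A UNIV N1] emeasure_mono[of A UNIV N2] s by simp
  qed (simp add: s)
 next
  case False
  define m where "m = measure N1 UNIV"
  have mpos: "m > 0" using False by (simp add: m_def zero_less_measure_iff)
  have *: "real_distribution (?b N m)" "char (?b N m) t = (1 / m) * (LINT x|N. iexp (t * x))"
   if N: "finite_measure N" "sets N = sets borel" "measure N UNIV = m" for N :: "real measure" and t
  proof -
   interpret N: finite_measure N by fact
   have spN: "space N = UNIV" using sets_eq_imp_space_eq[OF N(2)] by simp
   have "prob_space (?b N m)"
   proof (rule prob_spaceI)
    have "emeasure (?b N m) UNIV = ennreal (1 / m) * ennreal m"
    using N by (subst emeasure_density_const) (auto simp: N.emeasure_eq_measure)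
    then show "emeasure (?b N m) (space (?b N m)) = 1"
    using mpos spN by (simp add: ennreal_mult[symmetric])
   qed
   then show "real_distribution (?b N m)"
    using N(2) spN by (simp add: real_distribution_def real_distribution_axioms_def)
   have iexp_m: "(%x. iexp (t * x)) : bm N"
    using N(2) by (subst measurable_cong_sets[OF N(2) refl]) measurable
   show "char (?b N m) t = (1 / m) * (LINT x|N. iexp (t * x))"
    unfolding char_def using mpos iexp_m
    by (subst integral_density) (auto simp: scaleR_conv_of_real)
  qed
  have "density N1 (?a m) = density N2 (?a m)"
  proof (rule Levy_uniqueness)
   have m2: "measure N2 UNIV = m" using m by (simp add: m_def)
   show "real_distribution (density N1 (?a m))" "real_distribution (density N2 (?a m))"
    by (rule *(1)[OF fin(1) s(1) m_def[symmetric]], rule *(1)[OF fin(2) s(2) m2])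
   show "char (density N1 (?a m)) = char (density N2 (?a m))"
    by (rule ext) (simp only: *(2)[OF fin(1) s(1) m_def[symmetric]] *(2)[OF fin(2) s(2) m2] ch)
  qed
  then have eq: "ennreal (1 / m) * emeasure N1 A = ennreal (1 / m) * emeasure N2 A" if "A : sets borel" for A
   using emeasure_density_const[of A N1 "ennreal (1 / m)"] emeasure_density_const[of A N2 "ennreal (1 / m)"] that s by simp
  show ?thesis
  proof (rule measure_eqI)
   fix A assume "A : sets N1"
   then show "emeasure N1 A = emeasure N2 A"
   proof -
    assume A: "A : sets N1"
    have one: "ennreal m * ennreal (1 / m) = 1" using mpos by (simp add: ennreal_mult[symmetric])
    have "emeasure N1 A = ennreal m * (ennreal (1 / m) * emeasure N1 A)" using one by (simp add: mult.assoc[symmetric])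
    also have "... = ennreal m * (ennreal (1 / m) * emeasure N2 A)" using eq[of A] A s by simp
    also have "... = emeasure N2 A" using one by (simp add: mult.assoc[symmetric])
    finally show ?thesis .
   qed
  qed (simp add: s)
 qed
qed

text \<open>The weighted integrals are the characteristic functions of the images under
  \<open>k\<close> of the finite measures with density \<open>w\<close>; equal images give the
  claim.\<close>

lemma weighted_marginal_unique:
 fixes w k :: "'a => real"
 assumes fin: "finite_measure M1" "finite_measure M2" and s: "sets M2 = sets M1"
  and w: "w : bm M1" "!!x. 0 <= w x" "!!x. w x <= C" and k: "k : bm M1"
  and ch: "!!t. (\<integral>x. w x *\<^sub>R iexp (t * k x) \<partial>M1) = (\<integral>x. w x *\<^sub>R iexp (t * k x) \<partial>M2)"
  and S: "S : sets borel"
 shows "(LINT x|M1. w x * indicator S (k x)) = (LINT x|M2. w x * indicator S (k x))"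
proof -
 let ?a = "%M. density M (%x. ennreal (w x))"
 define N where "N M = distr (?a M) borel k" for M
 let ?b = "%M. LINT x|M. w x * indicator S (k x)"
 have N: "finite_measure (N M)" "(\<integral>x. iexp (t * x) \<partial>N M) = (\<integral>x. w x *\<^sub>R iexp (t * k x) \<partial>M)"
  "measure (N M) S = (?b M)"
  if M: "finite_measure M" "sets M = sets M1" for M t
 proof -
  interpret M: finite_measure M by fact
  have [measurable]: "w : bm M" "k : bm M" using w(1) k measurable_cong_sets[OF M(2) refl] by auto
  have iw: "integrable M w" by (rule M.integrable_const_bound[where B=C]) (use w in auto)
  have kd: "k : measurable (?a M) borel" by measurable
  have "emeasure (?a M) (space M) = (\<integral>\<^sup>+x. ennreal (w x) \<partial>M)"
   by (subst emeasure_density) (auto intro!: nn_integral_cong)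
  also have "... < \<infinity>" using iw w(2) by (simp add: nn_integral_eq_integral)
  finally have fd: "finite_measure (?a M)" by (intro finite_measureI) auto
  show fN: "finite_measure (N M)"
   unfolding N_def by (rule finite_measure.finite_measure_distr[OF fd kd])
  show "(\<integral>x. iexp (t * x) \<partial>N M) = (\<integral>x. w x *\<^sub>R iexp (t * k x) \<partial>M)"
   unfolding N_def by (subst integral_distr[OF kd]) (use w(2) in \<open>auto simp: integral_density\<close>)
  have "measure (N M) S = (\<integral>x. indicator S x \<partial>N M)" using S by (simp add: N_def)
  also have "... = (?b M)"
   unfolding N_def using S w(2) by (subst integral_distr[OF kd]) (auto simp: integral_density)
  finally show "measure (N M) S = (?b M)" .
 qed
 have "N M1 = N M2"
  by (rule finite_char_unique) (use N fin s ch in \<open>auto simp: N_def\<close>)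
 then show ?thesis using N(3)[OF fin(1) refl] N(3)[OF fin(2) s] by simp
qed

context l2_basis
begin

text \<open>Induction step that inserts one more coordinate indicator under the integral. Varying t
  in t k + r l gives weighted characteristic functions of \<open>ip k f\<close>, so one-dimensional
  uniqueness applies. It needs nonnegative weights, hence the oscillating factor enters through 1, 1
  + cos and 1 + sin and is reassembled at the end.\<close>

lemma char_functional_step:
 assumes fin: "finite_measure M1" "finite_measure M2" and s: "sets M1 = sets TB" "sets M2 = sets TB"
  and D: "D : bm TB" "!!f. 0 <= D f" "!!f. D f <= (1::real)"
  and ch: "!!l. l : T ==> (\<integral>f. D f *\<^sub>R iexp (ip l f) \<partial>M1) = (\<integral>f. D f *\<^sub>R iexp (ip l f) \<partial>M2)"
  and k: "k : T" and l: "l : T" and S: "S : sets borel"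
 shows "(\<integral>f. (D f * indicator S (ip k f)) *\<^sub>R iexp (ip l f) \<partial>M1) = (\<integral>f. (D f * indicator S (ip k f)) *\<^sub>R iexp (ip l f) \<partial>M2)"
proof -
 have meas: "D : bm M" "(%f. ip m f) : bm M" if "sets M = sets TB" "m : T" for M m
  using D(1) that measurable_ip by (auto simp: measurable_cong_sets[OF that(1) refl])
 have int: "integrable M (%f. D f *\<^sub>R (b f :: complex))"
  if "finite_measure M" "sets M = sets TB" "b : bm M" "!!f. norm (b f) <= 1" for M b
 proof -
  interpret finite_measure M by fact
  show ?thesis
  proof (rule integrable_const_bound[where B=1])
   show "AE x in M. norm (D x *\<^sub>R b x) <= 1" using D that(4) by (auto intro!: AE_I2 mult_le_one)
   show "(%f. D f *\<^sub>R b f) : bm M" using meas[OF that(2) T_zero] that(3) by measurable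
  qed
 qed
 let ?d = "%t r l. %x. t *\<^sub>R k x + r *\<^sub>R l x"
 have lin: "(?d t r l) : T" for t r using k l by (intro T_add T_scale)
 have iplin: "ip (?d t r l) f = t * ip k f + r * ip l f" if "f : T" for t r f
  using k l that by (simp add: ip_add_left T_scale ip_scale_left)
 \<comment> \<open>With coefficients (0, 0), (1/2, 1/2) and (1/(2i), -1/(2i)) this is 1, 1 + cos and
   1 + sin of \<open>ip l f\<close>.\<close>
 define W :: "complex => complex => (real^'d => real^'d) => complex" where "W \<alpha> \<beta> f = 1 + \<alpha> * iexp (ip l f) + \<beta> * iexp (- ip l f)" for \<alpha> \<beta> f
 let ?a = "%t l f. ip (%x. t *\<^sub>R k x + (-1) *\<^sub>R l x) f"
 let ?b = "%t l f. ip (%x. t *\<^sub>R k x + 0 *\<^sub>R l x) f"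
 let ?c = "%t l f. ip (%x. t *\<^sub>R k x + 1 *\<^sub>R l x) f"
 have eqW: "(\<integral>f. D f *\<^sub>R (W \<alpha> \<beta> f * iexp (t * ip k f)) \<partial>M1) = (\<integral>f. D f *\<^sub>R (W \<alpha> \<beta> f * iexp (t * ip k f)) \<partial>M2)" for \<alpha> \<beta> t
 proof -
  have "(\<integral>f. D f *\<^sub>R (W \<alpha> \<beta> f * iexp (t * ip k f)) \<partial>M) =
    (\<integral>f. D f *\<^sub>R iexp (?b t l f) \<partial>M) +
    \<alpha> * (\<integral>f. D f *\<^sub>R iexp (?c t l f) \<partial>M) +
    \<beta> * (\<integral>f. D f *\<^sub>R iexp (?a t l f) \<partial>M)"
   if M: "finite_measure M" "sets M = sets TB" for M
  proof -
   have sp: "space M = T" using sets_eq_imp_space_eq[OF M(2)] by simp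
   have i: "integrable M (%f. D f *\<^sub>R iexp (ip (?d t r l) f))" for r
    using meas(2)[OF M(2) lin[of t r]] by (intro int[OF M]) (simp_all add: norm_exp_i_times)
   have "(\<integral>f. D f *\<^sub>R (W \<alpha> \<beta> f * iexp (t * ip k f)) \<partial>M) =
    (\<integral>f. D f *\<^sub>R iexp (?b t l f) +
    \<alpha> * (D f *\<^sub>R iexp (?c t l f)) +
    \<beta> * (D f *\<^sub>R iexp (?a t l f)) \<partial>M)"
   proof (rule Bochner_Integration.integral_cong[OF refl])
    fix f assume "f : space M"
    then have f: "f : T" by (simp add: sp)
    show "D f *\<^sub>R (W \<alpha> \<beta> f * iexp (t * ip k f)) =
    D f *\<^sub>R iexp (?b t l f) +
    \<alpha> * (D f *\<^sub>R iexp (?c t l f)) +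
    \<beta> * (D f *\<^sub>R iexp (?a t l f))"
    unfolding iplin[OF f] W_def
    by (simp add: scaleR_conv_of_real exp_add exp_diff exp_minus algebra_simps field_simps)
   qed
   also have "... = (\<integral>f. D f *\<^sub>R iexp (?b t l f) \<partial>M) +
    \<alpha> * (\<integral>f. D f *\<^sub>R iexp (?c t l f) \<partial>M) +
    \<beta> * (\<integral>f. D f *\<^sub>R iexp (?a t l f) \<partial>M)"
    using i by (simp only: Bochner_Integration.integral_add Bochner_Integration.integrable_add integral_mult_right_zero integrable_mult_right)
   finally show ?thesis .
  qed
  from this[OF fin(1) s(1)] this[OF fin(2) s(2)] show ?thesis by (simp only: ch[OF lin])
 qed
 have marg: "(LINT f|M1. (D f * w f) * indicator S (ip k f)) = (LINT f|M2. (D f * w f) * indicator S (ip k f))"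
  if w: "!!f. complex_of_real (w f) = W \<alpha> \<beta> f" "!!f. 0 <= w f" "!!f. w f <= 2" "w : bm M1" for \<alpha> \<beta> w
 proof (rule weighted_marginal_unique[where C=2])
  show "(%f. D f * w f) : bm M1" using meas[OF s(1) T_zero] w(4) by measurable
  show "0 <= D f * w f" "D f * w f <= 2" for f
   using D(2,3)[of f] w(2,3)[of f] mult_mono[of "D f" 1 "w f" 2] by auto
  show "(\<integral>f. (D f * w f) *\<^sub>R iexp (t * ip k f) \<partial>M1) = (\<integral>f. (D f * w f) *\<^sub>R iexp (t * ip k f) \<partial>M2)" for t
   using eqW[of \<alpha> \<beta> t] by (simp add: scaleR_conv_of_real w(1)[symmetric] mult.assoc)
 qed (use fin s S meas[OF s(1) k] in auto)
 have ml: "(%f. ip l f) : bm M1" "(%f. ip l f) : bm M2" using meas s l by auto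
 have m0: "(LINT f|M1. (D f * 1) * indicator S (ip k f)) = (LINT f|M2. (D f * 1) * indicator S (ip k f))"
  by (rule marg[of "%_. 1" 0 0]) (auto simp: W_def)
 have mc: "(LINT f|M1. (D f * (1 + cos (ip l f))) * indicator S (ip k f)) = (LINT f|M2. (D f * (1 + cos (ip l f))) * indicator S (ip k f))"
 proof (rule marg[of _ "1/2" "1/2"])
  show "complex_of_real (1 + cos (ip l f)) = W (1/2) (1/2) f" for f
   unfolding W_def by (simp add: cos_of_real[symmetric] cos_exp_eq add_divide_distrib)
  show "0 <= 1 + cos (ip l f)" for f using cos_ge_minus_one[of "ip l f"] by linarith
 qed (use ml in auto)
 have ms: "(LINT f|M1. (D f * (1 + sin (ip l f))) * indicator S (ip k f)) = (LINT f|M2. (D f * (1 + sin (ip l f))) * indicator S (ip k f))"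
 proof (rule marg[of _ "1/(2*\<i>)" "-1/(2*\<i>)"])
  show "complex_of_real (1 + sin (ip l f)) = W (1/(2*\<i>)) (-1/(2*\<i>)) f" for f
   unfolding W_def by (simp add: sin_of_real[symmetric] sin_exp_eq diff_divide_distrib right_diff_distrib)
  show "0 <= 1 + sin (ip l f)" for f using sin_ge_minus_one[of "ip l f"] by linarith
 qed (use ml in auto)
 define E where "E = (%f. D f * indicator S (ip k f))"
 have E: "E : bm M" "integrable M (%f. E f * c f)"
  if M: "finite_measure M" "sets M = sets TB" and c: "c : bm M" "!!f. abs (c f) <= 1" for M c
 proof -
  interpret finite_measure M by fact
  show m: "E : bm M" unfolding E_def using meas[OF M(2) k] S by measurable
  have "abs (E f * c f) <= 1" for f
   using D(2,3)[of f] c(2)[of f] by (auto simp: E_def indicator_def abs_mult mult_le_one)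
  then show "integrable M (%f. E f * c f)"
   using m c(1) by (intro integrable_const_bound[where B=1]) auto
 qed
 have split: "(LINT f|M. E f * (1 + c f)) = (LINT f|M. E f * 1) + (LINT f|M. E f * c f)"
  if M: "finite_measure M" "sets M = sets TB" and c: "c : bm M" "!!f. abs (c f) <= 1" for M c
  unfolding distrib_left using E(2)[OF M c] E(2)[OF M, of "%_. 1"] by (intro Bochner_Integration.integral_add) auto
 have comm: "(LINT f|M. (D f * w f) * indicator S (ip k f)) = (LINT f|M. E f * w f)" for M w
  by (simp add: E_def mult_ac)
 have cs: "(LINT f|M1. E f * cos (ip l f)) = (LINT f|M2. E f * cos (ip l f))"
   "(LINT f|M1. E f * sin (ip l f)) = (LINT f|M2. E f * sin (ip l f))"
  using m0 mc ms unfolding comm using ml split[OF fin(1) s(1)] split[OF fin(2) s(2)] by auto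
 have comb: "(\<integral>f. E f *\<^sub>R iexp (ip l f) \<partial>M) = complex_of_real (LINT f|M. E f * cos (ip l f)) + \<i> * complex_of_real (LINT f|M. E f * sin (ip l f))"
  if M: "finite_measure M" "sets M = sets TB" for M
 proof -
  have mM: "(%f. ip l f) : bm M" using meas[OF M(2) l] by simp
  have i: "integrable M (%f. E f * cos (ip l f))" "integrable M (%f. E f * sin (ip l f))"
   using mM by (auto intro!: E(2)[OF M])
  have ic: "integrable M (%f. complex_of_real (E f * cos (ip l f)))" "integrable M (%f. complex_of_real (E f * sin (ip l f)))"
   by (rule integrable_of_real[OF i(1)], rule integrable_of_real[OF i(2)])
  have "(\<integral>f. E f *\<^sub>R iexp (ip l f) \<partial>M) = (\<integral>f. complex_of_real (E f * cos (ip l f)) + \<i> * complex_of_real (E f * sin (ip l f)) \<partial>M)"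
   by (intro Bochner_Integration.integral_cong refl) (simp add: scaleR_conv_of_real cis_conv_exp[symmetric] complex_eq_iff)
  also have "... = complex_of_real (LINT f|M. E f * cos (ip l f)) + \<i> * complex_of_real (LINT f|M. E f * sin (ip l f))"
   using Bochner_Integration.integral_add[OF ic(1) integrable_mult_right[OF ic(2), of "\<i>"]]
   by (simp only: integral_complex_of_real integral_mult_right_zero)
  finally show ?thesis .
 qed
 show ?thesis using comb[OF fin(1) s(1)] comb[OF fin(2) s(2)] cs unfolding E_def by simp
qed

text \<open>Coordinate indicators are inserted one by one; at \<open>l = 0\<close> the oscillating
  factor disappears and the masses of cylinder sets, an intersection-stable generator,
  remain.\<close>

lemma char_functional_unique:
 assumes fin: "finite_measure M1" "finite_measure M2" and s: "sets M1 = sets TB" "sets M2 = sets TB"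
  and ch: "!!l. l : T ==> (LINT f|M1. iexp (ip l f)) = (LINT f|M2. iexp (ip l f))"
 shows "M1 = M2"
proof -
 interpret M1: finite_measure M1 by fact
 interpret M2: finite_measure M2 by fact
 define D :: "nat => (nat => real set) => (real^'d => real^'d) => real" where
  "D n S f = (\<Prod>i<n. indicator (S i) (ip (g i) f))" for n S f
 have Dm: "D n S : bm TB" if "!!i. S i : sets borel" for n S
  unfolding D_def[abs_def] using that by measurable
 have D01: "0 <= D n S f" "D n S f <= 1" for n S f
  unfolding D_def by (auto intro: prod_nonneg prod_le_1)
 have step: "(\<integral>f. D n S f *\<^sub>R iexp (ip l f) \<partial>M1) = (\<integral>f. D n S f *\<^sub>R iexp (ip l f) \<partial>M2)"
  if S: "!!i. S i : sets borel" and "l : T" for n S l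
  using \<open>l : T\<close>
 proof (induction n arbitrary: l)
  case 0
  then show ?case using ch by (simp add: D_def)
 next
  case (Suc n)
  have "D (Suc n) S f = D n S f * indicator (S n) (ip (g n) f)" for f by (simp add: D_def)
  then show ?case
   using char_functional_step[OF fin s Dm[OF S] D01 Suc.IH g_T Suc.prems S] by simp
 qed
 define E where "E = {A. EX n S. (ALL i. S i : sets borel) & A = {f\<in>T. ALL i<n. ip (g i) f : S i}}"
 have Dind: "D n S f = indicator {f\<in>T. ALL i<n. ip (g i) f : S i} f" if "f : T" for n S f
 proof (cases "ALL i<n. ip (g i) f : S i")
  case True then show ?thesis using that by (auto simp: D_def)
 next
  case False
  then obtain i where "i < n" "ip (g i) f \<notin> S i" by auto
  then have "D n S f = 0" unfolding D_def by (intro prod_zero bexI[of _ i]) auto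
  with False show ?thesis by auto
 qed
 have EA: "A : sets TB" if "A : E" for A
 proof -
  obtain n S where S: "!!i. S i : sets borel" "A = {f\<in>T. ALL i<n. ip (g i) f : S i}" using \<open>A : E\<close> by (auto simp: E_def)
  have "A = {f\<in>space TB. D n S f = 1}" using S(2) Dind[of _ n S] by (auto simp: indicator_def)
  also have "... : sets TB" using Dm[OF S(1)] by measurable
  finally show ?thesis .
 qed
 show ?thesis
 proof (rule measure_eqI_generator_eq[where E=E and \<Omega>=T and A="%_. T"])
  show "Int_stable E"
  proof (rule Int_stableI)
   fix a b assume "a : E" "b : E"
   then obtain n S m R where *: "!!i. S i : sets borel" "a = {f\<in>T. ALL i<n. ip (g i) f : S i}"
    "!!i. R i : sets borel" "b = {f\<in>T. ALL i<m. ip (g i) f : R i}" by (auto simp: E_def)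
   show "a \<inter> b : E"
    unfolding E_def
   proof (intro CollectI exI conjI allI)
    show "(if i < n then S i else UNIV) \<inter> (if i < m then R i else UNIV) : sets borel" for i using * by auto
    show "a \<inter> b = {f\<in>T. ALL i<max n m. ip (g i) f : (if i < n then S i else UNIV) \<inter> (if i < m then R i else UNIV)}"
    using * by auto
   qed
  qed
  show "E \<subseteq> Pow T" by (auto simp: E_def)
  show "emeasure M1 X = emeasure M2 X" if XE: "X : E" for X
  proof -
   obtain n S where S: "!!i. S i : sets borel" "X = {f\<in>T. ALL i<n. ip (g i) f : S i}" using \<open>X : E\<close> by (auto simp: E_def)
   have *: "(\<integral>f. D n S f *\<^sub>R iexp (ip (%x. 0) f) \<partial>M) = complex_of_real (measure M X)" if M: "finite_measure M" "sets M = sets TB" for M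
   proof -
    interpret finite_measure M by fact
    have sp: "space M = T" using sets_eq_imp_space_eq[OF M(2)] by simp
    have "(\<integral>f. D n S f *\<^sub>R iexp (ip (%x. 0) f) \<partial>M) = (LINT f|M. complex_of_real (indicator X f))"
    using Dind S(2) by (intro Bochner_Integration.integral_cong) (auto simp: sp scaleR_conv_of_real)
    also have "... = complex_of_real (measure M X)"
    using EA[OF XE] M by simp
    finally show ?thesis .
   qed
   from *[OF fin(1) s(1)] *[OF fin(2) s(2)] step[OF S(1) T_zero, of n]
   show ?thesis by (simp add: M1.emeasure_eq_measure M2.emeasure_eq_measure)
  qed
  have sig: "sets TB = sigma_sets T E"
  proof
   show "sigma_sets T E \<subseteq> sets TB" using sets.sigma_sets_subset[of E TB] EA by auto
   have "sets TB \<subseteq> sets (sigma T E)"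
   proof (rule tangent_borel_subset)
    show sp: "space (sigma T E) = T" using \<open>E \<subseteq> Pow T\<close> by (rule space_measure_of)
    fix n
    show "(%f. ip f (g n)) : bm (sigma T E)"
    proof (rule measurableI)
    fix A :: "real set" assume A: "A : sets borel"
    have "(%f. ip f (g n)) -` A \<inter> space (sigma T E) = {f\<in>T. ALL i<Suc n. ip (g i) f : (if i = n then A else UNIV)}"
    using sp by (auto simp: ip_sym)
    also have "... : E" unfolding E_def using A by (intro CollectI exI[of _ "Suc n"] exI[of _ "%i. if i = n then A else UNIV"]) auto
    finally show "(%f. ip f (g n)) -` A \<inter> space (sigma T E) : sets (sigma T E)"
    using \<open>E \<subseteq> Pow T\<close> by (simp add: sets_measure_of sigma_sets.Basic)
    qed simp
   qed
   then show "sets TB \<subseteq> sigma_sets T E" using \<open>E \<subseteq> Pow T\<close> by (simp add: sets_measure_of)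
  qed
  show "sets M1 = sigma_sets T E" "sets M2 = sigma_sets T E" using s sig by auto
  have "T : E" unfolding E_def by (intro CollectI exI[of _ 0] exI[of _ "%_. UNIV"]) auto
  then show "range (%_::nat. T) \<subseteq> E" by auto
 qed auto
qed

end

section \<open>The Gaussian measure\<close>

lemma char_normal:
 assumes "\<sigma> > 0"
 shows "(\<integral>x. iexp x \<partial>density lborel (normal_density 0 \<sigma>)) = exp (- (\<sigma>^2) / 2)"
proof -
 have "(\<integral>x. iexp x \<partial>density lborel (normal_density 0 \<sigma>)) = (\<integral>x. normal_density 0 \<sigma> x *\<^sub>R iexp x \<partial>lborel)"
  by (subst integral_density) auto
 also have "... = abs (\<sigma>) *\<^sub>R (\<integral>x. normal_density 0 \<sigma> (0 + \<sigma> * x) *\<^sub>R iexp (0 + \<sigma> * x) \<partial>lborel)"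
  by (rule lborel_integral_real_affine) (use assms in simp)
 also have "... = (\<integral>x. std_normal_density x *\<^sub>R iexp (\<sigma> * x) \<partial>lborel)"
  unfolding Bochner_Integration.integral_scaleR_right[symmetric]
 proof (intro Bochner_Integration.integral_cong refl)
  fix x
  have "abs (\<sigma>) * normal_density 0 \<sigma> (0 + \<sigma> * x) = std_normal_density x"
   using assms by (simp add: normal_density_def real_sqrt_mult power_mult_distrib field_simps)
  then show "abs (\<sigma>) *\<^sub>R normal_density 0 \<sigma> (0 + \<sigma> * x) *\<^sub>R iexp (0 + \<sigma> * x) = std_normal_density x *\<^sub>R iexp (\<sigma> * x)"
   by (simp add: scaleR_scaleR)
 qed
 also have "... = char std_normal_distribution \<sigma>"
  unfolding char_def by (subst integral_density) auto
 finally show ?thesis by (simp add: char_std_normal_distribution exp_of_real[symmetric] del: exp_of_real)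
qed

text \<open>\<open>nondegenerate\<close> gives each basis direction a positive variance, by which
  the resampling formula below divides.\<close>

locale gaussian_space = l2_basis lam g for lam :: "(real^'d) measure" and g +
 fixes B :: "(real^'d => real^'d) => real^'d => real^'d" and G :: "(real^'d => real^'d) measure"
 assumes nuclear: "trace_class lam B" and gaussian: "centered_gaussian lam G"
  and covariance: "has_covariance lam G B" and nondegenerate: "0 < ip (g n) (B (g n))"
begin

lemma B_T: "f : T ==> B f : T" using nuclear by (auto simp: trace_class_def)

lemma prob_G: "prob_space G" and sets_G [measurable_cong]: "sets G = sets TB"
 using gaussian by (auto simp: centered_gaussian_def)

sublocale G: prob_space G by (rule prob_G)

lemma space_G [simp]: "space G = T" using sets_eq_imp_space_eq[OF sets_G] by simp

definition bq :: "(real^'d => real^'d) => (real^'d => real^'d) => real" where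
 "bq x y = ip x (B y)"

lemma bq_covariance: assumes "x : T" "y : T"
 shows "integrable G (%f. ip x f * ip y f)" "(LINT f|G. ip x f * ip y f) = bq x y"
 using covariance assms by (auto simp: has_covariance_def bq_def)

lemma bq_sym: "x : T ==> y : T ==> bq x y = bq y x"
 using bq_covariance(2)[of x y] bq_covariance(2)[of y x] by (simp add: mult.commute)

lemma bq_add_left: "x : T ==> x' : T ==> y : T ==> bq (%z. x z + x' z) y = bq x y + bq x' y"
 by (simp add: bq_def ip_add_left B_T)

lemma bq_diff_left: "x : T ==> x' : T ==> y : T ==> bq (%z. x z - x' z) y = bq x y - bq x' y"
 by (simp add: bq_def ip_diff_left B_T)

lemma bq_scale_left: "bq (%z. c *\<^sub>R x z) y = c * bq x y"
 by (simp add: bq_def ip_scale_left)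

lemma bq_sum_left: "(!!i. i : I ==> x i : T) ==> y : T ==> bq (%z. \<Sum>i\<in>I. x i z) y = (\<Sum>i\<in>I. bq (x i) y)"
 by (simp add: bq_def ip_sum_left B_T)

lemma bq_diff_right: "x : T ==> x' : T ==> y : T ==> bq y (%z. x z - x' z) = bq y x - bq y x'"
 by (simp add: bq_sym[of y] T_diff bq_diff_left)

lemma bq_scale_right: "x : T ==> y : T ==> bq y (%z. c *\<^sub>R x z) = c * bq y x"
 by (simp add: bq_sym[of y] T_scale bq_scale_left)

lemma bq_sum_right: "(!!i. i : I ==> x i : T) ==> y : T ==> bq y (%z. \<Sum>i\<in>I. x i z) = (\<Sum>i\<in>I. bq y (x i))"
 by (simp add: bq_sym[of y] T_sum bq_sum_left)

lemma bq_cong_AE: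
 assumes "AE z in lam. x z = x' z" "AE z in lam. y z = y' z" "x : T" "x' : T" "y : T" "y' : T"
 shows "bq x y = bq x' y'"
proof -
 have "bq x y = bq x' y" unfolding bq_def by (rule ip_cong_AE) (use assms B_T in auto)
 also have "... = bq y x'" using assms by (simp add: bq_sym)
 also have "... = bq y' x'" unfolding bq_def by (rule ip_cong_AE) (use assms B_T in auto)
 finally show ?thesis using assms by (simp add: bq_sym)
qed

lemma bq_nonneg: "x : T ==> 0 <= bq x x"
 using bq_covariance(2)[of x x] by (metis integral_nonneg_AE AE_I2 zero_le_square)

text \<open>With B y = sum_j <b_j, y> a_j, both bounds hold for \<open>K\<close> equal to the sum of
  the products of norms. In the second, \<open>M n\<close> plays the image of \<open>g n\<close>
  under a bounded operator with adjoint \<open>M'\<close>; moving \<open>M'\<close> onto a_j leaves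
  coordinates of two fixed vectors, and Bessel's inequality bounds their sum over n uniformly in
  \<open>N\<close>.\<close>

lemma nuclear_bounds:
 "EX K>=0. (ALL x:T. ALL y:T. abs (bq x y) <= K * nm x * nm y) \<and>
  (ALL C>=0. ALL M M'. (ALL n. M n : T) & (ALL k:T. M' k : T & nm (M' k) <= C * nm k & (ALL n. ip k (M n) = ip (M' k) (g n)))
    --> (ALL N. (\<Sum>n<N. abs (bq (M n) (g n))) <= C * K))"
proof -
 obtain a b where ab: "!!j::nat. a j : T" "!!j. b j : T" "summable (%j. nm (a j) * nm (b j))"
  "!!f. f : T ==> (%N. nm (%x. B f x - (\<Sum>j<N. ip (b j) f *\<^sub>R a j x))) ~~> 0"
  using nuclear by (auto simp: trace_class_def)
 define K where "K = (\<Sum>j. nm (a j) * nm (b j))"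
 have K0: "K >= 0" unfolding K_def by (intro suminf_nonneg ab) simp
 have KJ: "(\<Sum>j<J. nm (a j) * nm (b j)) <= K" for J
  unfolding K_def by (intro sum_le_suminf ab) auto
 have lim: "(%N. \<Sum>j<N. ip (b j) y * ip x (a j)) ~~> bq x y" if "x : T" "y : T" for x y
 proof (rule tendsto_by_bound[where c="%N. nm x * nm (%z. B y z - (\<Sum>j<N. ip (b j) y *\<^sub>R a j z))"])
  fix N
  have sT: "(%z. \<Sum>j<N. ip (b j) y *\<^sub>R a j z) : T" by (intro T_sum T_scale ab)
  have "(\<Sum>j<N. ip (b j) y * ip x (a j)) - bq x y = - ip x (%z. B y z - (\<Sum>j<N. ip (b j) y *\<^sub>R a j z))"
   using that sT ab by (simp add: ip_diff_right B_T bq_def ip_sum_right T_scale ip_scale_right)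
  then show "norm ((\<Sum>j<N. ip (b j) y * ip x (a j)) - bq x y) <= nm x * nm (%z. B y z - (\<Sum>j<N. ip (b j) y *\<^sub>R a j z))"
   using ip_bound[OF that(1) T_diff[OF B_T[OF that(2)] sT]] by simp
 next
  show "(%N. nm x * nm (%z. B y z - (\<Sum>j<N. ip (b j) y *\<^sub>R a j z))) ~~> 0"
   by (intro tendsto_mult_right_zero ab that)
 qed
 show ?thesis
 proof (intro exI[of _ K] conjI K0 ballI allI impI)
  fix x y assume xy: "x : T" "y : T"
  have "abs (\<Sum>j<N. ip (b j) y * ip x (a j)) <= K * nm x * nm y" for N
  proof -
   have "abs (\<Sum>j<N. ip (b j) y * ip x (a j)) <= (\<Sum>j<N. abs (ip (b j) y) * abs (ip x (a j)))"
    by (rule order_trans[OF sum_abs]) (simp add: abs_mult)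
   also have "... <= (\<Sum>j<N. (nm (a j) * nm (b j)) * (nm x * nm y))"
   proof (rule sum_mono)
    fix j
    have "abs (ip (b j) y) * abs (ip x (a j)) <= (nm (b j) * nm y) * (nm x * nm (a j))"
    using ip_bound[OF ab(2) xy(2)] ip_bound[OF xy(1) ab(1)] by (intro mult_mono) auto
    then show "abs (ip (b j) y) * abs (ip x (a j)) <= (nm (a j) * nm (b j)) * (nm x * nm y)" by (simp add: mult_ac)
   qed
   also have "... <= K * (nm x * nm y)" unfolding sum_distrib_right[symmetric]
    by (intro mult_right_mono KJ) auto
   finally show ?thesis by (simp add: mult_ac)
  qed
  then show "abs (bq x y) <= K * nm x * nm y"
   using LIMSEQ_le_const2[OF tendsto_rabs[OF lim[OF xy]]] by blast
 next
  \<comment> \<open>The sums over n and j are interchanged while both are finite; only afterwards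
    does \<open>J\<close> tend to infinity.\<close>
  fix C M M' N assume C: "0 <= C" and M: "(ALL n. M n : T) & (ALL k:T. M' k : T & nm (M' k) <= C * nm k & (ALL n. ip k (M n) = ip (M' k) (g n)))"
  have "(\<Sum>n<N. abs (\<Sum>j<J. ip (b j) (g n) * ip (M n) (a j))) <= C * K" for J
  proof -
   have "(\<Sum>n<N. abs (\<Sum>j<J. ip (b j) (g n) * ip (M n) (a j))) <= (\<Sum>n<N. \<Sum>j<J. abs (ip (b j) (g n) * ip (M n) (a j)))"
    by (intro sum_mono sum_abs)
   also have "... = (\<Sum>j<J. \<Sum>n<N. abs (ip (b j) (g n) * ip (M' (a j)) (g n)))"
    using M ab(1) by (subst sum.swap) (simp add: ip_sym[of "M _"])
   also have "... <= (\<Sum>j<J. C * (nm (a j) * nm (b j)))"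
   proof (rule sum_mono)
    fix j
    have "(\<Sum>n<N. abs (ip (b j) (g n) * ip (M' (a j)) (g n))) <= nm (b j) * nm (M' (a j))"
    using M ab by (intro bessel2) auto
    also have "... <= nm (b j) * (C * nm (a j))" using M ab by (intro mult_left_mono) auto
    finally show "(\<Sum>n<N. abs (ip (b j) (g n) * ip (M' (a j)) (g n))) <= C * (nm (a j) * nm (b j))" by (simp add: mult_ac)
   qed
   also have "... <= C * K" unfolding sum_distrib_left[symmetric] by (intro mult_left_mono KJ C)
   finally show ?thesis .
  qed
  moreover have "(%J. \<Sum>n<N. abs (\<Sum>j<J. ip (b j) (g n) * ip (M n) (a j))) ~~> (\<Sum>n<N. abs (bq (M n) (g n)))"
   using M by (intro tendsto_sum tendsto_rabs lim) auto
  ultimately show "(\<Sum>n<N. abs (bq (M n) (g n))) <= C * K" by (intro LIMSEQ_le_const2) auto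
 qed
qed

definition "K = (SOME K. K >= 0 & (ALL x:T. ALL y:T. abs (bq x y) <= K * nm x * nm y) \<and>
  (ALL C>=0. ALL M M'. (ALL n. M n : T) & (ALL k:T. M' k : T & nm (M' k) <= C * nm k & (ALL n. ip k (M n) = ip (M' k) (g n)))
    --> (ALL N. (\<Sum>n<N. abs (bq (M n) (g n))) <= C * K)))"

lemma K_props: "K >= 0 & (ALL x:T. ALL y:T. abs (bq x y) <= K * nm x * nm y) \<and>
  (ALL C>=0. ALL M M'. (ALL n. M n : T) & (ALL k:T. M' k : T & nm (M' k) <= C * nm k & (ALL n. ip k (M n) = ip (M' k) (g n)))
    --> (ALL N. (\<Sum>n<N. abs (bq (M n) (g n))) <= C * K))"
 unfolding K_def using nuclear_bounds by (rule someI_ex)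

lemma K_nonneg: "0 <= K" and bq_bound: "x : T ==> y : T ==> abs (bq x y) <= K * nm x * nm y"
 using K_props by auto

lemma trace_bound:
 assumes "0 <= C" "!!n. M n : T" "!!k. k : T ==> M' k : T" "!!k. k : T ==> nm (M' k) <= C * nm k"
  "!!k n. k : T ==> ip k (M n) = ip (M' k) (g n)"
 shows "(\<Sum>n<N. abs (bq (M n) (g n))) <= C * K"
 using K_props assms by blast

text \<open>Case of the identity operator with constant 1: the variances of the coordinates are
  summable.\<close>

lemma trace_sum: "(\<Sum>n<N. bq (g n) (g n)) <= K"
 using trace_bound[of 1 g "%k. k" N] bq_nonneg[OF g_T] by simp

subsection \<open>Moments\<close>

text \<open>The assumed normal laws carry an unspecified standard deviation; the covariance
  identifies its square with \<open>bq l l\<close>. The point mass at 0 fits the same formulas with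
  variance 0.\<close>

lemma one_dim_law: assumes l: "l : T"
 shows "integrable G (%f. (ip l f)^4)" "(LINT f|G. (ip l f)^4) = 3 * (bq l l)^2"
  "(LINT f|G. iexp (ip l f)) = exp (- bq l l / 2)"
  "bq l l > 0 ==> distr G borel (%f. ip l f) = density lborel (normal_density 0 (sqrt (bq l l)))"
proof -
 let ?a = "%f. ip l f"
 have m: "?a : measurable G borel" using l by measurable
 define c where "c = bq l l"
 have c: "c = (\<integral>x. x^2 \<partial>distr G borel ?a)"
  unfolding c_def using bq_covariance(2)[OF l l] by (subst integral_distr[OF m]) (auto simp: power2_eq_square)
 let ?d = "%f. (ip l f)^4"
 have i4: "integrable G ?d \<longleftrightarrow> integrable (distr G borel ?a) (%x. x^4)"
  by (subst integrable_distr_eq[OF m]) auto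
 let ?c = "LINT f|G. (ip l f)^4"
 have e4: "?c = (\<integral>x. x^4 \<partial>distr G borel ?a)"
  by (subst integral_distr[OF m]) auto
 let ?b = "LINT f|G. iexp (ip l f)"
 have ei: "?b = (\<integral>x. iexp x \<partial>distr G borel ?a)"
  by (subst integral_distr[OF m]) auto
 have "integrable G ?d & ?c = 3 * (bq l l)^2 \<and>
  ?b = exp (- bq l l / 2) \<and>
  (bq l l > 0 --> distr G borel ?a = density lborel (normal_density 0 (sqrt (bq l l))))"
 proof (cases "distr G borel ?a = return borel 0")
  case True
  have "c = 0" unfolding c True by (subst integral_return) auto
  moreover have "integrable (return borel (0::real)) (%x. x^4)" 
   by (rule finite_measure.integrable_const_bound[OF prob_space.finite_measure[OF prob_space_return], where B=0]) (auto simp: AE_return)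
  ultimately show ?thesis unfolding i4 e4 ei True c_def by (auto simp: integral_return)
 next
  case False
  then obtain \<sigma> where \<sigma>: "\<sigma> > 0" "distr G borel ?a = density lborel (normal_density 0 \<sigma>)"
   using gaussian l by (auto simp: centered_gaussian_def)
  have c\<sigma>: "c = \<sigma>^2"
  proof -
   have "c = (\<integral>x. normal_density 0 \<sigma> x * (x - 0)^(2 * 1) \<partial>lborel)"
    unfolding c \<sigma>(2) by (subst integral_density) (auto simp: normal_density_nonneg)
   also have "... = \<sigma>^2" unfolding integral_normal_moment_even[OF \<sigma>(1)] by (simp add: field_simps)
   finally show ?thesis .
  qed
  have n4: "has_bochner_integral lborel (%x. normal_density 0 \<sigma> x * x^4) (3 * c^2)"
  proof -
   have f4: "fact 4 = (24::real)" by (simp add: fact_numeral)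
   show ?thesis using normal_moment_even[OF \<sigma>(1), of 0 2] \<sigma>(1)
    by (simp add: c\<sigma> f4 power_divide field_simps eval_nat_numeral)
  qed
  have i: "integrable G ?d"
   unfolding i4 \<sigma>(2) using n4 by (subst integrable_density) (auto simp: normal_density_nonneg has_bochner_integral_iff)
  have "?c = 3 * c^2"
   unfolding e4 \<sigma>(2) using n4 by (subst integral_density) (auto simp: normal_density_nonneg has_bochner_integral_iff)
  moreover have "?b = exp (- c / 2)"
   unfolding ei \<sigma>(2) c\<sigma> by (rule char_normal[OF \<sigma>(1)])
  moreover have "sqrt c = \<sigma>" using c\<sigma> \<sigma>(1) by simp
  ultimately show ?thesis using i \<sigma>(2) by (simp add: c_def)
 qed
 then show "integrable G ?d" "?c = 3 * (bq l l)^2"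
  "?b = exp (- bq l l / 2)"
  "bq l l > 0 ==> distr G borel ?a = density lborel (normal_density 0 (sqrt (bq l l)))"
  by auto
qed

text \<open>This moment makes functions of quadratic growth square integrable. With c_n the variance
  of coordinate n, the squared partial sums of squared coordinates have expectation at most 3 (sum
  c_n)^2 <= 3 K^2, and monotone convergence finishes.\<close>

lemma nm4_integrable: "integrable G (%f. (nm f)^4)"
proof -
 define S where "S N f = (\<Sum>n<N. (ip (g n) f)^2)" for N f
 define c where "c n = bq (g n) (g n)" for n
 have c: "c n > 0" for n using nondegenerate by (simp add: c_def bq_def)
 have Sq: "(S N f)^2 = (\<Sum>n<N. \<Sum>m<N. (ip (g n) f)^2 * (ip (g m) f)^2)" for N f
  by (simp add: S_def power2_eq_square sum_product)
 \<comment> \<open>The weights balance the fourth moments 3 c_n^2 and 3 c_m^2, so that the mixed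
   moment is bounded by 3 c_n c_m and the double sum factorises.\<close>
 have pw: "(x::real)^2 * y^2 <= ((c m / c n) * x^4 + (c n / c m) * y^4) / 2" for x y n m
 proof -
  have "0 <= (sqrt (c m / c n) * x^2 - sqrt (c n / c m) * y^2)^2" by simp
  also have "... = (c m / c n) * x^4 + (c n / c m) * y^4 - 2 * (sqrt (c m / c n) * sqrt (c n / c m)) * (x^2 * y^2)"
   using c[of m] c[of n] by (simp add: power2_diff power_mult_distrib flip: power_mult)
  also have "sqrt (c m / c n) * sqrt (c n / c m) = 1"
   using c[of m] c[of n] by (simp flip: real_sqrt_mult)
  finally show ?thesis by simp
 qed
 let ?a = "%n m. LINT f|G. (ip (g n) f)^2 * (ip (g m) f)^2"
 let ?b = "%c m n f. (c m / c n) * (ip (g n) f)^4 + (c n / c m) * (ip (g m) f)^4"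
 let ?c = "%n m. %f. (ip (g n) f)^2 * (ip (g m) f)^2"
 have im: "integrable G (?c n m)"
   "(?a n m) <= 3 * (c n * c m)" for n m
 proof -
  have i: "integrable G (%f. (?b c m n f) / 2)"
   using one_dim_law(1)[OF g_T] by simp
  show i2: "integrable G (?c n m)"
  proof (rule Bochner_Integration.integrable_bound[OF i])
   show "(?c n m) : bm G" by measurable
   show "AE f in G. norm ((ip (g n) f)^2 * (ip (g m) f)^2) <= norm ((?b c m n f) / 2)"
   proof (rule AE_I2)
    fix f
    have "0 <= (ip (g n) f)^2 * (ip (g m) f)^2" by simp
    then show "norm ((ip (g n) f)^2 * (ip (g m) f)^2) <= norm ((?b c m n f) / 2)"
    using pw[of "ip (g n) f" "ip (g m) f" m n] unfolding real_norm_def by linarith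
   qed
  qed
  have "(?a n m) <= (LINT f|G. (?b c m n f) / 2)"
   by (rule integral_mono[OF i2 i pw])
  also have "... = ((c m / c n) * (3 * (c n)^2) + (c n / c m) * (3 * (c m)^2)) / 2"
   using one_dim_law(1,2)[OF g_T] by (simp add: c_def)
  also have "... = 3 * (c n * c m)" using c[of n] c[of m] by (simp add: power2_eq_square field_simps)
  finally show "(?a n m) <= 3 * (c n * c m)" .
 qed
 have SI: "integrable G (%f. (S N f)^2)" for N unfolding Sq using im(1) by simp
 have Sb: "(LINT f|G. (S N f)^2) <= 3 * K^2" for N
 proof -
  have "(LINT f|G. (S N f)^2) = (\<Sum>n<N. \<Sum>m<N. (?a n m))"
   unfolding Sq using im(1) by simp
  also have "... <= (\<Sum>n<N. \<Sum>m<N. 3 * (c n * c m))" by (intro sum_mono im)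
  also have "... = 3 * (\<Sum>n<N. c n)^2" unfolding power2_eq_square sum_product unfolding sum_distrib_left by (rule refl)
  also have "... <= 3 * K^2"
   using trace_sum[of N] c by (intro mult_left_mono power_mono) (auto simp: c_def intro!: sum_nonneg bq_nonneg)
  finally show ?thesis .
 qed
 have Smono: "S N f <= S M f" if "N <= M" for N M f
  unfolding S_def using that by (intro sum_mono2) auto
 have S0: "S N f >= 0" for N f unfolding S_def by (intro sum_nonneg) simp
 have inc: "incseq (%N. LINT f|G. (S N f)^2)"
  by (rule incseq_SucI, rule integral_mono[OF SI SI]) (intro power_mono Smono S0; simp)
 obtain L where L: "(%N. LINT f|G. (S N f)^2) ~~> L"
  using incseq_convergent[OF inc] Sb by blast
 let ?d = "%S f. %N. (S N f)^2"
 show ?thesis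
 proof (rule integrable_monotone_convergence[OF SI _ _ L])
  show "AE f in G. incseq (?d S f)"
   by (auto intro!: AE_I2 incseq_SucI power_mono Smono S0)
  show "AE f in G. (?d S f) ~~> (nm f)^4"
  proof (rule AE_I2)
   fix f assume "f : space G"
   then have "(%N. S N f) ~~> (nm f)\<^sup>2"
    using parseval[of f f] by (simp add: sums_def S_def ip_sym[of f] flip: nm_power2 power2_eq_square)
   then have "(?d S f) ~~> ((nm f)^2)\<^sup>2" by (rule tendsto_power)
   then show "(?d S f) ~~> (nm f)^4" by (simp flip: power_mult)
  qed
 qed measurable
qed

text \<open>The default integrability test from here on. The exponent 4 is what a product of two
  functions of quadratic growth reaches.\<close>

lemma growth_integrable:
 fixes q :: "(real^'d => real^'d) => real"
 assumes [measurable]: "q : bm TB" and b: "!!f. f : T ==> abs (q f) <= C * (1 + nm f)^4"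
 shows "integrable G q"
proof (rule Bochner_Integration.integrable_bound)
 show "integrable G (%f. C * (8 * (1 + (nm f)^4)))" using nm4_integrable by simp
 show "q : bm G" by measurable
 show "AE f in G. norm (q f) <= norm (C * (8 * (1 + (nm f)^4)))"
 proof (rule AE_I2)
  fix f assume "f : space G"
  then have f: "f : T" by simp
  have C: "C >= 0" using b[OF T_zero] by (simp add: order_trans[OF abs_ge_zero])
  \<comment> \<open>The difference of the two sides is (x - 1)^2 times a positive quadratic.\<close>
  have "(1 + x)^4 <= 8 * (1 + x^4)" for x :: real
  proof -
   have "8 * (1 + x^4) - (1 + x)^4 = (x - 1)^2 * (7 * x^2 + 10 * x + 7)"
    by (simp add: algebra_simps power2_eq_square power4_eq_xxxx)
   moreover have "7 * x^2 + 10 * x + 7 = 5 * (x + 1)^2 + 2 * x^2 + 2" by (simp add: algebra_simps power2_eq_square)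
   ultimately show ?thesis by (smt (verit) mult_nonneg_nonneg zero_le_power2)
  qed
  then have "C * (1 + nm f)^4 <= C * (8 * (1 + (nm f)^4))" using C by (intro mult_left_mono)
  then show "norm (q f) <= norm (C * (8 * (1 + (nm f)^4)))" using b[OF f] by simp
 qed
qed

end

section \<open>Integration by parts\<close>

lemma normal_density_at_infinity:
 assumes "\<sigma> > 0"
 shows "(normal_density 0 \<sigma> \<longlongrightarrow> 0) at_top" "(normal_density 0 \<sigma> \<longlongrightarrow> 0) at_bot"
proof -
 let ?a = "normal_density 0 \<sigma> \<longlongrightarrow> 0"
 let ?b = "2 * \<sigma>^2"
 have *: "?a F" if "filterlim (%z::real. z^2) at_top F" for F
 proof -
  have "filterlim (%z. 1 / ?b * z^2) at_top F"
   by (rule filterlim_tendsto_pos_mult_at_top[OF tendsto_const _ that]) (use assms in simp)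
  then have "filterlim (%z. - (1 / ?b * z^2)) at_bot F" by (simp add: filterlim_uminus_at_bot)
  then have "((%z. exp (- (1 / ?b * z^2))) \<longlongrightarrow> 0) F" by (rule filterlim_compose[OF exp_at_bot])
  then have "((%z. 1 / sqrt (2 * pi * \<sigma>^2) * exp (- (1 / ?b * z^2))) \<longlongrightarrow> 0) F" by (rule tendsto_mult_right_zero)
  then show ?thesis by (simp add: normal_density_def[abs_def])
 qed
 show "?a at_top" by (rule *) (rule filterlim_pow_at_top[OF _ filterlim_ident], simp)
 show "?a at_bot" by (rule *) (rule filterlim_pow_at_bot_even[OF _ filterlim_ident], simp_all)
qed

text \<open>Fundamental theorem of calculus for the product of \<open>m\<close> with the density,
  whose logarithmic derivative is -z / \<sigma>^2. The boundary terms vanish since \<open>m\<close>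
  is bounded.\<close>

lemma normal_integration_by_parts:
 fixes m m' :: "real => real"
 assumes \<sigma>: "\<sigma> > 0" and d: "!!z. (m has_real_derivative m' z) (at z)" and cont: "continuous_on UNIV m'"
  and b: "!!z. abs (m z) <= C" and i: "integrable (density lborel (normal_density 0 \<sigma>)) m'"
 shows "(\<integral>z. \<sigma>^2 * m' z \<partial>density lborel (normal_density 0 \<sigma>)) = (\<integral>z. m z * z \<partial>density lborel (normal_density 0 \<sigma>))"
proof -
 let ?\<phi> = "normal_density 0 \<sigma>"
 have mc: "continuous_on UNIV m" using d by (meson DERIV_isCont continuous_at_imp_continuous_on)
 have [measurable]: "m : bm borel" "m' : bm borel"
  using mc cont by (auto intro: borel_measurable_continuous_onI)
 have i1: "integrable lborel (%z. ?\<phi> z * m' z)"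
  using i by (subst (asm) integrable_density) (auto simp: normal_density_nonneg)
 have i2: "integrable lborel (%z. ?\<phi> z * (m z * z))"
 proof (rule Bochner_Integration.integrable_bound)
  show "integrable lborel (%z. C * (?\<phi> z * abs (z - 0)^1))" using integrable_normal_moment_abs[OF \<sigma>, of 0 1] by simp
  show "AE z in lborel. norm (?\<phi> z * (m z * z)) <= norm (C * (?\<phi> z * abs (z - 0)^1))"
  proof (rule AE_I2)
   fix z
   have "?\<phi> z * (abs (m z) * abs z) <= ?\<phi> z * (C * abs z)"
    using b[of z] by (intro mult_left_mono mult_right_mono) (auto simp: normal_density_nonneg)
   then show "norm (?\<phi> z * (m z * z)) <= norm (C * (?\<phi> z * abs (z - 0)^1))"
    using order_trans[OF abs_ge_zero b[of z]] by (simp add: abs_mult normal_density_nonneg mult_ac)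
  qed
 qed measurable
 define F' where "F' z = ?\<phi> z * m' z - ?\<phi> z * (m z * z) / \<sigma>^2" for z
 have i3: "integrable lborel F'" unfolding F'_def using i1 i2 by simp
 let ?a = "%z. m z * ?\<phi> z"
 have D: "(?a has_real_derivative F' z) (at z)" for z
 proof -
  define \<kappa> where "\<kappa> = 1 / sqrt (2 * pi * \<sigma>^2)"
  have \<phi>: "?\<phi> z = \<kappa> * exp (- (z^2) / (2 * \<sigma>^2))" for z by (simp add: normal_density_def \<kappa>_def)
  show ?thesis unfolding F'_def \<phi> using \<sigma>
   by (auto intro!: derivative_eq_intros d simp: field_simps power2_eq_square)
 qed
 have contF: "isCont F' z" for z
 proof -
  have "isCont m z" "isCont m' z" using mc cont by (auto simp: continuous_on_eq_continuous_at)
  then show ?thesis unfolding F'_def normal_density_def using \<sigma> by (intro continuous_intros) auto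
 qed
 have lim: "(?a \<longlongrightarrow> 0) F" if "(?\<phi> \<longlongrightarrow> 0) F" for F
 proof (rule Lim_null_comparison)
  show "((%z. C * ?\<phi> z) \<longlongrightarrow> 0) F" by (rule tendsto_mult_right_zero[OF that])
  show "\<forall>\<^sub>F z in F. norm (m z * ?\<phi> z) <= C * ?\<phi> z"
   using b by (intro always_eventually) (auto simp: abs_mult normal_density_nonneg intro: mult_right_mono)
 qed
 let ?b = "\<integral>z. ?\<phi> z * (m z * z) \<partial>lborel"
 let ?c = "(?a o real_of_ereal) \<longlongrightarrow> 0"
 let ?d = "\<integral>z. ?\<phi> z * m' z \<partial>lborel"
 have "(LBINT z=-\<infinity>..\<infinity>. F' z) = 0 - 0"
 proof (rule interval_integral_FTC_integrable)
  show "(?a has_vector_derivative F' z) (at z)" for z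
   using D by (simp add: has_real_derivative_iff_has_vector_derivative)
  show "set_integrable lborel (einterval (-\<infinity>) \<infinity>) F'" using i3 by (simp add: set_integrable_def einterval_def)
  show "?c (at_right (-\<infinity>))"
   using lim[OF normal_density_at_infinity(2)[OF \<sigma>]] by (simp add: ereal_tendsto_simps)
  show "?c (at_left \<infinity>)"
   using lim[OF normal_density_at_infinity(1)[OF \<sigma>]] by (simp add: ereal_tendsto_simps)
 qed (use contF in auto)
 then have "(LINT z|lborel. F' z) = 0"
  by (simp add: interval_lebesgue_integral_def set_lebesgue_integral_def einterval_def)
 then have "?d = ?b / \<sigma>^2"
  unfolding F'_def using i1 i2 by simp
 then have "\<sigma>^2 * ?d = ?b" using \<sigma> by simp
 then show ?thesis
  by (simp add: integral_density normal_density_nonneg)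
qed

context gaussian_space
begin

text \<open>The component of the Gaussian in the direction \<open>B k\<close> may be replaced by an independent copy.\<close>

lemma resample_direction:
 assumes k: "k : T" and c: "bq k k > 0"
 defines "N \<equiv> density lborel (normal_density 0 (sqrt (bq k k)))"
 defines "\<Phi> \<equiv> (%(f, z) x. f x + ((z - ip k f) / bq k k) *\<^sub>R B k x)"
 shows "\<Phi> : measurable (G \<Otimes>\<^sub>M N) TB" "G = distr (G \<Otimes>\<^sub>M N) TB \<Phi>" "prob_space N"
proof -
 show pN: "prob_space N" unfolding N_def by (rule prob_space_normal_density) (use c in simp)
 interpret N: prob_space N by (rule pN)
 interpret P: pair_prob_space G N ..
 have sN [measurable_cong]: "sets N = sets borel" by (simp add: N_def)
 have hT: "B k : T" by (rule B_T[OF k])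
 let ?a = "G \<Otimes>\<^sub>M N"
 have spP: "space ?a = T \<times> UNIV" by (simp add: space_pair_measure N_def)
 have \<Phi>_T: "\<Phi> p : T" if "p : space ?a" for p
  using that hT by (auto simp: \<Phi>_def spP intro: T_line)
 have ip\<Phi>: "ip l (\<Phi> (f, z)) = ip l f + ((z - ip k f) / bq k k) * ip l (B k)" if "l : T" "f : T" for l f z
  using that hT by (simp add: \<Phi>_def ip_add_right T_scale ip_scale_right)
 show meas: "\<Phi> : measurable ?a TB"
 proof (rule measurable_TB_I)
  fix n
  have "(%p. ip (g n) (fst p) + ((snd p - ip k (fst p)) / bq k k) * ip (g n) (B k)) : bm ?a"
   using k by measurable
  then show "(%p. ip (\<Phi> p) (g n)) : bm ?a"
   by (subst measurable_cong[where g="%p. ip (g n) (fst p) + ((snd p - ip k (fst p)) / bq k k) * ip (g n) (B k)"])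
    (auto simp: spP ip_sym[of _ "g n"] ip\<Phi>)
 qed (rule \<Phi>_T)
 show "G = distr ?a TB \<Phi>"
 proof (rule char_functional_unique)
  show "finite_measure G" by (rule G.finite_measure)
  show "finite_measure (distr ?a TB \<Phi>)" by (rule P.finite_measure_distr[OF meas])
  fix l assume l: "l : T"
  \<comment> \<open>\<open>a\<close> is the regression coefficient of \<open>ip l\<close> on
    \<open>ip k\<close>: the remainder \<open>l'\<close> is uncorrelated with \<open>k\<close>. The
    characteristic functional of the resampled field therefore splits into two Gaussian factors
    whose variances add up to \<open>bq l l\<close>.\<close>
  define a where "a = bq l k / bq k k"
  define l' where "l' = (%x. l x - a *\<^sub>R k x)"
  have l'T: "l' : T" unfolding l'_def using l k by (intro T_diff T_scale)
  have il: "iexp (ip l (\<Phi> (f, z))) = iexp (ip l' f) * iexp (a * z)" if "f : T" for f z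
  proof -
   have "ip l (\<Phi> (f, z)) = ip l' f + a * z"
    using l k that c by (simp add: ip\<Phi> l'_def ip_diff_left T_scale ip_scale_left a_def bq_def[symmetric] field_simps)
   then show ?thesis by (simp add: exp_add[symmetric] distrib_left)
  qed
  have "(\<integral>f. iexp (ip l f) \<partial>distr ?a TB \<Phi>) = (\<integral>p. iexp (ip l (\<Phi> p)) \<partial>?a)"
   using l by (subst integral_distr[OF meas]) auto
  also have "... = (\<integral>p. (case p of (f, z) => iexp (ip l' f) * iexp (a * z)) \<partial>?a)"
   by (intro Bochner_Integration.integral_cong refl) (auto simp: spP il)
  also have "... = (\<integral>f. \<integral>z. iexp (ip l' f) * iexp (a * z) \<partial>N \<partial>G)"
  proof (rule P.integral_fst[symmetric])
   show "integrable ?a (%(f, z). iexp (ip l' f) * iexp (a * z))"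
    using l'T by (intro P.integrable_const_bound[where B=1]) (auto simp: norm_mult norm_exp_i_times split_beta)
  qed
  also have "... = (LINT f|G. iexp (ip l' f)) * (LINT z|N. iexp (a * z))" by simp
  also have "(LINT z|N. iexp (a * z)) = (LINT f|G. iexp (a * ip k f))"
   unfolding N_def one_dim_law(4)[OF k c, symmetric] using k by (subst integral_distr) auto
  also have "... = (LINT f|G. iexp (ip (%x. a *\<^sub>R k x) f))" by (simp add: ip_scale_left)
  also have "... = exp (- (a^2 * bq k k) / 2)"
   using k by (subst one_dim_law(3)) (auto simp: T_scale bq_scale_left bq_scale_right power2_eq_square mult.assoc)
  also have "(LINT f|G. iexp (ip l' f)) = exp (- bq l' l' / 2)" by (rule one_dim_law(3)[OF l'T])
  also have "complex_of_real (exp (- bq l' l' / 2)) * complex_of_real (exp (- (a^2 * bq k k) / 2)) = complex_of_real (exp (- bq l l / 2))"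
  proof -
   have "bq l' l' = bq l l - 2 * a * bq l k + a^2 * bq k k"
    unfolding l'_def using l k by (simp add: bq_diff_left bq_diff_right T_scale T_diff bq_scale_left bq_scale_right bq_sym[of k l] power2_eq_square algebra_simps)
   moreover have "a * bq l k = a^2 * bq k k" using c by (simp add: a_def power2_eq_square)
   ultimately have "bq l' l' + a^2 * bq k k = bq l l" by simp
   then show ?thesis unfolding of_real_mult[symmetric] exp_add[symmetric] by (simp add: field_simps)
  qed
  finally show "(LINT f|G. iexp (ip l f)) = (\<integral>f. iexp (ip l f) \<partial>distr ?a TB \<Phi>)"
   using one_dim_law(3)[OF l] by simp
 qed (simp_all add: sets_G)
qed

text \<open>Differentiability along whole lines, with a derivative continuous on each of them, is
  the regularity that the one-dimensional formula asks for after resampling.\<close>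

definition deriv_along :: "(real^'d => real^'d) => ((real^'d => real^'d) => real) => ((real^'d => real^'d) => real) => bool" where
 "deriv_along h P P' \<longleftrightarrow> P : bm TB & P' : bm TB \<and>
  (ALL f:T. (ALL t. ((%s. P (%x. f x + s *\<^sub>R h x)) has_real_derivative P' (%x. f x + t *\<^sub>R h x)) (at t)) \<and>
   continuous_on UNIV (%t. P' (%x. f x + t *\<^sub>R h x)))"

text \<open>By invariance under resampling both sides become iterated integrals over
  \<open>f\<close> and a normal variable z. For fixed \<open>f\<close> the inner integrals agree by
  the one-dimensional formula, because \<open>ip k\<close> of the resampled field equals z.\<close>

lemma integration_by_parts_bounded:
 assumes k: "k : T" and c: "bq k k > 0" and d: "deriv_along (B k) P P'"
  and b: "!!f. f : T ==> abs (P f) <= C" and i: "integrable G P'"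
 shows "(LINT f|G. P' f) = (LINT f|G. P f * ip k f)"
proof -
 define c where "c = bq k k"
 define N where "N = density lborel (normal_density 0 (sqrt (bq k k)))"
 define \<Phi> where "\<Phi> = (%(f, z) x. f x + ((z - ip k f) / bq k k) *\<^sub>R B k x)"
 note R = resample_direction[OF k assms(2), folded N_def \<Phi>_def]
 interpret N: prob_space N by (rule R(3))
 interpret P: pair_prob_space G N ..
 have cpos: "c > 0" using assms(2) by (simp add: c_def)
 have [measurable]: "P : bm TB" "P' : bm TB" using d by (auto simp: deriv_along_def)
 have hT: "B k : T" by (rule B_T[OF k])
 let ?b = "%f. P f * ip k f"
 have i2: "integrable G ?b"
 proof (rule growth_integrable[where C="C * nm k"])
  fix f assume f: "f : T"
  have C0: "C >= 0" using b[OF f] by linarith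
  have "abs (P f) * abs (ip k f) <= C * (nm k * nm f)" using b[OF f] ip_bound[OF k f] C0 by (intro mult_mono) auto
  also have "... = (C * nm k) * nm f" by simp
  also have "... <= (C * nm k) * (1 + nm f)^4"
  proof (intro mult_left_mono)
   show "nm f <= (1 + nm f)^4" using self_le_power[of "1 + nm f" 4] by simp
  qed (use C0 in simp)
  finally show "abs (P f * ip k f) <= C * nm k * (1 + nm f) ^ 4" by (simp add: abs_mult)
 qed (use k in measurable)
 have ii: "integrable (G \<Otimes>\<^sub>M N) (%p. Q (\<Phi> p)) & (LINT f|G. Q f) = (\<integral>f. \<integral>z. Q (\<Phi> (f, z)) \<partial>N \<partial>G)"
  if "integrable G Q" "Q : bm TB" for Q :: "_ => real"
 proof -
  have a: "integrable (G \<Otimes>\<^sub>M N) (%p. Q (\<Phi> p))"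
   using that(1) by (subst (asm) R(2)) (simp add: integrable_distr_eq[OF R(1) that(2)])
  have "(LINT f|G. Q f) = (\<integral>p. Q (\<Phi> p) \<partial>(G \<Otimes>\<^sub>M N))"
   by (subst R(2)) (simp add: integral_distr[OF R(1) that(2)])
  also have "... = (\<integral>f. \<integral>z. Q (\<Phi> (f, z)) \<partial>N \<partial>G)" by (rule P.integral_fst'[OF a, symmetric])
  finally show ?thesis using a by simp
 qed
 let ?a = "%f0 z c. %x. f0 x + (z / c) *\<^sub>R B k x"
 have "(\<integral>f. \<integral>z. P' (\<Phi> (f, z)) \<partial>N \<partial>G) = (\<integral>f. \<integral>z. ?b (\<Phi> (f, z)) \<partial>N \<partial>G)"
 proof (rule integral_cong_AE)
  have ae: "AE f in G. integrable N (%z. P' (\<Phi> (f, z)))"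
   using P.AE_integrable_fst'[OF conjunct1[OF ii[OF i]]] by simp
  show "AE f in G. (LINT z|N. P' (\<Phi> (f, z))) = (LINT z|N. ?b (\<Phi> (f, z)))"
   using ae AE_space
  proof eventually_elim
   case (elim f)
   then have f: "f : T" by simp
   \<comment> \<open>\<open>f0\<close> is the resampled field at z = 0, so z enters only through the
     line f0 + (z / c) B k.\<close>
   define f0 where "f0 = (%x. f x + (- ip k f / c) *\<^sub>R B k x)"
   have f0: "f0 : T" unfolding f0_def using f hT by (rule T_line)
   have \<Phi>0: "\<Phi> (f, z) = (?a f0 z c)" for z
    by (auto simp: \<Phi>_def f0_def c_def diff_divide_distrib scaleR_diff_left fun_eq_iff)
   have ipz: "ip k (\<Phi> (f, z)) = z" for z
   proof -
    have "ip k (B k) = c" by (simp add: c_def bq_def)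
    then show ?thesis unfolding \<Phi>_def using k f hT cpos
    by (simp add: ip_add_right T_scale ip_scale_right c_def[symmetric])
   qed
   define m where "m = (%z. P (?a f0 z c))"
   define m' where "m' = (%z. P' (?a f0 z c) / c)"
   \<comment> \<open>A unit change of z moves the field by B k / c; this factor 1 / c cancels
     against the variance \<open>c\<close>.\<close>
   have "(LINT z|N. (sqrt c)^2 * m' z) = (LINT z|N. m z * z)"
    unfolding N_def c_def[symmetric]
   proof (rule normal_integration_by_parts)
    show "sqrt c > 0" using cpos by simp
    show "(m has_real_derivative m' z) (at z)" for z
    proof -
    have "((%s. P (%x. f0 x + s *\<^sub>R B k x)) has_real_derivative P' (?a f0 z c)) (at (z / c))"
    using d f0 by (auto simp: deriv_along_def)
    moreover have "((%z. z / c) has_real_derivative 1 / c) (at z)"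
    using cpos by (auto intro!: derivative_eq_intros)
    ultimately show ?thesis
    using DERIV_chain'[where f="%z. z / c" and g="%s. P (%x. f0 x + s *\<^sub>R B k x)" and s=UNIV]
    unfolding m_def m'_def by fastforce
    qed
    have "continuous_on UNIV (%t. P' (%x. f0 x + t *\<^sub>R B k x))" using d f0 by (auto simp: deriv_along_def)
    moreover have "continuous_on UNIV (%z. z / c)" using cpos by (intro continuous_intros) auto
    ultimately have "continuous_on UNIV (%z. P' (?a f0 z c))"
    by (rule continuous_on_compose2) auto
    then show "continuous_on UNIV m'" unfolding m'_def using cpos by (intro continuous_on_divide continuous_on_const) auto
    show "abs (m z) <= C" for z unfolding m_def using T_line[OF f0 hT] by (intro b) auto
    show "integrable (density lborel (normal_density 0 (sqrt c))) m'"
    using elim(1) unfolding \<Phi>0 m'_def N_def c_def by simp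
   qed
   then show ?case using cpos unfolding \<Phi>0 m_def m'_def by (simp add: ipz[unfolded \<Phi>0])
  qed
  show "(%f. LINT z|N. P' (\<Phi> (f, z))) : bm G"
   using R(1) by measurable
  show "(%f. LINT z|N. P (\<Phi> (f, z)) * ip k (\<Phi> (f, z))) : bm G"
   using R(1) k by measurable
 qed
 then show ?thesis using ii[OF i] ii[OF i2] k by simp
qed

text \<open>Composition with t -> (n+1) sin (t / (n+1)) makes \<open>P\<close> bounded without
  enlarging |P| or |P'|, so the bounded case applies and both integrals converge by
  domination.\<close>

theorem integration_by_parts:
 assumes k: "k : T" and c: "bq k k > 0" and d: "deriv_along (B k) P P'"
  and i: "integrable G P'" and i2: "integrable G (%f. P f * ip k f)"
 shows "(LINT f|G. P' f) = (LINT f|G. P f * ip k f)"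
proof -
 have [measurable]: "P : bm TB" "P' : bm TB" using d by (auto simp: deriv_along_def)
 define S where "S n f = real (Suc n) * sin (P f / real (Suc n))" for n f
 define S' where "S' n f = cos (P f / real (Suc n)) * P' f" for n f
 have iS': "integrable G (S' n)" for n
 proof (rule Bochner_Integration.integrable_bound[OF i])
  show "S' n : bm G" unfolding S'_def by measurable
  show "AE f in G. norm (S' n f) <= norm (P' f)"
   unfolding S'_def by (auto simp: abs_mult intro!: AE_I2 mult_left_le_one_le)
 qed
 let ?a = "%f t. %x. f x + t *\<^sub>R B k x"
 have eq: "(LINT f|G. S' n f) = (LINT f|G. S n f * ip k f)" for n
 proof (rule integration_by_parts_bounded[OF k c _ _ iS'])
  show "deriv_along (B k) (S n) (S' n)"
   unfolding deriv_along_def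
  proof (intro conjI ballI allI)
   fix f t assume f: "f : T"
   have D: "((%s. P (%x. f x + s *\<^sub>R B k x)) has_real_derivative P' (?a f t)) (at t)" for t
    using d f by (auto simp: deriv_along_def)
   have C': "continuous_on UNIV (%t. P' (?a f t))"
    using d f by (auto simp: deriv_along_def)
   show "((%s. S n (%x. f x + s *\<^sub>R B k x)) has_real_derivative S' n (?a f t)) (at t)"
    unfolding S_def S'_def by (rule derivative_eq_intros D refl | simp)+
   have "continuous_on UNIV (%s. P (%x. f x + s *\<^sub>R B k x))"
    using D by (meson DERIV_isCont continuous_at_imp_continuous_on)
   then show "continuous_on UNIV (%t. S' n (?a f t))"
    unfolding S'_def using C' by (intro continuous_intros) auto
  qed (unfold S_def S'_def, measurable)
  show "abs (S n f) <= real (Suc n)" for f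
   unfolding S_def abs_mult by (simp add: mult_left_le)
 qed
 let ?b = "%x n. x / real (Suc n)"
 have l1: "(%n. LINT f|G. S' n f) ~~> (LINT f|G. P' f)"
 proof (rule integral_dominated_convergence[where w="%f. abs (P' f)"])
  have "(%n. cos (?b x n) * y) ~~> cos 0 * y" for x y :: real
   using LIMSEQ_Suc[OF lim_const_over_n[of x]] by (intro tendsto_intros) auto
  then show "AE f in G. (%n. S' n f) ~~> P' f" unfolding S'_def by (auto intro!: AE_I2)
  show "AE f in G. norm (S' n f) <= abs (P' f)" for n
   unfolding S'_def by (auto simp: abs_mult intro!: AE_I2 mult_left_le_one_le)
 qed (use i in \<open>auto simp: S'_def[abs_def]\<close>)
 have l2: "(%n. LINT f|G. S n f * ip k f) ~~> (LINT f|G. P f * ip k f)"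
 proof (rule integral_dominated_convergence[where w="%f. abs (P f * ip k f)"])
  have "(%n. real (Suc n) * sin (?b x n)) ~~> x" for x :: real
  proof (cases "x = 0")
   case False
   have "((%h::real. (sin (0 + h) - sin 0) / h) \<longlongrightarrow> cos 0) (at 0)"
    using DERIV_sin[of "0::real"] unfolding DERIV_def .
   then have s: "((%h::real. sin h / h) \<longlongrightarrow> 1) (at 0)" by simp
   have "filterlim (%n. x / real (Suc n)) (at 0) sequentially"
    unfolding filterlim_at using False LIMSEQ_Suc[OF lim_const_over_n[of x]] by auto
   from tendsto_mult_left[OF filterlim_compose[OF s this], of x]
   have "(%n. x * (sin (?b x n) / (?b x n))) ~~> x * 1" .
   moreover have "x * (sin (?b x n) / (?b x n)) = real (Suc n) * sin (?b x n)" for n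
    using False by (simp del: of_nat_Suc)
   ultimately show ?thesis by (simp only: mult_1_right)
  qed simp
  then have "(%n. real (Suc n) * sin (?b x n) * y) ~~> x * y" for x y :: real
   by (intro tendsto_mult tendsto_const)
  then show "AE f in G. (%n. S n f * ip k f) ~~> P f * ip k f" unfolding S_def by (auto intro!: AE_I2)
  have "abs (real (Suc n) * sin (?b x n)) <= abs x" for x n
   using abs_sin_x_le_abs_x[of "x / real (Suc n)"] by (simp add: abs_mult field_simps del: of_nat_Suc)
  then show "AE f in G. norm (S n f * ip k f) <= abs (P f * ip k f)" for n
   unfolding S_def by (auto simp: abs_mult intro!: AE_I2 mult_right_mono)
 qed (use i2 k in \<open>auto simp: S_def[abs_def]\<close>)
 show ?thesis using LIMSEQ_unique[OF l1] l2 eq by simp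
qed

end

section \<open>The Wasserstein distance\<close>

lemma P2_l2_space: "mu : P2 ==> l2_space mu" by (simp add: l2_space_def)

text \<open>The product coupling makes the infimum in \<open>W2\<close> range over a nonempty set,
  as the lower-bound rule for real infima requires.\<close>

lemma couplings_nonempty:
 assumes "mu : P2" "nu : P2" shows "mu \<Otimes>\<^sub>M nu : couplings mu nu"
proof -
 interpret M: l2_space mu by (rule P2_l2_space[OF assms(1)])
 interpret N: l2_space nu by (rule P2_l2_space[OF assms(2)])
 interpret pair_prob_space mu nu ..
 let ?a = "mu \<Otimes>\<^sub>M nu"
 have s: "sets ?a = sets borel"
  using sets_pair_measure_cong[OF M.sets_lam N.sets_lam] by (simp only: borel_prod)
 have sp: "space mu = UNIV" "space nu = UNIV" by simp_all
 have m1: "fst : measurable ?a borel" and m2: "snd : measurable ?a borel"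
  using measurable_fst[of mu nu] measurable_snd[of mu nu]
  by (simp_all add: measurable_cong_sets[OF refl M.sets_lam] measurable_cong_sets[OF refl N.sets_lam])
 have e1: "distr ?a borel fst = mu"
 proof (rule measure_eqI)
  fix A assume "A : sets (distr ?a borel fst)"
  then have A: "A : sets mu" "A : sets borel" by (simp_all add: M.sets_lam)
  have "emeasure (distr ?a borel fst) A = emeasure ?a (fst -` A \<inter> space ?a)"
   by (rule emeasure_distr[OF m1 A(2)])
  also have "fst -` A \<inter> space ?a = A \<times> space nu" by (auto simp: space_pair_measure)
  also have "emeasure ?a (A \<times> space nu) = emeasure mu A * emeasure nu (space nu)"
   by (rule N.emeasure_pair_measure_Times[OF A(1) sets.top])
  finally show "emeasure (distr ?a borel fst) A = emeasure mu A" by (simp only: N.emeasure_space_1 mult_1_right)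
 qed (simp add: M.sets_lam)
 have e2: "distr ?a borel snd = nu"
 proof (rule measure_eqI)
  fix A assume "A : sets (distr ?a borel snd)"
  then have A: "A : sets nu" "A : sets borel" by (simp_all add: N.sets_lam)
  have "emeasure (distr ?a borel snd) A = emeasure ?a (snd -` A \<inter> space ?a)"
   by (rule emeasure_distr[OF m2 A(2)])
  also have "snd -` A \<inter> space ?a = space mu \<times> A" by (auto simp: space_pair_measure)
  also have "emeasure ?a (space mu \<times> A) = emeasure mu (space mu) * emeasure nu A"
   by (rule N.emeasure_pair_measure_Times[OF sets.top A(1)])
  finally show "emeasure (distr ?a borel snd) A = emeasure nu A" by (simp only: M.emeasure_space_1 mult_1)
 qed (simp add: N.sets_lam)
 show ?thesis using s e1 e2 by (simp add: couplings_def)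
qed

lemma W2_le:
 assumes "\<pi> : couplings mu nu" shows "W2 mu nu <= sqrt (LINT z|\<pi>. (dist (fst z) (snd z))^2)"
proof -
 have "(INF \<pi>\<in>couplings mu nu. \<integral>z. (dist (fst z) (snd z))^2 \<partial>\<pi>) <= (LINT z|\<pi>. (dist (fst z) (snd z))^2)"
  by (rule cINF_lower[OF _ assms]) (auto intro!: bdd_belowI[where m=0])
 then show ?thesis unfolding W2_def by (rule real_sqrt_le_mono)
qed

lemma lipschitz_integrable:
 fixes \<phi> :: "real^'d => real"
 assumes "mu : P2" and L: "!!x y. abs (\<phi> x - \<phi> y) <= L * norm (x - y)"
 shows "continuous_on UNIV \<phi>" "integrable mu \<phi>"
proof -
 interpret M: l2_space mu by (rule P2_l2_space[OF assms(1)])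
 \<comment> \<open>A Lipschitz bound between two distinct points forces a nonnegative
   constant.\<close>
 have L0: "L >= 0" using L[of 0 "axis undefined 1"] by (simp add: norm_axis_1 order_trans[OF abs_ge_zero])
 have "L-lipschitz_on UNIV \<phi>" by (rule lipschitz_onI) (use L L0 in \<open>auto simp: dist_norm dist_real_def\<close>)
 then show c: "continuous_on UNIV \<phi>" by (rule lipschitz_on_continuous_on)
 show "integrable mu \<phi>"
 proof (rule Bochner_Integration.integrable_bound)
  show "integrable mu (%x. abs (\<phi> 0) + L * norm x)" using M.integral_norm_bound(1)[OF M.T_id] by simp
  show "\<phi> : bm mu" using borel_measurable_continuous_onI[OF c] measurable_cong_sets[OF M.sets_lam refl] by auto
  show "AE x in mu. norm (\<phi> x) <= norm (abs (\<phi> 0) + L * norm x)"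
  proof (rule AE_I2)
   fix x
   have "abs (\<phi> x) <= abs (\<phi> 0) + L * norm x" using L[of x 0] by simp
   then show "norm (\<phi> x) <= norm (abs (\<phi> 0) + L * norm x)" by simp
  qed
 qed
qed

text \<open>For each coupling the difference of the integrals is at most L times the mean distance,
  and nonnegativity of the variance bounds the mean by the root mean square. Squares are compared
  first, so that the infimum can be taken under the root in \<open>W2\<close>.\<close>

lemma W2_lipschitz_integral:
 fixes \<phi> :: "real^'d => real"
 assumes P: "mu : P2" "nu : P2" and L: "!!x y. abs (\<phi> x - \<phi> y) <= L * norm (x - y)"
 shows "abs ((\<integral>x. \<phi> x \<partial>nu) - (\<integral>x. \<phi> x \<partial>mu)) <= L * W2 mu nu"
proof -
 interpret M: l2_space mu by (rule P2_l2_space[OF P(1)])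
 interpret N: l2_space nu by (rule P2_l2_space[OF P(2)])
 have L0: "L >= 0" using L[of 0 "axis undefined 1"] by (simp add: norm_axis_1 order_trans[OF abs_ge_zero])
 let ?D = "abs ((\<integral>x. \<phi> x \<partial>nu) - (\<integral>x. \<phi> x \<partial>mu))"
 note \<phi> = lipschitz_integrable[OF P(1) L] lipschitz_integrable[OF P(2) L]
 have [measurable]: "\<phi> : bm borel" using \<phi>(1) by (rule borel_measurable_continuous_onI)
 let ?a = "%z. dist (fst z) (snd z)"
 let ?b = "%\<pi>. LINT z|\<pi>. dist (fst z) (snd z)"
 let ?c = "%z. dist (fst z) (snd z)"
 let ?d = "%\<pi>. LINT z|\<pi>. (?a z)^2"
 have *: "?D\<^sup>2 <= L^2 * (?d \<pi>)" if "\<pi> : couplings mu nu" for \<pi>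
 proof -
  have \<pi>: "sets \<pi> = sets borel" "distr \<pi> borel fst = mu" "distr \<pi> borel snd = nu" using that by (auto simp: couplings_def)
  note [measurable_cong] = \<pi>(1)
  have m1: "fst : measurable \<pi> borel" and m2: "snd : measurable \<pi> borel"
   using \<pi>(1) by (auto simp: measurable_cong_sets[OF \<pi>(1) refl] borel_prod[symmetric])
  interpret \<pi>: prob_space \<pi>
   using M.prob unfolding \<pi>(2)[symmetric] by (rule prob_space_distrD[OF m1])
  have mdist: "?c : bm \<pi>" using m1 m2 by measurable
  have i1: "integrable \<pi> (%z. (norm (fst z))^2)"
   using M.second_moment unfolding \<pi>(2)[symmetric] by (subst (asm) integrable_distr_eq[OF m1]) auto
  have i2: "integrable \<pi> (%z. (norm (snd z))^2)"
   using N.second_moment unfolding \<pi>(3)[symmetric] by (subst (asm) integrable_distr_eq[OF m2]) auto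
  have p1: "integrable \<pi> (%z. \<phi> (fst z))" "(\<integral>x. \<phi> x \<partial>mu) = (\<integral>z. \<phi> (fst z) \<partial>\<pi>)"
   using \<phi>(2) unfolding \<pi>(2)[symmetric] by (auto simp: integrable_distr_eq[OF m1] integral_distr[OF m1])
  have p2: "integrable \<pi> (%z. \<phi> (snd z))" "(\<integral>x. \<phi> x \<partial>nu) = (\<integral>z. \<phi> (snd z) \<partial>\<pi>)"
   using \<phi>(4) unfolding \<pi>(3)[symmetric] by (auto simp: integrable_distr_eq[OF m2] integral_distr[OF m2])
  have d2: "integrable \<pi> (%z. (?a z)^2)"
  proof (rule Bochner_Integration.integrable_bound)
   show "integrable \<pi> (%z. 2 * (norm (fst z))^2 + 2 * (norm (snd z))^2)" using i1 i2 by simp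
   show "(%z. (?a z)^2) : bm \<pi>" using mdist by measurable
   show "AE z in \<pi>. norm ((?a z)^2) <= norm (2 * (norm (fst z))^2 + 2 * (norm (snd z))^2)"
   proof (rule AE_I2)
    fix z :: "(real^'d) \<times> (real^'d)"
    have "(?a z)^2 <= (norm (fst z) + norm (snd z))^2" by (simp add: dist_norm norm_triangle_ineq4 power_mono)
    also have "... <= 2 * (norm (fst z))^2 + 2 * (norm (snd z))^2"
    using sum_squares_bound[of "norm (fst z)" "norm (snd z)"] by (simp add: power2_sum)
    finally show "norm ((?a z)^2) <= norm (2 * (norm (fst z))^2 + 2 * (norm (snd z))^2)" by simp
   qed
  qed
  have d1: "integrable \<pi> ?c"
  proof (rule Bochner_Integration.integrable_bound)
   show "integrable \<pi> (%z. 1 + (?a z)^2)" using d2 by simp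
   show "?c : bm \<pi>" by (rule mdist)
   show "AE z in \<pi>. norm (?a z) <= norm (1 + (?a z)^2)"
   proof (rule AE_I2)
    fix z :: "(real^'d) \<times> (real^'d)"
    have "0 <= (dist (fst z) (snd z) - 1)^2" by simp
    then show "norm (?a z) <= norm (1 + (?a z)^2)"
    unfolding power2_diff by (simp add: abs_if)
   qed
  qed
  have "?D = abs (\<integral>z. \<phi> (snd z) - \<phi> (fst z) \<partial>\<pi>)" using p1 p2 by simp
  also have "... <= (\<integral>z. abs (\<phi> (snd z) - \<phi> (fst z)) \<partial>\<pi>)" by (rule integral_abs_bound)
  also have "... <= (LINT z|\<pi>. L * dist (fst z) (snd z))"
  proof (rule integral_mono)
   show "abs (\<phi> (snd z) - \<phi> (fst z)) <= L * dist (fst z) (snd z)" for z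
    using L[of "snd z" "fst z"] by (metis dist_commute dist_norm)
  qed (use p1 p2 d1 in auto)
  finally have D: "?D <= L * (?b \<pi>)" by simp
  have "(?b \<pi>)^2 <= (?d \<pi>)"
  proof -
   have "0 <= \<pi>.variance ?c" by (rule \<pi>.variance_positive)
   also have "... = (?d \<pi>) - (?b \<pi>)^2"
    by (rule \<pi>.variance_eq[OF d1 d2])
   finally show ?thesis by simp
  qed
  moreover have "?D\<^sup>2 <= L^2 * (?b \<pi>)^2"
   using D unfolding power_mult_distrib[symmetric] by (intro power_mono) auto
  ultimately show ?thesis by (smt (verit) mult_left_mono zero_le_power2)
 qed
 define I where "I = (INF \<pi>\<in>couplings mu nu. \<integral>z. (?a z)^2 \<partial>\<pi>)"
 have ne: "couplings mu nu ~= {}" using couplings_nonempty[OF P] by auto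
 have I0: "I >= 0" unfolding I_def by (rule cINF_greatest[OF ne]) simp
 show ?thesis
 proof (cases "L = 0")
  case True
  then show ?thesis using *[OF couplings_nonempty[OF P]] by simp
 next
  case False
  then have "L > 0" using L0 by simp
  then have "?D\<^sup>2 / L^2 <= I" unfolding I_def
   using * by (intro cINF_greatest[OF ne]) (simp add: field_simps)
  then have "?D\<^sup>2 <= L^2 * I" using \<open>L > 0\<close> by (simp add: field_simps)
  then have "sqrt (?D\<^sup>2) <= sqrt (L^2 * I)" by (rule real_sqrt_le_mono)
  then show ?thesis using L0 by (simp add: real_sqrt_mult W2_def I_def)
 qed
qed

context l2_space
begin

section \<open>Push-forwards and transported integrals\<close>

lemma push_P2: assumes "f : T" shows "Psi f : P2"
proof -
 have m: "f : measurable lam borel" using assms by (rule T_measurable_lam)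
 show ?thesis unfolding P2_def push_def
  using prob_space_distr[OF m] T_integrable[OF assms] by (simp add: integrable_distr_eq[OF m])
qed

lemma integral_push: "f : T ==> \<phi> : bm borel ==> (\<integral>x. \<phi> x \<partial>Psi f) = (\<integral>x. \<phi> (f x) \<partial>lam)"
 for \<phi> :: "_ => 'b::{banach, second_countable_topology}"
 unfolding push_def using T_measurable_lam by (intro integral_distr)

lemma l2_inner_push:
 "f : T ==> h : bm borel ==> k : bm borel ==>
  l2_inner (Psi f) h k = ip (h o f) (k o f)"
 unfolding l2_inner_def by (subst integral_push) auto

lemma tangent_push_iff:
 assumes f: "f : T" and h: "h : bm borel"
 shows "h : tangent (Psi f) \<longleftrightarrow> h o f : T"
proof -
 have "integrable (Psi f) (%x. (norm (h x))^2) \<longleftrightarrow> integrable lam (%x. (norm (h (f x)))^2)"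
  unfolding push_def using h by (intro integrable_distr_eq[OF T_measurable_lam[OF f]]) measurable
 moreover have "h o f : bm borel" using measurable_comp[OF T_measurable[OF f] h] .
 ultimately show ?thesis using h by (simp add: tangent_def)
qed

lemma tangent_push: "f : T ==> h : tangent (Psi f) ==> h o f : T"
 using tangent_push_iff[of f h] by (simp add: tangent_def)

lemma AE_push: assumes "f : T" "{x. P x} : sets borel" "AE x in Psi f. P x" shows "AE x in lam. P (f x)"
 using assms T_measurable_lam[OF assms(1)] unfolding push_def by (subst (asm) AE_distr_iff) auto

lemma push_push: "f : T ==> h : bm borel ==> push (Psi f) h = Psi (h o f)"
 unfolding push_def using T_measurable_lam by (intro distr_distr) auto

text \<open>The joint law of \<open>f\<close> and \<open>h\<close> under \<open>lam\<close> is a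
  coupling whose cost is the squared L2 distance; push-forward is therefore 1-Lipschitz.\<close>

lemma W2_push: assumes "f : T" "h : T" shows "W2 (Psi f) (Psi h) <= nm (%x. f x - h x)"
proof -
 have [measurable]: "f : bm borel" "h : bm borel" using assms T_measurable by auto
 define \<pi> where "\<pi> = distr lam borel (%x. (f x, h x))"
 have m: "(%x. (f x, h x)) : measurable lam borel" by (simp add: borel_prod[symmetric])
 have fs: "fst : measurable (borel :: ((real^'d) \<times> (real^'d)) measure) borel" "snd : measurable (borel :: ((real^'d) \<times> (real^'d)) measure) borel"
  by (auto intro!: borel_measurable_continuous_onI continuous_on_fst continuous_on_snd)
 have "\<pi> : couplings (Psi f) (Psi h)"
 proof -
  have "distr \<pi> borel fst = Psi f" unfolding \<pi>_def push_def by (subst distr_distr[OF fs(1) m]) (simp add: o_def)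
  moreover have "distr \<pi> borel snd = Psi h" unfolding \<pi>_def push_def by (subst distr_distr[OF fs(2) m]) (simp add: o_def)
  moreover have "sets \<pi> = sets borel" by (simp add: \<pi>_def)
  ultimately show ?thesis by (simp add: couplings_def)
 qed
 from W2_le[OF this] have "W2 (Psi f) (Psi h) <= sqrt (LINT z|\<pi>. (dist (fst z) (snd z))^2)" .
 also have "(LINT z|\<pi>. (dist (fst z) (snd z))^2) = (LINT x|lam. (dist (f x) (h x))^2)"
 proof -
  have "(%z::(real^'d) \<times> (real^'d). (dist (fst z) (snd z))^2) : bm borel"
   by (intro borel_measurable_continuous_onI continuous_intros)
  then show ?thesis unfolding \<pi>_def by (subst integral_distr[OF m]) auto
 qed
 also have "sqrt ... = nm (%x. f x - h x)"
  by (simp add: l2_norm_def ip_self dist_norm)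
 finally show ?thesis .
qed

lemma W2_conv: assumes "conv F f" shows "(%n. W2 (Psi f) (Psi (F n))) ~~> 0"
proof (rule tendsto_by_bound)
 fix n
 have "\<pi> : couplings (Psi f) (Psi (F n)) ==> 0 <= (LINT z|\<pi>. (dist (fst z) (snd z))^2)" for \<pi> by simp
 moreover have "couplings (Psi f) (Psi (F n)) ~= {}"
  using couplings_nonempty push_P2 conv_T[OF assms] by blast
 ultimately have "0 <= W2 (Psi f) (Psi (F n))" unfolding W2_def
  by (intro real_sqrt_ge_zero cINF_greatest) auto
 then show "norm (W2 (Psi f) (Psi (F n)) - 0) <= nm (%x. F n x - f x)"
  using W2_push[OF conv_T(2)[OF assms] conv_T(1)[OF assms, of n]] nm_minus_commute[of f "F n"] by simp
qed (use assms in \<open>simp add: conv_def\<close>)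

text \<open>Through the pullback sigma-algebra it suffices that preimages of \<open>W2\<close>-open
  sets are open, which the Lipschitz bound gives.\<close>

lemma measurable_push [measurable]: "Psi : measurable TB P2_borel"
proof (rule measurableI)
 show "Psi f : space P2_borel" if "f : space TB" for f using that push_P2 by (simp add: P2_borel_def)
 fix A assume "A : sets (P2_borel :: (real^'d) measure measure)"
 moreover have "Psi : space TB \<rightarrow> P2" using push_P2 by auto
 note N = pullback_sigma[OF this]
 let ?a = "%A. sigma P2 {A. A \<subseteq> P2 & Psi -` A \<inter> space TB : sets TB}"
 let ?b = "metric_borel T (%f g. nm (%x. f x - g x))"
 have "sets (P2_borel :: (real^'d) measure measure) \<subseteq> sets (?a A)"
  unfolding P2_borel_def
 proof (rule metric_borel_subsetI[OF N(2)])
  fix U :: "(real^'d) measure set" assume U: "U \<subseteq> P2" "!!mu. mu : U ==> EX r>0. ALL nu:P2. W2 mu nu < r --> nu : U"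
  have "Psi -` U \<inter> space TB : sets TB"
   unfolding tangent_borel_def
  proof (rule metric_borel_openI)
   fix f assume "f : Psi -` U \<inter> space ?b"
   then have f: "f : T" "Psi f : U" by auto
   from U(2)[OF f(2)] obtain r where r: "r > 0" "!!nu. nu : P2 ==> W2 (Psi f) nu < r ==> nu : U" by auto
   show "EX r>0. ALL y:T. nm (%x. f x - y x) < r --> y : Psi -` U \<inter> space ?b"
    using r push_P2 W2_push[OF f(1)] by (intro exI[of _ r]) (auto intro: order.strict_trans1)
  qed auto
  then show "U : sets (?a A)" using U(1) unfolding N(1) by simp
 qed
 ultimately show "Psi -` A \<inter> space TB : sets TB" using N(1) by auto
qed

lemma P2_continuous_seqcont: assumes "P2_continuous u" shows "seqcont (%f. u (Psi f))"
 unfolding seqcont_def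
proof (intro allI impI LIMSEQ_I)
 fix F f and r :: real assume c: "conv F f" and r: "0 < r"
 obtain dl where dl: "dl > 0" "!!nu. nu : P2 ==> W2 (Psi f) nu < dl ==> abs (u nu - u (Psi f)) < r"
  using assms r push_P2[OF conv_T(2)[OF c]] unfolding P2_continuous_def by blast
 obtain N where "!!n. n >= N ==> abs (W2 (Psi f) (Psi (F n))) < dl"
  using LIMSEQ_D[OF W2_conv[OF c] dl(1)] by auto
 then show "EX no. ALL n>=no. norm (u (Psi (F n)) - u (Psi f)) < r"
  using dl(2) push_P2[OF conv_T(1)[OF c]] by (intro exI[of _ N]) (auto dest!: abs_less_iff[THEN iffD1])
qed

lemma simple_approx: assumes "f : T" shows "EX F. conv F f & (ALL n. finite (range (F n)))"
proof -
 have fm: "f : bm borel" using assms by (rule T_measurable)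
 from borel_measurable_implies_sequence_metric[OF fm, of 0] obtain F where
  F: "!!i. simple_function borel (F i)" "!!x. (%i. F i x) ~~> f x" "!!i x. dist (F i x) 0 <= 2 * dist (f x) 0" by auto
 have "conv F f"
 proof (rule conv_dominated[OF _ fm])
  show "F n : bm borel" for n using F(1) by (rule borel_measurable_simple_function)
  show "AE x in lam. (%n. F n x) ~~> f x" using F(2) by simp
  show "integrable lam (%x. 4 * (norm (f x))^2)" using T_integrable[OF assms] by simp
  show "(norm (F n x))^2 <= 4 * (norm (f x))^2" for n x
   using power_mono[OF F(3)[of n x], of 2] by (simp add: power_mult_distrib)
 qed simp
 then show ?thesis using F(1) by (auto simp: simple_function_def)
qed

end

section \<open>Differentiation along curves of push-forwards\<close>

text \<open>\<open>dir_deriv\<close> is a total \<open>Lim\<close>, whose value is informative only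
  where the limit exists. Here it is turned back into convergence of the difference quotients to the
  pairing with a bounded continuous gradient version.\<close>

lemma C1b_P2_D:
 assumes "u : C1b_P2"
 obtains v C where "continuous_grad_version u v" "!!mu x. mu : P2 ==> norm (v mu x) <= C" "!!mu. mu : P2 ==> abs (u mu) <= C" "P2_continuous u"
  "!!mu f. mu : P2 ==> f : tangent mu ==> (diff_quotient u mu f \<longlongrightarrow> l2_inner mu (v mu) f) (at 0)"
proof -
 obtain v C where v: "continuous_grad_version u v" and C: "!!mu x. mu : P2 ==> abs (u mu) + norm (v mu x) <= C"
  using assms by (auto simp: C1b_P2_def)
 have id: "intrinsically_differentiable u" using assms by (auto simp: C1b_P2_def C1_P2_def)
 have lim: "(diff_quotient u mu f \<longlongrightarrow> l2_inner mu (v mu) f) (at 0)" if "mu : P2" "f : tangent mu" for mu f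
 proof -
  have "EX l. (diff_quotient u mu f \<longlongrightarrow> l) (at 0)" using id that unfolding intrinsically_differentiable_def by auto
  then obtain l where l: "(diff_quotient u mu f \<longlongrightarrow> l) (at 0)" ..
  then have "dir_deriv u mu f = l" unfolding dir_deriv_def by (intro tendsto_Lim) auto
  moreover have "dir_deriv u mu f = l2_inner mu (v mu) f"
   using v that unfolding continuous_grad_version_def is_intrinsic_grad_def by blast
  ultimately show ?thesis using l by simp
 qed
 show thesis
 proof (rule that[OF v _ _ _ lim])
  show "norm (v mu x) <= C" if "mu : P2" for mu x using C[OF that, of x] by simp
  show "abs (u mu) <= C" if "mu : P2" for mu using C[OF that, of 0] norm_ge_zero[of "v mu 0"] by linarith
  show "P2_continuous u" using id by (simp add: intrinsically_differentiable_def)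
 qed
qed

context l2_space
begin

text \<open>By the chain rule this is the gradient of \<open>u o Psi\<close> at \<open>f\<close>
  when \<open>v\<close> is a gradient version of a function \<open>u\<close> in
  \<open>C1b_P2\<close>.\<close>

definition lift :: "((real^'d) measure => real^'d => real^'d) => (real^'d => real^'d) => real^'d => real^'d" where
 "lift v f = v (Psi f) o f"

lemma lift_T:
 assumes "continuous_grad_version u v" "f : T" shows "lift v f : T"
 using assms push_P2[OF assms(2)] unfolding lift_def
 by (intro tangent_push) (auto simp: continuous_grad_version_def is_intrinsic_grad_def)

text \<open>Both arguments of \<open>v\<close> move with \<open>F n\<close>. Joint continuity
  controls them at points where \<open>F n x\<close> converges, whence the almost everywhere
  hypothesis; the bound on \<open>v\<close> provides the majorant.\<close>

lemma lift_conv: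
 assumes v: "continuous_grad_version u v" and b: "!!mu x. mu : P2 ==> norm (v mu x) <= C"
  and c: "conv F f" "AE x in lam. (%n. F n x) ~~> f x"
 shows "conv (%n. lift v (F n)) (lift v f)"
proof (rule conv_dominated)
 show "lift v (F n) : bm borel" for n using lift_T[OF v conv_T(1)[OF c(1)]] by (rule T_measurable)
 show "lift v f : bm borel" using lift_T[OF v conv_T(2)[OF c(1)]] by (rule T_measurable)
 show "integrable lam (%x. C^2)" by simp
 show "(norm (lift v (F n) x))^2 <= C^2" for n x
  using b[OF push_P2[OF conv_T(1)[OF c(1)]]] by (simp add: lift_def power_mono)
 show "(norm (lift v f x))^2 <= C^2" for x
  using b[OF push_P2[OF conv_T(2)[OF c(1)]]] by (simp add: lift_def power_mono)
 show "AE x in lam. (%n. lift v (F n) x) ~~> lift v f x"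
  using c(2)
 proof eventually_elim
  case (elim x)
  show ?case
  proof (rule LIMSEQ_I)
   fix r :: real assume "0 < r"
   then obtain dl where dl: "dl > 0" "!!nu y. nu : P2 ==> W2 (Psi f) nu < dl ==> dist (f x) y < dl ==> dist (v (Psi f) (f x)) (v nu y) < r"
    using v push_P2[OF conv_T(2)[OF c(1)]] unfolding continuous_grad_version_def by meson
   obtain N1 where N1: "!!n. n >= N1 ==> norm (W2 (Psi f) (Psi (F n)) - 0) < dl"
    using LIMSEQ_D[OF W2_conv[OF c(1)] dl(1)] by auto
   obtain N2 where N2: "!!n. n >= N2 ==> norm (F n x - f x) < dl" using LIMSEQ_D[OF elim dl(1)] by auto
   show "EX no. ALL n>=no. norm (lift v (F n) x - lift v f x) < r"
   proof (intro exI[of _ "max N1 N2"] allI impI)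
    fix n assume "max N1 N2 <= n"
    then have "W2 (Psi f) (Psi (F n)) < dl" "dist (f x) (F n x) < dl"
    using N1[of n] N2[of n] by (auto simp: dist_norm norm_minus_commute)
    from dl(2)[OF push_P2[OF conv_T(1)[OF c(1)]] this] show "norm (lift v (F n) x - lift v f x) < r"
    by (simp add: lift_def dist_norm norm_minus_commute)
   qed
  qed
 qed
qed

lemma ip_conv:
 assumes "conv F f" "conv H h" shows "(%n. ip (F n) (H n)) ~~> ip f h"
proof (rule tendsto_by_bound[where c="%n. nm (%x. F n x - f x) * nm (H n) + nm f * nm (%x. H n x - h x)"])
 fix n
 note T = conv_T[OF assms(1)] conv_T[OF assms(2)]
 have "ip (F n) (H n) - ip f h = ip (%x. F n x - f x) (H n) + ip f (%x. H n x - h x)"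
  using T by (simp add: ip_diff_left ip_diff_right)
 then show "norm (ip (F n) (H n) - ip f h) <= nm (%x. F n x - f x) * nm (H n) + nm f * nm (%x. H n x - h x)"
  using ip_bound[OF T_diff[OF T(1)[of n] T(2)] T(3)[of n]] ip_bound[OF T(2) T_diff[OF T(3)[of n] T(4)]]
  unfolding real_norm_def by linarith
next
 let ?a = "%n. nm (%x. F n x - f x) * nm (H n) + nm f * nm (%x. H n x - h x)"
 have "?a ~~> 0 * nm h + nm f * 0"
  using assms seqcontD[OF seqcont_nm assms(2)] unfolding conv_def by (intro tendsto_intros) auto
 then show "?a ~~> 0" by simp
qed

lemma conv_const: "f : T ==> conv (%_. f) f" by (simp add: conv_def)

lemma seqcont_lift:
 assumes "continuous_grad_version u v" "!!mu x. mu : P2 ==> norm (v mu x) <= C" "k : T"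
 shows "seqcont (%f. ip (lift v f) k)"
 by (rule seqcontI_AE) (intro ip_conv lift_conv[OF assms(1,2)] conv_const assms(3))

text \<open>For finitely valued \<open>X\<close> and \<open>h\<close>, \<open>X + s h\<close> separates the values of \<open>(X, h)\<close> for all but finitely
 many \<open>s\<close>, so that \<open>h\<close> is a function of \<open>X + s h\<close> and the intrinsic derivative applies.\<close>

lemma simple_curve:
 assumes v: "!!mu f. mu : P2 ==> f : tangent mu ==> (diff_quotient u mu f \<longlongrightarrow> l2_inner mu (v mu) f) (at 0)"
  and vT: "continuous_grad_version u v" and cont: "P2_continuous u"
  and X: "X : T" "finite (range X)" and h: "h : T" "finite (range h)" and t: "0 <= t"
 shows "((%s. ip (lift v (%x. X x + s *\<^sub>R h x)) h) has_integral
  u (Psi (%x. X x + t *\<^sub>R h x)) - u (Psi X)) {0..t}"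
proof -
 let ?a = "%s R. %x. X x + s *\<^sub>R h x"
 define g where "g s = u (Psi (?a s R))" for s
 define R where "R = range (%x. (X x, h x))"
 have finR: "finite R"
  by (rule finite_subset[OF _ finite_cartesian_product[OF X(2) h(2)]]) (auto simp: R_def)
 \<comment> \<open>Two distinct pairs of values are merged by at most one s, and there are finitely
   many pairs.\<close>
 define bad where "bad p q = {s. fst p + s *\<^sub>R snd p = fst q + s *\<^sub>R snd q}" for p q :: "(real^'d) \<times> (real^'d)"
 have bad: "finite (bad p q)" if "p ~= q" for p q
 proof (rule ccontr)
  assume inf: "infinite (bad p q)"
  then obtain s where s: "s : bad p q" using finite.emptyI by (metis ex_in_conv)
  have "infinite (bad p q - {s})" using inf by simp
  then obtain r where r: "r : bad p q" "r ~= s" using finite.emptyI by (metis DiffE ex_in_conv singletonI)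
  have "(fst p + s *\<^sub>R snd p) - (fst p + r *\<^sub>R snd p) = (fst q + s *\<^sub>R snd q) - (fst q + r *\<^sub>R snd q)"
   using s r(1) by (simp add: bad_def)
  then have "(s - r) *\<^sub>R (snd p - snd q) = 0" by (simp add: algebra_simps)
  then have "snd p = snd q" using r(2) by simp
  then show False using s that by (simp add: bad_def prod_eq_iff)
 qed
 define S where "S = (\<Union>p\<in>R. \<Union>q\<in>R - {p}. bad p q)"
 have finS: "finite S" unfolding S_def by (intro finite_UN_I finite_Diff finR bad) auto
 have contg: "continuous_on UNIV g"
  unfolding g_def by (rule seqcont_line[OF P2_continuous_seqcont[OF cont] X(1) h(1)])
 have deriv: "(g has_vector_derivative ip (lift v (?a s R)) h) (at s)" if "s \<notin> S" for s
 proof -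
  define Y where "Y = (?a s R)"
  have YT: "Y : T" unfolding Y_def using X h by (intro T_line)
  \<comment> \<open>Off the exceptional set, distinct pairs have distinct sums, so exactly one term
    is active at each point of the range of \<open>Y\<close>, and k o Y = h.\<close>
  define k where "k z = (\<Sum>p\<in>R. indicator {fst p + s *\<^sub>R snd p} z *\<^sub>R snd p)" for z :: "real^'d"
  have km: "k : bm borel" unfolding k_def by measurable
  have kY: "k (Y x) = h x" for x
  proof -
   have p: "(X x, h x) : R" by (simp add: R_def)
   have "indicator {fst p + s *\<^sub>R snd p} (Y x) *\<^sub>R snd p = (if p = (X x, h x) then h x else 0)" if "p : R" for p
   proof (cases "p = (X x, h x)")
    case False
    then have "s \<notin> bad (X x, h x) p" using \<open>s \<notin> S\<close> p that unfolding S_def by blast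
    then show ?thesis using False by (auto simp: bad_def Y_def)
   qed (auto simp: Y_def)
   then have "k (Y x) = (\<Sum>p\<in>R. if p = (X x, h x) then h x else 0)" unfolding k_def by (intro sum.cong) auto
   also have "... = h x" using finR p by simp
   finally show ?thesis .
  qed
  have koY: "k o Y = h" using kY by auto
  have kT: "k : tangent (Psi Y)" using tangent_push_iff[OF YT km] h(1) koY by simp
  have "diff_quotient u (Psi Y) k = (%eps. (g (s + eps) - g s) / eps)"
  proof
   fix eps
   have "push (Psi Y) (%x. x + eps *\<^sub>R k x) = Psi (%x. X x + (s + eps) *\<^sub>R h x)"
    using km by (subst push_push[OF YT]) (simp_all add: o_def kY[unfolded Y_def] Y_def scaleR_add_left add.assoc)
   then show "diff_quotient u (Psi Y) k eps = (g (s + eps) - g s) / eps"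
    by (simp add: diff_quotient_def g_def Y_def)
  qed
  moreover have "l2_inner (Psi Y) (v (Psi Y)) k = ip (lift v Y) h"
  proof -
   have "v (Psi Y) : bm borel"
    using vT push_P2[OF YT] by (auto simp: continuous_grad_version_def is_intrinsic_grad_def tangent_def)
   then show ?thesis by (simp add: l2_inner_push[OF YT _ km] koY lift_def)
  qed
  ultimately have "((%eps. (g (s + eps) - g s) / eps) \<longlongrightarrow> ip (lift v Y) h) (at 0)"
   using v[OF push_P2[OF YT] kT] by simp
  then have "(g has_real_derivative ip (lift v Y) h) (at s)" by (simp add: DERIV_def)
  then show ?thesis by (simp add: has_real_derivative_iff_has_vector_derivative Y_def)
 qed
 \<comment> \<open>The exceptional parameters are harmless: this form of the theorem tolerates
   finitely many of them once \<open>g\<close> is continuous.\<close>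
 have "((%s. ip (lift v (?a s R)) h) has_integral g t - g 0) {0..t}"
 proof (rule fundamental_theorem_of_calculus_interior_strong[OF finS t])
  show "continuous_on {0..t} g" using contg by (rule continuous_on_subset) simp
 qed (rule deriv, simp)
 then show ?thesis by (simp add: g_def)
qed

text \<open>The integral formula for simple functions passes to the limit because the integrands
  converge for each s and are uniformly bounded. The limiting integrand is continuous in s, so the
  formula can be differentiated.\<close>

theorem push_curve_derivative:
 assumes u: "u : C1b_P2" and vT: "continuous_grad_version u v" and b: "!!mu x. mu : P2 ==> norm (v mu x) <= C"
  and X: "X : T" and h: "h : T"
 shows "((%s. u (Psi (%x. X x + s *\<^sub>R h x))) has_real_derivative ip (lift v (%x. X x + t *\<^sub>R h x)) h) (at t)"
proof -
 obtain v' where v': "continuous_grad_version u v'" "P2_continuous u"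
  "!!mu f. mu : P2 ==> f : tangent mu ==> (diff_quotient u mu f \<longlongrightarrow> l2_inner mu (v' mu) f) (at 0)"
  using C1b_P2_D[OF u] by metis
 have lim: "(diff_quotient u mu f \<longlongrightarrow> l2_inner mu (v mu) f) (at 0)" if "mu : P2" "f : tangent mu" for mu f
 proof -
  have "l2_inner mu (v mu) f = l2_inner mu (v' mu) f"
   using vT v'(1) that unfolding continuous_grad_version_def is_intrinsic_grad_def by metis
  then show ?thesis using v'(3)[OF that] by simp
 qed
 let ?a = "%Y s. %x. Y x + s *\<^sub>R h x"
 let ?c = "%Y. %s. ip (lift v (?a Y s)) h"
 have contj: "continuous_on UNIV (?c Y)" if "Y : T" for Y
  by (rule seqcont_line[OF seqcont_lift[OF vT b h] that h])
 let ?b = "%F n s H. lift v (%x. F n x + s *\<^sub>R H n x)"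
 let ?d = "%H n. %x. H n x - h x"
 have FTC: "((?c Y) has_integral
  u (Psi (%x. Y x + t *\<^sub>R h x)) - u (Psi Y)) {0..t}" if Y: "Y : T" and t: "0 <= t" for Y t
 proof -
  obtain F where F: "conv F Y" "!!n. finite (range (F n))" using simple_approx[OF Y] by blast
  obtain H where H: "conv H h" "!!n. finite (range (H n))" using simple_approx[OF h] by blast
  define j where "j n s = ip (?b F n s H) (H n)" for n s
  have line: "conv (%n x. F n x + s *\<^sub>R H n x) (?a Y s)" for s
  proof (rule conv_bound)
   show "nm (%x. F n x + s *\<^sub>R H n x - (Y x + s *\<^sub>R h x)) <= nm (%x. F n x - Y x) + abs s * nm (?d H n)" for n
    using nm_triangle[OF T_diff[OF conv_T[OF F(1)]] T_scale[OF T_diff[OF conv_T[OF H(1)]]], of n s n] nm_scale[of s "%x. H n x - h x"]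
    by (simp add: algebra_simps)
   have "(%n. nm (%x. F n x - Y x) + abs s * nm (?d H n)) ~~> 0 + abs s * 0"
    using F(1) H(1) unfolding conv_def by (intro tendsto_intros) auto
   then show "(%n. nm (%x. F n x - Y x) + abs s * nm (?d H n)) ~~> 0" by simp
  qed (use conv_T[OF F(1)] conv_T[OF H(1)] in \<open>auto intro: T_line\<close>)
  have hi: "(j n has_integral u (Psi (%x. F n x + t *\<^sub>R H n x)) - u (Psi (F n))) {0..t}" for n
   unfolding j_def by (rule simple_curve[OF lim vT v'(2) conv_T(1)[OF F(1)] F(2) conv_T(1)[OF H(1)] H(2) t])
  have jl: "(%n. j n s) ~~> ip (lift v (?a Y s)) h" for s
  proof -
   have jd: "(%n. j n s - ip (?b F n s H) h) ~~> 0"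
   proof (rule tendsto_by_bound)
    fix n
    have LT: "lift v (%x. F n x + s *\<^sub>R H n x) : T" by (rule lift_T[OF vT conv_T(1)[OF line]])
    have "norm (j n s - ip (?b F n s H) h) = abs (ip (?b F n s H) (?d H n))"
    using LT conv_T[OF H(1)] by (simp add: j_def ip_diff_right)
    also have "... <= nm (?b F n s H) * nm (?d H n)"
    by (rule ip_bound[OF LT T_diff[OF conv_T[OF H(1)]]])
    also have "... <= abs C * nm (?d H n)"
    using b[OF push_P2[OF conv_T(1)[OF line]]]
    by (intro mult_right_mono nm_bounded T_measurable[OF LT]) (auto simp: lift_def intro: order_trans[OF _ abs_ge_self])
    finally show "norm (j n s - ip (?b F n s H) h - 0) <= abs C * nm (?d H n)" by simp
   next
    show "(%n. abs C * nm (?d H n)) ~~> 0"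
    using H(1) unfolding conv_def by (intro tendsto_mult_right_zero) auto
   qed
   from tendsto_add[OF jd seqcontD[OF seqcont_lift[OF vT b h] line[of s]]] show ?thesis by simp
  qed
  obtain Bd where Bd: "!!n. nm (H n) <= Bd"
   using convergent_imp_Bseq[OF convergentI[OF seqcontD[OF seqcont_nm H(1)]]] unfolding Bseq_def by auto
  have jb: "norm (j n s) <= abs C * Bd" for n s
  proof -
   have LT: "lift v (%x. F n x + s *\<^sub>R H n x) : T" by (rule lift_T[OF vT conv_T(1)[OF line]])
   have "abs (j n s) <= nm (?b F n s H) * nm (H n)"
    unfolding j_def by (rule ip_bound[OF LT conv_T(1)[OF H(1)]])
   also have "... <= abs C * Bd"
    using b[OF push_P2[OF conv_T(1)[OF line]]]
    by (intro mult_mono Bd nm_bounded T_measurable[OF LT]) (auto simp: lift_def intro: order_trans[OF _ abs_ge_self])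
   finally show ?thesis by simp
  qed
  have io: "(?c Y) integrable_on {0..t}"
   and I: "(%n. integral {0..t} (j n)) ~~> integral {0..t} (?c Y)"
   using dominated_convergence[of j "{0..t}" "%_. abs C * Bd" "%s. ip (lift v (?a Y s)) h"] hi jl jb
   by (auto simp: has_integral_integrable)
  have I2: "(%n. integral {0..t} (j n)) ~~> u (Psi (%x. Y x + t *\<^sub>R h x)) - u (Psi Y)"
   unfolding integral_unique[OF hi]
   using seqcontD[OF P2_continuous_seqcont[OF v'(2)] line[of t]] seqcontD[OF P2_continuous_seqcont[OF v'(2)] F(1)]
   by (intro tendsto_diff)
  show ?thesis using io LIMSEQ_unique[OF I I2] by (simp add: has_integral_iff)
 qed
 \<comment> \<open>The integral formula covers only parameters to the right of its base point. A
   base one unit earlier makes \<open>t\<close> interior: it becomes parameter 1 in [0, 2].\<close>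
 define Y where "Y = (%x. X x + (t - 1) *\<^sub>R h x)"
 have YT: "Y : T" unfolding Y_def by (rule T_line[OF X h])
 define j where "j = (?c Y)"
 have "((%s. integral {0..s} j) has_real_derivative j 1) (at 1 within {0..2})"
  by (rule integral_has_real_derivative) (use continuous_on_subset[OF contj[OF YT]] in \<open>auto simp: j_def\<close>)
 then have "((%s. integral {0..s} j) has_real_derivative j 1) (at 1)"
  using at_within_Icc_at[of 0 "1::real" 2] by simp
 then have d: "((%s. integral {0..s} j + u (Psi Y)) has_real_derivative j 1) (at 1)"
  by (auto intro!: derivative_eq_intros)
 have ev: "\<forall>\<^sub>F s in nhds 1. integral {0..s} j + u (Psi Y) = u (Psi (?a Y s))"
 proof -
  have "\<forall>\<^sub>F s::real in nhds 1. s : {0<..}" by (intro eventually_nhds_in_open) auto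
  then show ?thesis
  proof eventually_elim
   case (elim s)
   then have "0 <= s" by simp
   from integral_unique[OF FTC[OF YT this]] show ?case by (simp add: j_def)
  qed
 qed
 have "((%s. u (Psi (?a Y s))) has_real_derivative j 1) (at 1)"
  using iffD1[OF DERIV_cong_ev[OF refl ev refl] d] .
 then have e1: "((%s. u (Psi (?a Y s))) has_real_derivative j 1) (at (t - t + 1))" by simp
 have e2: "((%s. s - t + 1) has_real_derivative 1) (at t)" by (auto intro!: derivative_eq_intros)
 have "((%s. u (Psi (%x. Y x + (s - t + 1) *\<^sub>R h x))) has_real_derivative j 1 * 1) (at t)"
  using DERIV_chain'[where f="%s. s - t + 1" and g="%s. u (Psi (?a Y s))", OF e2 e1] .
 moreover have "Y x + (s - t + 1) *\<^sub>R h x = X x + s *\<^sub>R h x" for x s by (simp add: Y_def algebra_simps)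
 moreover have "Y x + h x = X x + t *\<^sub>R h x" for x by (simp add: Y_def algebra_simps)
 ultimately show ?thesis by (simp add: j_def)
qed

end

section \<open>Functions with a bounded continuous gradient\<close>

lemma differentiable_continuous_on_UNIV:
 assumes "!!x. (\<phi> has_derivative D x) (at x)" shows "continuous_on UNIV \<phi>"
 using assms by (meson continuous_at_imp_continuous_on has_derivative_continuous)

lemma taylor_bound:
 fixes \<phi> :: "real^'d => real"
 assumes d: "!!x. (\<phi> has_derivative (%h. D x \<bullet> h)) (at x)"
  and L: "!!x y. norm (D x - D y) <= L * norm (x - y)"
 shows "abs (\<phi> (x + h) - \<phi> x - D x \<bullet> h) <= L * (norm h)^2"
proof -
 have L0: "L >= 0" using L[of 0 "axis undefined 1"] by (simp add: norm_axis_1 order_trans[OF norm_ge_zero])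
 have "norm (\<phi> (x + h) - \<phi> x - D x \<bullet> (x + h - x)) <= norm (x + h - x) * (L * norm h)"
 proof (rule differentiable_bound_linearization[where S="closed_segment x (x + h)" and f'="%x h. D x \<bullet> h"])
  show "x + t *\<^sub>R (x + h - x) : closed_segment x (x + h)" if "t : {0..1}" for t
   using that by (auto simp: in_segment algebra_simps intro!: exI[of _ t])
  show "(\<phi> has_derivative (%h. D y \<bullet> h)) (at y within closed_segment x (x + h))" for y
   by (rule has_derivative_at_withinI[OF d])
  show "onorm ((%h. D y \<bullet> h) - (%h. D x \<bullet> h)) <= L * norm h" if "y : closed_segment x (x + h)" for y
  proof (rule onorm_bound)
   show "0 <= L * norm h" using L0 by simp
   have "norm (y - x) <= norm h" using segment_bound(1)[OF that] by simp
   then have "norm (D y - D x) <= L * norm h" using L[of y x] L0 by (meson mult_left_mono order_trans)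
   then show "norm (((%h. D y \<bullet> h) - (%h. D x \<bullet> h)) k) <= L * norm h * norm k" for k
    using Cauchy_Schwarz_ineq2[of "D y - D x" k] by (simp add: inner_diff_left[symmetric]) (meson mult_right_mono norm_ge_zero order_trans)
  qed
 qed simp
 then show ?thesis by (simp add: power2_eq_square mult_ac)
qed

lemma lipschitz_of_gradient:
 fixes \<phi> :: "'a::euclidean_space => real"
 assumes d: "!!x. (\<phi> has_derivative (%h. D x \<bullet> h)) (at x)" and C: "!!x. norm (D x) <= C"
 shows "abs (\<phi> x - \<phi> y) <= C * norm (x - y)"
proof -
 have "norm (\<phi> x - \<phi> y) <= C * norm (x - y)"
 proof (rule differentiable_bound[where S=UNIV])
  show "onorm (%h. D x \<bullet> h) <= C" for x
  proof (rule onorm_bound)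
   show "0 <= C" using C[of x] norm_ge_zero order_trans by blast
   show "norm (D x \<bullet> h) <= C * norm h" for h
    using Cauchy_Schwarz_ineq2[of "D x" h] C[of x] by simp (meson mult_right_mono norm_ge_zero order_trans)
  qed
 qed (use d in auto)
 then show ?thesis by simp
qed

definition smooth_fun :: "(real^'d => real) => (real^'d => real^'d) => real => real => bool" where
 "smooth_fun \<phi> D C L \<longleftrightarrow> (ALL x. (\<phi> has_derivative (%h. D x \<bullet> h)) (at x)) & (ALL x. norm (D x) <= C) \<and>
  (ALL x y. norm (D x - D y) <= L * norm (x - y))"

text \<open>A Frechet-type condition, uniform in the direction, which the chain rule preserves.
  Boundedness of \<open>u\<close> is left out so that integrals of unbounded functions with bounded
  gradient are included; together with it membership in \<open>C1b_P2\<close> follows.\<close>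

definition smooth_P2 :: "((real^'d) measure => real) => ((real^'d) measure => real^'d => real^'d) => bool" where
 "smooth_P2 u v \<longleftrightarrow> P2_continuous u & (EX C. ALL mu:P2. ALL x. norm (v mu x) <= C) & (ALL mu:P2. v mu : bm borel) \<and>
  (ALL mu:P2. ALL x. ALL e>0. EX dl>0. ALL nu:P2. ALL y. W2 mu nu < dl & dist x y < dl --> dist (v mu x) (v nu y) < e) \<and>
  (ALL mu:P2. ALL e>0. EX dl>0. ALL f:tangent mu. l2_norm mu f < dl -->
    abs (u (push mu (%x. x + f x)) - u mu - l2_inner mu (v mu) f) <= e * l2_norm mu f)"

lemma smooth_P2D:
 assumes "smooth_P2 u v"
 shows "P2_continuous u" "EX C. ALL mu:P2. ALL x. norm (v mu x) <= C" "mu : P2 ==> v mu : bm borel"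
  "mu : P2 ==> e > 0 ==> EX dl>0. ALL nu:P2. ALL y. W2 mu nu < dl & dist x y < dl --> dist (v mu x) (v nu y) < e"
  "mu : P2 ==> e > 0 ==> EX dl>0. ALL f:tangent mu. l2_norm mu f < dl -->
    abs (u (push mu (%x. x + f x)) - u mu - l2_inner mu (v mu) f) <= e * l2_norm mu f"
 using assms by (simp_all add: smooth_P2_def)

lemma lipschitz_continuous_vec:
 fixes D :: "'a::real_normed_vector => 'b::real_normed_vector"
 assumes "!!x y. norm (D x - D y) <= L * norm (x - y)"
 shows "continuous_on UNIV D"
proof -
 have "norm (D x - D y) <= abs L * norm (x - y)" for x y
  using assms[of x y] by (meson abs_ge_self mult_right_mono norm_ge_zero order_trans)
 then have "\<bar>L\<bar>-lipschitz_on UNIV D" by (intro lipschitz_onI) (auto simp: dist_norm)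
 then show ?thesis by (rule lipschitz_on_continuous_on)
qed

lemma P2_continuous_lipschitz:
 fixes \<phi> :: "real^'d => real"
 assumes L: "!!x y. abs (\<phi> x - \<phi> y) <= L * norm (x - y)"
 shows "P2_continuous (%mu. \<integral>x. \<phi> x \<partial>mu)"
 unfolding P2_continuous_def
proof (intro ballI allI impI)
 fix mu :: "(real^'d) measure" and e :: real assume mu: "mu : P2" and e: "e > 0"
 let ?a = "abs L + 1"
 show "EX dl>0. ALL nu:P2. W2 mu nu < dl --> abs ((\<integral>x. \<phi> x \<partial>nu) - (\<integral>x. \<phi> x \<partial>mu)) < e"
 proof (intro exI[of _ "e / ?a"] conjI ballI impI)
  show "e / ?a > 0" using e by simp
  fix nu :: "(real^'d) measure" assume nu: "nu : P2" "W2 mu nu < e / ?a"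
  have L0: "L >= 0" using L[of 0 "axis undefined 1"] by (simp add: norm_axis_1 order_trans[OF abs_ge_zero])
  have "abs ((\<integral>x. \<phi> x \<partial>nu) - (\<integral>x. \<phi> x \<partial>mu)) <= L * W2 mu nu" by (rule W2_lipschitz_integral[OF mu nu(1) L])
  also have "... <= L * (e / ?a)" using nu(2) L0 by (intro mult_left_mono) auto
  also have "... < e" using e L0 by (simp add: field_simps)
  finally show "abs ((\<integral>x. \<phi> x \<partial>nu) - (\<integral>x. \<phi> x \<partial>mu)) < e" .
 qed
qed

context l2_space
begin

text \<open>A Lipschitz gradient grows linearly and the function quadratically, so both are
  integrable along square integrable fields. Integration of the pointwise Taylor bound makes the
  error quadratic in \<open>nm h\<close>.\<close>

lemma integral_taylor:
 fixes \<phi> :: "real^'d => real"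
 assumes d: "!!x. (\<phi> has_derivative (%h. D x \<bullet> h)) (at x)"
  and L: "!!x y. norm (D x - D y) <= L * norm (x - y)"
  and f: "f : T" and h: "h : T"
 shows "D o f : T" "integrable lam (%x. \<phi> (f x))"
  "abs ((\<integral>x. \<phi> (f x + h x) \<partial>lam) - (\<integral>x. \<phi> (f x) \<partial>lam) - ip (D o f) h) <= L * (nm h)^2"
proof -
 have L0: "L >= 0" using L[of 0 "axis undefined 1"] by (simp add: norm_axis_1 order_trans[OF norm_ge_zero])
 have [measurable]: "D : bm borel" "\<phi> : bm borel"
  using lipschitz_continuous_vec[OF L] differentiable_continuous_on_UNIV[OF d]
  by (simp_all add: borel_measurable_continuous_onI)
 have [measurable]: "f : bm lam" "h : bm lam" "f : bm borel"
  using f h T_measurable_lam T_measurable by auto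
 have DT: "D o f : T" if f: "f : T" for f
 proof -
  have [measurable]: "f : bm borel" using f T_measurable by auto
  have "(%x. (D (f x) - D 0) + D 0) : T"
  proof (rule T_add)
   show "(%x. D (f x) - D 0) : T"
    by (rule nm_mono(1)[OF f _ _ L0]) (use L[of _ 0] in \<open>auto\<close>)
   show "(%x. D 0) : T" by (rule T_bounded[where C="norm (D 0)"]) auto
  qed
  then show ?thesis by (simp add: o_def)
 qed
 show "D o f : T" by (rule DT[OF f])
 let ?a = "%f x. abs (\<phi> 0) + norm (D 0) * norm (f x) + L * (norm (f x))^2"
 have int: "integrable lam (%x. \<phi> (f x))" if f: "f : T" for f
 proof (rule Bochner_Integration.integrable_bound)
  have [measurable]: "f : bm lam" using f T_measurable_lam by auto
  show "integrable lam (%x. abs (\<phi> 0) + norm (D 0) * norm (f x) + L * (norm (f x))^2)"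
   using integral_norm_bound(1)[OF f] T_integrable[OF f] by simp
  show "(%x. \<phi> (f x)) : bm lam" by measurable
  show "AE x in lam. norm (\<phi> (f x)) <= norm (?a f x)"
  proof (rule AE_I2)
   fix x
   have "abs (\<phi> (0 + f x) - \<phi> 0 - D 0 \<bullet> f x) <= L * (norm (f x))^2" by (rule taylor_bound[OF d L])
   moreover have "abs (D 0 \<bullet> f x) <= norm (D 0) * norm (f x)" by (rule Cauchy_Schwarz_ineq2)
   ultimately have "abs (\<phi> (f x)) <= abs (\<phi> 0) + norm (D 0) * norm (f x) + L * (norm (f x))^2" by simp
   then show "norm (\<phi> (f x)) <= norm (?a f x)" by simp
  qed
 qed
 show "integrable lam (%x. \<phi> (f x))" by (rule int[OF f])
 have i: "integrable lam (%x. \<phi> (f x + h x))" using int[OF T_add[OF f h]] .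
 have j: "integrable lam (%x. D (f x) \<bullet> h x)" using inner_integrable[OF DT[OF f] h] by simp
 have "(\<integral>x. \<phi> (f x + h x) \<partial>lam) - (\<integral>x. \<phi> (f x) \<partial>lam) - ip (D o f) h = (\<integral>x. \<phi> (f x + h x) - \<phi> (f x) - D (f x) \<bullet> h x \<partial>lam)"
  using i int[OF f] j by (simp add: l2_inner_def)
 also have "abs (...) <= (LINT x|lam. L * (norm (h x))^2)"
 proof (rule order_trans[OF integral_abs_bound], rule integral_mono)
  show "abs (\<phi> (f x + h x) - \<phi> (f x) - D (f x) \<bullet> h x) <= L * (norm (h x))^2" for x by (rule taylor_bound[OF d L])
 qed (use i int[OF f] j T_integrable[OF h] in auto)
 finally show "abs ((\<integral>x. \<phi> (f x + h x) \<partial>lam) - (\<integral>x. \<phi> (f x) \<partial>lam) - ip (D o f) h) <= L * (nm h)^2"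
  by (simp add: nm_power2_integral)
qed

end

lemma smooth_P2_integral:
 fixes \<phi> :: "real^'d => real"
 assumes "smooth_fun \<phi> D C L"
 shows "smooth_P2 (%mu. \<integral>x. \<phi> x \<partial>mu) (%mu. D)"
proof -
 have d: "!!x. (\<phi> has_derivative (%h. D x \<bullet> h)) (at x)" and C: "!!x. norm (D x) <= C"
  and L: "!!x y. norm (D x - D y) <= L * norm (x - y)" using assms by (auto simp: smooth_fun_def)
 have L0: "L >= 0" using L[of 0 "axis undefined 1"] by (simp add: norm_axis_1 order_trans[OF norm_ge_zero])
 have cD: "continuous_on UNIV D" by (rule lipschitz_continuous_vec[OF L])
 have [measurable]: "\<phi> : bm borel"
  using differentiable_continuous_on_UNIV[OF d] by (rule borel_measurable_continuous_onI)
 let ?a = "%mu f. \<integral>x. \<phi> x \<partial>push mu (%x. x + f x)"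
 show ?thesis
  unfolding smooth_P2_def
 proof (intro conjI ballI allI impI)
  show "P2_continuous (%mu. \<integral>x. \<phi> x \<partial>mu)" by (rule P2_continuous_lipschitz[OF lipschitz_of_gradient[OF d C]])
  show "EX C. ALL mu:(P2 :: (real^'d) measure set). ALL x. norm (D x) <= C" using C by blast
  show "D : bm borel" using cD by (rule borel_measurable_continuous_onI)
 next
  fix mu :: "(real^'d) measure" and x and e :: real assume "e > 0"
  then obtain dl where "dl > 0" "!!y. dist y x < dl ==> dist (D y) (D x) < e"
   using cD unfolding continuous_on_iff by (metis UNIV_I)
  then show "EX dl>0. ALL nu:P2. ALL y. W2 mu nu < dl & dist x y < dl --> dist (D x) (D y) < e"
   by (metis dist_commute)
 next
  fix mu :: "(real^'d) measure" and e :: real assume mu: "mu : P2" and e: "e > 0"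
  interpret M: l2_space mu by (rule P2_l2_space[OF mu])
  show "EX dl>0. ALL f:tangent mu. l2_norm mu f < dl -->
   abs ((?a mu f) - (\<integral>x. \<phi> x \<partial>mu) - l2_inner mu D f) <= e * l2_norm mu f"
  proof (intro exI[of _ "e / (L + 1)"] conjI ballI impI)
   show "e / (L + 1) > 0" using e L0 by simp
   fix f assume f: "f : tangent mu" "l2_norm mu f < e / (L + 1)"
   have "(?a mu f) = (\<integral>x. \<phi> (x + f x) \<partial>mu)"
    by (rule M.integral_push[OF M.T_add[OF M.T_id f(1)]]) simp
   then have "abs ((?a mu f) - (\<integral>x. \<phi> x \<partial>mu) - l2_inner mu D f) <= L * (l2_norm mu f)^2"
    using M.integral_taylor(3)[OF d L M.T_id f(1)] by (simp add: o_def)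
   also have "... = (L * l2_norm mu f) * l2_norm mu f" by (simp add: power2_eq_square)
   also have "... <= e * l2_norm mu f"
   proof (rule mult_right_mono[OF _ M.nm_nonneg])
    have "L * l2_norm mu f <= L * (e / (L + 1))" using f(2) L0 by (intro mult_left_mono) auto
    also have "... <= e" using e L0 by (simp add: field_simps)
    finally show "L * l2_norm mu f <= e" .
   qed
   finally show "abs ((?a mu f) - (\<integral>x. \<phi> x \<partial>mu) - l2_inner mu D f) <= e * l2_norm mu f" .
  qed
 qed
qed

text \<open>The Frechet-type estimate applied to multiples of one field gives the directional
  derivatives; applied along a null sequence of fields it gives the remainder condition of
  \<open>C1_P2\<close>.\<close>

lemma smooth_P2_C1b:
 fixes u :: "(real^'d) measure => real"
 assumes s: "smooth_P2 u v" and b: "!!mu. mu : P2 ==> abs (u mu) <= C"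
 shows "u : C1b_P2" "continuous_grad_version u v"
proof -
 obtain C' where C': "!!mu x. mu : P2 ==> norm (v mu x) <= C'" using smooth_P2D(2)[OF s] by auto
 have fr: "EX dl>0. ALL f:tangent mu. l2_norm mu f < dl -->
    abs (u (push mu (%x. x + f x)) - u mu - l2_inner mu (v mu) f) <= e * l2_norm mu f" if "mu : P2" "e > 0" for mu e
  by (rule smooth_P2D(5)[OF s that])
 have vT: "v mu : tangent mu" if "mu : P2" for mu
 proof -
  interpret M: l2_space mu by (rule P2_l2_space[OF that])
  show ?thesis by (rule M.T_bounded[OF _ C'[OF that]]) (rule smooth_P2D(3)[OF s that])
 qed
 have lim: "(diff_quotient u mu f \<longlongrightarrow> l2_inner mu (v mu) f) (at 0)" if mu: "mu : P2" and f: "f : tangent mu" for mu f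
 proof (rule LIM_I)
  interpret M: l2_space mu by (rule P2_l2_space[OF mu])
  fix r :: real assume r: "0 < r"
  \<comment> \<open>The added 1 permits division when \<open>f\<close> vanishes almost
    everywhere.\<close>
  define n where "n = l2_norm mu f + 1"
  have n: "n > 0" "l2_norm mu f < n" using M.nm_nonneg[of f] by (simp_all add: n_def add_nonneg_pos del: M.nm_nonneg)
  obtain dl where dl: "dl > 0" "!!f. f : tangent mu ==> l2_norm mu f < dl ==>
    abs (u (push mu (%x. x + f x)) - u mu - l2_inner mu (v mu) f) <= (r / n) * l2_norm mu f"
   using fr[OF mu, of "r / n"] r n by auto
  show "EX s>0. ALL x. x ~= 0 & norm (x - 0) < s --> norm (diff_quotient u mu f x - l2_inner mu (v mu) f) < r"
  proof (intro exI[of _ "dl / n"] conjI allI impI)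
   show "dl / n > 0" using dl n by simp
   fix eps :: real assume "eps ~= 0 & norm (eps - 0) < dl / n"
   then have eps: "eps ~= 0" "abs (eps) * n < dl" using n by (auto simp: field_simps)
   have "l2_norm mu (%x. eps *\<^sub>R f x) = abs (eps) * l2_norm mu f" by (rule M.nm_scale)
   moreover have "abs (eps) * l2_norm mu f <= abs (eps) * n" using n by (intro mult_left_mono) auto
   ultimately have "abs (u (push mu (%x. x + eps *\<^sub>R f x)) - u mu - eps * l2_inner mu (v mu) f) <= (r / n) * (abs (eps) * l2_norm mu f)"
    using dl(2)[OF M.T_scale[OF f, of eps]] eps(2) by (simp add: M.ip_scale_right)
   also have "... = abs (eps) * (r * (l2_norm mu f / n))" by simp
   also have "... < abs (eps) * r" using eps(1) r n by (intro mult_strict_left_mono) (auto simp: field_simps)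
   finally have "abs (u (push mu (%x. x + eps *\<^sub>R f x)) - u mu - eps * l2_inner mu (v mu) f) / abs (eps) < r"
    using eps(1) by (simp add: field_simps)
   moreover have "diff_quotient u mu f eps - l2_inner mu (v mu) f = (u (push mu (%x. x + eps *\<^sub>R f x)) - u mu - eps * l2_inner mu (v mu) f) / eps"
    using eps(1) by (simp add: diff_quotient_def field_simps)
   ultimately show "norm (diff_quotient u mu f eps - l2_inner mu (v mu) f) < r" by (simp add: abs_divide)
  qed
 qed
 have dd: "dir_deriv u mu f = l2_inner mu (v mu) f" if "mu : P2" "f : tangent mu" for mu f
  unfolding dir_deriv_def using lim[OF that] by (intro tendsto_Lim) auto
 show cgv: "continuous_grad_version u v"
  unfolding continuous_grad_version_def is_intrinsic_grad_def
  using vT dd smooth_P2D(4)[OF s] by simp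
 have id: "intrinsically_differentiable u"
  unfolding intrinsically_differentiable_def
 proof (intro conjI ballI allI)
  show "P2_continuous u" using s by (simp add: smooth_P2_def)
  fix mu :: "(real^'d) measure" assume mu: "mu : P2"
  interpret M: l2_space mu by (rule P2_l2_space[OF mu])
  show "EX l. (diff_quotient u mu f \<longlongrightarrow> l) (at 0)" if "f : tangent mu" for f using lim[OF mu that] by blast
  show "dir_deriv u mu (%x. f x + g x) = dir_deriv u mu f + dir_deriv u mu g" if "f : tangent mu" "g : tangent mu" for f g
   using that by (simp add: dd mu M.T_add M.ip_add_right vT)
  show "dir_deriv u mu (%x. c *\<^sub>R f x) = c * dir_deriv u mu f" if "f : tangent mu" for f c
   using that by (simp add: dd mu M.T_scale M.ip_scale_right)
  show "EX C. ALL f:tangent mu. abs (dir_deriv u mu f) <= C * l2_norm mu f"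
   using M.ip_bound[OF vT[OF mu]] by (intro exI[of _ "l2_norm mu (v mu)"]) (simp add: dd mu)
 qed
 let ?a = "%mu f n. abs (u (push mu (%x. x + f n x)) - u mu - dir_deriv u mu (f n)) / l2_norm mu (f n) - 0"
 have fre: "(%n. abs (u (push mu (%x. x + f n x)) - u mu - dir_deriv u mu (f n)) / l2_norm mu (f n)) ~~> 0"
  if mu: "mu : P2" and f: "!!n. f n : tangent mu" "!!n. l2_norm mu (f n) ~= 0" "(%n. l2_norm mu (f n)) ~~> 0" for mu and f :: "nat => _"
 proof (rule LIMSEQ_I)
  interpret M: l2_space mu by (rule P2_l2_space[OF mu])
  fix r :: real assume r: "0 < r"
  obtain dl where dl: "dl > 0" "!!f. f : tangent mu ==> l2_norm mu f < dl ==>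
    abs (u (push mu (%x. x + f x)) - u mu - l2_inner mu (v mu) f) <= (r / 2) * l2_norm mu f"
   using fr[OF mu, of "r / 2"] r by auto
  obtain N where N: "!!n. n >= N ==> norm (l2_norm mu (f n) - 0) < dl" using LIMSEQ_D[OF f(3) dl(1)] by auto
  show "EX no. ALL n>=no. norm (?a mu f n) < r"
  proof (intro exI[of _ N] allI impI)
   fix n assume "N <= n"
   have pos: "l2_norm mu (f n) > 0" using f(2)[of n] M.nm_nonneg[of "f n"] by linarith
   have "abs (u (push mu (%x. x + f n x)) - u mu - dir_deriv u mu (f n)) <= (r / 2) * l2_norm mu (f n)"
    using dl(2)[OF f(1)] N[OF \<open>N <= n\<close>] dd[OF mu f(1)] by simp
   also have "... < r * l2_norm mu (f n)" using r pos by simp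
   finally have "abs (u (push mu (%x. x + f n x)) - u mu - dir_deriv u mu (f n)) / l2_norm mu (f n) < r"
    using pos by (simp add: divide_less_eq)
   then show "norm (?a mu f n) < r"
    using pos by simp
  qed
 qed
 show "u : C1b_P2"
  unfolding C1b_P2_def C1_P2_def
 proof (intro CollectI conjI ballI allI impI id)
  show "EX v. continuous_grad_version u v" using cgv by blast
  have "abs (u mu) + norm (v mu x) <= C + C'" if "mu : P2" for mu x using b[OF that] C'[OF that] by (rule add_mono)
  then show "EX v. continuous_grad_version u v & (EX C. ALL mu:P2. ALL x. abs (u mu) + norm (v mu x) <= C)" using cgv by blast
 qed (use fre in auto)
qed

text \<open>Chain rule. The bound on \<open>DF\<close> concerns the range of the inner functions,
  which admits products of bounded functions, where \<open>DF\<close> is unbounded as a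
  whole.\<close>

lemma smooth_P2_compose:
 fixes u :: "'m::finite => (real^'d) measure => real" and F :: "real^'m => real"
 assumes s: "!!i. smooth_P2 (u i) (v i)"
  and d: "!!y. (F has_derivative (%h. DF y \<bullet> h)) (at y)" and c: "continuous_on UNIV DF"
  and b: "!!mu. mu : P2 ==> norm (DF (\<chi> i. u i mu)) <= C"
 shows "smooth_P2 (%mu. F (\<chi> i. u i mu)) (%mu x. \<Sum>i\<in>UNIV. (DF (\<chi> i. u i mu) $ i) *\<^sub>R v i mu x)"
proof -
 define y where "y mu = (\<chi> i. u i mu)" for mu
 have ubd: "EX Cv. ALL mu:P2. ALL x. norm (v i mu x) <= Cv" for i by (rule smooth_P2D(2)[OF s])
 then obtain Cv where Cv: "!!i mu x. mu : P2 ==> norm (v i mu x) <= Cv i" by metis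
 have ycont: "EX dl>0. ALL nu:P2. W2 mu nu < dl --> dist (y nu) (y mu) < e" if "mu : P2" "e > 0" for mu e
 proof -
  have "ALL i. EX dl>0. ALL nu:P2. W2 mu nu < dl --> abs (u i nu - u i mu) < e / real CARD('m)"
   using smooth_P2D(1)[OF s] that unfolding P2_continuous_def by (simp add: zero_less_card_finite)
  then obtain dl where dl: "!!i. dl i > 0" "!!i nu. nu : P2 ==> W2 mu nu < dl i ==> abs (u i nu - u i mu) < e / real CARD('m)" by metis
  show ?thesis
  proof (intro exI[of _ "Min (range dl)"] conjI ballI impI)
   show "Min (range dl) > 0" using dl(1) by (subst Min_gr_iff) auto
   fix nu :: "(real^'d) measure" assume nu: "nu : P2" "W2 mu nu < Min (range dl)"
   then have *: "abs (u i nu - u i mu) < e / real CARD('m)" for i by (intro dl(2)) (auto simp: Min_gr_iff)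
   have "dist (y nu) (y mu) <= (\<Sum>i\<in>UNIV. abs ((y nu - y mu) $ i))" unfolding dist_norm by (rule norm_le_l1_cart)
   also have "... < (\<Sum>i\<in>(UNIV :: 'm set). e / real CARD('m))" using * by (intro sum_strict_mono) (auto simp: y_def)
   also have "... = e" by simp
   finally show "dist (y nu) (y mu) < e" .
  qed
 qed
 have Fc: "continuous_on UNIV F" by (rule differentiable_continuous_on_UNIV[OF d])
 have comp_cont: "EX dl>0. ALL nu:P2. W2 mu nu < dl --> dist (H (y nu)) (H (y mu)) < e"
  if mu: "mu : P2" and e: "e > 0" and H: "continuous_on UNIV H" for mu e and H :: "real^'m => 'z::metric_space"
 proof -
  obtain d where d: "d > 0" "!!z. dist z (y mu) < d ==> dist (H z) (H (y mu)) < e"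
   using e H unfolding continuous_on_iff by (metis UNIV_I)
  from ycont[OF mu d(1)] show ?thesis using d(2) by blast
 qed
 let ?a = "%y mu. %x. \<Sum>i\<in>UNIV. (DF (y mu) $ i) *\<^sub>R v i mu x"
 let ?b = "%mu f. push mu (%x. x + f x)"
 let ?c = "%y mu x. \<Sum>i\<in>UNIV. (DF (y mu) $ i) *\<^sub>R v i mu x"
 show ?thesis
  unfolding smooth_P2_def y_def[symmetric]
 proof (intro conjI ballI allI impI)
  show "P2_continuous (%mu. F (y mu))"
   unfolding P2_continuous_def using comp_cont[OF _ _ Fc] by (simp add: dist_real_def)
  have "norm (?c y mu x) <= (\<Sum>i\<in>UNIV. C * Cv i)" if "mu : P2" for mu x
  proof (rule order_trans[OF norm_sum sum_mono])
   fix i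
   have "abs (DF (y mu) $ i) <= C" using component_le_norm_cart[of "DF (y mu)" i] b[OF that] unfolding y_def by linarith
   then show "norm ((DF (y mu) $ i) *\<^sub>R v i mu x) <= C * Cv i"
    using Cv[OF that, of i x] by (simp add: mult_mono')
  qed
  then show "EX C. ALL mu:P2. ALL x. norm (?c y mu x) <= C" by blast
  show "(?a y mu) : bm borel" if "mu : P2" for mu
  proof -
   have "v i mu : bm borel" for i by (rule smooth_P2D(3)[OF s that])
   then show ?thesis by measurable
  qed
 next
  fix mu :: "(real^'d) measure" and x :: "real^'d" and e :: real assume mu: "mu : P2" and e: "e > 0"
  show "EX dl>0. ALL nu:P2. ALL z. W2 mu nu < dl & dist x z < dl -->
    dist (?c y mu x) (\<Sum>i\<in>UNIV. (DF (y nu) $ i) *\<^sub>R v i nu z) < e"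
  \<comment> \<open>Joint continuity in the measure and the point is reduced to sequences, for which
    the limit rules for finite sums are available.\<close>
  proof (rule ccontr)
   define S where "S nu z = (\<Sum>i\<in>UNIV. (DF (y nu) $ i) *\<^sub>R v i nu z)" for nu z
   assume "~ ?thesis"
   then have neg: "~ (EX dl>0. ALL nu:P2. ALL z. W2 mu nu < dl & dist x z < dl --> dist (S mu x) (S nu z) < e)"
    unfolding S_def .
   have "EX nu z. nu : P2 & W2 mu nu < inverse (real (Suc n)) & dist x z < inverse (real (Suc n)) & ~ dist (S mu x) (S nu z) < e" for n
   proof -
    have "inverse (real (Suc n)) > 0" by simp
    then show ?thesis using neg by blast
   qed
   then obtain nu z where nz: "!!n. nu n : P2" "!!n. W2 mu (nu n) < inverse (real (Suc n))" "!!n. dist x (z n) < inverse (real (Suc n))"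
    "!!n. ~ dist (S mu x) (S (nu n) (z n)) < e" by metis
   have small: "EX N. ALL n>=N. W2 mu (nu n) < dl & dist x (z n) < dl" if dl: "dl > 0" for dl
   proof -
    obtain N where "!!n. n >= N ==> norm (inverse (real (Suc n)) - 0) < dl" using LIMSEQ_D[OF LIMSEQ_inverse_real_of_nat dl] by auto
    then have "inverse (real (Suc n)) < dl" if "n >= N" for n using that by force
    then show ?thesis using nz(2,3) by (meson less_trans)
   qed
   have "(%n. DF (y (nu n))) ~~> DF (y mu)"
    unfolding LIMSEQ_def
   proof (intro allI impI)
    fix r :: real assume "0 < r"
    from comp_cont[OF mu this c] obtain dl where "dl > 0" "!!nu. nu : P2 ==> W2 mu nu < dl ==> dist (DF (y nu)) (DF (y mu)) < r" by blast
    then show "EX no. ALL n>=no. dist (DF (y (nu n))) (DF (y mu)) < r" using small[of dl] nz(1) by blast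
   qed
   moreover have "(%n. v i (nu n) (z n)) ~~> v i mu x" for i
    unfolding LIMSEQ_def
   proof (intro allI impI)
    fix r :: real assume "0 < r"
    then obtain dl where "dl > 0" "!!nu z. nu : P2 ==> W2 mu nu < dl ==> dist x z < dl ==> dist (v i mu x) (v i nu z) < r"
    using smooth_P2D(4)[OF s[of i] mu, where e=r and x=x] by auto
    then show "EX no. ALL n>=no. dist (v i (nu n) (z n)) (v i mu x) < r" using small[of dl] nz(1) unfolding dist_commute[of _ "v i mu x"] by blast
   qed
   ultimately have "(%n. S (nu n) (z n)) ~~> S mu x"
    unfolding S_def by (intro tendsto_sum tendsto_scaleR tendsto_vec_nth)
   then obtain n where "dist (S (nu n) (z n)) (S mu x) < e"
    using e by (meson LIMSEQ_def le_refl)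
   then show False using nz(4)[of n] by (simp add: dist_commute)
  qed
 next
  fix mu :: "(real^'d) measure" and e :: real assume mu: "mu : P2" and e: "e > 0"
  interpret M: l2_space mu by (rule P2_l2_space[OF mu])
  have vT: "v i mu : tangent mu" for i
   by (rule M.T_bounded[OF _ Cv[OF mu]]) (rule smooth_P2D(3)[OF s mu])
  define V where "V = (\<Sum>i\<in>UNIV. l2_norm mu (v i mu)) + 1"
  have V: "V > 0" unfolding V_def by (intro add_nonneg_pos sum_nonneg) auto
  define m where "m = real CARD('m)"
  have m: "m >= 1" unfolding m_def by (simp add: Suc_le_eq)
  define Dn where "Dn = norm (DF (y mu)) + 1"
  have Dn: "Dn > 0" unfolding Dn_def by (simp add: add_nonneg_pos)
  \<comment> \<open>Linearising the inner functions costs e1 n in each of m components, amplified by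
    \<open>DF\<close> to at most (e/2) n. The bound \<open>e1 <= 1\<close> keeps the increment
    \<open>w\<close> below (V + m) n, and \<open>e2\<close> spends the remaining e/2 on linearising
    \<open>F\<close>.\<close>
  define e1 where "e1 = min 1 (e / (2 * m * Dn))"
  have e1: "e1 > 0" "e1 <= 1" "e1 * m * Dn <= e / 2"
  proof -
   show "e1 > 0" "e1 <= 1" using e m Dn by (auto simp: e1_def)
   have "e1 <= e / (2 * m * Dn)" by (simp add: e1_def)
   then show "e1 * m * Dn <= e / 2" using m Dn by (simp add: field_simps)
  qed
  define e2 where "e2 = e / (2 * (V + m))"
  have e2: "e2 > 0" using e V m by (simp add: e2_def)
  have Vm: "V + m > 0" using V m by simp
  obtain d2 where d2: "d2 > 0" "!!z. norm (z - y mu) < d2 ==> norm (F z - F (y mu) - DF (y mu) \<bullet> (z - y mu)) <= e2 * norm (z - y mu)"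
   using d[of "y mu"] e2 unfolding has_derivative_at_alt by blast
  have "ALL i. EX dl>0. ALL f:tangent mu. l2_norm mu f < dl -->
    abs (u i (?b mu f) - u i mu - l2_inner mu (v i mu) f) <= e1 * l2_norm mu f"
   using smooth_P2D(5)[OF s mu e1(1)] by blast
  then obtain dl where dl: "!!i. dl i > 0" "!!i f. f : tangent mu ==> l2_norm mu f < dl i ==>
    abs (u i (?b mu f) - u i mu - l2_inner mu (v i mu) f) <= e1 * l2_norm mu f" by metis
  show "EX dl>0. ALL f:tangent mu. l2_norm mu f < dl -->
    abs (F (y (?b mu f)) - F (y mu) - l2_inner mu (?a y mu) f) <= e * l2_norm mu f"
  proof (intro exI[of _ "min (Min (range dl)) (d2 / (V + m))"] conjI ballI impI)
   show "min (Min (range dl)) (d2 / (V + m)) > 0" using dl(1) d2(1) Vm by (simp add: Min_gr_iff)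
   fix f assume f: "f : tangent mu" and lt: "l2_norm mu f < min (Min (range dl)) (d2 / (V + m))"
   define n where "n = l2_norm mu f"
   have n0: "n >= 0" by (simp add: n_def)
   define w where "w = y (?b mu f) - y mu"
   define l where "l = (\<chi> i. l2_inner mu (v i mu) f)"
   have wi: "abs ((w - l) $ i) <= e1 * n" for i
    using dl(2)[OF f, of i] lt by (simp add: w_def l_def y_def n_def Min_gr_iff)
   have wl: "norm (w - l) <= m * (e1 * n)"
    using order_trans[OF norm_le_l1_cart sum_mono[of UNIV "%i. abs ((w - l) $ i)" "%_. e1 * n"]] wi by (simp add: m_def)
   have "norm l <= (\<Sum>i\<in>UNIV. abs (l $ i))" by (rule norm_le_l1_cart)
   also have "... <= (\<Sum>i\<in>UNIV. l2_norm mu (v i mu) * n)"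
    unfolding l_def n_def using M.ip_bound[OF vT f] by (intro sum_mono) simp
   also have "... <= V * n" using n0 by (simp add: V_def sum_distrib_right[symmetric] distrib_right)
   finally have l: "norm l <= V * n" .
   have "m * (e1 * n) <= m * (1 * n)" using e1 n0 m by (intro mult_left_mono mult_right_mono) auto
   then have w: "norm w <= (V + m) * n" using norm_triangle_sub[of w l] wl l by (simp add: distrib_right)
   also have "... < d2" using lt Vm by (simp add: n_def field_simps)
   finally have "norm (F (y mu + w) - F (y mu) - DF (y mu) \<bullet> w) <= e2 * norm w" using d2(2)[of "y mu + w"] by simp
   also have "... <= e2 * ((V + m) * n)" using w e2 by (intro mult_left_mono) auto
   also have "... = e / 2 * n" using Vm by (simp add: e2_def field_simps)
   finally have a: "abs (F (y mu + w) - F (y mu) - DF (y mu) \<bullet> w) <= e / 2 * n" by simp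
   have "abs (DF (y mu) \<bullet> w - DF (y mu) \<bullet> l) <= norm (DF (y mu)) * norm (w - l)"
    using Cauchy_Schwarz_ineq2[of "DF (y mu)" "w - l"] by (simp add: inner_diff_right)
   also have "... <= Dn * (m * (e1 * n))" using wl n0 e1 m by (intro mult_mono) (auto simp: Dn_def)
   also have "... = (e1 * m * Dn) * n" by simp
   also have "... <= e / 2 * n" using e1(3) n0 by (rule mult_right_mono)
   finally have b2: "abs (DF (y mu) \<bullet> w - DF (y mu) \<bullet> l) <= e / 2 * n" .
   have "l2_inner mu (?a y mu) f = DF (y mu) \<bullet> l"
    using vT f by (simp add: M.ip_sum_left M.T_scale M.ip_scale_left inner_vec_def l_def)
   moreover have "y (?b mu f) = y mu + w" by (simp add: w_def)
   moreover have "abs (F (y mu + w) - F (y mu) - DF (y mu) \<bullet> l) <= e * n" using a b2 by linarith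
   ultimately show "abs (F (y (?b mu f)) - F (y mu) - l2_inner mu (?a y mu) f) <= e * l2_norm mu f"
    by (simp add: n_def)
  qed
 qed
qed

section \<open>Approximation of indicators by multiplicative classes\<close>

text \<open>An L2 form of the monotone class argument: the sets whose indicators the class
  approximates form a sigma-algebra. It serves twice, for smooth functions on \<open>P2\<close> and
  for test functions on the tangent space.\<close>

locale approx_class = finite_measure M for M :: "'a measure" +
 fixes \<A> :: "('a => real) set"
 assumes A_meas: "a : \<A> ==> a : bm M"
  and A_range: "a : \<A> ==> x : space M ==> 0 <= a x & a x <= 1"
  and A_compl: "a : \<A> ==> (%x. 1 - a x) : \<A>"
  and A_mult: "a : \<A> ==> b : \<A> ==> (%x. a x * b x) : \<A>"
  and A_one: "(%x. 1) : \<A>"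
begin

definition approx :: "'a set => bool" where
 "approx S \<longleftrightarrow> S : sets M & (ALL eps>0. EX a:\<A>. (LINT x|M. (a x - indicator S x)^2) < eps)"

lemma square_integrable:
 fixes f h :: "'a => real"
 assumes [measurable]: "f : bm M" "h : bm M"
  and "!!x. x : space M ==> 0 <= f x & f x <= 1" "!!x. x : space M ==> 0 <= h x & h x <= 1"
 shows "integrable M (%x. (f x - h x)^2)"
proof (rule integrable_const_bound[where B=1])
 show "AE x in M. norm ((f x - h x)^2) <= 1"
 proof (rule AE_I2)
  fix x assume "x : space M"
  then have "abs (f x - h x) <= 1" using assms(3,4)[of x] by auto
  then show "norm ((f x - h x)^2) <= 1" by (simp add: abs_square_le_1)
 qed
qed measurable

lemma approx_integrable: "a : \<A> ==> S : sets M ==> integrable M (%x. (a x - indicator S x)^2)"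
 using A_meas A_range by (intro square_integrable) auto

lemma approx_limit:
 assumes S: "S : sets M" and a: "!!n. a n : \<A>" and lim: "!!x. x : space M ==> (%n. a n x) ~~> indicator S x"
 shows "approx S"
 unfolding approx_def
proof (intro conjI S allI impI)
 fix eps :: real assume eps: "eps > 0"
 let ?a = "%a x. %n. (a n x - indicator S x)^2"
 have "(%n. LINT x|M. (a n x - indicator S x)^2) ~~> (LINT x|M. 0)"
 proof (rule integral_dominated_convergence[where w="%_. 1"])
  show "AE x in M. (?a a x) ~~> 0"
  proof (rule AE_I2)
   fix x assume "x : space M"
   then have "(?a a x) ~~> (indicator S x - indicator S x)\<^sup>2"
    by (intro tendsto_intros lim)
   then show "(?a a x) ~~> 0" by simp
  qed
  show "AE x in M. norm ((a n x - indicator S x)^2) <= 1" for n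
  proof (rule AE_I2)
   fix x assume "x : space M"
   then have "abs (a n x - indicator S x) <= 1" using A_range[OF a[of n]] by (auto simp: indicator_def)
   then show "norm ((a n x - indicator S x)^2) <= 1" by (simp add: abs_square_le_1)
  qed
 qed (use A_meas[OF a] S in auto)
 from LIMSEQ_D[OF this eps] obtain n where "norm ((LINT x|M. (a n x - indicator S x)^2) - (LINT x|M. 0)) < eps" by blast
 then show "EX a:\<A>. (LINT x|M. (a x - indicator S x)^2) < eps" using a[of n] by (intro bexI[of _ "a n"]) auto
qed

lemma approx_trans:
 assumes S: "S : sets M" and "!!eps. eps > 0 ==> EX S'. approx S' & (LINT x|M. (indicat_real S' x - indicat_real S x)^2) < eps"
 shows "approx S"
 unfolding approx_def
proof (intro conjI S allI impI)
 let ?a = "%S' x. indicator S' x - indicator S x"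
 fix eps :: real assume eps: "eps > 0"
 then obtain S' where S': "approx S'" "(LINT x|M. (?a S' x)^2) < eps / 4"
  using assms(2)[of "eps / 4"] by auto
 then obtain a where a: "a : \<A>" "(LINT x|M. (a x - indicator S' x)^2) < eps / 4"
  using eps unfolding approx_def by (meson zero_less_divide_iff zero_less_numeral)
 have S'm: "S' : sets M" using S'(1) by (simp add: approx_def)
 have "(LINT x|M. (a x - indicator S x)^2) <= (LINT x|M. 2 * (a x - indicator S' x)^2 + 2 * (?a S' x)^2)"
 proof (rule integral_mono)
  show "integrable M (%x. 2 * (a x - indicator S' x)^2 + 2 * (?a S' x)^2)"
   using approx_integrable[OF a(1) S'm] square_integrable[of "indicator S'" "indicator S"] S S'm by auto
  show "(a x - indicator S x)^2 <= 2 * (a x - indicator S' x)^2 + 2 * (?a S' x)^2" for x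
  proof -
   have "0 <= ((a x - indicator S' x) - (indicator S' x - indicator S x :: real))^2" by simp
   then show ?thesis by (simp add: power2_eq_square algebra_simps)
  qed
 qed (use approx_integrable[OF a(1) S] in simp)
 also have "... = 2 * (LINT x|M. (a x - indicator S' x)^2) + 2 * (LINT x|M. (?a S' x)^2)"
  using approx_integrable[OF a(1) S'm] square_integrable[of "indicator S'" "indicator S"] S S'm by simp
 also have "... < eps" using a(2) S'(2) by simp
 finally show "EX a:\<A>. (LINT x|M. (a x - indicator S x)^2) < eps" using a(1) by blast
qed

lemma approx_compl: assumes "approx S" shows "approx (space M - S)"
 unfolding approx_def
proof (intro conjI allI impI)
 show "space M - S : sets M" using assms by (auto simp: approx_def)
 fix eps :: real assume "eps > 0"
 then obtain a where a: "a : \<A>" "(LINT x|M. (a x - indicator S x)^2) < eps" using assms by (auto simp: approx_def)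
 have "(LINT x|M. ((1 - a x) - indicator (space M - S) x)^2) = (LINT x|M. (a x - indicator S x)^2)"
  by (rule Bochner_Integration.integral_cong) (auto simp: indicator_def power2_eq_square algebra_simps)
 then show "EX a:\<A>. (LINT x|M. (a x - indicator (space M - S) x)^2) < eps"
  using A_compl[OF a(1)] a(2) by (intro bexI[of _ "%x. 1 - a x"]) auto
qed

text \<open>Telescoping: a b - 1_S 1_R = (a - 1_S) b + 1_S (b - 1_R), where the extra factors are
  bounded by 1.\<close>

lemma approx_Int: assumes "approx S" "approx R" shows "approx (S \<inter> R)"
 unfolding approx_def
proof (intro conjI allI impI)
 have SR: "S : sets M" "R : sets M" using assms by (auto simp: approx_def)
 then show "S \<inter> R : sets M" by auto
 let ?b = "%a x. a x - indicator S x"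
 let ?c = "%b x. b x - indicator R x"
 fix eps :: real assume "eps > 0"
 then have "eps / 4 > 0" by simp
 then obtain a b where a: "a : \<A>" "(LINT x|M. (?b a x)^2) < eps / 4"
  and b: "b : \<A>" "(LINT x|M. (?c b x)^2) < eps / 4" using assms unfolding approx_def by meson
 let ?a = "S \<inter> R"
 have "(LINT x|M. (a x * b x - indicator ?a x)^2) <= (LINT x|M. 2 * (?b a x)^2 + 2 * (?c b x)^2)"
 proof (rule integral_mono)
  show "integrable M (%x. (a x * b x - indicator ?a x)^2)"
   using approx_integrable[OF A_mult[OF a(1) b(1)], of "S \<inter> R"] SR by auto
  fix x assume x: "x : space M"
  have "abs (a x * b x - indicator ?a x) <= abs (a x - indicator S x) + abs (b x - indicator R x)"
  proof -
   have "a x * b x - indicator ?a x = (?b a x) * b x + indicator S x * (?c b x)"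
    by (simp add: indicator_inter_arith algebra_simps)
   moreover have "abs ((?b a x) * b x) <= abs (a x - indicator S x)"
    using A_range[OF b(1) x] by (simp add: abs_mult mult_left_le)
   moreover have "abs (indicator S x * (?c b x)) <= abs (b x - indicator R x)"
    by (auto simp: indicator_def)
   ultimately show ?thesis by linarith
  qed
  then have "(a x * b x - indicator ?a x)^2 <= (abs (a x - indicator S x) + abs (b x - indicator R x))^2"
   by (metis abs_ge_zero power2_abs power_mono)
  also have "... <= 2 * (?b a x)^2 + 2 * (?c b x)^2"
   using sum_squares_bound[of "abs (a x - indicator S x)" "abs (b x - indicator R x)"] by (simp add: power2_sum)
  finally show "(a x * b x - indicator ?a x)^2 <= 2 * (?b a x)^2 + 2 * (?c b x)^2" .
 qed (use approx_integrable[OF a(1) SR(1)] approx_integrable[OF b(1) SR(2)] in simp)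
 also have "... < eps" using approx_integrable[OF a(1) SR(1)] approx_integrable[OF b(1) SR(2)] a(2) b(2) by simp
 finally show "EX a:\<A>. (LINT x|M. (a x - indicator ?a x)^2) < eps"
  using A_mult[OF a(1) b(1)] by (intro bexI[of _ "%x. a x * b x"])
qed

lemma approx_empty: "approx {}"
 by (rule approx_limit[where a="%_ x. 1 - 1"]) (use A_compl[OF A_one] in auto)

text \<open>Finite unions come from complements and intersections; countable unions are L2 limits of
  finite ones.\<close>

lemma approx_sigma_algebra: "sigma_algebra (space M) {S. approx S}"
proof (rule sigma_algebra_iff2[THEN iffD2], intro conjI ballI allI impI)
 show "{S. approx S} \<subseteq> Pow (space M)" using sets.sets_into_space by (auto simp: approx_def)
 show "{} : {S. approx S}" using approx_empty by simp
 show "space M - S : {S. approx S}" if "S : {S. approx S}" for S using approx_compl that by simp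
 fix A :: "nat => 'a set" assume "range A \<subseteq> {S. approx S}"
 then have A: "approx (A i)" for i by auto
 then have Am: "A i : sets M" for i by (auto simp: approx_def)
 have fin: "approx (\<Union>i<n. A i)" for n
 proof (induction n)
  case (Suc n)
  have "(\<Union>i<Suc n. A i) = space M - ((space M - (\<Union>i<n. A i)) \<inter> (space M - A n))"
   using sets.sets_into_space[OF Am] by (auto simp: lessThan_Suc)
  then show ?case using approx_compl[OF approx_Int[OF approx_compl[OF Suc] approx_compl[OF A[of n]]]] by simp
 qed (simp add: approx_empty)
 have "approx (\<Union>i. A i)"
 proof (rule approx_trans)
  show "(\<Union>i. A i) : sets M" using Am by auto
  fix eps :: real assume eps: "eps > 0"
  have "(%n. LINT x|M. (indicat_real (\<Union>i<n. A i) x - indicat_real (\<Union>i. A i) x)^2) ~~> (LINT x|M. 0)"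
  proof (rule integral_dominated_convergence[where w="%_. 1"])
   show "AE x in M. (%n. (indicat_real (\<Union>i<n. A i) x - indicat_real (\<Union>i. A i) x)^2) ~~> 0"
   proof (rule AE_I2)
    fix x
    have "(%n. indicat_real (\<Union>i<n. A i) x) ~~> indicator (\<Union>i. A i) x" by (rule LIMSEQ_indicator_UN)
    then have "(%n. (indicat_real (\<Union>i<n. A i) x - indicat_real (\<Union>i. A i) x)^2) ~~> (indicat_real (\<Union>i. A i) x - indicat_real (\<Union>i. A i) x)\<^sup>2"
    by (intro tendsto_intros)
    then show "(%n. (indicat_real (\<Union>i<n. A i) x - indicat_real (\<Union>i. A i) x)^2) ~~> 0" by simp
   qed
   show "AE x in M. norm ((indicat_real (\<Union>i<n. A i) x - indicat_real (\<Union>i. A i) x)^2) <= 1" for n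
    by (auto simp: indicator_def intro!: AE_I2)
  qed (use Am in auto)
  from LIMSEQ_D[OF this eps] obtain n where "norm ((LINT x|M. (indicat_real (\<Union>i<n. A i) x - indicat_real (\<Union>i. A i) x)^2) - (LINT x|M. 0)) < eps" by blast
  then show "EX S'. approx S' & (LINT x|M. (indicat_real S' x - indicat_real (\<Union>i. A i) x)^2) < eps"
   using fin[of n] by (intro exI[of _ "\<Union>i<n. A i"]) auto
 qed
 then show "(\<Union>i. A i) : {S. approx S}" by simp
qed

section \<open>The sigma-algebra of approximable sets\<close>

definition approx_algebra :: "'a measure" where "approx_algebra = sigma (space M) {S. approx S}"

lemma approx_subset: "{S. approx S} \<subseteq> Pow (space M)"
 using sets.sets_into_space by (auto simp: approx_def)

lemma sets_approx_algebra: "sets approx_algebra = {S. approx S}"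
 unfolding approx_algebra_def sets_measure_of[OF approx_subset]
 by (rule sigma_algebra.sigma_sets_eq[OF approx_sigma_algebra])

lemma space_approx_algebra: "space approx_algebra = space M"
 unfolding approx_algebra_def by (rule space_measure_of[OF approx_subset])

text \<open>Applied with smooth steps of \<open>q\<close>. Once functions generating all measurable
  sets are covered in this way, every measurable set is approximable.\<close>

lemma approx_measurableI:
 fixes q :: "'a => real"
 assumes q: "q : bm M"
  and a: "!!c n. a c n : \<A>" and lim: "!!c x. x : space M ==> (%n. a c n x) ~~> indicator {c<..} (q x)"
 shows "q : bm approx_algebra"
proof (rule borel_measurableI_greater)
 fix c :: real
 have "approx (q -` {c<..} \<inter> space M)"
 proof (rule approx_limit[where a="a c"])
  show "q -` {c<..} \<inter> space M : sets M" using q by measurable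
  show "(%n. a c n x) ~~> indicator (q -` {c<..} \<inter> space M) x" if "x : space M" for x
   using lim[OF that, of c] that by (simp add: indicator_def)
 qed (rule a)
 moreover have "{x : space approx_algebra. c < q x} = q -` {c<..} \<inter> space M" by (auto simp: space_approx_algebra)
 ultimately show "{x : space approx_algebra. c < q x} : sets approx_algebra" by (simp add: sets_approx_algebra)
qed

text \<open>Cauchy-Schwarz carries orthogonality from the class to all indicators; testing with the
  sets where \<open>w\<close> is nonnegative and where it is nonpositive makes \<open>w\<close>
  vanish.\<close>

lemma orthogonal_zero:
 assumes all: "!!S. S : sets M ==> approx S" and w[measurable]: "w : bm M" and w2: "integrable M (%x. (w x)^2)"
  and orth: "!!a. a : \<A> ==> (LINT x|M. w x * a x) = 0"
 shows "AE x in M. w x = (0::real)"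
proof -
 have w1: "integrable M w" by (rule square_integrable_imp_integrable[OF w w2])
 have prod: "integrable M (%x. w x * a x)" if "a : bm M" "!!x. x : space M ==> abs (a x) <= 1" for a
 proof (rule Bochner_Integration.integrable_bound[OF w1])
  show "(%x. w x * a x) : bm M" using that(1) by measurable
  show "AE x in M. norm (w x * a x) <= norm (w x)"
   using that(2) by (auto intro!: AE_I2 mult_left_le simp: abs_mult)
 qed
 let ?a = "%a S. LINT x|M. (a x - indicator S x)^2"
 let ?b = "%a S. LINT x|M. w x * (a x - indicator S x)"
 let ?c = "%S. LINT x|M. w x * indicator S x"
 have zero: "(?c S) = 0" if S: "S : sets M" for S
 proof -
  define W where "W = (LINT x|M. (w x)^2)"
  have W0: "W >= 0" unfolding W_def by simp
  have "(?c S)^2 <= eps" if eps: "eps > 0" for eps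
  proof -
   have "eps / (W + 1) > 0" using eps W0 by simp
   then obtain a where a: "a : \<A>" "(?a a S) < eps / (W + 1)"
    using all[OF S] unfolding approx_def by meson
   have am: "a : bm M" by (rule A_meas[OF a(1)])
   have i1: "integrable M (%x. w x * a x)" using A_range[OF a(1)] by (intro prod am) auto
   have i2: "integrable M (%x. w x * indicator S x)" using S by (intro prod) (auto simp: indicator_def)
   have i3: "integrable M (%x. (a x - indicator S x)^2)" by (rule approx_integrable[OF a(1) S])
   have "(?c S) = - (?b a S)"
    using i1 i2 orth[OF a(1)] by (simp add: right_diff_distrib)
   moreover have "(?b a S)^2 <= W * (?a a S)"
   proof (rule discriminant_bound)
    fix t
    have "W + 2 * t * (?b a S) + t^2 * (?a a S)
    = (LINT x|M. (w x)^2 + 2 * t * (w x * (a x - indicator S x)) + t^2 * (a x - indicator S x)^2)"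
    unfolding W_def using w2 i1 i2 i3 by (simp add: right_diff_distrib)
    also have "... = (LINT x|M. (w x + t * (a x - indicator S x))^2)"
    by (intro Bochner_Integration.integral_cong refl) (simp add: power2_eq_square algebra_simps)
    finally show "0 <= W + 2 * t * (?b a S) + t^2 * (?a a S)" by simp
   qed
   moreover have "W * (?a a S) <= W * (eps / (W + 1))" using a(2) W0 by (intro mult_left_mono) auto
   moreover have "W * (eps / (W + 1)) <= eps" using W0 eps by (simp add: field_simps)
   ultimately show ?thesis by simp
  qed
  then have "(?c S)^2 <= 0" by (rule field_le_epsilon[of _ 0, simplified])
  then show ?thesis by simp
 qed
 let ?d = "%x. w x * indicator {x\<in>space M. w x <= 0} x"
 have "AE x in M. w x * indicator {x\<in>space M. w x >= 0} x = 0"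
 proof (rule integral_nonneg_eq_0_iff_AE[THEN iffD1])
  show "integrable M (%x. w x * indicator {x\<in>space M. w x >= 0} x)" by (intro prod) (auto simp: indicator_def)
  show "(\<integral>x. w x * indicator {x\<in>space M. w x >= 0} x \<partial>M) = 0" by (rule zero) measurable
 qed (auto simp: indicator_def)
 moreover have "AE x in M. - (?d x) = 0"
 proof (rule integral_nonneg_eq_0_iff_AE[THEN iffD1])
  show "integrable M (%x. - (?d x))"
   by (intro Bochner_Integration.integrable_minus prod) (auto simp: indicator_def)
  have "(\<integral>x. w x * indicator {x\<in>space M. w x <= 0} x \<partial>M) = 0" by (rule zero) measurable
  then show "(LINT x|M. - (?d x)) = 0" by simp
 qed (auto simp: indicator_def)
 ultimately show ?thesis using AE_space
  by eventually_elim (auto simp: indicator_def split: if_splits)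
qed

end

subsection \<open>Smooth step functions\<close>

text \<open>The shift by \<open>sqrt (real n)\<close> drives the value at 0 to 0, so that the limit
  is the indicator of the open half-line. The arctangent is taken because its first two derivatives
  are bounded.\<close>

definition step :: "nat => real => real" where
 "step n t = 1 / 2 + arctan (real n * t - sqrt (real n)) / pi"

definition step' :: "nat => real => real" where
 "step' n t = real n / (pi * (1 + (real n * t - sqrt (real n))^2))"

lemma step_bounds: "0 <= step n t" "step n t <= 1"
proof -
 have "- (pi / 2) < arctan x" "arctan x < pi / 2" for x using arctan_bounded[of x] by auto
 from this[of "real n * t - sqrt (real n)"] show "0 <= step n t" "step n t <= 1"
  unfolding step_def by (auto simp: field_simps)
qed

lemma step_deriv: "(step n has_real_derivative step' n t) (at t)"
proof -
 let ?a = "%t. 1 + (real n * t - sqrt (real n))^2"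
 have "((%t. real n * t - sqrt (real n)) has_real_derivative real n) (at t)"
  by (auto intro!: derivative_eq_intros)
 from DERIV_chain2[OF DERIV_arctan this]
 have "((%t. arctan (real n * t - sqrt (real n))) has_real_derivative inverse (?a t) * real n) (at t)" .
 from DERIV_add[OF DERIV_const[of "1 / 2"] DERIV_cdivide[OF this, of pi]]
 have "(step n has_real_derivative 0 + inverse (?a t) * real n / pi) (at t)"
  unfolding step_def[abs_def] .
 moreover have "0 + inverse (?a t) * real n / pi = step' n t"
  unfolding step'_def divide_inverse inverse_mult_distrib by (simp only: add_0_left mult_ac)
 ultimately show ?thesis by (simp only:)
qed

lemma step'_bound: "abs (step' n t) <= real n"
proof -
 define Y where "Y = pi * (1 + (real n * t - sqrt (real n))^2)"
 have "1 * 1 <= pi * (1 + (real n * t - sqrt (real n))^2)" by (intro mult_mono) (use pi_gt3 in auto)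
 then have Y: "1 <= Y" by (simp add: Y_def)
 then have "real n / Y <= real n / 1" by (intro divide_left_mono) auto
 then show ?thesis using Y unfolding step'_def Y_def[symmetric] by simp
qed

text \<open>The second derivative \<open>s2\<close> is bounded by n^2 because 2 |w| <= 1 + w^2 for w
  = n t - sqrt n.\<close>

lemma step'_lipschitz: "abs (step' n t - step' n s) <= (real n)^2 * abs (t - s)"
proof -
 define s2 where "s2 t = - (2 * (real n)^2 * (real n * t - sqrt (real n))) / (pi * (1 + (real n * t - sqrt (real n))^2)^2)" for t
 have D: "(step' n has_real_derivative s2 t) (at t)" for t
 proof -
  have pos: "1 + (real n * t - sqrt (real n))^2 ~= 0" by (smt (verit) zero_le_power2)
  show ?thesis
   unfolding step'_def s2_def using pos
   by (auto intro!: derivative_eq_intros simp: power2_eq_square) (simp add: field_simps)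
 qed
 have b: "abs (s2 t) <= (real n)^2" for t
 proof -
  define w where "w = real n * t - sqrt (real n)"
  have "2 * abs w <= 1 + w^2" using sum_squares_bound[of 1 "abs w"] by simp
  also have "... <= (1 + w^2)^2" by (rule self_le_power) auto
  also have "... <= pi * (1 + w^2)^2" using mult_right_mono[of 1 pi "(1 + w^2)^2"] pi_gt3 by simp
  finally have "2 * abs w <= pi * (1 + w^2)^2" .
  moreover have "pi * (1 + w^2)^2 > 0" by (smt (verit) mult_pos_pos pi_gt_zero zero_less_power zero_le_power2)
  ultimately have "2 * abs w / (pi * (1 + w^2)^2) <= 1" by simp
  then have "(real n)^2 * (2 * abs w / (pi * (1 + w^2)^2)) <= (real n)^2" by (intro mult_left_le) auto
  then show ?thesis unfolding s2_def w_def[symmetric] by (simp add: abs_mult abs_divide mult_ac)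
 qed
 have "norm (step' n t - step' n s) <= (real n)^2 * norm (t - s)"
  by (rule field_differentiable_bound[of UNIV _ s2]) (use D b in auto)
 then show ?thesis by simp
qed

lemma step_tendsto: "(%n. step n t) ~~> indicator {0<..} t"
proof -
 have sq: "filterlim (%n. sqrt (real n)) at_top sequentially"
  by (rule filterlim_compose[OF sqrt_at_top filterlim_real_sequentially])
 have eq: "real n * t - sqrt (real n) = sqrt (real n) * (sqrt (real n) * t - 1)" for n
  by (simp add: algebra_simps flip: real_sqrt_mult mult.assoc)
 let ?a = "%n. arctan (real n * t - sqrt (real n))"
 show ?thesis
 proof (cases "t > 0")
  case True
  have "filterlim (%n. t * sqrt (real n)) at_top sequentially"
   by (rule filterlim_tendsto_pos_mult_at_top[OF tendsto_const True sq])
  then have "filterlim (%n. -1 + t * sqrt (real n)) at_top sequentially"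
   by (rule filterlim_tendsto_add_at_top[OF tendsto_const])
  then have "filterlim (%n. sqrt (real n) * (-1 + t * sqrt (real n))) at_top sequentially"
   by (rule filterlim_at_top_mult_at_top[OF sq])
  then have "filterlim (%n. real n * t - sqrt (real n)) at_top sequentially"
   unfolding eq by (simp add: algebra_simps)
  then have "?a ~~> pi / 2"
   by (rule filterlim_compose[OF tendsto_arctan_at_top])
  then have "(%n. step n t) ~~> 1 / 2 + (pi / 2) / pi" unfolding step_def by (intro tendsto_intros) auto
  then show ?thesis using True by simp
 next
  case False
  have "filterlim (%n. real n * t - sqrt (real n)) at_bot sequentially"
  proof (rule filterlim_at_bot_mono)
   show "filterlim (%n. - sqrt (real n)) at_bot sequentially" using sq by (simp add: filterlim_uminus_at_bot)
   show "\<forall>\<^sub>F n in sequentially. real n * t - sqrt (real n) <= - sqrt (real n)"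
    using False by (auto intro!: always_eventually mult_nonneg_nonpos)
  qed
  then have "?a ~~> - (pi / 2)"
   by (rule filterlim_compose[OF tendsto_arctan_at_bot])
  then have "(%n. step n t) ~~> 1 / 2 + (- (pi / 2)) / pi" unfolding step_def by (intro tendsto_intros) auto
  then show ?thesis using False by simp
 qed
qed

subsection \<open>Evaluation of measures on Borel sets\<close>

lemma smooth_fun_step:
 fixes i :: "real^'d"
 assumes "norm i = 1"
 shows "smooth_fun (%x. step n (x \<bullet> i - c)) (%x. step' n (x \<bullet> i - c) *\<^sub>R i) (real n) ((real n)^2)"
 unfolding smooth_fun_def
proof (intro conjI allI)
 fix x y :: "real^'d"
 have "((%x. x \<bullet> i - c) has_derivative (%h. h \<bullet> i)) (at x)" by (auto intro!: derivative_eq_intros)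
 from DERIV_compose_FDERIV[OF step_deriv this, of n]
 show "((%x. step n (x \<bullet> i - c)) has_derivative (%h. step' n (x \<bullet> i - c) *\<^sub>R i \<bullet> h)) (at x)"
  by (simp add: inner_commute mult.commute)
 show "norm (step' n (x \<bullet> i - c) *\<^sub>R i) <= real n" using assms step'_bound by simp
 have "abs (step' n (x \<bullet> i - c) - step' n (y \<bullet> i - c)) <= (real n)^2 * abs ((x - y) \<bullet> i)"
  using step'_lipschitz[of n "x \<bullet> i - c" "y \<bullet> i - c"] by (simp add: inner_diff_left)
 also have "... <= (real n)^2 * norm (x - y)"
  using Cauchy_Schwarz_ineq2[of "x - y" i] assms by (intro mult_left_mono) auto
 finally show "norm (step' n (x \<bullet> i - c) *\<^sub>R i - step' n (y \<bullet> i - c) *\<^sub>R i) <= (real n)^2 * norm (x - y)"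
  using assms by (simp add: scaleR_diff_left[symmetric])
qed

text \<open>Factors bounded by 1 keep the gradient of the product bounded and Lipschitz. This makes
  the family of smoothly approximable sets below stable under intersection.\<close>

lemma smooth_fun_mult:
 assumes "smooth_fun \<phi> D C L" "smooth_fun \<psi> E C' L'" "!!x. abs (\<phi> x) <= 1" "!!x. abs (\<psi> x) <= 1"
 shows "smooth_fun (%x. \<phi> x * \<psi> x) (%x. \<phi> x *\<^sub>R E x + \<psi> x *\<^sub>R D x) (C' + C) (L' + C * C' + (L + C' * C))"
 unfolding smooth_fun_def
proof (intro conjI allI)
 note A = assms(1,2)[unfolded smooth_fun_def]
 have C0: "0 <= C" "0 <= C'" using A norm_ge_zero order_trans by blast+
 have lip: "abs (\<phi> x - \<phi> y) <= C * norm (x - y)" "abs (\<psi> x - \<psi> y) <= C' * norm (x - y)" for x y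
  by (rule lipschitz_of_gradient[of _ D]; use A in auto) (rule lipschitz_of_gradient[of _ E]; use A in auto)
 fix x y
 let ?b = "%x. \<phi> x *\<^sub>R E x + \<psi> x *\<^sub>R D x"
 show "((%x. \<phi> x * \<psi> x) has_derivative (%h. (?b x) \<bullet> h)) (at x)"
 proof -
  have "(\<phi> has_derivative (%h. D x \<bullet> h)) (at x)" "(\<psi> has_derivative (%h. E x \<bullet> h)) (at x)" using A by auto
  from has_derivative_mult[OF this] show ?thesis by (simp add: inner_add_left mult.commute)
 qed
 have "norm (?b x) <= abs (\<phi> x) * norm (E x) + abs (\<psi> x) * norm (D x)"
  by (rule order_trans[OF norm_triangle_ineq]) simp
 also have "... <= 1 * C' + 1 * C" using A assms(3,4) C0 by (intro add_mono mult_mono) auto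
 finally show "norm (?b x) <= C' + C" by simp
 have part: "norm (a x *\<^sub>R F x - a y *\<^sub>R F y) <= (M + c * K) * norm (x - y)"
  if "abs (a x) <= 1" "norm (F x - F y) <= M * norm (x - y)" "abs (a x - a y) <= c * norm (x - y)" "norm (F y) <= K" "0 <= K"
  for a :: "real^'a => real" and F :: "real^'a => real^'a" and M c K
 proof -
  have "a x *\<^sub>R F x - a y *\<^sub>R F y = a x *\<^sub>R (F x - F y) + (a x - a y) *\<^sub>R F y" by (simp add: algebra_simps)
  then have "norm (a x *\<^sub>R F x - a y *\<^sub>R F y) <= abs (a x) * norm (F x - F y) + abs (a x - a y) * norm (F y)"
   by (metis norm_scaleR norm_triangle_ineq)
  also have "... <= 1 * (M * norm (x - y)) + (c * norm (x - y)) * K"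
   using that by (intro add_mono mult_mono) (auto intro: order_trans[OF norm_ge_zero] order_trans[OF abs_ge_zero])
  finally show ?thesis by (simp add: algebra_simps)
 qed
 let ?a = "%x y. \<phi> x *\<^sub>R E x + \<psi> x *\<^sub>R D x - (\<phi> y *\<^sub>R E y + \<psi> y *\<^sub>R D y)"
 have "\<phi> x *\<^sub>R E x + \<psi> x *\<^sub>R D x - (\<phi> y *\<^sub>R E y + \<psi> y *\<^sub>R D y) = (\<phi> x *\<^sub>R E x - \<phi> y *\<^sub>R E y) + (\<psi> x *\<^sub>R D x - \<psi> y *\<^sub>R D y)" by simp
 then have "norm (?a x y) <= norm (\<phi> x *\<^sub>R E x - \<phi> y *\<^sub>R E y) + norm (\<psi> x *\<^sub>R D x - \<psi> y *\<^sub>R D y)"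
  by (metis norm_triangle_ineq)
 also have "... <= (L' + C * C') * norm (x - y) + (L + C' * C) * norm (x - y)"
  by (intro add_mono part) (use A assms(3,4) lip C0 in auto)
 finally show "norm (?a x y) <= (L' + C * C' + (L + C' * C)) * norm (x - y)"
  by (simp add: algebra_simps)
qed

text \<open>Such sets form an intersection-stable family containing the coordinate half-spaces,
  hence a generator of the Borel sets on which the mass is a limit of integrals of smooth
  functions.\<close>

definition smooth_approx :: "(real^'d) set => (nat => real^'d => real) => (nat => real^'d => real^'d) => (nat => real) => (nat => real) => bool" where
 "smooth_approx S \<phi> D C L \<longleftrightarrow> (ALL n. smooth_fun (\<phi> n) (D n) (C n) (L n)) & (ALL n x. 0 <= \<phi> n x & \<phi> n x <= 1) \<and>
  (ALL x. (%n. \<phi> n x) ~~> indicat_real S x)"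

lemma smooth_approxD:
 assumes "smooth_approx S \<phi> D C L"
 shows "!!n. smooth_fun (\<phi> n) (D n) (C n) (L n)" "!!n x. 0 <= \<phi> n x & \<phi> n x <= 1" "!!x. (%n. \<phi> n x) ~~> indicat_real S x"
 using assms by (simp_all add: smooth_approx_def)

text \<open>On the generating family, mu(S) is the limit of integrals of smooth functions by
  dominated convergence; intersection stability extends measurability to all evaluations.\<close>

lemma measurable_subprob_of_smooth:
 fixes N :: "(real^'d) measure measure"
 assumes sp: "space N = P2"
  and meas: "!!\<phi> D C L. smooth_fun \<phi> D C L ==> (!!x. 0 <= \<phi> x & \<phi> x <= 1) ==> (%mu. \<integral>x. \<phi> x \<partial>mu) : bm N"
 shows "(%mu. mu) : measurable N (subprob_algebra borel)"
proof -
 define \<G> where "\<G> = {S :: (real^'d) set. EX \<phi> D C L. smooth_approx S \<phi> D C L}"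
 have P2D: "prob_space mu" "sets mu = sets borel" if "mu : space N" for mu
  using that by (auto simp: sp P2_def)
 have smooth_meas: "\<phi> : bm borel" if "smooth_fun \<phi> D C L" for \<phi> :: "real^'d => real" and D C L
  using that unfolding smooth_fun_def by (intro borel_measurable_continuous_onI differentiable_continuous_on_UNIV) auto
 have \<G>m: "S : sets borel" if S: "S : \<G>" for S
 proof -
  obtain \<phi> D C L where sa: "smooth_approx S \<phi> D C L" using S unfolding \<G>_def by blast
  note * = smooth_approxD(1)[OF sa] smooth_approxD(3)[OF sa]
  have "indicat_real S : bm borel"
   by (rule borel_measurable_LIMSEQ_real[OF *(2) smooth_meas[OF *(1)]])
  then show ?thesis by (simp add: borel_measurable_indicator_iff)
 qed
 have half: "{x. c < x \<bullet> i} : \<G>" if "i : Basis" for c and i :: "real^'d"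
 proof -
  have "indicator {0<..} (x \<bullet> i - c) = indicat_real {x. c < x \<bullet> i} x" for x by (auto simp: indicator_def)
  then have "(%n. step n (x \<bullet> i - c)) ~~> indicat_real {x. c < x \<bullet> i} x" for x
   using step_tendsto[of "x \<bullet> i - c"] by simp
  then have "smooth_approx {x. c < x \<bullet> i} (%n x. step n (x \<bullet> i - c)) (%n x. step' n (x \<bullet> i - c) *\<^sub>R i) real (%n. (real n)^2)"
   unfolding smooth_approx_def using smooth_fun_step[OF norm_Basis[OF that]] step_bounds by simp
  then show ?thesis unfolding \<G>_def by blast
 qed
 show ?thesis
 proof (rule measurable_subprob_algebra_generated[where \<Omega>=UNIV and G=\<G>])
  show "sets (borel :: (real^'d) measure) = sigma_sets UNIV \<G>"
  proof
   show "sigma_sets UNIV \<G> \<subseteq> sets borel" using sets.sigma_sets_subset[of \<G> borel] \<G>m by auto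
   have "sets (borel :: (real^'d) measure) = sigma_sets UNIV ((%(a, i). {x. a < x \<bullet> i}) ` (UNIV \<times> Basis))"
    by (subst borel_eq_halfspace_greater) simp
   also have "... \<subseteq> sigma_sets UNIV \<G>" by (rule sigma_sets_mono') (use half in auto)
   finally show "sets (borel :: (real^'d) measure) \<subseteq> sigma_sets UNIV \<G>" .
  qed
  show "Int_stable \<G>"
  proof (rule Int_stableI)
   fix S R assume "S : \<G>" "R : \<G>"
   then obtain \<phi> D C L \<psi> E C' L' where sa: "smooth_approx S \<phi> D C L" "smooth_approx R \<psi> E C' L'"
    unfolding \<G>_def by blast
   note S = smooth_approxD[OF sa(1)] and R = smooth_approxD[OF sa(2)]
   have a: "abs (\<phi> n x) <= 1" "abs (\<psi> n x) <= 1" for n x using S(2)[of n x] R(2)[of n x] by auto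
   have "0 <= \<phi> n x * \<psi> n x & \<phi> n x * \<psi> n x <= 1" for n x using S(2)[of n x] R(2)[of n x] by (simp add: mult_le_one)
   moreover have "(%n. \<phi> n x * \<psi> n x) ~~> indicat_real (S \<inter> R) x" for x
    unfolding indicator_inter_arith by (rule tendsto_mult[OF S(3) R(3)])
   ultimately have "smooth_approx (S \<inter> R) (%n x. \<phi> n x * \<psi> n x) (%n x. \<phi> n x *\<^sub>R E n x + \<psi> n x *\<^sub>R D n x)
    (%n. C' n + C n) (%n. L' n + C n * C' n + (L n + C' n * C n))"
    unfolding smooth_approx_def using smooth_fun_mult[OF S(1) R(1) a] by simp
   then show "S \<inter> R : \<G>" unfolding \<G>_def by blast
  qed
  show "subprob_space mu" if "mu : space N" for mu using P2D[OF that] by (simp add: prob_space_imp_subprob_space)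
  show "sets mu = sets borel" if "mu : space N" for mu using P2D[OF that] by simp
  show "(%mu. emeasure mu UNIV) : bm N"
  proof (subst measurable_cong[where g="%_. 1"])
   fix mu :: "(real^'d) measure" assume "mu : space N"
   note P = P2D[OF this]
   show "emeasure mu UNIV = 1" using prob_space.emeasure_space_1[OF P(1)] sets_eq_imp_space_eq[OF P(2)] by simp
  qed simp
  fix S assume S: "S : \<G>"
  then obtain \<phi> D C L where sa: "smooth_approx S \<phi> D C L" unfolding \<G>_def by blast
  note * = smooth_approxD[OF sa]
  have "(%mu. measure mu S) : bm N"
  proof (rule borel_measurable_LIMSEQ_real)
   show "(%mu. \<integral>x. \<phi> n x \<partial>mu) : bm N" for n by (rule meas[OF *(1,2)])
   fix mu :: "(real^'d) measure" assume "mu : space N"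
   note P = P2D[OF this]
   interpret prob_space mu by (rule P(1))
   have mb: "f : bm mu" if "f : bm borel" for f :: "real^'d => real" using that measurable_cong_sets[OF P(2) refl] by auto
   have "(%n. \<integral>x. \<phi> n x \<partial>mu) ~~> (LINT x|mu. indicator S x)"
   proof (rule integral_dominated_convergence[where w="%_. 1"])
    show "indicat_real S : bm mu" using \<G>m[OF S] P(2) by simp
    show "\<phi> n : bm mu" for n by (rule mb[OF smooth_meas[OF *(1)]])
    show "AE x in mu. (%n. \<phi> n x) ~~> indicat_real S x" using *(3) by simp
    show "AE x in mu. norm (\<phi> n x) <= 1" for n using *(2) by auto
   qed simp
   then show "(%n. \<integral>x. \<phi> n x \<partial>mu) ~~> measure mu S" using \<G>m[OF S] P(2) by simp
  qed
  then have "(%mu. ennreal (measure mu S)) : bm N" by measurable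
  then show "(%mu. emeasure mu S) : bm N"
  proof (subst measurable_cong[where g="%mu. ennreal (measure mu S)"])
   fix mu :: "(real^'d) measure" assume "mu : space N"
   then interpret prob_space mu using P2D by blast
   show "emeasure mu S = ennreal (measure mu S)" by (rule emeasure_eq_measure)
  qed
 qed auto
qed

section \<open>Neighbourhoods in the Wasserstein space\<close>

lemma (in pair_prob_space) integral_tensor:
 fixes f :: "'a => real" and h :: "'b => real"
 assumes f: "integrable M1 f" and h: "integrable M2 h"
 shows "integrable (M1 \<Otimes>\<^sub>M M2) (%z. f (fst z) * h (snd z))"
  "(\<integral>z. f (fst z) * h (snd z) \<partial>(M1 \<Otimes>\<^sub>M M2)) = (LINT x|M1. f x) * (LINT y|M2. h y)"
proof -
 have [measurable]: "f : bm M1" "h : bm M2" using f h by auto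
 let ?a = "M1 \<Otimes>\<^sub>M M2"
 have "integrable ?a (%z. f (fst z) * h (snd z))"
 proof (rule Fubini_integrable)
  show "integrable M1 (%x. LINT y|M2. norm (f (fst (x, y)) * h (snd (x, y))))"
   using f by (simp add: abs_mult)
  show "AE x in M1. integrable M2 (%y. f (fst (x, y)) * h (snd (x, y)))" using h by simp
 qed measurable
 then show i: "integrable ?a (%z. f (fst z) * h (snd z))" .
 show "(\<integral>z. f (fst z) * h (snd z) \<partial>?a) = (LINT x|M1. f x) * (LINT y|M2. h y)"
  using integral_fst'[OF i] by simp
qed

text \<open>On each cell \<open>Q j\<close> the common mass \<open>m j\<close> of \<open>mu\<close> and \<open>nu\<close> is coupled independently inside the cell; the
 remaining masses are coupled independently.\<close>

lemma W2_cell_bound: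
 fixes mu nu :: "(real^'d) measure" and Q :: "nat => (real^'d) set"
 assumes P: "mu : P2" "nu : P2" and Q: "!!j. Q j : sets borel" "disjoint_family Q"
  and diam: "!!j x y. j < N ==> x : Q j ==> y : Q j ==> dist x y <= \<eta>"
  and R: "!!j x. j < N ==> x : Q j ==> norm x <= R" and \<eta>: "0 <= \<eta>"
  and d: "!!j. j < N ==> abs (measure mu (Q j) - measure nu (Q j)) <= dl"
 defines "\<tau> \<equiv> %\<rho> :: (real^'d) measure. \<integral>x. indicator (- (\<Union>j<N. Q j)) x * (norm x)^2 \<partial>\<rho>"
 shows "(W2 mu nu)^2 <= \<eta>^2 + 4 * real N * dl * R^2 + 2 * \<tau> mu + 2 * \<tau> nu"
proof -
 interpret M: l2_space mu by (rule P2_l2_space[OF P(1)])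
 interpret N: l2_space nu by (rule P2_l2_space[OF P(2)])
 interpret P: pair_prob_space mu nu ..
 note [measurable] = Q(1)
 define p where "p j = measure mu (Q j)" for j
 define q where "q j = measure nu (Q j)" for j
 define m where "m j = min (p j) (q j)" for j
 have m: "0 <= m j" "m j <= p j" "m j <= q j" for j by (auto simp: m_def p_def q_def)
 \<comment> \<open>\<open>al p\<close> and \<open>al q\<close> are the densities, relative to
   \<open>mu\<close> and \<open>nu\<close>, of the mass that is not matched inside the cells; off
   the cells they equal 1.\<close>
 define al where "al a x = 1 - (\<Sum>j<N. m j / a j * indicator (Q j) x)" for a :: "nat => real" and x
 define E where "E = - (\<Union>j<N. Q j)"
 have E[measurable]: "E : sets borel" unfolding E_def by measurable
 have cell: "(\<Sum>j<N. c j * indicator (Q j) x) = c i" if "i < N" "x : Q i" for c :: "nat => real" and i x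
 proof -
  have "c j * indicator (Q j) x = (if j = i then c i else 0)" for j
   using that(2) Q(2) by (auto simp: disjoint_family_on_def indicator_def)
  then show ?thesis using that(1) by (simp add: sum.delta)
 qed
 have off: "(\<Sum>j<N. c j * indicator (Q j) x) = 0" if "x : E" for c :: "nat => real" and x
  using that unfolding E_def by (intro sum.neutral) (auto simp: indicator_def)
 have al_cases: "(EX i<N. x : Q i) | x : E" for x unfolding E_def by auto
 have al01: "0 <= al a x & al a x <= 1" if "!!j. m j <= a j" for a x
 proof -
  have "0 <= m j / a j & m j / a j <= 1" for j using m(1)[of j] that[of j] by (auto simp: divide_le_eq_1)
  then show ?thesis using al_cases[of x] cell[of _ x "%j. m j / a j"] off[of x "%j. m j / a j"] unfolding al_def by fastforce
 qed
 have al_meas[measurable]: "al a : bm borel" for a unfolding al_def by measurable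
 \<comment> \<open>Both residual measures have this total mass.\<close>
 define S where "S = 1 - (\<Sum>j<N. m j)"
 let ?b = "%m a x. \<Sum>j<N. (1 - m j / a j) * R^2 * indicator (Q j) x"
 let ?j = "%al a \<rho>. LINT x|\<rho>. al a x * (norm x)^2"
 have al_int: "integrable \<rho> (al a)" "(LINT x|\<rho>. al a x) = S"
  "(?j al a \<rho>) <= real N * dl * R^2 + \<tau> \<rho>" "integrable \<rho> (%x. al a x * (norm x)^2)"
  if \<rho>: "\<rho> : P2" and a: "!!j. a j = measure \<rho> (Q j)" "!!j. m j <= a j" "!!j. j < N ==> a j - m j <= dl" for \<rho> :: "(real^'d) measure" and a
 proof -
  interpret A: l2_space \<rho> by (rule P2_l2_space[OF \<rho>])
  have Qi: "integrable \<rho> (%x. indicat_real (Q j) x)" "(LINT x|\<rho>. indicat_real (Q j) x) = a j" for j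
   using Q(1) by (auto simp: A.sets_lam a(1) intro!: A.integrable_const_bound[where B=1])
  have ma: "m j / a j * a j = m j" for j using m(1)[of j] a(2)[of j] by (cases "a j = 0") auto
  show i: "integrable \<rho> (al a)" unfolding al_def[abs_def] using Qi by simp
  show "(LINT x|\<rho>. al a x) = S" unfolding al_def S_def using Qi ma A.prob_space by simp
  have i2: "integrable \<rho> (%x. indicator E x * (norm x)^2)"
   by (rule Bochner_Integration.integrable_bound[OF A.second_moment]) (auto simp: indicator_def)
  show i3: "integrable \<rho> (%x. al a x * (norm x)^2)"
   using al01[OF a(2)] by (intro Bochner_Integration.integrable_bound[OF A.second_moment]) (auto simp: abs_mult intro!: mult_left_le_one_le)
  have js: "integrable \<rho> (%x. (1 - m j / a j) * R^2 * indicat_real (Q j) x)" for j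
   by (rule integrable_mult_right[OF Qi(1)])
  have jS: "integrable \<rho> (%x. \<Sum>j<N. (1 - m j / a j) * R^2 * indicat_real (Q j) x)"
   by (rule Bochner_Integration.integrable_sum) (rule js)
  have "(?j al a \<rho>) <= (LINT x|\<rho>. (?b m a x) + indicator E x * (norm x)^2)"
  proof (rule integral_mono[OF i3])
   show "integrable \<rho> (%x. (?b m a x) + indicator E x * (norm x)^2)"
    by (rule Bochner_Integration.integrable_add[OF jS i2])
   fix x
   show "al a x * (norm x)^2 <= (?b m a x) + indicator E x * (norm x)^2"
   proof (cases "x : E")
    case True
    have a1: "al a x = 1" unfolding al_def off[OF True] by simp
    have a2: "(?b m a x) = 0" by (rule off[OF True])
    show ?thesis unfolding a1 a2 using True by simp
   next
    case False
    then obtain i where i: "i < N" "x : Q i" using al_cases by blast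
    have "0 <= 1 - m i / a i" using m(1)[of i] a(2)[of i] by (auto simp: divide_le_eq_1)
    moreover have "(norm x)^2 <= R^2" using R[OF i] by (simp add: power_mono)
    ultimately have "(1 - m i / a i) * (norm x)^2 <= (1 - m i / a i) * R^2" by (rule mult_left_mono[rotated])
    moreover have a1: "al a x = 1 - m i / a i" unfolding al_def cell[OF i, of "%j. m j / a j"] by (rule refl)
    moreover have a2: "(?b m a x) = (1 - m i / a i) * R^2"
    by (rule cell[OF i, of "%j. (1 - m j / a j) * R^2"])
    ultimately show ?thesis unfolding a1 a2 using False by simp
   qed
  qed
  also have "... = (\<Sum>j<N. (1 - m j / a j) * R^2 * a j) + \<tau> \<rho>"
   unfolding Bochner_Integration.integral_add[OF jS i2] Bochner_Integration.integral_sum[OF js]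
   by (simp only: integral_mult_right_zero Qi(2) \<tau>_def E_def)
  also have "(\<Sum>j<N. (1 - m j / a j) * R^2 * a j) <= (\<Sum>j<N. dl * R^2)"
  proof (rule sum_mono)
   fix j assume "j : {..<N}"
   have "(1 - m j / a j) * R^2 * a j = (a j - m j / a j * a j) * R^2" by (simp add: algebra_simps)
   also have "... <= dl * R^2" unfolding ma using a(3)[of j] \<open>j : {..<N}\<close> by (intro mult_right_mono) auto
   finally show "(1 - m j / a j) * R^2 * a j <= dl * R^2" .
  qed
  finally show "(?j al a \<rho>) <= real N * dl * R^2 + \<tau> \<rho>" by simp
 qed
 have pm: "p j - m j <= dl" "q j - m j <= dl" if "j < N" for j
  using d[OF that] order_trans[OF abs_ge_zero d[OF that]] unfolding p_def[symmetric] q_def[symmetric] m_def by auto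
 note A = al_int[OF P(1) p_def m(2) pm(1)] and B = al_int[OF P(2) q_def m(3) pm(2)]
 have S0: "S >= 0"
 proof -
  have "0 <= (LINT x|mu. al p x)" using al01[of p] m by (intro Bochner_Integration.integral_nonneg) auto
  then show ?thesis using A(2) by simp
 qed
 let ?e = "%j x y. indicator (Q j) x * indicator (Q j) y"
 \<comment> \<open>Density of the coupling with respect to the product measure. Division by zero
   yields 0, which is right here: a cell that is null for one measure has m j = 0, and for S = 0
   both residuals vanish almost everywhere.\<close>
 define k where "k x y = (\<Sum>j<N. m j / (p j * q j) * (?e j x y)) + al p x * al q y / S" for x y
 let ?a = "mu \<Otimes>\<^sub>M nu"
 have km: "(%z. k (fst z) (snd z)) : bm ?a" unfolding k_def by measurable
 have k0: "0 <= k x y" for x y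
  unfolding k_def using al01[of p x] al01[of q y] m S0 by (intro add_nonneg_nonneg sum_nonneg mult_nonneg_nonneg divide_nonneg_nonneg) (auto simp: p_def q_def)
 have Qi: "integrable mu (indicat_real (Q j))" "(LINT x|mu. indicat_real (Q j) x) = p j"
   "integrable nu (indicat_real (Q j))" "(LINT x|nu. indicat_real (Q j) x) = q j" for j
  using Q(1) by (auto simp: M.sets_lam N.sets_lam p_def q_def intro!: M.integrable_const_bound[where B=1] N.integrable_const_bound[where B=1])
 have mq: "m j / (p j * q j) * q j = m j / p j" "m j / (p j * q j) * p j = m j / q j" for j
  using m[of j] by (cases "p j = 0"; cases "q j = 0"; simp)+
 have AE0: "AE x in \<rho>. al a x = 0" if "S = 0" "integrable \<rho> (al a)" "(LINT x|\<rho>. al a x) = S" "!!j. m j <= a j" for \<rho> a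
  using that integral_nonneg_eq_0_iff_AE[of \<rho> "al a"] al01[of a] by simp
 have kx: "AE x in mu. (\<integral>\<^sup>+y. ennreal (k x y) \<partial>nu) = 1"
 proof -
  have "AE x in mu. S = 0 --> al p x = 0" using AE0[OF _ A(1,2) m(2)] by (cases "S = 0") auto
  then show ?thesis
  proof eventually_elim
   case (elim x)
   have i: "integrable nu (k x)" unfolding k_def[abs_def] using Qi B(1) by auto
   have "(LINT y|nu. k x y) = (\<Sum>j<N. m j / (p j * q j) * (indicator (Q j) x * q j)) + al p x * S / S"
    unfolding k_def using Qi B(1,2) by simp
   also have "(\<Sum>j<N. m j / (p j * q j) * (indicator (Q j) x * q j)) = (\<Sum>j<N. m j / p j * indicator (Q j) x)"
    by (intro sum.cong refl) (metis mq(1) mult.assoc mult.commute)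
   also have "... = 1 - al p x" by (simp add: al_def)
   finally have "(LINT y|nu. k x y) = 1" using elim by (cases "S = 0") auto
   then show ?case using k0 i by (simp add: nn_integral_eq_integral)
  qed
 qed
 have ky: "AE y in nu. (\<integral>\<^sup>+x. ennreal (k x y) \<partial>mu) = 1"
 proof -
  have "AE x in nu. S = 0 --> al q x = 0" using AE0[OF _ B(1,2) m(3)] by (cases "S = 0") auto
  then show ?thesis
  proof eventually_elim
   case (elim y)
   have i: "integrable mu (%x. k x y)" unfolding k_def using Qi A(1) by auto
   have "(LINT x|mu. k x y) = (\<Sum>j<N. m j / (p j * q j) * (p j * indicator (Q j) y)) + S * al q y / S"
    unfolding k_def using Qi A(1,2) by simp
   also have "(\<Sum>j<N. m j / (p j * q j) * (p j * indicator (Q j) y)) = (\<Sum>j<N. m j / q j * indicator (Q j) y)"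
    by (intro sum.cong refl) (metis mq(2) mult.assoc)
   also have "... = 1 - al q y" by (simp add: al_def)
   finally have "(LINT x|mu. k x y) = 1" using elim by (cases "S = 0") auto
   then show ?case using k0 i by (simp add: nn_integral_eq_integral)
  qed
 qed
 define \<pi> where "\<pi> = density ?a (%z. ennreal (k (fst z) (snd z)))"
 have s\<pi>: "sets \<pi> = sets borel"
  using sets_pair_measure_cong[OF M.sets_lam N.sets_lam] unfolding \<pi>_def sets_density by (simp only: borel_prod)
 have m1: "fst : measurable ?a borel" and m2: "snd : measurable ?a borel"
  using measurable_fst[of mu nu] measurable_snd[of mu nu]
  by (simp_all add: measurable_cong_sets[OF refl M.sets_lam] measurable_cong_sets[OF refl N.sets_lam])
 let ?i = "%k X f. \<integral>\<^sup>+z. ennreal (k (fst z) (snd z)) * indicator X (f z) \<partial>?a"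
 have e: "emeasure (distr \<pi> borel f) X = (?i k X f)"
  if f: "f : measurable ?a borel" and X: "X : sets borel" for f :: "_ => real^'d" and X
 proof -
  have f': "f : measurable \<pi> borel" using f unfolding \<pi>_def by simp
  have "emeasure (distr \<pi> borel f) X = emeasure \<pi> (f -` X \<inter> space \<pi>)" by (rule emeasure_distr[OF f' X])
  also have "... = (\<integral>\<^sup>+z. ennreal (k (fst z) (snd z)) * indicator (f -` X \<inter> space ?a) z \<partial>?a)"
   unfolding \<pi>_def space_density using km measurable_sets[OF f X] by (intro emeasure_density) auto
  also have "... = (?i k X f)"
   by (intro nn_integral_cong) (auto simp: indicator_def)
  finally show ?thesis .
 qed
 have d1: "distr \<pi> borel fst = mu"
 proof (rule measure_eqI)
  fix X assume "X : sets (distr \<pi> borel fst)"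
  then have X: "X : sets borel" by simp
  have "emeasure (distr \<pi> borel fst) X = (\<integral>\<^sup>+x. \<integral>\<^sup>+y. ennreal (k x y) * indicator X x \<partial>nu \<partial>mu)"
   unfolding e[OF m1 X] using km m1 X by (subst N.nn_integral_fst[symmetric]) auto
  also have "... = (\<integral>\<^sup>+x. indicator X x \<partial>mu)"
  proof (rule nn_integral_cong_AE)
   show "AE x in mu. (\<integral>\<^sup>+y. ennreal (k x y) * indicator X x \<partial>nu) = indicator X x"
    using kx
   proof eventually_elim
    case (elim x)
    have "(%y. ennreal (k x y)) : bm nu" unfolding k_def by measurable
    from nn_integral_multc[OF this, of "indicator X x"] elim show ?case by simp
   qed
  qed
  also have "... = emeasure mu X" using X by (simp add: M.sets_lam)
  finally show "emeasure (distr \<pi> borel fst) X = emeasure mu X" .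
 qed (simp add: M.sets_lam)
 have d2: "distr \<pi> borel snd = nu"
 proof (rule measure_eqI)
  fix X assume "X : sets (distr \<pi> borel snd)"
  then have X: "X : sets borel" by simp
  have "emeasure (distr \<pi> borel snd) X = (\<integral>\<^sup>+y. \<integral>\<^sup>+x. ennreal (k x y) * indicator X y \<partial>mu \<partial>nu)"
   unfolding e[OF m2 X] using km m2 X by (subst P.nn_integral_snd[symmetric]) (auto simp: split_beta')
  also have "... = (\<integral>\<^sup>+y. indicator X y \<partial>nu)"
  proof (rule nn_integral_cong_AE)
   show "AE y in nu. (\<integral>\<^sup>+x. ennreal (k x y) * indicator X y \<partial>mu) = indicator X y"
    using ky
   proof eventually_elim
    case (elim y)
    have "(%x. ennreal (k x y)) : bm mu" unfolding k_def by measurable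
    from nn_integral_multc[OF this, of "indicator X y"] elim show ?case by simp
   qed
  qed
  also have "... = emeasure nu X" using X by (simp add: N.sets_lam)
  finally show "emeasure (distr \<pi> borel snd) X = emeasure nu X" .
 qed (simp add: N.sets_lam)
 have \<pi>: "\<pi> : couplings mu nu" using s\<pi> d1 d2 by (simp add: couplings_def)
 define c where "c z = (dist (fst z) (snd z))^2" for z :: "(real^'d) \<times> (real^'d)"
 have cm: "c : bm ?a" unfolding c_def[abs_def] using m1 m2 by measurable
 let ?h = "%c \<pi>. LINT z|\<pi>. c z"
 have cost: "(?h c \<pi>) = (\<integral>z. k (fst z) (snd z) * c z \<partial>?a)"
  unfolding \<pi>_def using km cm k0 by (subst integral_density) auto
 \<comment> \<open>Majorant of cost times density: matched mass travels at most \<eta>, and for the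
   residuals the squared distance is at most twice the sum of the squared norms.\<close>
 define b where "b z = \<eta>^2 * k (fst z) (snd z) + 2 / S * (al p (fst z) * (norm (fst z))^2 * al q (snd z)) + 2 / S * (al p (fst z) * (al q (snd z) * (norm (snd z))^2))" for z
 have t1: "integrable ?a (%z. indicat_real (Q j) (fst z) * indicat_real (Q j) (snd z))"
  "(\<integral>z. indicat_real (Q j) (fst z) * indicat_real (Q j) (snd z) \<partial>?a) = p j * q j" for j
  using P.integral_tensor[OF Qi(1) Qi(3)] by (auto simp: p_def q_def)
 have t2: "integrable ?a (%z. al p (fst z) * al q (snd z))"
  by (intro P.integral_tensor A(1) B(1))
 have ki: "integrable ?a (%z. k (fst z) (snd z))" unfolding k_def
  by (intro Bochner_Integration.integrable_add Bochner_Integration.integrable_sum integrable_mult_right integrable_divide t1(1) t2)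
 have k1: "(\<integral>z. k (fst z) (snd z) \<partial>?a) = 1"
 proof -
  have UB: "(UNIV :: (real^'d) set) : sets borel" by simp
  have "emeasure (distr \<pi> borel fst) UNIV = 1" unfolding d1 using M.emeasure_space_1 by simp
  then have "(\<integral>\<^sup>+z. ennreal (k (fst z) (snd z)) \<partial>?a) = 1" unfolding e[OF m1 UB] by simp
  then show ?thesis using nn_integral_eq_integral[OF ki] k0 by simp
 qed
 let ?c = "%al p. LINT x|mu. al p x * (norm x)^2"
 have t3: "integrable ?a (%z. al p (fst z) * (norm (fst z))^2 * al q (snd z))"
   "(\<integral>z. al p (fst z) * (norm (fst z))^2 * al q (snd z) \<partial>?a) = (?c al p) * S"
  using P.integral_tensor[of "%x. al p x * (norm x)^2" "al q"] A B by auto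
 let ?d = "%al q. LINT x|nu. al q x * (norm x)^2"
 have t4: "integrable ?a (%z. al p (fst z) * (al q (snd z) * (norm (snd z))^2))"
   "(\<integral>z. al p (fst z) * (al q (snd z) * (norm (snd z))^2) \<partial>?a) = S * (?d al q)"
  using P.integral_tensor[of "al p" "%x. al q x * (norm x)^2"] A B by auto
 have bi: "integrable ?a b" unfolding b_def[abs_def] using ki t3 t4 by simp
 have kb: "k (fst z) (snd z) * c z <= b z" for z
 proof -
  define x y where "x = fst z" and "y = snd z"
  have a0: "0 <= al p x" "0 <= al q y" using al01[of p x] al01[of q y] m by auto
  have kk: "0 <= m j / (p j * q j)" for j using m[of j] by (simp add: p_def q_def)
  have "c z <= 2 * (norm x)^2 + 2 * (norm y)^2"
  proof -
   have "c z <= (norm x + norm y)^2" unfolding c_def x_def y_def by (simp add: dist_norm norm_triangle_ineq4 power_mono)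
   also have "... <= 2 * (norm x)^2 + 2 * (norm y)^2"
    using sum_squares_bound[of "norm x" "norm y"] by (simp add: power2_sum)
   finally show ?thesis .
  qed
  then have r: "al p x * al q y / S * c z <= al p x * al q y / S * (2 * (norm x)^2 + 2 * (norm y)^2)"
   using a0 S0 by (intro mult_left_mono) auto
  have "(\<Sum>j<N. m j / (p j * q j) * (?e j x y)) * c z <= (\<Sum>j<N. m j / (p j * q j) * (?e j x y)) * \<eta>^2"
   unfolding sum_distrib_right
  proof (rule sum_mono)
   fix j assume "j : {..<N}"
   then have "indicator (Q j) x * indicator (Q j) y * c z <= indicator (Q j) x * indicator (Q j) y * \<eta>^2"
    using diam[of j x y] \<eta> by (auto simp: indicator_def c_def x_def y_def intro: power_mono)
   from mult_left_mono[OF this kk[of j]]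
   show "m j / (p j * q j) * (?e j x y) * c z <= m j / (p j * q j) * (?e j x y) * \<eta>^2"
    by (simp only: mult.assoc)
  qed
  also have "... <= k x y * \<eta>^2" unfolding k_def using a0 S0 by (intro mult_right_mono) auto
  finally have "k x y * c z <= k x y * \<eta>^2 + al p x * al q y / S * (2 * (norm x)^2 + 2 * (norm y)^2)"
   using r by (subst (1) k_def) (simp add: distrib_right)
  also have "... = b z" unfolding b_def x_def y_def by (simp add: algebra_simps)
  finally show ?thesis by (simp add: x_def y_def)
 qed
 have b0: "0 <= c z" for z by (simp add: c_def)
 have "(?h c \<pi>) <= (\<integral>z. b z \<partial>?a)"
  unfolding cost
 proof (rule integral_mono[OF _ bi kb])
  show "integrable ?a (%z. k (fst z) (snd z) * c z)"
  proof (rule Bochner_Integration.integrable_bound[OF bi])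
   show "AE z in mu \<Otimes>\<^sub>M nu. norm (k (fst z) (snd z) * c z) <= norm (b z)"
   proof (rule AE_I2)
    fix z
    have "0 <= k (fst z) (snd z) * c z" using k0 b0 by simp
    then show "norm (k (fst z) (snd z) * c z) <= norm (b z)" using kb[of z] by simp
   qed
  qed (use km cm in measurable)
 qed
 also have "... = \<eta>^2 + 2 / S * ((?c al p) * S) + 2 / S * (S * (?d al q))"
  unfolding b_def using ki k1 t3 t4 by simp
 also have "... <= \<eta>^2 + 2 * (?c al p) + 2 * (?d al q)"
 proof (cases "S = 0")
  case True
  have "0 <= (?c al p)" "0 <= (?d al q)"
   using al01[of p] al01[of q] m by (auto intro!: Bochner_Integration.integral_nonneg)
  then show ?thesis using True by simp
 qed simp
 also have "... <= \<eta>^2 + 4 * real N * dl * R^2 + 2 * \<tau> mu + 2 * \<tau> nu"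
  using A(3) B(3) by simp
 finally have c: "(?h c \<pi>) <= \<eta>^2 + 4 * real N * dl * R^2 + 2 * \<tau> mu + 2 * \<tau> nu" .
 have "W2 mu nu <= sqrt (?h c \<pi>)" unfolding c_def by (rule W2_le[OF \<pi>])
 moreover have "0 <= W2 mu nu" unfolding W2_def
  using couplings_nonempty[OF P] by (intro real_sqrt_ge_zero cINF_greatest) auto
 ultimately have "(W2 mu nu)^2 <= (sqrt (?h c \<pi>))^2" by (intro power_mono)
 also have "... = (?h c \<pi>)" using b0 by simp
 finally show ?thesis using c by simp
qed

text \<open>By the coupling bound, a \<open>W2\<close>-ball contains a neighbourhood fixed by
  finitely many cell masses and one tail of the second moment. Both kinds of functionals are
  measurable as soon as evaluations are, and countably many of them suffice.\<close>

lemma P2_borel_subset: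
 fixes Nm :: "(real^'d) measure measure"
 assumes sp: "space Nm = P2" and id: "(%mu. mu) : measurable Nm (subprob_algebra borel)"
 shows "sets (P2_borel :: (real^'d) measure measure) \<subseteq> sets Nm"
 unfolding P2_borel_def
proof (rule metric_borel_subsetI[OF sp])
 fix U :: "(real^'d) measure set" assume U: "U \<subseteq> P2" and nb: "!!mu. mu : U ==> EX r>0. ALL nu:P2. W2 mu nu < r --> nu : U"
 obtain Ds :: "(real^'d) set" where Ds: "countable Ds" "!!X. open X ==> X ~= {} ==> EX d:Ds. d : X"
  using countable_dense_exists by blast
 define e where "e = from_nat_into Ds"
 have Dne: "Ds ~= {}" using Ds(2)[of UNIV] by auto
 let ?a = "%n. inverse (real (Suc n))"
 \<comment> \<open>Disjoint cells covering the space, each inside a ball of radius 1/(n+1) around a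
   point of a countable dense set.\<close>
 define Q where "Q n = disjointed (%j. ball (e j) (?a n))" for n :: nat
 have Qb: "Q n j : sets borel" for n j
 proof -
  have "range (%j. ball (e j) (?a n)) \<subseteq> sets borel" by auto
  from sets.range_disjointed_sets[OF this] show ?thesis unfolding Q_def by blast
 qed
 have Qd: "disjoint_family (Q n)" for n unfolding Q_def by (rule disjoint_family_disjointed)
 have Qball: "Q n j \<subseteq> ball (e j) (?a n)" for n j unfolding Q_def by (rule disjointed_subset)
 have QU: "(\<Union>j. Q n j) = UNIV" for n
 proof -
  have "(\<Union>j. ball (e j) (?a n)) = UNIV"
  proof (intro equalityI subset_UNIV subsetI)
   fix x :: "real^'d"
   obtain d where "d : Ds" "d : ball x (?a n)" using Ds(2)[of "ball x (?a n)"] by auto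
   moreover then obtain j where "d = e j" using from_nat_into_surj[OF Ds(1)] unfolding e_def by metis
   ultimately show "x : (\<Union>j. ball (e j) (?a n))" by (auto simp: dist_commute)
  qed
  then show ?thesis unfolding Q_def UN_disjointed_eq .
 qed
 let ?b = "%N Q n. - (\<Union>j<N. Q n j)"
 define \<tau> where "\<tau> n N mu = (LINT x|mu. indicator (?b N Q n) x * (norm x)^2)" for n N :: nat and mu :: "(real^'d) measure"
 define \<phi> where "\<phi> i mu = (case i of Inl (n, j) => measure mu (Q n j) | Inr (n, N) => \<tau> n N mu)" for i :: "(nat \<times> nat) + (nat \<times> nat)" and mu
 show "U : sets Nm"
 proof (rule sets_of_countable_topology)
  show "\<phi> i : bm Nm" for i
  proof (cases i)
   case (Inl a)
   have "(%mu. measure mu (Q (fst a) (snd a))) : bm Nm"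
    by (rule measurable_compose[OF id measurable_measure_subprob_algebra[OF Qb]])
   then show ?thesis by (simp add: \<phi>_def[abs_def] Inl split_beta)
  next
   case (Inr a)
   have "(%x::real^'d. indicator (- (\<Union>j<snd a. Q (fst a) j)) x * (norm x)^2) : bm borel"
    using Qb by measurable
   from measurable_compose[OF id integral_measurable_subprob_algebra[OF this]]
   show ?thesis by (simp add: \<phi>_def[abs_def] \<tau>_def[abs_def] Inr split_beta)
  qed
  show "U \<subseteq> space Nm" using U sp by simp
  fix mu assume mu: "mu : U"
  then have muP: "mu : P2" using U by auto
  interpret M: l2_space mu by (rule P2_l2_space[OF muP])
  obtain r where r: "r > 0" "!!nu. nu : P2 ==> W2 mu nu < r ==> nu : U" using nb[OF mu] by auto
  \<comment> \<open>The radius is chosen below r/8 so that cells have diameter at most r/4.\<close>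
  have "r / 8 > 0" using r(1) by simp
  from LIMSEQ_D[OF LIMSEQ_inverse_real_of_nat this]
  obtain n where "norm (inverse (real (Suc n)) - 0) < r / 8" by blast
  then have n: "2 * inverse (real (Suc n)) < r / 4" by simp
  have "(%N. \<tau> n N mu) ~~> (LINT x|mu. 0)"
   unfolding \<tau>_def
  proof (rule integral_dominated_convergence[where w="%x. (norm x)^2"])
   show "AE x in mu. (%N. indicat_real (?b N Q n) x * (norm x)^2) ~~> 0"
   proof (rule AE_I2)
    fix x
    obtain i where "x : Q n i" using QU[of n] by auto
    then have "indicat_real (?b N Q n) x * (norm x)^2 = 0" if "N >= Suc i" for N
    using that by (auto simp: indicator_def)
    then have "\<forall>\<^sub>F N in sequentially. indicat_real (?b N Q n) x * (norm x)^2 = 0"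
    unfolding eventually_sequentially by blast
    then show "(%N. indicat_real (?b N Q n) x * (norm x)^2) ~~> 0" by (rule tendsto_eventually)
   qed
   show "(%x. indicat_real (?b N Q n) x * (norm x)^2) : bm mu" for N
    using Qb by measurable
  qed (use M.second_moment in \<open>auto simp: indicator_def\<close>)
  from LIMSEQ_D[OF this, of "r^2 / 32"] r(1) obtain N where "norm (\<tau> n N mu - (LINT x|mu. 0)) < r^2 / 32" by auto
  then have N: "\<tau> n N mu < r^2 / 32" by simp
  define R where "R = (\<Sum>j<N. norm (e j)) + 1"
  have R0: "R > 0" unfolding R_def by (intro add_nonneg_pos sum_nonneg) auto
  have RQ: "norm x <= R" if "j < N" "x : Q n j" for j x
  proof -
   have "dist (e j) x < inverse (real (Suc n))" using that Qball[of n j] by auto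
   also have "inverse (real (Suc n)) <= 1" by (simp add: inverse_le_1_iff)
   finally have "norm x <= norm (e j) + 1" using norm_triangle_sub[of x "e j"] by (simp add: dist_norm norm_minus_commute)
   also have "norm (e j) <= (\<Sum>j<N. norm (e j))" using that(1) by (intro member_le_sum) auto
   finally show ?thesis by (simp add: R_def)
  qed
  \<comment> \<open>With diameters r/4, a tail of \<open>mu\<close> below r^2/32 and this
    \<open>dl\<close>, the coupling bound stays below (1/16 + 1/8 + 1/16 + 1/8) r^2, which is 3/8 of
    r^2.\<close>
  define dl where "dl = min (r^2 / 32) (r^2 / (32 * (real N + 1) * R^2))"
  have dl: "dl > 0" "dl <= r^2 / 32" "real N * dl * R^2 <= r^2 / 32"
  proof -
   show "dl > 0" using r(1) R0 by (auto simp: dl_def)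
   show "dl <= r^2 / 32" unfolding dl_def by (rule min.cobounded1)
   have "dl <= r^2 / (32 * (real N + 1) * R^2)" by (simp add: dl_def)
   then have "(real N * R^2) * dl <= (real N * R^2) * (r^2 / (32 * (real N + 1) * R^2))" by (intro mult_left_mono) auto
   also have "... = (real N / (real N + 1)) * (r^2 / 32)"
   proof -
    have "(x * R^2) * (y / (32 * c * R^2)) = (x / c) * (y / 32)" if "c > 0" for x y c :: real
    using R0 that by (simp add: field_simps)
    from this[of "real N + 1"] show ?thesis by simp
   qed
   also have "... <= 1 * (r^2 / 32)" by (intro mult_right_mono) auto
   finally show "real N * dl * R^2 <= r^2 / 32" by (simp add: mult_ac)
  qed
  show "EX I. EX dl>0. finite I & (ALL nu:space Nm. (ALL i:I. abs (\<phi> i nu - \<phi> i mu) < dl) --> nu : U)"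
  proof (intro exI[of _ "insert (Inr (n, N)) ((%j. Inl (n, j)) ` {..<N})"] exI[of _ dl] conjI ballI impI)
   fix nu assume "nu : space Nm" and *: "ALL i:insert (Inr (n, N)) ((%j. Inl (n, j)) ` {..<N}). abs (\<phi> i nu - \<phi> i mu) < dl"
   then have nu: "nu : P2" using sp by simp
   have t: "abs (\<tau> n N nu - \<tau> n N mu) < dl" using * by (auto simp: \<phi>_def)
   have mm: "abs (measure mu (Q n j) - measure nu (Q n j)) <= dl" if "j < N" for j
    using * that by (auto simp: \<phi>_def abs_minus_commute less_imp_le)
   have "(W2 mu nu)^2 <= (r / 4)^2 + 4 * real N * dl * R^2 + 2 * \<tau> n N mu + 2 * \<tau> n N nu"
    unfolding \<tau>_def
   proof (rule W2_cell_bound[OF muP nu Qb Qd _ RQ _ mm])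
    fix j x y assume "x : Q n j" "y : Q n j"
    then have "dist (e j) x < inverse (real (Suc n))" "dist (e j) y < inverse (real (Suc n))" using Qball[of n j] by auto
    then have "dist x y < 2 * inverse (real (Suc n))" using dist_triangle[of x y "e j"] by (simp add: dist_commute)
    then show "dist x y <= r / 4" using n by simp
   qed (use r in auto)
   also have "... < r^2" using N t dl r(1) by (simp add: power_divide)
   finally have "W2 mu nu < r" using r(1) by (simp add: power_less_imp_less_base)
   then show "nu : U" by (rule r(2)[OF nu])
  qed (use dl in auto)
 qed
qed

lemma measurable_P2_borel: "P2_continuous u ==> u : bm P2_borel"
 unfolding P2_borel_def P2_continuous_def by (rule metric_borel_measurableI) (simp add: dist_real_def)

lemma space_P2_borel [simp]: "space P2_borel = P2" by (simp add: P2_borel_def)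

text \<open>Converse to the inclusion above: evaluations are Borel for \<open>W2\<close>, because
  integrals of smooth functions are continuous.\<close>

lemma measurable_P2_subprob: "(%mu. mu) : measurable (P2_borel :: (real^'d) measure measure) (subprob_algebra borel)"
 by (rule measurable_subprob_of_smooth)
  (auto intro!: measurable_P2_borel smooth_P2D(1)[OF smooth_P2_integral])

lemma measurable_P2_integral [measurable]:
 "\<phi> : bm borel ==> (%mu. \<integral>x. \<phi> x \<partial>mu) : bm P2_borel" for \<phi> :: "real^'d => real"
 using measurable_compose[OF measurable_P2_subprob integral_measurable_subprob_algebra[of \<phi> borel]] by simp

subsection \<open>Density of the smooth functions\<close>

definition smooth_class :: "((real^'d) measure => real) set" where
 "smooth_class = {u. (EX v. smooth_P2 u v) & (ALL mu:P2. 0 <= u mu & u mu <= 1)}"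

text \<open>\<open>real^unit\<close> presents a single function as a vector, so that the vector
  chain rule applies.\<close>

lemma smooth_P2_real_compose:
 fixes u :: "(real^'d) measure => real"
 assumes u: "smooth_P2 u v" and h: "!!t. (h has_real_derivative h' t) (at t)" "continuous_on UNIV h'"
  and b: "!!mu. mu : P2 ==> abs (h' (u mu)) <= C"
 shows "EX w. smooth_P2 (%mu. h (u mu)) w"
proof -
 let ?F = "%y :: real^unit. h (y $ ())" and ?DF = "%y :: real^unit. (\<chi> i::unit. h' (y $ ()))"
 have d: "(?F has_derivative (%k. ?DF y \<bullet> k)) (at y)" for y :: "real^unit"
 proof -
  have "((%y :: real^unit. y $ ()) has_derivative (%k. k $ ())) (at y)"
   by (rule bounded_linear_imp_has_derivative[OF bounded_linear_vec_nth])
  from DERIV_compose_FDERIV[OF h(1) this]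
  show ?thesis by (simp add: inner_vec_def UNIV_unit mult.commute)
 qed
 have c: "continuous_on UNIV ?DF"
  by (intro continuous_on_vec_lambda continuous_on_compose2[OF h(2)] continuous_intros) auto
 have b': "norm (?DF (\<chi> i. u mu)) <= C" if "mu : P2" for mu
  using b[OF that] by (simp add: norm_vec_def L2_set_def UNIV_unit)
 have "smooth_P2 (%mu. ?F (\<chi> i. u mu)) (%mu x. \<Sum>i\<in>UNIV. (?DF (\<chi> i. u mu) $ i) *\<^sub>R v mu x)"
  using smooth_P2_compose[where u="%i :: unit. u" and v="%i :: unit. v" and F="?F" and DF="?DF" and C=C, OF u d c b'] .
 then show ?thesis by auto
qed

text \<open>Chain rule for the product of the two coordinates of \<open>real^bool\<close>; the
  gradient swaps the coordinates and is bounded on the range of the pair.\<close>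

lemma smooth_P2_mult:
 fixes u u' :: "(real^'d) measure => real"
 assumes u: "smooth_P2 u v" "smooth_P2 u' v'" and b: "!!mu. mu : P2 ==> abs (u mu) <= 1" "!!mu. mu : P2 ==> abs (u' mu) <= 1"
 shows "EX w. smooth_P2 (%mu. u mu * u' mu) w"
proof -
 let ?F = "%y :: real^bool. y $ True * y $ False" and ?DF = "%y :: real^bool. (\<chi> i. y $ (~ i))"
 let ?a = "%mu. \<chi> i. (if i then u else u') mu"
 have "smooth_P2 (%mu. ?F (?a mu)) (%mu x. \<Sum>i\<in>UNIV. (?DF (?a mu) $ i) *\<^sub>R (if i then v else v') mu x)"
 proof (rule smooth_P2_compose[where F="?F" and DF="?DF" and C=2])
  show "smooth_P2 (if i then u else u') (if i then v else v')" for i using u by simp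
  fix y :: "real^bool"
  have *: "((%y :: real^bool. y $ i) has_derivative (%k. k $ i)) (at y)" for i
   by (rule bounded_linear_imp_has_derivative[OF bounded_linear_vec_nth])
  from has_derivative_mult[OF *[of True] *[of False]]
  show "(?F has_derivative (%k. ?DF y \<bullet> k)) (at y)" by (simp add: inner_vec_def UNIV_bool mult.commute add.commute)
 next
  show "continuous_on UNIV ?DF" by (intro continuous_on_vec_lambda continuous_intros)
  show "norm (?DF (?a mu)) <= 2" if "mu : P2" for mu
   using order_trans[OF norm_le_l1_cart, of "?DF (?a mu)" 2] b[OF that] by (simp add: UNIV_bool)
 qed
 then show ?thesis by auto
qed

text \<open>Smooth steps of integrals of smooth functions make these integrals measurable for the
  approximable sets. They determine all evaluations, and evaluations generate the Borel sets of
  \<open>P2\<close>.\<close>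

lemma smooth_class_approx:
 assumes M: "prob_space M" "sets M = sets (P2_borel :: (real^'d) measure measure)"
 shows "approx_class M (smooth_class :: ((real^'d) measure => real) set)"
  "S : sets M ==> approx_class.approx M smooth_class S"
proof -
 interpret prob_space M by fact
 have sp: "space M = P2" using sets_eq_imp_space_eq[OF M(2)] by simp
 show ac: "approx_class M (smooth_class :: ((real^'d) measure => real) set)"
 proof
  fix a :: "(real^'d) measure => real" assume a: "a : smooth_class"
  then obtain v where v: "smooth_P2 a v" by (auto simp: smooth_class_def)
  show "a : bm M" using measurable_P2_borel[OF smooth_P2D(1)[OF v]] measurable_cong_sets[OF M(2) refl] by auto
  show "0 <= a x & a x <= 1" if "x : space M" for x using a that sp by (auto simp: smooth_class_def)
  have "((%t. 1 - t) has_real_derivative -1) (at t)" for t :: real by (auto intro!: derivative_eq_intros)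
  from smooth_P2_real_compose[OF v this, of 1]
  show "(%x. 1 - a x) : smooth_class" using a by (auto simp: smooth_class_def)
  fix b :: "(real^'d) measure => real" assume b: "b : smooth_class"
  then obtain w where w: "smooth_P2 b w" by (auto simp: smooth_class_def)
  show "(%x. a x * b x) : smooth_class"
   using smooth_P2_mult[OF v w] a b by (auto simp: smooth_class_def mult_le_one)
 next
  have "smooth_fun (%x :: real^'d. 0) (%x. 0) 0 0" by (simp add: smooth_fun_def)
  from smooth_P2_integral[OF this] have z: "smooth_P2 (%mu :: (real^'d) measure. 0) (%mu x. 0)" by simp
  have "((%t. t + 1) has_real_derivative 1) (at t)" for t :: real by (auto intro!: derivative_eq_intros)
  from smooth_P2_real_compose[OF z this, of 1]
  show "(%x. 1) : (smooth_class :: ((real^'d) measure => real) set)" by (auto simp: smooth_class_def)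
 qed
 interpret approx_class M "smooth_class :: ((real^'d) measure => real) set" by (rule ac)
 have "sets (P2_borel :: (real^'d) measure measure) \<subseteq> sets approx_algebra"
 proof (rule P2_borel_subset)
  show s: "space approx_algebra = (P2 :: (real^'d) measure set)" by (simp add: space_approx_algebra sp)
  show "(%mu. mu) : measurable approx_algebra (subprob_algebra (borel :: (real^'d) measure))"
  proof (rule measurable_subprob_of_smooth[OF s])
   fix \<phi> :: "real^'d => real" and D C L assume sf: "smooth_fun \<phi> D C L"
   define u where "u = (%mu. \<integral>x. \<phi> x \<partial>mu)"
   have u: "smooth_P2 u (%mu. D)" unfolding u_def by (rule smooth_P2_integral[OF sf])
   have "u : bm approx_algebra"
   proof (rule approx_measurableI)
    show "u : bm M" using measurable_P2_borel[OF smooth_P2D(1)[OF u]] measurable_cong_sets[OF M(2) refl] by auto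
    fix c :: real
    show "(%mu. step n (u mu - c)) : smooth_class" for n
    proof -
    have d: "((%t. step n (t - c)) has_real_derivative step' n (t - c)) (at t)" for t
    proof -
    have "((%t. t - c) has_real_derivative 1) (at t)" by (auto intro!: derivative_eq_intros)
    from DERIV_chain2[OF step_deriv this, of n] show ?thesis by simp
    qed
    have "continuous_on UNIV (%t. step' n (t - c))"
    by (rule lipschitz_continuous_vec[where L="(real n)^2"]) (use step'_lipschitz[of n "_ - c" "_ - c"] in simp)
    from smooth_P2_real_compose[OF u d this step'_bound] show ?thesis
    using step_bounds by (auto simp: smooth_class_def)
    qed
    show "(%n. step n (u mu - c)) ~~> indicator {c<..} (u mu)" for mu
    using step_tendsto[of "u mu - c"] by (simp add: indicator_def)
   qed
   then show "(%mu. \<integral>x. \<phi> x \<partial>mu) : bm approx_algebra" by (simp add: u_def)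
  qed
 qed
 then show "S : sets M ==> approx S" using M(2) by (auto simp: sets_approx_algebra)
qed

section \<open>Test functions on the tangent space\<close>

context gaussian_space
begin

section \<open>Calculus of derivatives along a direction\<close>

lemma deriv_along_measurable:
 assumes "deriv_along h P P'" shows "P : bm TB" "P' : bm TB"
 using assms by (auto simp: deriv_along_def)

lemma deriv_along_D:
 assumes "deriv_along h P P'" "f : T"
 shows "((%s. P (%x. f x + s *\<^sub>R h x)) has_real_derivative P' (%x. f x + t *\<^sub>R h x)) (at t)"
  "continuous_on UNIV (%t. P' (%x. f x + t *\<^sub>R h x))" "continuous_on UNIV (%t. P (%x. f x + t *\<^sub>R h x))"
proof -
 let ?a = "%t. %x. f x + t *\<^sub>R h x"
 show d: "((%s. P (%x. f x + s *\<^sub>R h x)) has_real_derivative P' (?a t)) (at t)" for t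
  using assms by (auto simp: deriv_along_def)
 show "continuous_on UNIV (%t. P' (?a t))" using assms by (auto simp: deriv_along_def)
 show "continuous_on UNIV (%t. P (?a t))"
  using d by (meson DERIV_isCont continuous_at_imp_continuous_on)
qed

lemma deriv_alongI:
 assumes "P : bm TB" "P' : bm TB"
  "!!f t. f : T ==> ((%s. P (%x. f x + s *\<^sub>R h x)) has_real_derivative P' (%x. f x + t *\<^sub>R h x)) (at t)"
  "!!f. f : T ==> continuous_on UNIV (%t. P' (%x. f x + t *\<^sub>R h x))"
 shows "deriv_along h P P'"
 using assms by (simp add: deriv_along_def)

lemma deriv_along_mult:
 assumes P: "deriv_along h P P'" and R: "deriv_along h R R'"
 shows "deriv_along h (%f. P f * R f) (%f. P' f * R f + P f * R' f)"
proof (rule deriv_alongI)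
 note [measurable] = deriv_along_measurable[OF P] deriv_along_measurable[OF R]
 show "(%f. P f * R f) : bm TB" "(%f. P' f * R f + P f * R' f) : bm TB" by measurable
 fix f t assume f: "f : T"
 let ?a = "%f t. %x. f x + t *\<^sub>R h x"
 show "((%s. P (%x. f x + s *\<^sub>R h x) * R (%x. f x + s *\<^sub>R h x)) has_real_derivative
   P' (?a f t) * R (?a f t) + P (?a f t) * R' (?a f t)) (at t)"
  using DERIV_mult[OF deriv_along_D(1)[OF P f] deriv_along_D(1)[OF R f]] by (simp add: mult.commute add.commute)
next
 fix f assume f: "f : T"
 let ?a = "%f t. %x. f x + t *\<^sub>R h x"
 show "continuous_on UNIV (%t. P' (?a f t) * R (?a f t) + P (?a f t) * R' (?a f t))"
  by (intro continuous_intros deriv_along_D[OF P f] deriv_along_D[OF R f])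
qed

lemma deriv_along_add:
 assumes P: "deriv_along h P P'" and R: "deriv_along h R R'"
 shows "deriv_along h (%f. P f + R f) (%f. P' f + R' f)"
proof (rule deriv_alongI)
 note [measurable] = deriv_along_measurable[OF P] deriv_along_measurable[OF R]
 show "(%f. P f + R f) : bm TB" "(%f. P' f + R' f) : bm TB" by measurable
qed (intro continuous_intros derivative_intros deriv_along_D[OF P] deriv_along_D[OF R]; assumption)+

lemma deriv_along_sum:
 assumes "!!i. i : I ==> deriv_along h (P i) (P' i)"
 shows "deriv_along h (%f. \<Sum>i\<in>I. P i f) (%f. \<Sum>i\<in>I. P' i f)"
 using assms
proof (induction I rule: infinite_finite_induct)
 case (insert i I)
 then show ?case using deriv_along_add[of h "P i" "P' i" "%f. \<Sum>i\<in>I. P i f" "%f. \<Sum>i\<in>I. P' i f"] by simp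
qed (simp_all add: deriv_along_def)

lemma deriv_along_const: "deriv_along h (%f. c) (%f. 0)"
 by (simp add: deriv_along_def)

lemma deriv_along_compose:
 assumes P: "deriv_along h P P'" and r: "!!t. (r has_real_derivative r' t) (at t)" "continuous_on UNIV r'"
 shows "deriv_along h (%f. r (P f)) (%f. r' (P f) * P' f)"
proof (rule deriv_alongI)
 note [measurable] = deriv_along_measurable[OF P]
 have "continuous_on UNIV r" using r(1) by (meson DERIV_isCont continuous_at_imp_continuous_on)
 note [measurable] = borel_measurable_continuous_onI[OF this] borel_measurable_continuous_onI[OF r(2)]
 show "(%f. r (P f)) : bm TB" "(%f. r' (P f) * P' f) : bm TB" by measurable
 fix f t assume f: "f : T"
 show "((%s. r (P (%x. f x + s *\<^sub>R h x))) has_real_derivative r' (P (%x. f x + t *\<^sub>R h x)) * P' (%x. f x + t *\<^sub>R h x)) (at t)"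
  by (rule DERIV_chain2[OF r(1) deriv_along_D(1)[OF P f]])
next
 fix f assume f: "f : T"
 show "continuous_on UNIV (%t. r' (P (%x. f x + t *\<^sub>R h x)) * P' (%x. f x + t *\<^sub>R h x))"
  by (intro continuous_on_mult deriv_along_D(2)[OF P f] continuous_on_compose2[OF r(2) deriv_along_D(3)[OF P f]]) simp
qed

lemma deriv_along_linear:
 assumes l: "l : T" and h: "h : T" shows "deriv_along h (%f. ip l f) (%f. ip l h)"
proof (rule deriv_alongI)
 fix f t assume f: "f : T"
 have "ip l (%x. f x + s *\<^sub>R h x) = ip l f + s * ip l h" for s
  using l h f by (simp add: ip_add_right T_scale ip_scale_right)
 then show "((%s. ip l (%x. f x + s *\<^sub>R h x)) has_real_derivative ip l h) (at t)"
  by (auto intro!: derivative_eq_intros)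
qed (use l in auto)

text \<open>Bounded derivatives along the directions \<open>B (g m)\<close> are what partial
  integration against a gradient uses. The bound may depend on \<open>m\<close>, since only finitely
  many directions occur at a time.\<close>

definition test :: "((real^'d => real^'d) => real) set" where
 "test = {q. (EX C. ALL f:T. abs (q f) <= C) & (ALL m. EX q' C. deriv_along (B (g m)) q q' & (ALL f:T. abs (q' f) <= C))}"

lemma testD:
 assumes "q : test"
 shows "q : bm TB" "EX C. ALL f:T. abs (q f) <= C" "EX q' C. deriv_along (B (g m)) q q' & (ALL f:T. abs (q' f) <= C)"
 using assms deriv_along_measurable unfolding test_def by blast+

lemma test_mult: assumes "q : test" "r : test" shows "(%f. q f * r f) : test"
 unfolding test_def
proof (intro CollectI conjI allI)
 obtain C D where C: "!!f. f : T ==> abs (q f) <= C" and D: "!!f. f : T ==> abs (r f) <= D"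
  using testD(2)[OF assms(1)] testD(2)[OF assms(2)] by blast
 have C0: "0 <= C" "0 <= D" using C[OF T_zero] D[OF T_zero] abs_ge_zero order_trans by blast+
 show "EX C. ALL f:T. abs (q f * r f) <= C" using C D C0 by (intro exI[of _ "C * D"]) (auto simp: abs_mult intro: mult_mono)
 fix m
 obtain q' r' C' D' where q': "deriv_along (B (g m)) q q'" "!!f. f : T ==> abs (q' f) <= C'"
  and r': "deriv_along (B (g m)) r r'" "!!f. f : T ==> abs (r' f) <= D'"
  using testD(3)[OF assms(1), of m] testD(3)[OF assms(2), of m] by blast
 have "abs (q' f * r f + q f * r' f) <= C' * D + C * D'" if "f : T" for f
 proof -
  have "abs (q' f) * abs (r f) <= C' * D" "abs (q f) * abs (r' f) <= C * D'"
   using C[OF that] D[OF that] q'(2)[OF that] r'(2)[OF that] C0 by (auto intro!: mult_mono intro: order_trans[OF abs_ge_zero])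
  then show ?thesis using abs_triangle_ineq[of "q' f * r f" "q f * r' f"] by (simp add: abs_mult)
 qed
 then show "EX q' C. deriv_along (B (g m)) (%f. q f * r f) q' & (ALL f:T. abs (q' f) <= C)"
  using deriv_along_mult[OF q'(1) r'(1)] by blast
qed

lemma test_add: assumes "q : test" "r : test" shows "(%f. q f + r f) : test"
 unfolding test_def
proof (intro CollectI conjI allI)
 obtain C D where C: "!!f. f : T ==> abs (q f) <= C" and D: "!!f. f : T ==> abs (r f) <= D"
  using testD(2)[OF assms(1)] testD(2)[OF assms(2)] by blast
 have "abs (q f + r f) <= C + D" if "f : T" for f using C[OF that] D[OF that] by linarith
 then show "EX C. ALL f:T. abs (q f + r f) <= C" by blast
 fix m
 obtain q' r' C' D' where q': "deriv_along (B (g m)) q q'" "!!f. f : T ==> abs (q' f) <= C'"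
  and r': "deriv_along (B (g m)) r r'" "!!f. f : T ==> abs (r' f) <= D'"
  using testD(3)[OF assms(1), of m] testD(3)[OF assms(2), of m] by blast
 have "abs (q' f + r' f) <= C' + D'" if "f : T" for f using q'(2)[OF that] r'(2)[OF that] by linarith
 then show "EX q' C. deriv_along (B (g m)) (%f. q f + r f) q' & (ALL f:T. abs (q' f) <= C)"
  using deriv_along_add[OF q'(1) r'(1)] by blast
qed

lemma test_const: "(%f. c) : test"
 unfolding test_def
proof (intro CollectI conjI allI)
 show "EX q' C. deriv_along (B (g m)) (%f. c) q' & (ALL f:T. abs (q' f) <= C)" for m
  by (intro exI[of _ "%f. 0"] exI[of _ 0]) (simp add: deriv_along_const)
qed blast

lemma test_sum: "(!!i. i : I ==> q i : test) ==> (%f. \<Sum>i\<in>I. q i f) : test"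
 by (induction I rule: infinite_finite_induct) (auto intro: test_add test_const)

lemma test_step: assumes l: "l : T" shows "(%f. step n (ip l f - c)) : test"
 unfolding test_def
proof (intro CollectI conjI allI)
 show "EX C. ALL f:T. abs (step n (ip l f - c)) <= C" using step_bounds by (intro exI[of _ 1]) simp
 fix m
 have h: "B (g m) : T" by (simp add: B_T)
 have d: "deriv_along (B (g m)) (%f. ip l f + (- c)) (%f. ip l (B (g m)) + 0)"
  by (rule deriv_along_add[OF deriv_along_linear[OF l h] deriv_along_const])
 have c: "continuous_on UNIV (step' n)" by (rule lipschitz_continuous_vec[where L="(real n)^2"]) (use step'_lipschitz in simp)
 have "abs (step' n (ip l f - c) * ip l (B (g m))) <= real n * abs (ip l (B (g m)))" for f
  unfolding abs_mult by (intro mult_right_mono step'_bound) simp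
 then show "EX q' C. deriv_along (B (g m)) (%f. step n (ip l f - c)) q' & (ALL f:T. abs (q' f) <= C)"
  using deriv_along_compose[OF d step_deriv c] by (intro exI[of _ "%f. step' n (ip l f - c) * ip l (B (g m))"]) auto
qed

definition test01 :: "((real^'d => real^'d) => real) set" where
 "test01 = {q : test. ALL f:T. 0 <= q f & q f <= 1}"

lemma test_approx: "approx_class G test01" "S : sets G ==> approx_class.approx G test01 S"
proof -
 show ac: "approx_class G test01"
 proof
  fix a assume a: "a : test01"
  show "a : bm G" using testD(1) a measurable_cong_sets[OF sets_G refl] by (auto simp: test01_def)
  show "0 <= a x & a x <= 1" if "x : space G" for x using a that by (auto simp: test01_def)
  have "(%f. 1 + (-1) * a f) : test" using a by (intro test_add test_mult test_const) (auto simp: test01_def)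
  then show "(%x. 1 - a x) : test01" using a by (auto simp: test01_def)
  fix b assume b: "b : test01"
  show "(%x. a x * b x) : test01" using a b by (auto simp: test01_def mult_le_one intro: test_mult)
 qed (simp add: test01_def test_const)
 interpret approx_class G test01 by (rule ac)
 have "sets TB \<subseteq> sets approx_algebra"
 proof (rule tangent_borel_subset)
  show "space approx_algebra = T" by (simp add: space_approx_algebra)
  fix n
  show "(%f. ip f (g n)) : bm approx_algebra"
  proof (rule approx_measurableI)
   show "(%f. ip f (g n)) : bm G" by measurable
   show "(%f. step k (ip f (g n) - c)) : test01" for c k
    using test_step[OF g_T[of n], of k c] step_bounds by (simp add: test01_def ip_sym[of _ "g n"])
   show "(%k. step k (ip f (g n) - c)) ~~> indicator {c<..} (ip f (g n))" for c f
    using step_tendsto[of "ip f (g n) - c"] by (simp add: indicator_def)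
  qed
 qed
 then show "S : sets G ==> approx S" using sets_G by (auto simp: sets_approx_algebra)
qed

text \<open>Simple functions approximate \<open>q\<close> in L2, and the indicators of their
  finitely many level sets are then replaced by test functions.\<close>

lemma test_dense:
 assumes q: "q : bm TB" and C: "!!f. f : T ==> abs (q f) <= C" and eps: "eps > 0"
 shows "EX r:test. (LINT f|G. (q f - r f)^2) < eps"
proof -
 interpret approx_class G test01 by (rule test_approx(1))
 have qG: "q : bm G" using q by measurable
 from borel_measurable_implies_sequence_metric[OF qG, of 0] obtain s where
  s0: "ALL i. simple_function G (s i)" "ALL f:space G. (%i. s i f) ~~> q f" "ALL i. ALL f:space G. dist (s i f) 0 <= 2 * dist (q f) 0"
  by (elim exE conjE) blast
 have s: "!!i. simple_function G (s i)" "!!f. f : T ==> (%i. s i f) ~~> q f" "!!i f. f : T ==> abs (s i f) <= 2 * abs (q f)"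
  using s0 by (simp_all add: dist_real_def)
 have sm: "s i : bm G" for i using s(1) by (rule borel_measurable_simple_function)
 have C0: "C >= 0" using C[OF T_zero] by (rule order_trans[OF abs_ge_zero])
 have dom: "(q f - s i f)^2 <= 9 * C^2" if "f : T" for f i
 proof -
  have "abs (q f - s i f) <= 3 * C" using C[OF that] s(3)[OF that, of i] by linarith
  then have "(q f - s i f)^2 <= (3 * C)^2" by (metis abs_ge_zero power2_abs power_mono)
  then show ?thesis by (simp add: power_mult_distrib)
 qed
 have "(%i. LINT f|G. (q f - s i f)^2) ~~> (LINT f|G. 0)"
 proof (rule integral_dominated_convergence[where w="%_. 9 * C^2"])
  show "AE f in G. (%i. (q f - s i f)^2) ~~> 0"
  proof (rule AE_I2)
   fix f assume "f : space G"
   then have "(%i. (q f - s i f)^2) ~~> (q f - q f)\<^sup>2" by (intro tendsto_intros s) simp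
   then show "(%i. (q f - s i f)^2) ~~> 0" by simp
  qed
  show "AE f in G. norm ((q f - s i f)^2) <= 9 * C^2" for i using dom by (auto intro!: AE_I2)
 qed (use qG sm in auto)
 from LIMSEQ_D[OF this, of "eps / 4"] eps obtain i where "norm ((LINT f|G. (q f - s i f)^2) - (LINT f|G. 0)) < eps / 4" by auto
 then have i: "(LINT f|G. (q f - s i f)^2) < eps / 4" by simp
 define Y where "Y = s i ` T"
 have finY: "finite Y" using s(1)[of i] by (simp add: Y_def simple_function_def)
 define n where "n = real (card Y) + 1"
 \<comment> \<open>By the finite Cauchy-Schwarz inequality the squared error is at most card Y times
   the sum of y^2 times the squared errors of the indicators, so each indicator may err by eps / (4
   n Z). The added 1 in \<open>n\<close> and \<open>Z\<close> excludes division by zero.\<close>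
 define Z where "Z = (\<Sum>y\<in>Y. y^2) + 1"
 have Z: "Z > 0" unfolding Z_def by (intro add_nonneg_pos sum_nonneg) auto
 have nZ: "n > 0" by (simp add: n_def)
 define J where "J y f = (indicator (s i -` {y} \<inter> T) f :: real)" for y f
 have "EX a:test01. (LINT f|G. (a f - J y f)^2) < eps / (4 * n * Z)" if "y : Y" for y
 proof -
  have "s i -` {y} \<inter> T : sets G" using measurable_sets[OF sm, of "{y}" i] by simp
  from test_approx(2)[OF this] show ?thesis unfolding approx_def J_def using eps nZ Z by auto
 qed
 then have "ALL y:Y. EX a. a : test01 & (LINT f|G. (a f - J y f)^2) < eps / (4 * n * Z)" by blast
 from bchoice[OF this] obtain a where a: "!!y. y : Y ==> a y : test01" "!!y. y : Y ==> (LINT f|G. (a y f - J y f)^2) < eps / (4 * n * Z)"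
  by blast
 define r where "r f = (\<Sum>y\<in>Y. y * a y f)" for f
 have r: "r : test" unfolding r_def using a(1) by (intro test_sum test_mult test_const) (auto simp: test01_def)
 have sf: "s i f = (\<Sum>y\<in>Y. y * J y f)" if "f : T" for f
 proof -
  have "(\<Sum>y\<in>Y. y * J y f) = (\<Sum>y\<in>Y. if y = s i f then y else 0)"
   using that by (intro sum.cong) (auto simp: J_def indicator_def)
  also have "... = s i f" using finY that by (auto simp: Y_def)
  finally show ?thesis by simp
 qed
 have ai: "integrable G (%f. (a y f - J y f)^2)" if "y : Y" for y
  using approx_integrable[OF a(1)[OF that], of "s i -` {y} \<inter> T"] measurable_sets[OF sm, of "{y}" i] by (simp add: J_def)
 have rG: "r : bm G" using testD(1)[OF r] by measurable
 obtain Cr where Cr: "!!f. f : T ==> abs (r f) <= Cr" using testD(2)[OF r] by auto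
 have bi: "integrable G (%f. (b f)^2)" if "b : bm G" "!!f. f : T ==> abs (b f) <= D" for b and D :: real
 proof (rule G.integrable_const_bound[where B="D^2"])
  show "AE f in G. norm ((b f)^2) <= D^2"
  proof (rule AE_I2)
   fix f assume "f : space G"
   then have "abs (b f)^2 <= D^2" using that(2)[of f] by (intro power_mono) auto
   then show "norm ((b f)^2) <= D^2" by simp
  qed
 qed (use that(1) in measurable)
 have i1: "integrable G (%f. (q f - s i f)^2)"
 proof (rule bi)
  show "abs (q f - s i f) <= 3 * C" if "f : T" for f using C[OF that] s(3)[OF that, of i] by linarith
 qed (use qG sm in measurable)
 have i2: "integrable G (%f. (s i f - r f)^2)"
 proof (rule bi)
  show "abs (s i f - r f) <= 2 * C + Cr" if "f : T" for f using C[OF that] s(3)[OF that, of i] Cr[OF that] by linarith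
 qed (use rG sm in measurable)
 have i3: "integrable G (%f. (q f - r f)^2)"
 proof (rule bi)
  show "abs (q f - r f) <= C + Cr" if "f : T" for f using C[OF that] Cr[OF that] by linarith
 qed (use rG qG in measurable)
 let ?a = "%Y J f a. \<Sum>y\<in>Y. (y * (J y f - a y f))^2"
 have "(LINT f|G. (s i f - r f)^2) <= (LINT f|G. (?a Y J f a) * real (card Y))"
 proof (rule integral_mono[OF i2])
  show "integrable G (%f. (?a Y J f a) * real (card Y))"
   unfolding power_mult_distrib power2_commute[of "J _ _"] using ai by (intro integrable_mult_left Bochner_Integration.integrable_sum integrable_mult_right)
  fix f assume "f : space G"
  then have "s i f - r f = (\<Sum>y\<in>Y. y * (J y f - a y f))"
   unfolding r_def using sf[of f] by (simp only: space_G sum_subtractf right_diff_distrib)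
  then show "(s i f - r f)^2 <= (?a Y J f a) * real (card Y)"
   using sum_squared_le_sum_of_squares[of "%y. y * (J y f - a y f)" Y] finY by simp
 qed
 also have "... = (\<Sum>y\<in>Y. y^2 * (LINT f|G. (a y f - J y f)^2)) * real (card Y)"
  unfolding power_mult_distrib power2_commute[of "J _ _"] using ai by simp
 also have "... <= (\<Sum>y\<in>Y. y^2 * (eps / (4 * n * Z))) * real (card Y)"
  using a(2) by (intro mult_right_mono sum_mono mult_left_mono) (auto intro: less_imp_le)
 also have "... <= Z * (eps / (4 * n * Z)) * n"
  unfolding sum_distrib_right[symmetric] using eps nZ Z by (intro mult_mono) (auto simp: Z_def n_def intro!: mult_nonneg_nonneg sum_nonneg)
 also have "... = eps / 4" using nZ Z by (simp add: field_simps)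
 finally have sr: "(LINT f|G. (s i f - r f)^2) <= eps / 4" .
 have "(LINT f|G. (q f - r f)^2) <= (LINT f|G. 2 * (q f - s i f)^2 + 2 * (s i f - r f)^2)"
 proof (rule integral_mono[OF i3])
  fix f
  have "0 <= ((q f - s i f) - (s i f - r f))^2" by simp
  then show "(q f - r f)^2 <= 2 * (q f - s i f)^2 + 2 * (s i f - r f)^2" by (simp add: power2_eq_square algebra_simps)
 qed (use i1 i2 in simp)
 also have "... < eps" using i1 i2 i sr by simp
 finally show ?thesis using r by blast
qed

section \<open>Square integrable fields\<close>

text \<open>Measurability is asked of pairings with fixed vectors; through the countable basis this
  makes norms and \<open>bq\<close> pairings measurable.\<close>

definition field :: "((real^'d => real^'d) => real^'d => real^'d) => bool" where
 "field X \<longleftrightarrow> (ALL f:T. X f : T) & (ALL k:T. (%f. ip (X f) k) : bm TB) & integrable G (%f. (nm (X f))^2)"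

text \<open>The form of \<open>pre_form\<close> extended from gradients to arbitrary fields, so that
  limits of gradients can be treated as fields themselves.\<close>

definition Q :: "((real^'d => real^'d) => real^'d => real^'d) => ((real^'d => real^'d) => real^'d => real^'d) => real" where
 "Q X Y = (LINT f|G. bq (X f) (Y f))"

lemma field_T: "field X ==> f : T ==> X f : T" by (simp add: field_def)

lemma nm2_measurable:
 assumes "!!f. f : T ==> X f : T" "!!k. k : T ==> (%f. ip (X f) k) : bm TB"
 shows "(%f. (nm (X f))^2) : bm TB"
proof -
 have "(%f. \<Sum>n. ip (X f) (g n) * ip (X f) (g n)) : bm TB" using assms(2)[OF g_T] by measurable
 then show ?thesis
  by (subst measurable_cong[where g="%f. \<Sum>n. ip (X f) (g n) * ip (X f) (g n)"])
   (use parseval assms(1) in \<open>auto simp: nm_power2 sums_iff\<close>)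
qed

lemma fieldI:
 assumes "!!f. f : T ==> X f : T" "!!k. k : T ==> (%f. ip (X f) k) : bm TB"
  and b: "!!f. f : T ==> nm (X f) <= C * (1 + nm f)"
 shows "field X"
 unfolding field_def
proof (intro conjI ballI assms(1,2))
 show "integrable G (%f. (nm (X f))^2)"
 proof (rule growth_integrable[OF nm2_measurable[OF assms(1,2)]])
  fix f assume f: "f : T"
  have "(nm (X f))^2 <= (C * (1 + nm f))^2" by (rule power_mono[OF b[OF f]]) simp
  also have "... = C^2 * (1 + nm f)^2" by (simp add: power_mult_distrib)
  also have "... <= C^2 * (1 + nm f)^4" by (intro mult_left_mono power_increasing) auto
  finally show "abs ((nm (X f))\<^sup>2) <= C^2 * (1 + nm f) ^ 4" by simp
 qed
qed

text \<open>Measurability comes from the Parseval series of \<open>bq\<close>, in which symmetry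
  moves \<open>B\<close> onto the fixed basis vectors.\<close>

lemma bq_field:
 assumes X: "field X" and Y: "field Y"
 shows "(%f. bq (X f) (Y f)) : bm TB" "integrable G (%f. bq (X f) (Y f))"
proof -
 let ?b = "%f. bq (X f) (Y f)"
 have "(%f. \<Sum>n. ip (X f) (g n) * ip (Y f) (B (g n))) : bm TB"
  by (intro borel_measurable_suminf borel_measurable_times) (use X Y B_T[OF g_T] g_T in \<open>simp_all add: field_def\<close>)
 also have "?this \<longleftrightarrow> ?b : bm TB"
 proof (rule measurable_cong)
  fix f assume "f : space TB"
  then have T: "X f : T" "Y f : T" using X Y by (auto simp: field_def)
  have "ip (Y f) (B (g n)) = ip (B (Y f)) (g n)" for n
   using bq_sym[OF T(2) g_T[of n]] unfolding bq_def by (simp add: ip_sym)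
  then show "(\<Sum>n. ip (X f) (g n) * ip (Y f) (B (g n))) = bq (X f) (Y f)"
   using parseval[OF T(1) B_T[OF T(2)]] by (simp add: bq_def sums_iff)
 qed
 finally show m: "?b : bm TB" .
 let ?a = "%f. (nm (X f))^2 + (nm (Y f))^2"
 show "integrable G ?b"
 proof (rule Bochner_Integration.integrable_bound)
  show "integrable G (%f. K * (?a f))" using X Y by (simp add: field_def)
  show "AE f in G. norm (bq (X f) (Y f)) <= norm (K * (?a f))"
  proof (rule AE_I2)
   fix f assume "f : space G"
   then have T: "X f : T" "Y f : T" using X Y by (auto simp: field_def)
   have "nm (X f) * nm (Y f) <= (nm (X f))^2 + (nm (Y f))^2"
    using sum_squares_bound[of "nm (X f)" "nm (Y f)"] mult_nonneg_nonneg[OF nm_nonneg[of "X f"] nm_nonneg[of "Y f"]] by linarith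
   then have "K * (nm (X f) * nm (Y f)) <= K * (?a f)" using K_nonneg by (rule mult_left_mono)
   then have "abs (bq (X f) (Y f)) <= K * (?a f)" using bq_bound[OF T] by (simp add: mult.assoc)
   then show "norm (bq (X f) (Y f)) <= norm (K * (?a f))" by simp
  qed
 qed (use m in measurable)
qed

lemma field_scale: assumes "field X" shows "field (%f x. c *\<^sub>R X f x)"
 using assms unfolding field_def by (auto simp: T_scale ip_scale_left nm_scale power_mult_distrib)

lemma field_add: assumes X: "field X" and Y: "field Y" shows "field (%f x. X f x + Y f x)"
proof -
 let ?a = "%f. %x. X f x + Y f x"
 have T: "(?a f) : T" if "f : T" for f using X Y that by (auto simp: field_def intro: T_add)
 have m: "(%f. ip (?a f) k) : bm TB" if k: "k : T" for k
 proof (subst measurable_cong[where g="%f. ip (X f) k + ip (Y f) k"])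
  show "ip (?a f) k = ip (X f) k + ip (Y f) k" if "f : space TB" for f
   using X Y that k by (auto simp: field_def ip_add_left)
  show "(%f. ip (X f) k + ip (Y f) k) : bm TB"
   by (intro borel_measurable_add) (use X Y k in \<open>simp_all add: field_def\<close>)
 qed
 have "integrable G (%f. (nm (?a f))^2)"
 proof (rule Bochner_Integration.integrable_bound)
  show "integrable G (%f. 2 * (nm (X f))^2 + 2 * (nm (Y f))^2)" using X Y by (simp add: field_def)
  show "(%f. (nm (?a f))^2) : bm G" using nm2_measurable[OF T m] by measurable
  show "AE f in G. norm ((nm (?a f))^2) <= norm (2 * (nm (X f))^2 + 2 * (nm (Y f))^2)"
  proof (rule AE_I2)
   fix f assume "f : space G"
   then have "(nm (?a f))^2 <= (nm (X f) + nm (Y f))^2"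
    using X Y by (intro power_mono nm_triangle) (auto simp: field_def)
   also have "... <= 2 * (nm (X f))^2 + 2 * (nm (Y f))^2"
    using sum_squares_bound[of "nm (X f)" "nm (Y f)"] by (simp add: power2_sum)
   finally show "norm ((nm (?a f))^2) <= norm (2 * (nm (X f))^2 + 2 * (nm (Y f))^2)" by simp
  qed
 qed
 then show ?thesis using T m by (simp add: field_def)
qed

lemma field_diff: assumes "field X" "field Y" shows "field (%f x. X f x - Y f x)"
 using field_add[OF assms(1) field_scale[OF assms(2), of "-1"]] by simp

lemma Q_sym: assumes "field X" "field Y" shows "Q X Y = Q Y X"
 unfolding Q_def using assms by (intro Bochner_Integration.integral_cong refl) (auto simp: field_def intro: bq_sym)

lemma Q_add_left: assumes "field X" "field X'" "field Y" shows "Q (%f x. X f x + X' f x) Y = Q X Y + Q X' Y"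
proof -
 have "Q (%f x. X f x + X' f x) Y = (LINT f|G. bq (X f) (Y f) + bq (X' f) (Y f))"
  unfolding Q_def using assms by (intro Bochner_Integration.integral_cong refl bq_add_left) (auto simp: field_def)
 then show ?thesis using bq_field assms by (simp add: Q_def)
qed

lemma Q_scale_left: "Q (%f x. c *\<^sub>R X f x) Y = c * Q X Y"
 by (simp add: Q_def bq_scale_left)

lemma Q_diff_left: assumes "field X" "field X'" "field Y" shows "Q (%f x. X f x - X' f x) Y = Q X Y - Q X' Y"
 using Q_add_left[OF assms(1) field_scale[OF assms(2), of "-1"] assms(3)] Q_scale_left[of "-1" X' Y] by simp

lemma Q_diff_right: assumes "field X" "field X'" "field Y" shows "Q Y (%f x. X f x - X' f x) = Q Y X - Q Y X'"
 using assms by (simp add: Q_sym[of Y] field_diff Q_diff_left)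

lemma Q_nonneg: "field X ==> 0 <= Q X X"
 unfolding Q_def by (intro Bochner_Integration.integral_nonneg bq_nonneg) (auto simp: field_def)

lemma Q_cauchy_schwarz: assumes X: "field X" and Y: "field Y" shows "abs (Q X Y) <= sqrt (Q X X) * sqrt (Q Y Y)"
proof -
 let ?a = "%t. %f x. X f x + t *\<^sub>R Y f x"
 have "(Q X Y)^2 <= Q X X * Q Y Y"
 proof (rule discriminant_bound)
  fix t
  have tY: "field (%f x. t *\<^sub>R Y f x)" by (rule field_scale[OF Y])
  have s: "field (?a t)" by (rule field_add[OF X tY])
  have "Q (?a t) (?a t) =
   Q (?a t) X + t * Q (?a t) Y"
   unfolding Q_add_left[OF X tY s] Q_scale_left Q_sym[OF X s] Q_sym[OF Y s] by simp
  also have "... = Q X X + 2 * t * Q X Y + t^2 * Q Y Y"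
   unfolding Q_add_left[OF X tY X] Q_add_left[OF X tY Y] Q_scale_left Q_sym[OF Y X] by (simp add: power2_eq_square algebra_simps)
  finally show "0 <= Q X X + 2 * t * Q X Y + t^2 * Q Y Y" using Q_nonneg[OF s] by simp
 qed
 then have "sqrt ((Q X Y)^2) <= sqrt (Q X X * Q Y Y)" by (rule real_sqrt_le_mono)
 then show ?thesis by (simp add: real_sqrt_mult)
qed

lemma Q_triangle: assumes X: "field X" and Y: "field Y" shows "sqrt (Q X X) <= sqrt (Q Y Y) + sqrt (Q (%f x. X f x - Y f x) (%f x. X f x - Y f x))"
proof -
 let ?D = "%f x. X f x - Y f x"
 have D: "field ?D" by (rule field_diff[OF X Y])
 have "Q X X = Q (%f x. Y f x + ?D f x) X" by simp
 also have "... = Q Y X + Q ?D X" by (rule Q_add_left[OF Y D X])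
 finally have e1: "Q X X = Q X Y + Q X ?D" using Q_sym[OF Y X] Q_sym[OF D X] by simp
 have "Q X X <= sqrt (Q X X) * (sqrt (Q Y Y) + sqrt (Q ?D ?D))"
  using e1 Q_cauchy_schwarz[OF X Y] Q_cauchy_schwarz[OF X D] by (simp add: distrib_left)
 moreover have "Q X X = sqrt (Q X X) * sqrt (Q X X)" using Q_nonneg[OF X] by simp
 ultimately have *: "sqrt (Q X X) * sqrt (Q X X) <= sqrt (Q X X) * (sqrt (Q Y Y) + sqrt (Q ?D ?D))" by simp
 show ?thesis
 proof (cases "Q X X = 0")
  case True
  then show ?thesis using Q_nonneg[OF Y] Q_nonneg[OF D] by simp
 next
  case False
  then have "sqrt (Q X X) > 0" using Q_nonneg[OF X] by simp
  then show ?thesis using * mult_le_cancel_left_pos by blast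
 qed
qed

lemma Q_bound: assumes X: "field X" shows "Q X X <= K * (LINT f|G. (nm (X f))^2)"
proof -
 have "Q X X <= (LINT f|G. K * (nm (X f))^2)"
  unfolding Q_def
 proof (rule integral_mono[OF bq_field(2)[OF X X]])
  show "bq (X f) (X f) <= K * (nm (X f))^2" if "f : space G" for f
   using bq_bound[of "X f" "X f"] X that by (auto simp: field_def power2_eq_square mult.assoc)
 qed (use X in \<open>simp add: field_def\<close>)
 then show ?thesis by simp
qed

subsection \<open>Closability\<close>

lemma lift_field:
 assumes v: "continuous_grad_version u v" and b: "!!mu x. mu : P2 ==> norm (v mu x) <= C"
 shows "field (lift v)" "!!f. f : T ==> nm (lift v f) <= abs C"
proof -
 show nb: "nm (lift v f) <= abs C" if "f : T" for f
 proof (rule nm_bounded)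
  show "lift v f : bm borel" using lift_T[OF v that] by (rule T_measurable)
  show "norm (lift v f x) <= abs C" for x
   unfolding lift_def comp_def by (rule order_trans[OF b[OF push_P2[OF that]] abs_ge_self])
 qed simp
 show "field (lift v)"
 proof (rule fieldI)
  show "lift v f : T" if "f : T" for f by (rule lift_T[OF v that])
  show "(%f. ip (lift v f) k) : bm TB" if "k : T" for k
   by (rule seqcont_measurable[OF seqcont_lift[OF v b that]])
  show "nm (lift v f) <= abs C * (1 + nm f)" if "f : T" for f
   using nb[OF that] mult_left_mono[of 1 "1 + nm f" "abs C"] by simp
 qed
qed

lemma deriv_along_lift:
 assumes u: "u : C1b_P2" and v: "continuous_grad_version u v" and b: "!!mu x. mu : P2 ==> norm (v mu x) <= C"
  and h: "h : T"
 shows "deriv_along h (%f. u (Psi f)) (%f. ip (lift v f) h)"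
proof (rule deriv_alongI)
 obtain v' where c: "P2_continuous u" using C1b_P2_D[OF u] by metis
 show "(%f. u (Psi f)) : bm TB" by (rule seqcont_measurable[OF P2_continuous_seqcont[OF c]])
 show "(%f. ip (lift v f) h) : bm TB" by (rule seqcont_measurable[OF seqcont_lift[OF v b h]])
 show "((%s. u (Psi (%x. f x + s *\<^sub>R h x))) has_real_derivative ip (lift v (%x. f x + t *\<^sub>R h x)) h) (at t)"
  if "f : T" for f t by (rule push_curve_derivative[OF u v b that h])
 show "continuous_on UNIV (%t. ip (lift v (%x. f x + t *\<^sub>R h x)) h)" if "f : T" for f
  by (rule seqcont_line[OF seqcont_lift[OF v b h] that h])
qed

lemma L2_product_bound:
 fixes p r :: "(real^'d => real^'d) => real"
 assumes p: "p : bm G" "integrable G (%f. (p f)^2)" and r: "r : bm G" "integrable G (%f. (r f)^2)"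
 shows "integrable G (%f. p f * r f)" "(LINT f|G. p f * r f)^2 <= (LINT f|G. (p f)^2) * (LINT f|G. (r f)^2)"
proof -
 show i: "integrable G (%f. p f * r f)"
 proof (rule Bochner_Integration.integrable_bound)
  show "integrable G (%f. (p f)^2 + (r f)^2)" using p r by simp
  show "AE f in G. norm (p f * r f) <= norm ((p f)^2 + (r f)^2)"
  proof (rule AE_I2)
   fix f
   have "2 * abs (p f) * abs (r f) <= (p f)^2 + (r f)^2" using sum_squares_bound[of "abs (p f)" "abs (r f)"] by simp
   moreover have "0 <= abs (p f) * abs (r f)" by simp
   ultimately show "norm (p f * r f) <= norm ((p f)^2 + (r f)^2)" unfolding real_norm_def abs_mult by linarith
  qed
 qed (use p r in measurable)
 let ?a = "LINT f|G. (p f)^2"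
 let ?b = "LINT f|G. (r f)^2"
 let ?c = "LINT f|G. p f * r f"
 show "?c\<^sup>2 <= ?a * ?b"
 proof (rule discriminant_bound)
  fix t
  have "?a + 2 * t * ?c + t^2 * ?b = (LINT f|G. (p f)^2 + 2 * t * (p f * r f) + t^2 * (r f)^2)"
   using p r i by simp
  also have "... = (LINT f|G. (p f + t * r f)^2)"
   by (intro Bochner_Integration.integral_cong refl) (simp add: power2_eq_square algebra_simps)
  finally show "0 <= ?a + 2 * t * ?c + t^2 * ?b" by simp
 qed
qed

text \<open>Against a field with finitely many smooth coordinates, the derivative of \<open>p\<close> can be moved away by
 partial integration.\<close>

lemma Q_test_field_tendsto:
 assumes d: "!!n m. deriv_along (B (g m)) (p n) (%f. ip (X n f) (B (g m)))"
  and pb: "!!n f. f : T ==> abs (p n f) <= Cp n"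
  and X: "!!n. field (X n)" and b: "!!n f. f : T ==> nm (X n f) <= C n"
  and p0: "(%n. LINT f|G. (p n f)^2) ~~> 0" and q: "q : test"
 shows "(%n. LINT f|G. q f * bq (X n f) (g m)) ~~> 0"
proof -
 have h: "B (g m) : T" by (simp add: B_T)
 obtain Cq where Cq: "!!f. f : T ==> abs (q f) <= Cq" using testD(2)[OF q] by auto
 obtain q' Cq' where q': "deriv_along (B (g m)) q q'" "!!f. f : T ==> abs (q' f) <= Cq'" using testD(3)[OF q, of m] by auto
 have Cq0: "0 <= Cq" "0 <= Cq'" using Cq[OF T_zero] q'(2)[OF T_zero] abs_ge_zero order_trans by blast+
 note [measurable] = deriv_along_measurable[OF q'(1)]
 \<comment> \<open>The adjoint of differentiation along \<open>B (g m)\<close> applied to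
   \<open>q\<close>. It is square integrable, so pairing with it vanishes together with the L2 norm
   of \<open>p n\<close>.\<close>
 define R where "R f = q f * ip (g m) f - q' f" for f
 have Rm[measurable]: "R : bm TB" unfolding R_def by measurable
 have Rb: "abs (R f) <= (Cq + Cq') * (1 + nm f)" if "f : T" for f
 proof -
  have "nm (g m) = 1" using g_ortho[of m m] by (simp add: l2_norm_def)
  then have "abs (q f) * abs (ip (g m) f) <= Cq * nm f" using Cq[OF that] ip_bound[OF g_T that, of m] Cq0 by (intro mult_mono) auto
  then have "abs (R f) <= Cq * nm f + Cq'" unfolding R_def using q'(2)[OF that] abs_triangle_ineq4[of "q f * ip (g m) f" "q' f"] by (simp add: abs_mult)
  also have "... <= (Cq + Cq') * (1 + nm f)" using Cq0 by (simp add: algebra_simps)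
  finally show ?thesis .
 qed
 have R2: "integrable G (%f. (R f)^2)"
 proof (rule growth_integrable)
  fix f assume f: "f : T"
  have "(R f)^2 <= ((Cq + Cq') * (1 + nm f))^2" using power_mono[OF Rb[OF f] abs_ge_zero, of 2] by simp
  also have "... <= (Cq + Cq')^2 * (1 + nm f)^4" unfolding power_mult_distrib by (intro mult_left_mono power_increasing) auto
  finally show "abs ((R f)\<^sup>2) <= (Cq + Cq')^2 * (1 + nm f)^4" by simp
 qed measurable
 let ?a = "%n R. LINT f|G. p n f * R f"
 let ?b = "%n m. LINT f|G. q f * bq (X n f) (g m)"
 have eq: "(?b n m) = (?a n R)"
  and pm: "(%f. p n f) : bm G" and p2: "integrable G (%f. (p n f)^2)" for n
 proof -
  have Pb: "abs (p n f) <= Cp n" if "f : T" for f by (rule pb[OF that])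
  have Cp0: "0 <= Cp n" using pb[OF T_zero] abs_ge_zero order_trans by blast
  note [measurable] = deriv_along_measurable[OF d[of m n]]
  show pm: "(%f. p n f) : bm G" by measurable
  show p2: "integrable G (%f. (p n f)^2)"
  proof (rule G.integrable_const_bound[where B="(Cp n)^2"])
   show "AE f in G. norm ((p n f)^2) <= (Cp n)^2"
   proof (rule AE_I2)
    fix f assume "f : space G"
    then have "abs (p n f)^2 <= (Cp n)^2" using Pb[of f] by (intro power_mono) auto
    then show "norm ((p n f)^2) <= (Cp n)^2" by simp
   qed
  qed measurable
  have lb: "abs (ip (X n f) (B (g m))) <= C n * nm (B (g m))" if "f : T" for f
   by (intro order_trans[OF ip_bound[OF field_T[OF X that] h]] mult_right_mono nm_nonneg b[OF that])
  have i1: "integrable G (%f. ip (X n f) (B (g m)) * q f)"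
  proof (rule G.integrable_const_bound[where B="(C n * nm (B (g m))) * Cq"])
   show "AE f in G. norm (ip (X n f) (B (g m)) * q f) <= (C n * nm (B (g m))) * Cq"
   proof (rule AE_I2)
    fix f assume "f : space G"
    then have f: "f : T" by simp
    show "norm (ip (X n f) (B (g m)) * q f) <= (C n * nm (B (g m))) * Cq"
    unfolding real_norm_def abs_mult
    by (rule mult_mono[OF lb[OF f] Cq[OF f] order_trans[OF abs_ge_zero lb[OF f]] abs_ge_zero])
   qed
  qed measurable
  have i2: "integrable G (%f. p n f * q' f)"
  proof (rule G.integrable_const_bound[where B="Cp n * Cq'"])
   show "AE f in G. norm (p n f * q' f) <= Cp n * Cq'"
    using Pb q'(2) Cp0 by (auto intro!: AE_I2 mult_mono simp: abs_mult)
  qed measurable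
  have i3: "integrable G (%f. p n f * q f * ip (g m) f)"
  proof (rule growth_integrable[where C="Cp n * Cq"])
   fix f assume f: "f : T"
   have "nm (g m) = 1" using g_ortho[of m m] by (simp add: l2_norm_def)
   then have "abs (ip (g m) f) <= (1 + nm f)^4" using ip_bound[OF g_T f, of m] self_le_power[of "1 + nm f" 4] by simp
   then have "abs (p n f) * abs (q f) * abs (ip (g m) f) <= Cp n * Cq * (1 + nm f)^4"
    using Pb[OF f] Cq[OF f] Cp0 Cq0 by (intro mult_mono) auto
   then show "abs (p n f * q f * ip (g m) f) <= Cp n * Cq * (1 + nm f)^4" by (simp add: abs_mult)
  qed measurable
  have "(LINT f|G. ip (X n f) (B (g m)) * q f + p n f * q' f) = (LINT f|G. p n f * q f * ip (g m) f)"
   by (rule integration_by_parts[OF g_T _ deriv_along_mult[OF d[of m n] q'(1)]]) (use i1 i2 i3 nondegenerate[of m] in \<open>auto simp: bq_def\<close>)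
  then have "(LINT f|G. ip (X n f) (B (g m)) * q f) = (LINT f|G. p n f * q f * ip (g m) f) - (LINT f|G. p n f * q' f)"
   using i1 i2 by simp
  also have "... = (?a n R)"
   unfolding R_def right_diff_distrib using i2 i3 by (simp add: mult.assoc)
  finally show "(?b n m) = (?a n R)"
   by (simp add: bq_def mult.commute)
 qed
 have RG: "R : bm G" by measurable
 let ?c = "%n. LINT f|G. (p n f)^2"
 let ?d = "%R. LINT f|G. (R f)^2"
 have "(%n. sqrt (?c n) * sqrt (?d R)) ~~> 0"
  using tendsto_real_sqrt[OF p0] by (intro tendsto_mult_left_zero) simp
 then show ?thesis
 proof (rule tendsto_by_bound[rotated])
  fix n
  have "sqrt ((?a n R)^2) <= sqrt ((?c n) * (?d R))"
   by (rule real_sqrt_le_mono[OF L2_product_bound(2)[OF pm p2 RG R2]])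
  then show "norm ((?b n m) - 0) <= sqrt (?c n) * sqrt (?d R)"
   unfolding eq by (simp add: real_sqrt_mult)
 qed
qed

text \<open>\<open>V\<close> is cut after finitely many basis coordinates and each coordinate is
  approximated by a test function; \<open>Q\<close> is at most \<open>K\<close> times the mean
  squared norm.\<close>

lemma test_field_approx:
 assumes V: "field V" and b: "!!f. f : T ==> nm (V f) <= C" and eps: "eps > 0"
 shows "EX N q. (ALL m. q m : test) & field (%f x. \<Sum>m<N. q m f *\<^sub>R g m x) \<and>
  Q (%f x. V f x - (\<Sum>m<N. q m f *\<^sub>R g m x)) (%f x. V f x - (\<Sum>m<N. q m f *\<^sub>R g m x)) < eps"
proof -
 \<comment> \<open>The mean squared error becomes at most 4 e: splitting a square gives a factor 2,
   and tail and coordinates contribute e each.\<close>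
 define e where "e = eps / (4 * (K + 1))"
 have e: "e > 0" using eps K_nonneg by (simp add: e_def)
 have C0: "C >= 0" using b[OF T_zero] nm_nonneg order_trans by blast
 have Vm: "(%f. ip (V f) k) : bm TB" if "k : T" for k using V that by (simp add: field_def)
 have VT: "V f : T" if "f : T" for f using V that by (simp add: field_def)
 let ?a = "%f N. %x. V f x - proj N (V f) x"
 have PT: "(?a f N) : T" if "f : T" for f N using VT[OF that] by (intro T_diff proj_T)
 have Pm: "(%f. (nm (?a f N))^2) : bm TB" for N
 proof (rule nm2_measurable[OF PT])
  fix k assume k: "k : T"
  show "(%f. ip (?a f N) k) : bm TB"
  proof (subst measurable_cong[where g="%f. ip (V f) k - (\<Sum>n<N. ip (V f) (g n) * ip k (g n))"])
   show "(%f. ip (V f) k - (\<Sum>n<N. ip (V f) (g n) * ip k (g n))) : bm TB"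
    using Vm[OF k] Vm[OF g_T] by measurable
  qed (use VT k in \<open>auto simp: ip_diff_left ip_proj_left\<close>)
 qed
 have Pb: "(nm (?a f N))^2 <= C^2" if "f : T" for f N
 proof -
  have "(nm (?a f N))^2 <= (nm (V f))^2"
   unfolding norm_tail[OF VT[OF that]] by (simp add: sum_nonneg)
  also have "... <= C^2" using b[OF that] by (simp add: power_mono)
  finally show ?thesis .
 qed
 let ?e = "%N. LINT f|G. (nm (?a f N))^2"
 have "(%N. LINT f|G. (nm (?a f N))^2) ~~> (LINT f|G. 0)"
 proof (rule integral_dominated_convergence[where w="%_. C^2"])
  show "AE f in G. (%N. (nm (?a f N))^2) ~~> 0"
   using tendsto_power[OF proj_tendsto[OF VT], of _ 2] by (auto intro!: AE_I2)
  show "AE f in G. norm ((nm (?a f N))^2) <= C^2" for N using Pb by (auto intro!: AE_I2)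
 qed (use Pm in auto)
 from LIMSEQ_D[OF this e] obtain N where "norm ((?e N) - (LINT f|G. 0)) < e" by blast
 then have N: "(?e N) < e" by simp
 let ?b = "%f m q. ip (V f) (g m) - q m f"
 let ?i = "%m q. LINT f|G. (?b f m q)^2"
 have "EX r:test. (LINT f|G. (ip (V f) (g m) - r f)^2) < e / (real N + 1)" for m
 proof (rule test_dense[OF Vm[OF g_T]])
  show "abs (ip (V f) (g m)) <= C" if "f : T" for f
  proof -
   have "nm (g m) = 1" using g_ortho[of m m] by (simp add: l2_norm_def)
   then show ?thesis using ip_bound[OF VT[OF that] g_T, of m] b[OF that] by simp
  qed
 qed (use e in simp)
 then have "ALL m. EX r. r : test & (LINT f|G. (ip (V f) (g m) - r f)^2) < e / (real N + 1)" by blast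
 from choice[OF this] obtain q where q: "!!m. q m : test" "!!m. (?i m q) < e / (real N + 1)" by blast
 define Y where "Y f x = (\<Sum>m<N. q m f *\<^sub>R g m x)" for f x
 have "ALL m. EX C. ALL f:T. abs (q m f) <= C" using testD(2)[OF q(1)] by blast
 from choice[OF this] obtain Cq where Cq: "!!m f. f : T ==> abs (q m f) <= Cq m" by blast
 have YT: "Y f : T" for f unfolding Y_def by (intro T_sum T_scale g_T)
 have Yip: "ip (Y f) k = (\<Sum>m<N. q m f * ip (g m) k)" if "k : T" for f k
  unfolding Y_def using that by (subst ip_sum_left) (auto intro: T_scale simp: ip_scale_left)
 let ?c = "%N f Y. %x. proj N (V f) x - Y f x"
 let ?h = "%N f q. \<Sum>m<N. (?b f m q)^2"
 have Ynm: "(nm (?c N f Y))^2 = (?h N f q)" if "f : T" for f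
 proof -
  have "(?c N f Y) = (%x. \<Sum>m<N. (?b f m q) *\<^sub>R g m x)"
   by (auto simp: proj_def Y_def sum_subtractf scaleR_diff_left)
  then have "(nm (?c N f Y))^2 = (\<Sum>m<N. (?b f m q) * (\<Sum>l<N. (ip (V f) (g l) - q l f) * ip (g m) (g l)))"
   unfolding nm_power2 by (simp add: ip_sum_left ip_sum_right T_sum T_scale ip_scale_left ip_scale_right)
  also have "... = (?h N f q)"
   by (intro sum.cong refl) (simp add: g_ortho power2_eq_square if_distrib sum.delta cong: if_cong)
  finally show ?thesis .
 qed
 have Yf: "field Y"
 proof (rule fieldI)
  show "(%f. ip (Y f) k) : bm TB" if "k : T" for k unfolding Yip[OF that] using testD(1)[OF q(1)] by measurable
  show "nm (Y f) <= (\<Sum>m<N. Cq m) * (1 + nm f)" if "f : T" for f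
  proof -
   have "nm (Y f) <= (\<Sum>m<N. Cq m)"
    unfolding Y_def
   proof (induction N)
    case (Suc N)
    have "nm (%x. \<Sum>m<Suc N. q m f *\<^sub>R g m x) <= nm (%x. \<Sum>m<N. q m f *\<^sub>R g m x) + nm (%x. q N f *\<^sub>R g N x)"
    by simp (intro nm_triangle T_sum T_scale g_T)
    moreover have "nm (%x. q N f *\<^sub>R g N x) <= Cq N"
    proof -
    have "nm (g N) = 1" using g_ortho[of N N] by (simp add: l2_norm_def)
    then show ?thesis unfolding nm_scale using Cq[OF that, of N] by simp
    qed
    ultimately show ?case using Suc by simp
   qed simp
   also have "... <= (\<Sum>m<N. Cq m) * (1 + nm f)"
    using mult_left_mono[of 1 "1 + nm f" "\<Sum>m<N. Cq m"] Cq[OF that] by (auto intro!: sum_nonneg intro: order_trans[OF abs_ge_zero])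
   finally show ?thesis .
  qed
 qed (rule YT)
 have D: "field (%f x. V f x - Y f x)" by (rule field_diff[OF V Yf])
 have qi: "integrable G (%f. (?b f m q)^2)" for m
 proof (rule G.integrable_const_bound[where B="(C + Cq m)^2"])
  show "AE f in G. norm ((?b f m q)^2) <= (C + Cq m)^2"
  proof (rule AE_I2)
   fix f assume "f : space G"
   then have f: "f : T" by simp
   have "nm (g m) = 1" using g_ortho[of m m] by (simp add: l2_norm_def)
   then have "abs (ip (V f) (g m) - q m f) <= C + Cq m" using ip_bound[OF VT[OF f] g_T, of m] b[OF f] Cq[OF f, of m] by simp
   then have "abs (ip (V f) (g m) - q m f)^2 <= (C + Cq m)^2" by (rule power_mono) simp
   then show "norm ((?b f m q)^2) <= (C + Cq m)^2" by simp
  qed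
  show "(%f. (?b f m q)^2) : bm G" using Vm[OF g_T[of m]] testD(1)[OF q(1)[of m]] by measurable
 qed
 have Pi: "integrable G (%f. (nm (?a f N))^2)"
  by (rule G.integrable_const_bound[where B="C^2"]) (use Pb Pm in \<open>auto intro!: AE_I2\<close>)
 let ?j = "%f Y. %x. V f x - Y f x"
 let ?d = "%Y. LINT f|G. (nm (?j f Y))^2"
 have "(?d Y) <= (LINT f|G. 2 * (nm (?a f N))^2 + 2 * (?h N f q))"
 proof (rule integral_mono)
  show "integrable G (%f. (nm (?j f Y))^2)" using D by (simp add: field_def)
  show "integrable G (%f. 2 * (nm (?a f N))^2 + 2 * (?h N f q))" using Pi qi by simp
  fix f assume "f : space G"
  then have f: "f : T" by simp
  have "nm (?j f Y) <= nm (?a f N) + nm (?c N f Y)"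
   using nm_triangle[OF PT[OF f, of N] T_diff[OF proj_T YT], of N "V f" f] by simp
  then have "(nm (?j f Y))^2 <= (nm (?a f N) + nm (?c N f Y))^2" by (rule power_mono) simp
  also have "... <= 2 * (nm (?a f N))^2 + 2 * (nm (?c N f Y))^2"
   using sum_squares_bound[of "nm (?a f N)" "nm (?c N f Y)"] by (simp add: power2_sum)
  finally show "(nm (?j f Y))^2 <= 2 * (nm (?a f N))^2 + 2 * (?h N f q)"
   unfolding Ynm[OF f] .
 qed
 also have "... = 2 * (?e N) + 2 * (\<Sum>m<N. (?i m q))"
  using Pi qi by simp
 also have "(\<Sum>m<N. (?i m q)) <= (\<Sum>m<N. e / (real N + 1))"
  using q(2) by (intro sum_mono less_imp_le)
 also have "... <= e" using e by (simp add: field_simps)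
 finally have "(?d Y) <= 4 * e" using N by simp
 then have "K * (?d Y) <= K * (4 * e)" using K_nonneg by (rule mult_left_mono)
 also have "... < eps" using eps K_nonneg by (simp add: e_def field_simps)
 finally have "Q (%f x. V f x - Y f x) (%f x. V f x - Y f x) < eps" using Q_bound[OF D] by simp
 then show ?thesis using q(1) Yf unfolding Y_def by blast
qed

text \<open>Convergence against test fields extends to every \<open>V\<close> that they approximate,
  because the norms of the \<open>X n\<close> are bounded by \<open>M\<close>.\<close>

lemma Q_weak_null:
 assumes d: "!!n m. deriv_along (B (g m)) (p n) (%f. ip (X n f) (B (g m)))"
  and pb: "!!n f. f : T ==> abs (p n f) <= Cp n"
  and X: "!!n. field (X n)" and b: "!!n f. f : T ==> nm (X n f) <= C n"
  and p0: "(%n. LINT f|G. (p n f)^2) ~~> 0"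
  and M: "!!n. Q (X n) (X n) <= M"
  and V: "field V" "!!f. f : T ==> nm (V f) <= D"
 shows "(%n. Q (X n) V) ~~> 0"
proof (rule LIMSEQ_I)
 fix r :: real assume r: "0 < r"
 note W = X
 have M0: "0 <= M" using Q_nonneg[OF W] M order_trans by blast
 let ?b = "2 * (sqrt M + 1)"
 have "(r / ?b)^2 > 0" using r M0 by (simp add: add_nonneg_eq_0_iff)
 from test_field_approx[OF V this] obtain N q where q: "!!m. q m : test" and
  Yf: "field (%f x. \<Sum>m<N. q m f *\<^sub>R g m x)" and
  YQ: "Q (%f x. V f x - (\<Sum>m<N. q m f *\<^sub>R g m x)) (%f x. V f x - (\<Sum>m<N. q m f *\<^sub>R g m x)) < (r / ?b)^2" by blast
 define Y where "Y = (%f x. \<Sum>m<N. q m f *\<^sub>R g m x)"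
 let ?a = "%Y. %f x. V f x - Y f x"
 have D: "field (?a Y)" unfolding Y_def by (rule field_diff[OF V(1) Yf])
 have QY: "Q (X n) Y = (\<Sum>m<N. LINT f|G. q m f * bq (X n f) (g m))" for n
 proof -
  have i: "integrable G (%f. q m f * bq (X n f) (g m))" for m
  proof -
   obtain Cq where Cq: "!!f. f : T ==> abs (q m f) <= Cq" using testD(2)[OF q] by metis
   have hm: "B (g m) : T" by (simp add: B_T)
   show ?thesis
   proof (rule G.integrable_const_bound[where B="Cq * (C n * nm (B (g m)))"])
    show "AE f in G. norm (q m f * bq (X n f) (g m)) <= Cq * (C n * nm (B (g m)))"
    proof (rule AE_I2)
    fix f assume "f : space G"
    then have f: "f : T" by simp
    have "abs (ip (X n f) (B (g m))) <= C n * nm (B (g m))"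
    by (intro order_trans[OF ip_bound[OF field_T[OF X f] hm]] mult_right_mono nm_nonneg b[OF f])
    then show "norm (q m f * bq (X n f) (g m)) <= Cq * (C n * nm (B (g m)))"
    unfolding bq_def real_norm_def abs_mult using Cq[OF f] by (intro mult_mono) (auto intro: order_trans[OF abs_ge_zero])
    qed
    show "(%f. q m f * bq (X n f) (g m)) : bm G"
    unfolding bq_def using testD(1)[OF q[of m]] deriv_along_measurable(2)[OF d[of m n]] by measurable
   qed
  qed
  have "Q (X n) Y = (LINT f|G. (\<Sum>m<N. q m f * bq (X n f) (g m)))"
   unfolding Q_def
  proof (rule Bochner_Integration.integral_cong[OF refl])
   fix f assume "f : space G"
   then have LT: "X n f : T" using field_T[OF X] by simp
   show "bq (X n f) (Y f) = (\<Sum>m<N. q m f * bq (X n f) (g m))"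
    unfolding Y_def using LT by (subst bq_sum_right) (auto simp: T_scale bq_scale_right)
  qed
  then show ?thesis using i by simp
 qed
 have "(%n. Q (X n) Y) ~~> (\<Sum>m<N. 0)"
  unfolding QY by (intro tendsto_sum Q_test_field_tendsto[OF d pb X b p0 q])
 then have "(%n. Q (X n) Y) ~~> 0" by simp
 from LIMSEQ_D[OF this, of "r / 2"] r obtain no where no: "!!n. n >= no ==> abs (Q (X n) Y) < r / 2" by auto
 show "EX no. ALL n>=no. norm (Q (X n) V - 0) < r"
 proof (intro exI[of _ no] allI impI)
  fix n assume "no <= n"
  have YF: "field Y" using Yf by (simp add: Y_def)
  have "Q (X n) V - Q (X n) Y = Q (X n) (?a Y)"
   using Q_diff_right[OF V(1) YF W[of n]] by simp
  moreover have "abs (Q (X n) (?a Y)) <= sqrt M * (r / ?b)"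
  proof (rule order_trans[OF Q_cauchy_schwarz[OF W D]], rule mult_mono)
   show "sqrt (Q (X n) (X n)) <= sqrt M" using M by simp
   have "sqrt (Q (?a Y) (?a Y)) <= sqrt ((r / ?b)^2)"
    using YQ unfolding Y_def by (intro real_sqrt_le_mono less_imp_le)
   also have "... = r / ?b" using r M0 by simp
   finally show "sqrt (Q (?a Y) (?a Y)) <= r / ?b" .
  qed (use M0 Q_nonneg[OF D] in auto)
  moreover have "sqrt M * (r / ?b) <= r / 2"
  proof -
   have "sqrt M * r <= (sqrt M + 1) * r" using r by simp
   moreover have "sqrt M + 1 > 0" using M0 by (simp add: add_nonneg_pos)
   ultimately show ?thesis by (simp add: field_simps)
  qed
  ultimately show "norm (Q (X n) V - 0) < r" using no[OF \<open>no <= n\<close>] unfolding real_norm_def by linarith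
 qed
qed

text \<open>Write Q(X_n, X_n) = Q(X_n, X_N) + Q(X_n, X_n - X_N). For fixed N the first term tends to
  0 by the weak convergence; the second is small since the sequence is Cauchy and bounded.\<close>

lemma Q_closable:
 assumes d: "!!n m. deriv_along (B (g m)) (p n) (%f. ip (X n f) (B (g m)))"
  and pb: "!!n f. f : T ==> abs (p n f) <= Cp n"
  and X: "!!n. field (X n)" and b: "!!n f. f : T ==> nm (X n f) <= C n"
  and p0: "(%n. LINT f|G. (p n f)^2) ~~> 0"
  and cauchy: "!!e. e > 0 ==> EX N. ALL n>=N. ALL k>=N. sqrt (Q (%f x. X n f x - X k f x) (%f x. X n f x - X k f x)) < e"
 shows "(%n. sqrt (Q (X n) (X n))) ~~> 0"
proof -
 let ?a = "%n k. %f x. X n f x - X k f x"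
 have "(%n. Q (X n) (X n)) ~~> 0"
 proof (rule LIMSEQ_I)
  fix r :: real assume r: "0 < r"
  obtain N1 where N1: "!!n k. n >= N1 ==> k >= N1 ==> sqrt (Q (?a n k) (?a n k)) < 1"
   using cauchy[of 1] by auto
  define S where "S = sqrt (Q (X N1) (X N1)) + 1"
  have S0: "S >= 1" using Q_nonneg[OF X[of N1]] by (simp add: S_def)
  have S: "sqrt (Q (X n) (X n)) <= S" if "n >= N1" for n
   using Q_triangle[OF X[of n] X[of N1]] N1[OF that order_refl] unfolding S_def by linarith
  have S2: "Q (X n) (X n) <= S^2" if "n >= N1" for n
   using power_mono[OF S[OF that], of 2] Q_nonneg[OF X[of n]] by simp
  obtain N2 where N2: "!!n k. n >= N2 ==> k >= N2 ==> sqrt (Q (?a n k) (?a n k)) < r / (2 * S)"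
   using cauchy[of "r / (2 * S)"] r S0 by auto
  define N where "N = max N1 N2"
  \<comment> \<open>The shift restricts to the indices for which the bound S^2 is known.\<close>
  have "(%n. Q (X (n + N)) (X N)) ~~> 0"
  proof (rule Q_weak_null[where p="%n. p (n + N)" and Cp="%n. Cp (n + N)" and C="%n. C (n + N)" and M="S^2" and D="C N"])
   show "(%n. LINT f|G. (p (n + N) f)^2) ~~> 0" by (rule LIMSEQ_ignore_initial_segment[OF p0])
   show "Q (X (n + N)) (X (n + N)) <= S^2" for n by (rule S2) (simp add: N_def)
  qed (use d pb X b in auto)
  from LIMSEQ_D[OF this, of "r / 2"] r obtain n0 where n0: "!!n. n >= n0 ==> abs (Q (X (n + N)) (X N)) < r / 2" by auto
  show "EX n0. ALL n>=n0. norm (Q (X n) (X n) - 0) < r"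
  proof (intro exI[of _ "n0 + N"] allI impI)
   fix n assume n: "n0 + N <= n"
   have "n = (n - N) + N" "n - N >= n0" using n by auto
   then have 1: "abs (Q (X n) (X N)) < r / 2" using n0[of "n - N"] by simp
   have D: "field (%f x. X n f x - X N f x)" by (rule field_diff[OF X X])
   have "abs (Q (X n) (%f x. X n f x - X N f x)) <= S * (r / (2 * S))"
    by (rule order_trans[OF Q_cauchy_schwarz[OF X D] mult_mono])
    (use S[of n] N2[of n N] n S0 Q_nonneg[OF D] in \<open>auto simp: N_def intro: less_imp_le\<close>)
   then have "abs (Q (X n) (%f x. X n f x - X N f x)) <= r / 2" using S0 by simp
   then show "norm (Q (X n) (X n) - 0) < r"
    using 1 Q_diff_right[OF X[of n] X[of N] X[of n]] unfolding real_norm_def by linarith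
  qed
 qed
 from tendsto_real_sqrt[OF this] show ?thesis by simp
qed

end

section \<open>The closed form and its generator\<close>

lemma is_intrinsic_grad_unique:
 assumes mu: "mu : P2" and h: "is_intrinsic_grad u mu h" and k: "is_intrinsic_grad u mu k"
 shows "AE x in mu. h x = k x"
proof -
 interpret M: l2_space mu by (rule P2_l2_space[OF mu])
 have hT: "h : M.T" and kT: "k : M.T" using h k by (auto simp: is_intrinsic_grad_def)
 let ?a = "%x. h x - k x"
 have dT: "?a : M.T" by (rule M.T_diff[OF hT kT])
 have "M.ip ?a ?a = M.ip h ?a - M.ip k ?a"
  by (rule M.ip_diff_left[OF hT kT dT])
 also have "... = 0"
 proof -
  have "dir_deriv u mu ?a = M.ip h ?a" "dir_deriv u mu ?a = M.ip k ?a"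
   using h k dT unfolding is_intrinsic_grad_def by blast+
  then show ?thesis by simp
 qed
 finally show ?thesis using M.AE_zero_of_ip[OF dT] by simp
qed

text \<open>\<open>intrinsic_grad\<close> picks a representative for each measure separately; here
  one bounded version, continuous in measure and point, is fixed per function.\<close>

definition C1b_grad :: "((real^'d) measure => real) => (real^'d) measure => real^'d => real^'d" where
 "C1b_grad u = (SOME v. continuous_grad_version u v & (EX C. ALL mu:P2. ALL x. norm (v mu x) <= C))"

lemma C1b_grad:
 assumes "u : C1b_P2"
 shows "continuous_grad_version u (C1b_grad u)" "EX C. ALL mu:P2. ALL x. norm (C1b_grad u mu x) <= C"
proof -
 have "EX v. continuous_grad_version u v & (EX C. ALL mu:P2. ALL x. norm (v mu x) <= C)" using C1b_P2_D[OF assms] by metis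
 from someI_ex[OF this] show "continuous_grad_version u (C1b_grad u)" "EX C. ALL mu:P2. ALL x. norm (C1b_grad u mu x) <= C"
  unfolding C1b_grad_def by blast+
qed

lemma C1b_bounded: assumes "u : C1b_P2" shows "EX C. ALL mu:P2. abs (u mu) <= C"
 using C1b_P2_D[OF assms] by metis

lemma C1b_continuous: assumes "u : C1b_P2" shows "P2_continuous u"
proof -
 show ?thesis using C1b_P2_D[OF assms] .
qed

lemma continuous_grad_versionD: "continuous_grad_version u v ==> mu : P2 ==> is_intrinsic_grad u mu (v mu)"
 by (simp add: continuous_grad_version_def)

lemma is_intrinsic_grad_diff:
 assumes u: "u : C1b_P2" and u': "u' : C1b_P2" and v: "continuous_grad_version u v" and v': "continuous_grad_version u' v'"
  and mu: "mu : P2"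
 shows "is_intrinsic_grad (%mu. u mu - u' mu) mu (%x. v mu x - v' mu x)"
proof -
 interpret M: l2_space mu by (rule P2_l2_space[OF mu])
 have vT: "v mu : M.T" "v' mu : M.T" using continuous_grad_versionD[OF v mu] continuous_grad_versionD[OF v' mu] by (auto simp: is_intrinsic_grad_def)
 have lim: "(diff_quotient u mu f \<longlongrightarrow> l2_inner mu (v mu) f) (at 0)"
  if u: "u : C1b_P2" and v: "continuous_grad_version u v" and f: "f : M.T" for u v f
 proof -
  have "EX v. continuous_grad_version u v & (ALL mu:P2. ALL f:tangent mu. (diff_quotient u mu f \<longlongrightarrow> l2_inner mu (v mu) f) (at 0))"
   using C1b_P2_D[OF u] by metis
  then obtain v0 where v0: "continuous_grad_version u v0"
   "!!mu f. mu : P2 ==> f : tangent mu ==> (diff_quotient u mu f \<longlongrightarrow> l2_inner mu (v0 mu) f) (at 0)" by blast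
  have "dir_deriv u mu f = l2_inner mu (v0 mu) f" "dir_deriv u mu f = l2_inner mu (v mu) f"
   using continuous_grad_versionD[OF v0(1) mu] continuous_grad_versionD[OF v mu] f by (auto simp: is_intrinsic_grad_def)
  then show ?thesis using v0(2)[OF mu f] by simp
 qed
 let ?a = "%u mu f. %eps. diff_quotient u mu f eps - diff_quotient u' mu f eps"
 let ?b = "%u. %mu. u mu - u' mu"
 have "dir_deriv (?b u) mu f = M.ip (%x. v mu x - v' mu x) f" if f: "f : M.T" for f
 proof -
  have "diff_quotient (?b u) mu f = (?a u mu f)"
   by (auto simp: diff_quotient_def diff_divide_distrib[symmetric])
  moreover have "((?a u mu f) \<longlongrightarrow> M.ip (v mu) f - M.ip (v' mu) f) (at 0)"
   by (intro tendsto_diff lim[OF u v f] lim[OF u' v' f])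
  ultimately have "dir_deriv (?b u) mu f = M.ip (v mu) f - M.ip (v' mu) f"
   unfolding dir_deriv_def by (simp add: tendsto_Lim)
  then show ?thesis using M.ip_diff_left[OF vT f] by simp
 qed
 then show ?thesis using M.T_diff[OF vT] by (auto simp: is_intrinsic_grad_def)
qed

context gaussian_space
begin

text \<open>Gradients are determined up to null sets of the push-forward, and these pull back along
  \<open>f\<close> to null sets of \<open>lam\<close>. The form therefore does not depend on the
  representatives.\<close>

lemma pre_form_Q:
 assumes v: "!!mu. mu : P2 ==> is_intrinsic_grad p mu (v mu)" and w: "!!mu. mu : P2 ==> is_intrinsic_grad r mu (w mu)"
 shows "pre_form lam B G p r = Q (lift v) (lift w)"
 unfolding pre_form_def Q_def
proof (rule Bochner_Integration.integral_cong[OF refl])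
 fix f assume "f : space G"
 then have f: "f : T" by simp
 have P: "Psi f : P2" by (rule push_P2[OF f])
 have *: "(AE x in lam. (intrinsic_grad p (Psi f) o f) x = lift v f x) \<and>
   intrinsic_grad p (Psi f) o f : T & lift v f : T"
  if v: "is_intrinsic_grad p (Psi f) (v (Psi f))" for p v
 proof -
  have i: "is_intrinsic_grad p (Psi f) (intrinsic_grad p (Psi f))"
   unfolding intrinsic_grad_def by (rule someI[of "is_intrinsic_grad p (Psi f)", OF v])
  have t: "intrinsic_grad p (Psi f) : tangent (Psi f)" "v (Psi f) : tangent (Psi f)"
   using i v by (auto simp: is_intrinsic_grad_def)
  have [measurable]: "intrinsic_grad p (Psi f) : bm borel" "v (Psi f) : bm borel"
   using t by (auto simp: tangent_def)
  have "{x : space borel. intrinsic_grad p (Psi f) x = v (Psi f) x} : sets borel" by measurable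
  then have "{x. intrinsic_grad p (Psi f) x = v (Psi f) x} : sets borel" by simp
  from AE_push[OF f this is_intrinsic_grad_unique[OF P i v]] show ?thesis
   using tangent_push[OF f t(1)] tangent_push[OF f t(2)] by (simp add: lift_def)
 qed
 from *[of p v, OF v[OF P]] *[of r w, OF w[OF P]]
 show "ip (intrinsic_grad p (Psi f) o f) (B (intrinsic_grad r (Psi f) o f)) = bq (lift v f) (lift w f)"
  using bq_cong_AE unfolding bq_def by blast
qed

definition tgrad :: "((real^'d) measure => real) => (real^'d => real^'d) => real^'d => real^'d" where
 "tgrad u = lift (C1b_grad u)"

lemma tgrad:
 assumes u: "u : C1b_P2"
 shows "field (tgrad u)" "EX C. ALL f:T. nm (tgrad u f) <= C"
  "h : T ==> deriv_along h (%f. u (Psi f)) (%f. ip (tgrad u f) h)"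
proof -
 obtain C where C: "!!mu x. mu : P2 ==> norm (C1b_grad u mu x) <= C" using C1b_grad(2)[OF u] by blast
 note v = C1b_grad(1)[OF u]
 show "field (tgrad u)" unfolding tgrad_def by (rule lift_field(1)[OF v C])
 have "nm (tgrad u f) <= abs C" if "f : T" for f unfolding tgrad_def by (rule lift_field(2)[OF v C that])
 then show "EX C. ALL f:T. nm (tgrad u f) <= C" by blast
 show "deriv_along h (%f. u (Psi f)) (%f. ip (tgrad u f) h)" if "h : T"
  unfolding tgrad_def by (rule deriv_along_lift[OF u v C that])
qed

lemma pre_form_tgrad: assumes "u : C1b_P2" "u' : C1b_P2" shows "pre_form lam B G u u' = Q (tgrad u) (tgrad u')"
 unfolding tgrad_def by (intro pre_form_Q continuous_grad_versionD C1b_grad assms)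

text \<open>The difference of the two chosen versions is a gradient of the difference, so the Cauchy
  condition in \<open>approximating\<close> becomes one on differences of fields.\<close>

lemma pre_form_tgrad_diff:
 assumes "u : C1b_P2" "u' : C1b_P2"
 shows "pre_form lam B G (%mu. u mu - u' mu) (%mu. u mu - u' mu) =
  Q (%f x. tgrad u f x - tgrad u' f x) (%f x. tgrad u f x - tgrad u' f x)"
proof -
 let ?a = "%mu x. C1b_grad u mu x - C1b_grad u' mu x"
 have "lift ?a = (%f x. tgrad u f x - tgrad u' f x)"
  by (auto simp: lift_def tgrad_def fun_eq_iff)
 moreover have "pre_form lam B G (%mu. u mu - u' mu) (%mu. u mu - u' mu) =
   Q (lift ?a) (lift ?a)"
  by (intro pre_form_Q is_intrinsic_grad_diff C1b_grad assms)
 ultimately show ?thesis by simp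
qed

lemma deriv_along_diff:
 assumes P: "deriv_along h P P'" and R: "deriv_along h R R'"
 shows "deriv_along h (%f. P f - R f) (%f. P' f - R' f)"
 using deriv_along_add[OF P deriv_along_mult[OF deriv_along_const[of h "-1"] R]] by simp

section \<open>Square integrable functions for the image law\<close>

lemma sets_image_law [measurable_cong]: "sets (image_law lam G) = sets P2_borel" by (simp add: image_law_def)

lemma prob_image_law: "prob_space (image_law lam G)"
 unfolding image_law_def by (rule G.prob_space_distr) measurable

lemma integral_image_law:
 "h : bm P2_borel ==> (\<integral>mu. h mu \<partial>image_law lam G) = (LINT f|G. h (Psi f))"
 "h : bm P2_borel ==> integrable (image_law lam G) h \<longleftrightarrow> integrable G (%f. h (Psi f))"
 for h :: "(real^'d) measure => real"
 unfolding image_law_def by (simp_all add: integral_distr integrable_distr_eq)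

lemma L2_fun_image_law:
 "h : L2_fun (image_law lam G) \<longleftrightarrow> h : bm P2_borel & integrable G (%f. (h (Psi f))^2)"
proof -
 have "h : bm (image_law lam G) \<longleftrightarrow> h : bm P2_borel"
  by (rule arg_cong[where f="(\<in>) h"], rule measurable_cong_sets) (simp_all add: sets_image_law)
 then show ?thesis unfolding L2_fun_def using integral_image_law(2)[of "%mu. (h mu)^2"] by auto
qed

lemma C1b_measurable: "u : C1b_P2 ==> u : bm P2_borel"
 by (rule measurable_P2_borel[OF C1b_continuous])

lemma C1b_L2: assumes u: "u : C1b_P2" shows "u : L2_fun (image_law lam G)"
 unfolding L2_fun_image_law
proof
 show um: "u : bm P2_borel" by (rule C1b_measurable[OF u])
 obtain C where C: "!!mu. mu : P2 ==> abs (u mu) <= C" using C1b_bounded[OF u] by blast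
 show "integrable G (%f. (u (Psi f))^2)"
 proof (rule G.integrable_const_bound[where B="C^2"])
  show "AE f in G. norm ((u (Psi f))^2) <= C^2"
  proof (rule AE_I2)
   fix f assume "f : space G"
   then have "abs (u (Psi f))^2 <= C^2" using C[OF push_P2, of f] by (intro power_mono) auto
   then show "norm ((u (Psi f))^2) <= C^2" by simp
  qed
 qed (use um in measurable)
qed

definition qn :: "((real^'d => real^'d) => real^'d => real^'d) => real" where "qn X = sqrt (Q X X)"

lemma qn_nonneg: "field X ==> 0 <= qn X" using Q_nonneg by (simp add: qn_def)

lemma qn_diff: assumes "field X" "field Y" shows "qn (%f x. X f x - Y f x) <= qn X + qn Y"
proof -
 let ?a = "%f x. (-1) *\<^sub>R Y f x"
 have D: "field (%f x. X f x - Y f x)" and m: "field ?a" by (rule field_diff[OF assms], rule field_scale[OF assms(2)])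
 have "qn (%f x. X f x - Y f x) <= qn X + qn (%f x. (X f x - Y f x) - X f x)"
  unfolding qn_def by (rule Q_triangle[OF D assms(1)])
 also have "(%f x. (X f x - Y f x) - X f x) = ?a" by simp
 also have "qn ?a = qn Y"
 proof -
  have "Q ?a ?a = - 1 * Q Y ?a" by (rule Q_scale_left)
  also have "... = - 1 * (- 1 * Q Y Y)" unfolding Q_sym[OF assms(2) m] Q_scale_left ..
  finally show ?thesis by (simp add: qn_def)
 qed
 finally show ?thesis .
qed

lemma approximating_iff:
 assumes u: "u : L2_fun (image_law lam G)"
 shows "approximating lam B G s u \<longleftrightarrow> (ALL n. s n : C1b_P2) \<and>
  (%n. LINT f|G. (s n (Psi f) - u (Psi f))^2) ~~> 0 \<and>
  (ALL e>0. EX N. ALL n>=N. ALL k>=N. qn (%f x. tgrad (s n) f x - tgrad (s k) f x) < e)"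
proof (cases "ALL n. s n : C1b_P2")
 case True
 let ?a = "%n k. %f x. tgrad (s n) f x - tgrad (s k) f x"
 let ?b = "%n k. %mu. s n mu - s k mu"
 have "(\<integral>mu. (s n mu - u mu)^2 \<partial>image_law lam G) = (LINT f|G. (s n (Psi f) - u (Psi f))^2)" for n
  using u C1b_measurable[of "s n"] True by (intro integral_image_law) (auto simp: L2_fun_image_law)
 moreover have "(ALL e>0. EX N. ALL n>=N. ALL k>=N. pre_form lam B G (?b n k) (?b n k) < e) \<longleftrightarrow>
  (ALL e>0. EX N. ALL n>=N. ALL k>=N. qn (?a n k) < e)" (is "?L \<longleftrightarrow> ?R")
 proof -
  have pq: "pre_form lam B G (?b n k) (?b n k) = (qn (?a n k))^2" for n k
   using True Q_nonneg[OF field_diff[OF tgrad(1)[of "s n"] tgrad(1)[of "s k"]]] by (simp add: pre_form_tgrad_diff qn_def)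
  have q0: "0 <= qn (?a n k)" for n k
   using True by (intro qn_nonneg field_diff tgrad) auto
  show ?thesis
  proof
   assume L: ?L
   show ?R
   proof (intro allI impI)
    fix e :: real assume e: "0 < e"
    then have "0 < e^2" by simp
    with L obtain N where N: "ALL n>=N. ALL k>=N. (qn (?a n k))^2 < e^2" unfolding pq by blast
    show "EX N. ALL n>=N. ALL k>=N. qn (?a n k) < e"
    using N e by (meson less_imp_le power_less_imp_less_base)
   qed
  next
   assume R: ?R
   show ?L
   proof (intro allI impI)
    fix e :: real assume e: "0 < e"
    then have "0 < sqrt e" by simp
    with R obtain N where N: "ALL n>=N. ALL k>=N. qn (?a n k) < sqrt e" by blast
    have "(qn (?a n k))^2 < e" if "n >= N" "k >= N" for n k
    proof -
    have "qn (?a n k) < sqrt e" using N that by blast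
    from power_strict_mono[OF this q0, of 2] show ?thesis using e by simp
    qed
    then show "EX N. ALL n>=N. ALL k>=N. pre_form lam B G (?b n k) (?b n k) < e" unfolding pq by blast
   qed
  qed
 qed
 ultimately show ?thesis unfolding approximating_def by simp
qed (auto simp: approximating_def)

lemma L2_square_sum:
 fixes p r :: "(real^'d => real^'d) => real"
 assumes [measurable]: "p : bm G" "r : bm G" and i: "integrable G (%f. (p f)^2)" "integrable G (%f. (r f)^2)"
 shows "integrable G (%f. (p f - r f)^2)" "(LINT f|G. (p f - r f)^2) <= 2 * (LINT f|G. (p f)^2) + 2 * (LINT f|G. (r f)^2)"
proof -
 have le: "(p f - r f)^2 <= 2 * (p f)^2 + 2 * (r f)^2" for f
 proof -
  have "0 <= (p f + r f)^2" by simp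
  then show ?thesis by (simp add: power2_eq_square algebra_simps)
 qed
 show d: "integrable G (%f. (p f - r f)^2)"
 proof (rule Bochner_Integration.integrable_bound)
  show "integrable G (%f. 2 * (p f)^2 + 2 * (r f)^2)" using i by simp
  show "AE f in G. norm ((p f - r f)^2) <= norm (2 * (p f)^2 + 2 * (r f)^2)"
   using le by (intro AE_I2) simp
 qed measurable
 let ?a = "LINT f|G. (p f - r f)^2"
 have "?a <= (LINT f|G. 2 * (p f)^2 + 2 * (r f)^2)"
  using d i le by (intro integral_mono) auto
 also have "... = 2 * (LINT f|G. (p f)^2) + 2 * (LINT f|G. (r f)^2)" using i by simp
 finally show "?a <= 2 * (LINT f|G. (p f)^2) + 2 * (LINT f|G. (r f)^2)" .
qed

text \<open>By closability, any approximating sequence has the same limiting gradient field.\<close>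

lemma approximating_gradient:
 assumes u: "u : L2_fun (image_law lam G)" and U: "field U"
  and un: "!!n. un n : C1b_P2" and un_lim: "(%n. LINT f|G. (un n (Psi f) - u (Psi f))^2) ~~> 0"
  and Un: "(%n. qn (%f x. tgrad (un n) f x - U f x)) ~~> 0"
  and s: "approximating lam B G s u"
 shows "(%n. qn (%f x. tgrad (s n) f x - U f x)) ~~> 0"
proof -
 have sC: "s n : C1b_P2" for n using s by (simp add: approximating_def)
 let ?d = "%n k. %f x. tgrad (s n) f x - tgrad (s k) f x"
 have s0: "(%n. LINT f|G. (s n (Psi f) - u (Psi f))^2) ~~> 0"
  and sQ: "!!e. e > 0 ==> EX N. ALL n>=N. ALL k>=N. qn (?d n k) < e"
  using s unfolding approximating_iff[OF u] by blast+
 note Sf = tgrad(1)[OF sC] and Uf = tgrad(1)[OF un]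
 define X where "X n f x = tgrad (s n) f x - tgrad (un n) f x" for n f x
 define p where "p n f = s n (Psi f) - un n (Psi f)" for n f
 have XF: "field (X n)" for n unfolding X_def by (rule field_diff[OF Sf Uf])
 have um: "u : bm P2_borel" and u2: "integrable G (%f. (u (Psi f))^2)" using u by (auto simp: L2_fun_image_law)
 have m: "(%f. v (Psi f) - u (Psi f)) : bm G" "integrable G (%f. (v (Psi f) - u (Psi f))^2)"
  if v: "v : C1b_P2" for v
 proof -
  note [measurable] = um C1b_measurable[OF v]
  show "(%f. v (Psi f) - u (Psi f)) : bm G" by measurable
  show "integrable G (%f. (v (Psi f) - u (Psi f))^2)"
   by (rule L2_square_sum(1)) (use u2 C1b_L2[OF v] in \<open>auto simp: L2_fun_image_law\<close>)
 qed
 let ?a = "%n. %f x. tgrad (un n) f x - U f x"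
 let ?b = "%n. LINT f|G. (un n (Psi f) - u (Psi f))^2"
 let ?c = "%n. LINT f|G. (s n (Psi f) - u (Psi f))^2"
 let ?e = "%X n k. %f x. X n f x - X k f x"
 have X0: "(%n. qn (X n)) ~~> 0"
  unfolding qn_def
 \<comment> \<open>The bounds exist for each index separately and vary with it, so they are supplied
   by choice.\<close>
 proof (rule Q_closable[where p=p and C="%n. (SOME C. ALL f:T. nm (X n f) <= C)" and Cp="%n. (SOME C. ALL f:T. abs (p n f) <= C)"])
  fix n
  show "deriv_along (B (g k)) (p n) (%f. ip (X n f) (B (g k)))" for k
  proof -
   have h: "B (g k) : T" by (simp add: B_T)
   have d: "deriv_along (B (g k)) (p n) (%f. ip (tgrad (s n) f) (B (g k)) - ip (tgrad (un n) f) (B (g k)))"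
    unfolding p_def by (rule deriv_along_diff[OF tgrad(3)[OF sC h] tgrad(3)[OF un h]])
   have e: "ip (X n f) (B (g k)) = ip (tgrad (s n) f) (B (g k)) - ip (tgrad (un n) f) (B (g k))" if "f : T" for f
    unfolding X_def by (rule ip_diff_left[OF field_T[OF Sf that] field_T[OF Uf that] h])
   show ?thesis
   proof (rule deriv_alongI)
    show "(%f. ip (X n f) (B (g k))) : bm TB" using XF[of n] h by (simp add: field_def)
   qed (use deriv_along_measurable(1)[OF d] deriv_along_D[OF d] e T_line[OF _ h] in \<open>simp_all\<close>)
  qed
  have "EX C. ALL f:T. abs (p n f) <= C"
  proof -
   obtain C C' where C: "!!mu. mu : P2 ==> abs (s n mu) <= C" "!!mu. mu : P2 ==> abs (un n mu) <= C'"
    using C1b_bounded[OF sC[of n]] C1b_bounded[OF un[of n]] by blast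
   have "abs (p n f) <= C + C'" if "f : T" for f unfolding p_def using C[OF push_P2[OF that]] by linarith
   then show ?thesis by blast
  qed
  from someI_ex[OF this] show "abs (p n f) <= (SOME C. ALL f:T. abs (p n f) <= C)" if "f : T" for f using that by blast
  have "EX C. ALL f:T. nm (X n f) <= C"
  proof -
   obtain C C' where C: "!!f. f : T ==> nm (tgrad (s n) f) <= C" "!!f. f : T ==> nm (tgrad (un n) f) <= C'"
    using tgrad(2)[OF sC[of n]] tgrad(2)[OF un[of n]] by blast
   have "nm (X n f) <= C + C'" if "f : T" for f
    unfolding X_def using nm_diff_triangle[OF field_T[OF Sf that] field_T[OF Uf that], of n n] C[OF that] by linarith
   then show ?thesis by blast
  qed
  from someI_ex[OF this] show "nm (X n f) <= (SOME C. ALL f:T. nm (X n f) <= C)" if "f : T" for f using that by blast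
  show "field (X n)" by (rule XF)
 next
  have "(%n. 2 * (?c n) + 2 * (?b n)) ~~> 2 * 0 + 2 * 0"
   by (intro tendsto_intros s0 un_lim)
  then have lim: "(%n. 2 * (?c n) + 2 * (?b n)) ~~> 0" by simp
  show "(%n. LINT f|G. (p n f)^2) ~~> 0"
  proof (rule tendsto_by_bound[OF _ lim])
   fix n
   have "(LINT f|G. (p n f)^2) <= 2 * (?c n) + 2 * (?b n)"
    using L2_square_sum(2)[OF m(1)[OF sC] m(1)[OF un] m(2)[OF sC] m(2)[OF un], of n n] by (simp add: p_def)
   then show "norm ((LINT f|G. (p n f)^2) - 0) <= 2 * (?c n) + 2 * (?b n)"
    by simp
  qed
 next
  fix e :: real assume e: "0 < e"
  obtain N1 where N1: "!!n k. n >= N1 ==> k >= N1 ==> qn (?d n k) < e / 3" using sQ[of "e / 3"] e by auto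
  obtain N2 where N2: "!!n. n >= N2 ==> qn (?a n) < e / 3" using LIMSEQ_D[OF Un, of "e / 3"] e by fastforce
  have "qn (?e X n k) < e" if "n >= max N1 N2" "k >= max N1 N2" for n k
  proof -
   have f1: "field (?d n k)" by (rule field_diff[OF Sf Sf])
   have f2: "field (?a n)" "field (%f x. tgrad (un k) f x - U f x)" by (rule field_diff[OF Uf U])+
   have "(?e X n k) =
    (%f x. (tgrad (s n) f x - tgrad (s k) f x) - ((tgrad (un n) f x - U f x) - (tgrad (un k) f x - U f x)))"
    by (simp add: X_def fun_eq_iff algebra_simps)
   then have "qn (?e X n k) <= qn (?d n k) +
    (qn (?a n) + qn (%f x. tgrad (un k) f x - U f x))"
    using qn_diff[OF f1 field_diff[OF f2]] qn_diff[OF f2] by simp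
   then show ?thesis using N1[of n k] N2[of n] N2[of k] that by simp
  qed
  then show "EX N. ALL n>=N. ALL k>=N. sqrt (Q (?e X n k) (?e X n k)) < e"
   unfolding qn_def by blast
 qed
 let ?h = "%n. %f x. tgrad (s n) f x - U f x"
 have "(%n. qn (X n) + qn (?a n)) ~~> 0 + 0" by (intro tendsto_add X0 Un)
 then have "(%n. qn (X n) + qn (?a n)) ~~> 0" by simp
 then show ?thesis
 proof (rule tendsto_by_bound[rotated])
  fix n
  have f: "field (?h n)" "field (?a n)" by (rule field_diff[OF Sf U], rule field_diff[OF Uf U])
  have "(%f x. (tgrad (s n) f x - U f x) - X n f x) = (?a n)" by (simp add: X_def)
  then have "qn (?h n) <= qn (X n) + qn (?a n)"
   using Q_triangle[OF f(1) XF[of n]] by (simp add: qn_def)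
  then show "norm (qn (?h n) - 0) <= qn (X n) + qn (?a n)"
   using qn_nonneg[OF f(1)] by simp
 qed
qed

lemma smooth_class_C1b: assumes "v : smooth_class" shows "v : C1b_P2"
proof -
 obtain w where w: "smooth_P2 v w" and b: "!!mu. mu : P2 ==> 0 <= v mu & v mu <= 1" using assms by (auto simp: smooth_class_def)
 show ?thesis by (rule smooth_P2_C1b(1)[OF w, of 1]) (use b in force)
qed

lemma C1b_form_domain: assumes v: "v : C1b_P2" shows "v : form_domain lam B G"
proof -
 have "approximating lam B G (%n. v) v" unfolding approximating_iff[OF C1b_L2[OF v]] using v by (auto simp: qn_def Q_def bq_def)
 then show ?thesis using C1b_L2[OF v] by (auto simp: form_domain_def)
qed

text \<open>Closability makes the gradients of every approximating sequence of \<open>u\<close> tend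
  to \<open>U\<close>, so the formula \<open>ibp\<close> extends from \<open>C1b_P2\<close> to the
  whole form domain by continuity. Density of \<open>smooth_class\<close> in L2 then makes the
  representing function unique.\<close>

theorem generator_criterion:
 assumes u: "u : L2_fun (image_law lam G)" and U: "field U"
  and un: "!!n. un n : C1b_P2" and un_lim: "(%n. LINT f|G. (un n (Psi f) - u (Psi f))^2) ~~> 0"
  and Un: "(%n. qn (%f x. tgrad (un n) f x - U f x)) ~~> 0"
  and w: "w : L2_fun (image_law lam G)"
  and ibp: "!!v. v : C1b_P2 ==> Q U (tgrad v) = - (LINT f|G. w (Psi f) * v (Psi f))"
 shows "u : generator_domain lam B G" "AE mu in image_law lam G. generator lam B G u mu = w mu"
proof -
 have Uf: "field (tgrad (un n))" for n by (rule tgrad(1)[OF un])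
 have wm: "w : bm P2_borel" and w2: "integrable G (%f. (w (Psi f))^2)" using w by (auto simp: L2_fun_image_law)
 let ?i = "%n k. %f x. tgrad (un n) f x - tgrad (un k) f x"
 have apx: "approximating lam B G un u"
  unfolding approximating_iff[OF u]
 proof (intro conjI allI impI un un_lim)
  fix e :: real assume e: "0 < e"
  obtain N where N: "!!n. n >= N ==> qn (%f x. tgrad (un n) f x - U f x) < e / 2" using LIMSEQ_D[OF Un, of "e / 2"] e by fastforce
  have "qn (?i n k) < e" if "n >= N" "k >= N" for n k
  proof -
   have "(%f x. (tgrad (un n) f x - U f x) - (tgrad (un k) f x - U f x)) = (?i n k)" by simp
   then show ?thesis using qn_diff[OF field_diff[OF Uf U] field_diff[OF Uf U], of n k] N[OF that(1)] N[OF that(2)] by simp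
  qed
  then show "EX N. ALL n>=N. ALL k>=N. qn (?i n k) < e" by blast
 qed
 then have dom: "u : form_domain lam B G" using u by (auto simp: form_domain_def)
 let ?a = "%v. \<integral>mu. w mu * v mu \<partial>image_law lam G"
 let ?b = "%v. LINT f|G. w (Psi f) * v (Psi f)"
 let ?c = "%s n. %f x. tgrad (s n) f x - U f x"
 let ?d = "LINT f|G. (w (Psi f))^2"
 let ?e = "%t n v. LINT f|G. (t n (Psi f) - v (Psi f))^2"
 let ?h = "image_law lam G"
 let ?j = "%s t. %n. pre_form lam B G (s n) (t n)"
 let ?k = "%t n v. LINT f|G. w (Psi f) * (t n (Psi f) - v (Psi f))"
 \<comment> \<open>The form is split at \<open>U\<close>: the part with the difference vanishes
   since the gradients of \<open>t n\<close> stay bounded, and the part with \<open>U\<close> is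
   evaluated by \<open>ibp\<close>.\<close>
 have lim: "(?j s t) ~~> - (?a v)"
  if v: "v : L2_fun ?h" and s: "approximating lam B G s u" and t: "approximating lam B G t v" for s t v
 proof -
  have vm: "v : bm P2_borel" and v2: "integrable G (%f. (v (Psi f))^2)" using v by (auto simp: L2_fun_image_law)
  have sC: "s n : C1b_P2" for n using s by (simp add: approximating_def)
  have tC: "t n : C1b_P2" for n using t by (simp add: approximating_def)
  have t0: "(%n. LINT f|G. (t n (Psi f) - v (Psi f))^2) ~~> 0"
   and tQ: "!!e. e > 0 ==> EX N. ALL n>=N. ALL k>=N. qn (%f x. tgrad (t n) f x - tgrad (t k) f x) < e"
   using t unfolding approximating_iff[OF v] by blast+
  note Sf = tgrad(1)[OF sC] and Tf = tgrad(1)[OF tC]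
  have SU: "(%n. qn (?c s n)) ~~> 0" by (rule approximating_gradient[OF u U un un_lim Un s])
  obtain N where N: "!!n. n >= N ==> qn (%f x. tgrad (t n) f x - tgrad (t N) f x) < 1" using tQ[of 1] by auto
  define S where "S = qn (tgrad (t N)) + 1"
  have S: "qn (tgrad (t n)) <= S" if "n >= N" for n
   using Q_triangle[OF Tf[of n] Tf[of N]] N[OF that] unfolding qn_def S_def by linarith
  have "(%n. Q (?c s n) (tgrad (t n))) ~~> 0"
  proof (rule Lim_null_comparison)
   show "\<forall>\<^sub>F n in sequentially. norm (Q (?c s n) (tgrad (t n))) <= qn (?c s n) * S"
   proof (rule eventually_sequentiallyI)
    fix n assume n: "N <= n"
    note D = field_diff[OF Sf[of n] U]
    show "norm (Q (?c s n) (tgrad (t n))) <= qn (?c s n) * S"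
    using Q_cauchy_schwarz[OF D Tf[of n]] mult_left_mono[OF S[OF n] qn_nonneg[OF D]] by (simp add: qn_def)
   qed
   show "(%n. qn (?c s n) * S) ~~> 0" using SU by (rule tendsto_mult_left_zero)
  qed
  moreover have "(%n. Q U (tgrad (t n))) ~~> - (?b v)"
  proof -
   have wv: "w' : C1b_P2 ==> integrable G (%f. w (Psi f) * w' (Psi f))" for w'
    using wm C1b_measurable[of w'] w2 C1b_L2[of w'] by (intro L2_product_bound) (auto simp: L2_fun_image_law)
   have wvv: "integrable G (%f. w (Psi f) * v (Psi f))"
    using wm vm w2 v2 by (intro L2_product_bound) auto
   have m: "(%f. w (Psi f)) : bm G" "(%f. t n (Psi f)) : bm G"
    "(%f. v (Psi f)) : bm G" for n
    using wm vm C1b_measurable[OF tC[of n]] by measurable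
   have t2: "integrable G (%f. (t n (Psi f))^2)" for n using C1b_L2[OF tC[of n]] by (simp add: L2_fun_image_law)
   have "(%n. sqrt ?d * sqrt (?e t n v)) ~~> sqrt ?d * sqrt 0"
    by (intro tendsto_mult tendsto_const tendsto_real_sqrt t0)
   then have l0: "(%n. sqrt ?d * sqrt (?e t n v)) ~~> 0" by simp
   have "(%n. LINT f|G. w (Psi f) * t n (Psi f)) ~~> (?b v)"
   proof (rule tendsto_by_bound[OF _ l0])
    fix n
    have tm: "(%f. t n (Psi f) - v (Psi f)) : bm G" using m(2)[of n] m(3) by measurable
    have "sqrt ((?k t n v)^2) <= sqrt (?d * (?e t n v))"
    by (rule real_sqrt_le_mono[OF L2_product_bound(2)[OF m(1) w2 tm L2_square_sum(1)[OF m(2,3) t2 v2]]])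
    moreover have "(?k t n v) = (LINT f|G. w (Psi f) * t n (Psi f)) - (?b v)"
    using wv[OF tC[of n]] wvv by (simp add: right_diff_distrib)
    ultimately show "norm ((LINT f|G. w (Psi f) * t n (Psi f)) - (?b v)) <=
    sqrt ?d * sqrt (?e t n v)"
    by (simp add: real_sqrt_mult)
   qed
   then show ?thesis unfolding ibp[OF tC] by (rule tendsto_minus)
  qed
  ultimately have "(%n. Q (?c s n) (tgrad (t n)) + Q U (tgrad (t n))) ~~>
   0 + - (?b v)" by (rule tendsto_add)
  moreover have "pre_form lam B G (s n) (t n) = Q (?c s n) (tgrad (t n)) + Q U (tgrad (t n))" for n
   unfolding pre_form_tgrad[OF sC tC] Q_diff_left[OF Sf U Tf] by simp
  moreover have "(?a v) = (?b v)"
   using wm vm by (intro integral_image_law) measurable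
  ultimately show ?thesis by simp
 qed
 have val: "generator_value lam B G u w"
  unfolding generator_value_def
 proof (intro conjI ballI w)
  fix v assume "v : form_domain lam B G"
  then obtain t where v: "v : L2_fun ?h" and t: "approximating lam B G t v" by (auto simp: form_domain_def)
  show "dirichlet_form lam B G u v = - (?a v)"
   unfolding dirichlet_form_def
  proof (rule the_equality)
   show "ALL s t. approximating lam B G s u & approximating lam B G t v --> (?j s t) ~~> - (?a v)"
    using lim[OF v] by blast
   fix r assume "ALL s t. approximating lam B G s u & approximating lam B G t v --> (?j s t) ~~> r"
   then have "(%n. pre_form lam B G (un n) (t n)) ~~> r" using apx t by blast
   then show "r = - (?a v)" using lim[OF v apx t] by (rule LIMSEQ_unique)
  qed
 qed
 show "u : generator_domain lam B G" using val dom by (auto simp: generator_domain_def)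
 define w' where "w' = generator lam B G u"
 \<comment> \<open>\<open>generator\<close> chooses some representing function. That
   \<open>w\<close> is one shows the choice to be meaningful; it is identified with \<open>w\<close>
   by orthogonality to \<open>smooth_class\<close>.\<close>
 have val': "generator_value lam B G u w'" unfolding w'_def generator_def by (rule someI[of "generator_value lam B G u", OF val])
 interpret M: prob_space "image_law lam G" by (rule prob_image_law)
 interpret approx_class "image_law lam G" smooth_class by (rule smooth_class_approx(1)[OF prob_image_law sets_image_law])
 have w'L: "w' : L2_fun ?h" using val' by (simp add: generator_value_def)
 then have wm': "w' : bm P2_borel" and w2': "integrable G (%f. (w' (Psi f))^2)" by (auto simp: L2_fun_image_law)
 have "AE mu in image_law lam G. w' mu - w mu = 0"
 proof (rule orthogonal_zero)
  show "approx S" if "S : sets ?h" for S by (rule smooth_class_approx(2)[OF prob_image_law sets_image_law that])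
  show "(%mu. w' mu - w mu) : bm ?h" using wm wm' by measurable
  have m2: "(%mu. (w' mu - w mu)^2) : bm P2_borel" using wm wm' by measurable
  have mm: "(%f. w' (Psi f)) : bm G" "(%f. w (Psi f)) : bm G" using wm wm' by measurable
  show "integrable ?h (%mu. (w' mu - w mu)^2)"
   unfolding integral_image_law(2)[OF m2] by (rule L2_square_sum(1)[OF mm w2' w2])
  fix v :: "(real^'d) measure => real" assume "v : smooth_class"
  then have v: "v : C1b_P2" by (rule smooth_class_C1b)
  note vm = C1b_measurable[OF v]
  have v2: "integrable G (%f. (v (Psi f))^2)" using C1b_L2[OF v] by (simp add: L2_fun_image_law)
  have vmm: "(%f. v (Psi f)) : bm G" using vm by measurable
  have ii: "integrable ?h (%mu. w' mu * v mu)" "integrable ?h (%mu. w mu * v mu)"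
   using L2_product_bound(1)[OF mm(1) w2' vmm v2] L2_product_bound(1)[OF mm(2) w2 vmm v2]
    integral_image_law(2)[of "%mu. w' mu * v mu"] integral_image_law(2)[of "%mu. w mu * v mu"] wm wm' vm by auto
  have "(\<integral>mu. w' mu * v mu \<partial>image_law lam G) = (?a v)"
   using val val' C1b_form_domain[OF v] unfolding generator_value_def by (metis neg_equal_iff_equal)
  then show "(\<integral>mu. (w' mu - w mu) * v mu \<partial>image_law lam G) = 0" using ii by (simp add: left_diff_distrib)
 qed
 then show "AE mu in image_law lam G. generator lam B G u mu = w mu" unfolding w'_def by simp
qed

end

section \<open>Cylinder functions\<close>

lemma C1_fun_derivative: assumes "C1_fun f" shows "(f has_derivative (%h. grad f x \<bullet> h)) (at x)"
proof -
 have d: "(f has_derivative frechet_derivative f (at x)) (at x)"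
  using assms by (simp add: C1_fun_def frechet_derivative_works[symmetric])
 interpret bounded_linear "frechet_derivative f (at x)" using d by (rule has_derivative_bounded_linear)
 have "frechet_derivative f (at x) h = grad f x \<bullet> h" for h
 proof -
  have "frechet_derivative f (at x) h = frechet_derivative f (at x) (\<Sum>k\<in>UNIV. h $ k *\<^sub>R axis k 1)"
   using basis_expansion[of h] by (simp add: scalar_mult_eq_scaleR)
  also have "... = (\<Sum>k\<in>UNIV. h $ k * partial k f x)" by (simp add: sum scaleR partial_def)
  finally show ?thesis by (simp add: inner_vec_def grad_def mult.commute)
 qed
 then have "frechet_derivative f (at x) = (%h. grad f x \<bullet> h)" by blast
 with d show ?thesis by simp
qed

lemma C1_fun_continuous: assumes "C1_fun f" shows "continuous_on UNIV (grad f)" "continuous_on UNIV f"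
proof -
 show "continuous_on UNIV (grad f)"
  unfolding grad_def using assms by (intro continuous_on_vec_lambda) (simp add: C1_fun_def)
 show "continuous_on UNIV f" by (rule differentiable_continuous_on_UNIV[OF C1_fun_derivative[OF assms]])
qed

lemma C2_funD: assumes "C2_fun f" shows "C1_fun f" "C1_fun (partial k f)"
 using assms by (auto simp: C2_fun_def)

lemma C2_fun_hessian_continuous: assumes "C2_fun f" shows "continuous_on UNIV (%x. hessian f x *v v)"
proof -
 have "continuous_on UNIV (partial k (partial l f))" for k l using C2_funD(2)[OF assms] by (simp add: C1_fun_def)
 then show ?thesis unfolding hessian_def matrix_vector_mult_def by (auto intro!: continuous_intros continuous_on_vec_lambda)
qed

lemma uniform_const:
 fixes P :: "'i::finite => real => bool"
 assumes "!!i. EX L. P i L" and mono: "!!i L L'. P i L ==> L <= L' ==> P i L'"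
 shows "EX L. ALL i. P i L"
proof -
 obtain c where c: "!!i. P i (c i)" using assms(1) by metis
 have "P i (Max (range c))" for i by (rule mono[OF c Max_ge]) auto
 then show ?thesis by blast
qed

lemma norm_vec_bound:
 fixes v :: "real^'n"
 assumes "!!k. abs (v $ k) <= C" shows "norm v <= real CARD('n) * C"
 using order_trans[OF norm_le_l1_cart[of v] sum_mono[of UNIV "%k. abs (v $ k)" "%_. C"]] assms by simp

text \<open>One constant for all later growth estimates. The gradient at 0 is included so that
  linear growth follows from the Lipschitz bound with the same constant.\<close>

definition C2_bound :: "(real^'n => real) => real => bool" where
 "C2_bound f L \<longleftrightarrow> 0 <= L & (ALL x y. norm (grad f x - grad f y) <= L * norm (x - y)) \<and>
  (ALL x v. norm (hessian f x *v v) <= L * norm v) & norm (grad f 0) <= L"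

lemma C2_bound_mono: assumes "C2_bound f L" "L <= L'" shows "C2_bound f L'"
 using assms unfolding C2_bound_def by (meson mult_right_mono norm_ge_zero order_trans)

lemma C2_bound_exists:
 fixes f :: "real^'n => real"
 assumes f: "C2_fun f" and b: "!!k l. bounded (range (partial k (partial l f)))"
 shows "EX L. C2_bound f L"
proof -
 have "EX C. ALL kl. ALL x. abs (partial (fst kl) (partial (snd kl) f) x) <= C"
  by (rule uniform_const) (use b in \<open>auto simp: bounded_iff intro: order_trans\<close>)
 then obtain C where C: "!!k l x. abs (partial k (partial l f) x) <= C" by fastforce
 have C0: "0 <= C" using C abs_ge_zero order_trans by blast
 define n where "n = real CARD('n)"
 have n0: "n >= 1" unfolding n_def by (simp add: Suc_leI)
 have g: "norm (grad (partial l f) x) <= n * C" for l x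
  unfolding n_def by (rule norm_vec_bound) (simp add: grad_def C)
 have p: "abs (partial l f x - partial l f y) <= n * C * norm (x - y)" for l x y
  by (rule lipschitz_of_gradient[OF C1_fun_derivative[OF C2_funD(2)[OF f]] g])
 have 1: "norm (grad f x - grad f y) <= n * (n * C * norm (x - y))" for x y
  unfolding n_def by (rule norm_vec_bound) (use p in \<open>simp add: grad_def n_def\<close>)
 have "abs ((hessian f x *v v) $ k) <= n * (C * norm v)" for x v k
 proof -
  have "abs ((hessian f x *v v) $ k) <= (\<Sum>l\<in>UNIV. abs (partial k (partial l f) x * v $ l))"
   unfolding matrix_vector_mult_def hessian_def by (simp add: sum_abs)
  also have "... <= (\<Sum>l\<in>(UNIV :: 'n set). C * norm v)"
   unfolding abs_mult using C C0 component_le_norm_cart by (intro sum_mono mult_mono) auto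
  finally show ?thesis by (simp add: n_def)
 qed
 then have 2: "norm (hessian f x *v v) <= n * (n * (C * norm v))" for x v
  unfolding n_def by (intro norm_vec_bound)
 have "C2_bound f (n * n * C + norm (grad f 0))"
  unfolding C2_bound_def
 proof (intro conjI allI)
  show "norm (grad f x - grad f y) <= (n * n * C + norm (grad f 0)) * norm (x - y)" for x y
   using 1[of x y] by (simp add: distrib_right mult.assoc add_increasing2)
  show "norm (hessian f x *v v) <= (n * n * C + norm (grad f 0)) * norm v" for x v
   using 2[of x v] by (simp add: distrib_right mult.assoc add_increasing2)
 qed (use n0 C0 in auto)
 then show ?thesis by blast
qed

lemma has_derivative_vec:
 fixes P :: "'n::finite => real => real"
 assumes "!!i. (P i has_real_derivative P' i) (at t)"
 shows "((%t. \<chi> i. P i t) has_derivative (%s. s *\<^sub>R (\<chi> i. P' i))) (at t)"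
proof (rule has_derivative_componentwise_within[THEN iffD2], rule ballI)
 fix b :: "real^'n" assume "b : Basis"
 then obtain i where "b = axis i 1" by (auto simp: Basis_vec_def)
 then show "((%t. (\<chi> i. P i t) \<bullet> b) has_derivative (%s. (s *\<^sub>R (\<chi> i. P' i)) \<bullet> b)) (at t)"
  using has_field_derivative_imp_has_derivative[OF assms[of i]] by (simp add: inner_axis mult_commute_abs)
qed

lemma DERIV_of_quadratic_bound:
 fixes P :: "real => real"
 assumes "!!s. abs (P (t + s) - P t - s * D) <= C * s^2"
 shows "(P has_real_derivative D) (at t)"
 unfolding DERIV_def
proof (rule Lim_null[THEN iffD2], rule Lim_null_comparison)
 show "\<forall>\<^sub>F s in at 0. norm ((P (t + s) - P t) / s - D) <= C * abs s"
 proof (rule eventually_at_filter[THEN iffD2], rule always_eventually, intro allI impI)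
  fix s :: real assume s: "s ~= 0"
  have "(P (t + s) - P t) / s - D = (P (t + s) - P t - s * D) / s" using s by (simp add: field_simps)
  then have "abs ((P (t + s) - P t) / s - D) = abs (P (t + s) - P t - s * D) / abs s" by (simp add: abs_divide)
  also have "... <= C * s^2 / abs s" using assms by (intro divide_right_mono) auto
  also have "C * s^2 / abs s = C * abs s" using s by (simp add: power2_eq_square field_simps abs_if)
  finally show "norm ((P (t + s) - P t) / s - D) <= C * abs s" by simp
 qed
 have "((%s. C * abs s) \<longlongrightarrow> C * abs (0)) (at 0)" by (intro tendsto_intros)
 then show "((%s. C * abs s) \<longlongrightarrow> 0) (at (0::real))" by simp
qed

context l2_space
begin

lemma lipschitz_comp:
 fixes D :: "real^'d => real^'d"
 assumes L: "!!x y. norm (D x - D y) <= L * norm (x - y)" "0 <= L"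
 shows "f : T ==> D o f : T" "f : T ==> nm (D o f) <= (norm (D 0) + L) * (1 + nm f)"
  "conv F f ==> conv (%n. D o F n) (D o f)"
proof -
 have Dm[measurable]: "D : bm borel"
  by (rule borel_measurable_continuous_onI[OF lipschitz_continuous_vec[OF L(1)]])
 let ?a = "%f h. %x. D (f x) - D (h x)"
 have d: "(?a f h) : T" "nm (?a f h) <= L * nm (%x. f x - h x)"
  if "f : T" "h : T" for f h
 proof -
  have m: "(?a f h) : bm borel"
   using T_measurable[OF that(1)] T_measurable[OF that(2)] by measurable
  show "(?a f h) : T" "nm (?a f h) <= L * nm (%x. f x - h x)"
   using nm_mono[OF T_diff[OF that] m L(1) L(2)] by blast+
 qed
 have c: "(%x. D 0) : T" by (rule T_bounded[of _ "norm (D 0)"]) auto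
 show DT: "D o f : T" if "f : T" for f
  using T_add[OF d(1)[OF that T_zero] c] by (simp add: comp_def)
 show "nm (D o f) <= (norm (D 0) + L) * (1 + nm f)" if f: "f : T"
 proof -
  have "nm (D o f) <= nm (%x. D 0) + nm (%x. (D o f) x - D 0)" by (rule nm_triangle_diff[OF DT[OF f] c])
  also have "... <= norm (D 0) + L * nm f"
   using d(2)[OF f T_zero] nm_bounded[of "%x. D 0" "norm (D 0)"] by (simp add: comp_def)
  also have "... <= (norm (D 0) + L) * (1 + nm f)" using L(2) by (simp add: algebra_simps)
  finally show ?thesis .
 qed
 show "conv (%n. D o F n) (D o f)" if F: "conv F f"
 proof (rule conv_bound)
  show "nm (%x. (D o F n) x - (D o f) x) <= L * nm (%x. F n x - f x)" for n
   using d(2)[OF conv_T(1)[OF F] conv_T(2)[OF F]] by (simp add: comp_def)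
  show "(%n. L * nm (%x. F n x - f x)) ~~> 0" using F by (intro tendsto_mult_right_zero) (simp add: conv_def)
 qed (use DT conv_T[OF F] in auto)
qed

definition hess :: "(real^'d => real) => (real^'d => real^'d) => (real^'d => real^'d) => real^'d => real^'d" where
 "hess \<phi> f k = (%x. hessian \<phi> (f x) *v k x)"

context
 fixes \<phi> :: "real^'d => real" and L :: real
 assumes C2: "C2_fun \<phi>" and bd: "C2_bound \<phi> L"
begin

lemma C2_boundD: "0 <= L" "norm (grad \<phi> x - grad \<phi> y) <= L * norm (x - y)" "norm (hessian \<phi> x *v v) <= L * norm v" "norm (grad \<phi> 0) <= L"
 using bd by (auto simp: C2_bound_def)

lemma C2_grad_T: "f : T ==> grad \<phi> o f : T"
 by (rule lipschitz_comp(1)[OF C2_boundD(2,1)])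

lemma C2_grad_bound: assumes "f : T" shows "nm (grad \<phi> o f) <= 2 * L * (1 + nm f)"
proof -
 have "nm (grad \<phi> o f) <= (norm (grad \<phi> 0) + L) * (1 + nm f)" by (rule lipschitz_comp(2)[OF C2_boundD(2,1) assms])
 also have "... <= 2 * L * (1 + nm f)" using C2_boundD(4) by (intro mult_right_mono) auto
 finally show ?thesis .
qed

lemma seqcont_grad: "k : T ==> seqcont (%f. ip (grad \<phi> o f) k)"
 unfolding seqcont_def using ip_conv[OF lipschitz_comp(3)[OF C2_boundD(2,1)] conv_const] by blast

lemma C2_measurable [measurable]: "\<phi> : bm borel"
 by (rule borel_measurable_continuous_onI[OF C1_fun_continuous(2)[OF C2_funD(1)[OF C2]]])

lemma hess_measurable: "f : bm borel ==> k : bm borel ==> hess \<phi> f k : bm borel"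
proof -
 assume [measurable]: "f : bm borel" "k : bm borel"
 have [measurable]: "partial i (partial j \<phi>) : bm borel" for i j
  using C2_funD(2)[OF C2, of j] by (intro borel_measurable_continuous_onI) (simp add: C1_fun_def)
 have "(%x. k x \<bullet> axis j 1) : bm borel" for j by measurable
 then have [measurable]: "(%x. k x $ j) : bm borel" for j by (simp add: inner_axis)
 have "hess \<phi> f k = (%x. \<Sum>i\<in>UNIV. (\<Sum>j\<in>UNIV. partial i (partial j \<phi>) (f x) * k x $ j) *\<^sub>R axis i 1)"
  by (auto simp: hess_def fun_eq_iff vec_eq_iff hessian_def matrix_vector_mult_def axis_def if_distrib sum.delta cong: if_cong)
 then show ?thesis by simp
qed

lemma hess_T: assumes "f : T" "k : T" shows "hess \<phi> f k : T" "nm (hess \<phi> f k) <= L * nm k"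
proof -
 have m: "hess \<phi> f k : bm borel" by (rule hess_measurable[OF T_measurable[OF assms(1)] T_measurable[OF assms(2)]])
 have b: "norm (hess \<phi> f k x) <= L * norm (k x)" for x unfolding hess_def by (rule C2_boundD(3))
 show "hess \<phi> f k : T" "nm (hess \<phi> f k) <= L * nm k" using nm_mono[OF assms(2) m b C2_boundD(1)] by blast+
qed

lemma hess_pointwise_bound: "abs (h x \<bullet> hess \<phi> f k x) <= L * (norm (h x) * norm (k x))"
proof -
 have "abs (h x \<bullet> hess \<phi> f k x) <= norm (h x) * norm (hess \<phi> f k x)" by (rule Cauchy_Schwarz_ineq2)
 also have "... <= norm (h x) * (L * norm (k x))" unfolding hess_def by (intro mult_left_mono C2_boundD(3)) simp
 finally show ?thesis by (simp add: mult_ac)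
qed

lemma norm_product_integrable: "h : T ==> k : T ==> integrable lam (%x. L * (norm (h x) * norm (k x)))"
proof -
 assume h: "h : T" and k: "k : T"
 have "integrable lam (%x. norm (h x) * norm (k x))"
 proof (rule Bochner_Integration.integrable_bound)
  show "integrable lam (%x. (norm (h x))^2 + (norm (k x))^2)" using T_integrable[OF h] T_integrable[OF k] by simp
  show "AE x in lam. norm (norm (h x) * norm (k x)) <= norm ((norm (h x))^2 + (norm (k x))^2)"
  proof (rule AE_I2)
   fix x
   have "2 * (norm (h x) * norm (k x)) <= (norm (h x))^2 + (norm (k x))^2" using sum_squares_bound[of "norm (h x)" "norm (k x)"] by simp
   moreover have "0 <= norm (h x) * norm (k x)" by simp
   ultimately have "norm (h x) * norm (k x) <= (norm (h x))^2 + (norm (k x))^2" by linarith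
   then show "norm (norm (h x) * norm (k x)) <= norm ((norm (h x))^2 + (norm (k x))^2)" by simp
  qed
  show "(%x. norm (h x) * norm (k x)) : bm lam" using T_measurable_lam[OF h] T_measurable_lam[OF k] by measurable
 qed
 then show ?thesis by simp
qed

text \<open>For fixed \<open>h\<close> and \<open>k\<close>, continuity of the Hessian gives
  pointwise convergence along almost everywhere convergent fields, and L |h| |k| is an integrable
  majorant.\<close>

lemma seqcont_hess: assumes h: "h : T" and k: "k : T" shows "seqcont (%f. ip h (hess \<phi> f k))"
proof (rule seqcontI_AE)
 fix F f assume F: "conv F f" and ae: "AE x in lam. (%n. F n x) ~~> f x"
 show "(%n. ip h (hess \<phi> (F n) k)) ~~> ip h (hess \<phi> f k)"
  unfolding l2_inner_def
 proof (rule integral_dominated_convergence[OF _ _ norm_product_integrable[OF h k]])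
  show "(%x. h x \<bullet> hess \<phi> f k x) : bm lam" "(%x. h x \<bullet> hess \<phi> (F n) k x) : bm lam" for n
   using T_measurable_lam[OF h] T_measurable_lam[OF hess_T(1)[OF conv_T(2)[OF F] k]] T_measurable_lam[OF hess_T(1)[OF conv_T(1)[OF F] k]]
   by measurable
  show "AE x in lam. (%n. h x \<bullet> hess \<phi> (F n) k x) ~~> h x \<bullet> hess \<phi> f k x"
   using ae
  proof eventually_elim
   case (elim x)
   have "(%n. hessian \<phi> (F n x) *v k x) ~~> hessian \<phi> (f x) *v k x"
    by (rule continuous_on_tendsto_compose[OF C2_fun_hessian_continuous[OF C2] elim]) auto
   then show ?case unfolding hess_def by (intro tendsto_intros)
  qed
  show "AE x in lam. norm (h x \<bullet> hess \<phi> (F n) k x) <= L * (norm (h x) * norm (k x))" for n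
   using hess_pointwise_bound by (intro AE_I2) simp
 qed
qed

text \<open>The row index of \<open>hessian\<close> belongs to the outer derivative, so the
  direction of motion \<open>h\<close> pairs with rows and \<open>k\<close> with columns.\<close>

lemma grad_inner_derivative:
 "((%s. grad \<phi> (z + s *\<^sub>R h) \<bullet> k) has_real_derivative h \<bullet> (hessian \<phi> (z + t *\<^sub>R h) *v k)) (at t)"
proof -
 let ?b = "z + t *\<^sub>R h"
 have p: "((%s. partial l \<phi> (z + s *\<^sub>R h)) has_real_derivative grad (partial l \<phi>) ?b \<bullet> h) (at t)" for l
 proof -
  have l: "((%s. z + s *\<^sub>R h) has_derivative (%s. s *\<^sub>R h)) (at t)" by (auto intro!: derivative_eq_intros)
  have "((%s. partial l \<phi> (z + s *\<^sub>R h)) has_derivative (%s. grad (partial l \<phi>) ?b \<bullet> (s *\<^sub>R h))) (at t)"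
   by (rule has_derivative_compose[OF l C1_fun_derivative[OF C2_funD(2)[OF C2]]])
  then show ?thesis unfolding has_field_derivative_def by (rule has_derivative_eq_rhs) (auto simp: mult.commute)
 qed
 let ?a = "\<Sum>l\<in>UNIV. (grad (partial l \<phi>) ?b \<bullet> h) * k $ l"
 have "((%s. \<Sum>l\<in>UNIV. partial l \<phi> (z + s *\<^sub>R h) * k $ l) has_real_derivative
   ?a) (at t)"
  by (intro DERIV_sum DERIV_cmult_right p)
 moreover have "?a = h \<bullet> (hessian \<phi> ?b *v k)"
 proof -
  have "?a =
    (\<Sum>l\<in>UNIV. \<Sum>i\<in>UNIV. h $ i * (partial i (partial l \<phi>) ?b * k $ l))"
   by (simp add: inner_vec_def grad_def sum_distrib_right sum_distrib_left mult_ac)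
  also have "... = (\<Sum>i\<in>UNIV. \<Sum>l\<in>UNIV. h $ i * (partial i (partial l \<phi>) ?b * k $ l))" by (rule sum.swap)
  finally show ?thesis by (simp add: inner_vec_def hessian_def matrix_vector_mult_def sum_distrib_left)
 qed
 ultimately show ?thesis by (simp add: inner_vec_def grad_def)
qed

text \<open>Differentiation under the integral: the Lipschitz gradient bounds the difference
  quotients by L |h| |k|. Sequences tending to 0 bring the limit into the form of dominated
  convergence.\<close>

lemma ip_grad_derivative:
 assumes f: "f : T" and h: "h : T" and k: "k : T"
 shows "((%s. ip (grad \<phi> o (%x. f x + s *\<^sub>R h x)) k) has_real_derivative ip h (hess \<phi> (%x. f x + t *\<^sub>R h x) k)) (at t)"
 unfolding DERIV_def
proof (rule LIMSEQ_SEQ_conv[THEN iffD1], intro allI impI, elim conjE)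
 fix S :: "nat => real" assume S: "ALL n. S n ~= 0" "S ~~> 0"
 let ?c = "%s x. f x + s *\<^sub>R h x"
 have cT: "grad \<phi> o ?c s : T" for s by (rule C2_grad_T[OF T_line[OF f h]])
 have gl: "norm (grad \<phi> (?c (t + s) x) - grad \<phi> (?c t x)) <= L * (abs s * norm (h x))" for s x
  using C2_boundD(2)[of "?c (t + s) x" "?c t x"] by (simp add: algebra_simps)
 let ?a = "%S n x. grad \<phi> (?c (t + S n) x) \<bullet> k x - grad \<phi> (?c t x) \<bullet> k x"
 let ?b = "%s x. grad \<phi> (?c (t + s) x) \<bullet> k x - grad \<phi> (?c t x) \<bullet> k x"
 have lim: "(%n. LINT x|lam. (?a S n x) / S n) ~~> (\<integral>x. h x \<bullet> hess \<phi> (?c t) k x \<partial>lam)"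
 proof (rule integral_dominated_convergence[OF _ _ norm_product_integrable[OF h k]])
  show "(%x. h x \<bullet> hess \<phi> (?c t) k x) : bm lam"
   using T_measurable_lam[OF h] T_measurable_lam[OF hess_T(1)[OF T_line[OF f h] k]] by measurable
  show "(%x. (?a S n x) / S n) : bm lam" for n
   using T_measurable_lam[OF cT] T_measurable_lam[OF k] unfolding comp_def by measurable
  show "AE x in lam. (%n. (?a S n x) / S n) ~~> h x \<bullet> hess \<phi> (?c t) k x"
  proof (rule AE_I2)
   fix x
   have "(%s. (?b s x) / s) \<midarrow>0\<rightarrow> h x \<bullet> hess \<phi> (?c t) k x"
    using grad_inner_derivative[of "f x" "h x" "k x" t] unfolding DERIV_def hess_def .
   from this[unfolded LIMSEQ_SEQ_conv[symmetric]] S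
   show "(%n. (?a S n x) / S n) ~~> h x \<bullet> hess \<phi> (?c t) k x" by blast
  qed
  show "AE x in lam. norm ((?a S n x) / S n) <= L * (norm (h x) * norm (k x))" for n
  proof (rule AE_I2)
   fix x
   have "abs ((grad \<phi> (?c (t + S n) x) - grad \<phi> (?c t x)) \<bullet> k x) <= L * (abs (S n) * norm (h x)) * norm (k x)"
    by (rule order_trans[OF Cauchy_Schwarz_ineq2 mult_right_mono[OF gl]]) simp
   then have "abs ((grad \<phi> (?c (t + S n) x) - grad \<phi> (?c t x)) \<bullet> k x) / abs (S n) <= L * (norm (h x) * norm (k x))"
    using S(1) by (simp add: divide_le_eq mult_ac)
   then show "norm ((?a S n x) / S n) <= L * (norm (h x) * norm (k x))"
    by (simp add: inner_diff_left abs_divide)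
  qed
 qed
 have eq: "(LINT x|lam. (?b s x) / s) =
   (ip (grad \<phi> o ?c (t + s)) k - ip (grad \<phi> o ?c t) k) / s" for s
  using inner_integrable[OF cT[of "t + s"] k] inner_integrable[OF cT[of t] k] by (simp add: l2_inner_def comp_def)
 show "(%n. (ip (grad \<phi> o ?c (t + S n)) k - ip (grad \<phi> o ?c t) k) / S n) ~~> ip h (hess \<phi> (?c t) k)"
  using lim unfolding eq by (simp only: l2_inner_def)
qed

lemma integral_phi_derivative:
 assumes f: "f : T" and h: "h : T"
 shows "((%s. \<integral>x. \<phi> x \<partial>Psi (%x. f x + s *\<^sub>R h x)) has_real_derivative ip (grad \<phi> o (%x. f x + t *\<^sub>R h x)) h) (at t)"
proof (rule DERIV_of_quadratic_bound[where C="L * (nm h)^2"])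
 fix s
 have e: "(\<integral>x. \<phi> x \<partial>Psi (%x. f x + r *\<^sub>R h x)) = (\<integral>x. \<phi> (f x + r *\<^sub>R h x) \<partial>lam)" for r
  by (rule integral_push[OF T_line[OF f h] C2_measurable])
 let ?a = "%x. f x + t *\<^sub>R h x"
 have "abs ((\<integral>x. \<phi> ((f x + t *\<^sub>R h x) + s *\<^sub>R h x) \<partial>lam) - (\<integral>x. \<phi> (f x + t *\<^sub>R h x) \<partial>lam) -
   ip (grad \<phi> o ?a) (%x. s *\<^sub>R h x)) <= L * (nm (%x. s *\<^sub>R h x))^2"
  by (rule integral_taylor(3)[OF C1_fun_derivative[OF C2_funD(1)[OF C2]] C2_boundD(2) T_line[OF f h] T_scale[OF h]])
 then show "abs ((\<integral>x. \<phi> x \<partial>Psi (%x. f x + (t + s) *\<^sub>R h x)) - (\<integral>x. \<phi> x \<partial>Psi ?a) -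
   s * ip (grad \<phi> o ?a) h) <= L * (nm h)^2 * s^2"
  unfolding e by (simp add: ip_scale_right nm_scale power_mult_distrib scaleR_add_left add.assoc mult_ac)
qed

end

end

context gaussian_space
begin

lemma deriv_along_grad:
 assumes "C2_fun \<phi>" "C2_bound \<phi> L" "h : T" "k : T"
 shows "deriv_along h (%f. ip (grad \<phi> o f) k) (%f. ip h (hess \<phi> f k))"
 by (intro deriv_alongI seqcont_measurable seqcont_line ip_grad_derivative seqcont_grad seqcont_hess assms) (use assms in auto)

lemma deriv_along_integral:
 assumes "C2_fun \<phi>" "C2_bound \<phi> L" "h : T"
 shows "deriv_along h (%f. \<integral>x. \<phi> x \<partial>Psi f) (%f. ip (grad \<phi> o f) h)"
proof (rule deriv_alongI)
 note [measurable] = C2_measurable[OF assms(1,2)]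
 show "(%f. \<integral>x. \<phi> x \<partial>Psi f) : bm TB"
  by (rule measurable_compose[OF measurable_push measurable_P2_integral]) measurable
 show "(%f. ip (grad \<phi> o f) h) : bm TB" by (rule seqcont_measurable[OF seqcont_grad[OF assms]])
 fix f assume f: "f : T"
 show "((%s. \<integral>x. \<phi> x \<partial>Psi (%x. f x + s *\<^sub>R h x)) has_real_derivative ip (grad \<phi> o (%x. f x + t *\<^sub>R h x)) h) (at t)" for t
  by (rule integral_phi_derivative[OF assms(1,2) f assms(3)])
 show "continuous_on UNIV (%t. ip (grad \<phi> o (%x. f x + t *\<^sub>R h x)) h)" by (rule seqcont_line[OF seqcont_grad[OF assms] f assms(3)])
qed

lemma deriv_along_vec:
 fixes P :: "'m::finite => (real^'d => real^'d) => real" and R :: "real^'m => real"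
 assumes P: "!!i. deriv_along h (P i) (P' i)" and R: "C1_fun R"
 shows "deriv_along h (%f. R (\<chi> i. P i f)) (%f. \<Sum>i\<in>UNIV. partial i R (\<chi> i. P i f) * P' i f)"
proof (rule deriv_alongI)
 have vm: "(%f. \<chi> i. P i f) : bm TB"
 proof (rule borel_measurable_euclidean_space[THEN iffD2], rule ballI)
  fix b :: "real^'m" assume "b : Basis"
  then obtain i where "b = axis i 1" by (auto simp: Basis_vec_def)
  then show "(%f. (\<chi> i. P i f) \<bullet> b) : bm TB" using deriv_along_measurable(1)[OF P[of i]] by (simp add: inner_axis)
 qed
 have pc: "continuous_on UNIV (partial i R)" for i using R by (simp add: C1_fun_def)
 note [measurable] = borel_measurable_continuous_onI[OF C1_fun_continuous(2)[OF R]] borel_measurable_continuous_onI[OF pc]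
  deriv_along_measurable(2)[OF P] vm
 show "(%f. R (\<chi> i. P i f)) : bm TB" "(%f. \<Sum>i\<in>UNIV. partial i R (\<chi> i. P i f) * P' i f) : bm TB" by measurable
 fix f assume f: "f : T"
 let ?a = "%f t. %x. f x + t *\<^sub>R h x"
 let ?b = "%f. %s. R (\<chi> i. P i (%x. f x + s *\<^sub>R h x))"
 show "((?b f) has_real_derivative
   (\<Sum>i\<in>UNIV. partial i R (\<chi> i. P i (?a f t)) * P' i (?a f t))) (at t)" for t
 proof -
  have "((?b f) has_derivative
    (%s. grad R (\<chi> i. P i (?a f t)) \<bullet> (s *\<^sub>R (\<chi> i. P' i (?a f t))))) (at t)"
   by (rule has_derivative_compose[OF has_derivative_vec[OF deriv_along_D(1)[OF P f]] C1_fun_derivative[OF R]])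
  then show ?thesis unfolding has_field_derivative_def
   by (rule has_derivative_eq_rhs) (auto simp: fun_eq_iff inner_vec_def grad_def sum_distrib_left sum_distrib_right mult_ac)
 qed
 have "continuous_on UNIV (%t. \<chi> i. P i (?a f t))" by (intro continuous_on_vec_lambda deriv_along_D(3)[OF P f])
 from continuous_on_compose2[OF pc this] show "continuous_on UNIV (%t. \<Sum>i\<in>UNIV. partial i R (\<chi> i. P i (?a f t)) * P' i (?a f t))"
  by (intro continuous_on_sum continuous_on_mult deriv_along_D(2)[OF P f]) auto
qed

text \<open>The form evaluated at \<open>B x\<close> and \<open>x\<close> is the squared norm of
  \<open>B x\<close>, so one factor cancels in the bound for \<open>bq\<close>.\<close>

lemma nm_B: assumes "x : T" shows "nm (B x) <= K * nm x"
proof (cases "nm (B x) = 0")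
 case False
 then have p: "0 < nm (B x)" using nm_nonneg[of "B x"] by linarith
 have "nm (B x) * nm (B x) <= K * nm (B x) * nm x"
  using bq_bound[OF B_T[OF assms] assms] nm_power2[of "B x"] by (simp add: bq_def power2_eq_square)
 then have "nm (B x) * nm (B x) <= nm (B x) * (K * nm x)" by (simp add: mult_ac)
 then show ?thesis using p by (rule mult_left_le_imp_le)
qed (use K_nonneg in simp)

text \<open>Symmetry turns the pairing with \<open>B (g m)\<close> into a coordinate of
  \<open>B x\<close>; Parseval gives the sum and Bessel a bound free of \<open>N\<close>.\<close>

lemma bq_sums:
 assumes "x : T" "y : T"
 shows "(%m. ip x (B (g m)) * ip y (g m)) sums bq x y" "abs (\<Sum>m<N. ip x (B (g m)) * ip y (g m)) <= K * nm x * nm y"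
proof -
 have e: "ip x (B (g m)) = ip (B x) (g m)" for m
  using bq_sym[OF assms(1) g_T[of m]] unfolding bq_def by (simp add: ip_sym)
 have "(%m. ip x (B (g m)) * ip y (g m)) sums ip (B x) y" unfolding e by (rule parseval[OF B_T[OF assms(1)] assms(2)])
 moreover have "ip (B x) y = bq x y" using bq_sym[OF assms] unfolding bq_def by (simp add: ip_sym)
 ultimately show "(%m. ip x (B (g m)) * ip y (g m)) sums bq x y" by simp
 have "abs (\<Sum>m<N. ip x (B (g m)) * ip y (g m)) <= (\<Sum>m<N. abs (ip (B x) (g m) * ip y (g m)))" unfolding e by (rule sum_abs)
 also have "... <= nm (B x) * nm y" by (rule bessel2[OF B_T[OF assms(1)] assms(2)])
 also have "... <= K * nm x * nm y" by (intro mult_right_mono nm_B assms) simp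
 finally show "abs (\<Sum>m<N. ip x (B (g m)) * ip y (g m)) <= K * nm x * nm y" .
qed

text \<open>The trace estimate is applied to multiplication by the Hessian, whose adjoint is
  multiplication by the transposed matrix. The bound on the partial sums serves as a majorant in
  later limits.\<close>

lemma coeff_a_sums:
 assumes C2: "C2_fun \<phi>" and bd: "C2_bound \<phi> L" and f: "f : T"
 shows "(%m. ip (B (g m)) (hess \<phi> f (g m))) sums coeff_a lam B g \<phi> f" "abs (\<Sum>m<N. ip (B (g m)) (hess \<phi> f (g m))) <= L * K"
  "abs (coeff_a lam B g \<phi> f) <= L * K"
proof -
 define M' where "M' k x = transpose (hessian \<phi> (f x)) *v k x" for k x
 have hT: "hess \<phi> f (g n) : T" for n by (rule hess_T(1)[OF C2 bd f g_T])
 have L0: "0 <= L" using bd by (simp add: C2_bound_def)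
 \<comment> \<open>The transposed matrix inherits the operator bound: for w = H^T v one has w . w =
   v . (H w).\<close>
 have t: "norm (transpose (hessian \<phi> x) *v v) <= L * norm v" for x v
 proof -
  define w where "w = transpose (hessian \<phi> x) *v v"
  have "w \<bullet> w = v \<bullet> (hessian \<phi> x *v w)" by (subst (1) w_def) (simp add: dot_lmul_matrix)
  also have "... <= norm v * norm (hessian \<phi> x *v w)" by (rule norm_cauchy_schwarz)
  also have "... <= norm v * (L * norm w)" using bd by (intro mult_left_mono) (auto simp: C2_bound_def)
  finally have w: "norm w * norm w <= norm w * (L * norm v)" by (simp add: power2_norm_eq_inner[symmetric] power2_eq_square mult_ac)
  have "norm w <= L * norm v"
  proof (cases "norm w = 0")
   case False
   then show ?thesis using w mult_le_cancel_left_pos[of "norm w"] by simp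
  qed (use L0 in simp)
  then show ?thesis by (simp only: w_def)
 qed
 have M'm: "M' k : bm borel" if k: "k : bm borel" for k
 proof -
  have [measurable]: "partial i (partial j \<phi>) : bm borel" for i j
   using C2_funD(2)[OF C2, of j] by (intro borel_measurable_continuous_onI) (simp add: C1_fun_def)
  note [measurable] = T_measurable[OF f] k
  have "(%x. k x \<bullet> axis j 1) : bm borel" for j by measurable
  then have [measurable]: "(%x. k x $ j) : bm borel" for j by (simp add: inner_axis)
  have "M' k = (%x. \<Sum>i\<in>UNIV. (\<Sum>j\<in>UNIV. partial j (partial i \<phi>) (f x) * k x $ j) *\<^sub>R axis i 1)"
   unfolding M'_def transpose_def hessian_def
   by (auto simp: fun_eq_iff vec_eq_iff matrix_vector_mult_def axis_def if_distrib sum.delta cong: if_cong)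
  then show ?thesis by simp
 qed
 have M'T: "M' k : T" "nm (M' k) <= L * nm k" if k: "k : T" for k
  using nm_mono[OF k M'm[OF T_measurable[OF k]] _ L0] t unfolding M'_def by blast+
 let ?a = "%n. hess \<phi> f (g n)"
 have "ip k (?a n) = ip (M' k) (g n)" for k n
  unfolding l2_inner_def hess_def M'_def by (simp add: dot_lmul_matrix[symmetric])
 then have b: "(\<Sum>n<N. abs (bq (?a n) (g n))) <= L * K" for N
  by (intro trace_bound[where M'=M'] L0 hT M'T)
 have e: "bq (?a n) (g n) = ip (B (g n)) (?a n)" for n by (simp add: bq_def ip_sym)
 have "summable (%n. abs (bq (?a n) (g n)))" by (rule summableI_nonneg_bounded[OF _ b]) simp
 then have "summable (%n. ip (B (g n)) (?a n))" unfolding e by (rule summable_rabs_cancel)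
 then show s: "(%m. ip (B (g m)) (hess \<phi> f (g m))) sums coeff_a lam B g \<phi> f"
  unfolding coeff_a_def hess_def by (rule summable_sums)
 show pb: "abs (\<Sum>m<N. ip (B (g m)) (hess \<phi> f (g m))) <= L * K" for N
  using order_trans[OF sum_abs b[of N]] unfolding e .
 show "abs (coeff_a lam B g \<phi> f) <= L * K"
  by (rule LIMSEQ_le_const2[OF tendsto_rabs[OF s[unfolded sums_def]]]) (use pb in blast)
qed

end

locale cylinder = gaussian_space lam g B G for lam :: "(real^'d) measure" and g B G +
 fixes F :: "real^'m => real" and \<phi> :: "'m => real^'d => real" and L :: real
 assumes F2: "C2_fun F" and \<phi>2: "!!i. C2_fun (\<phi> i)" and \<phi>b: "!!i. C2_bound (\<phi> i) L"
  and F1b: "!!i y. abs (partial i F y) <= L" and F2b: "!!i j y. abs (partial i (partial j F) y) <= L"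
begin

definition Y :: "(real^'d) measure => real^'m" where "Y mu = (\<chi> i. \<integral>x. \<phi> i x \<partial>mu)"

text \<open>The gradient of the cylinder function, already lifted to the tangent space. Since it may
  grow linearly, it enters as a limit of gradients of bounded functions and not through
  \<open>tgrad\<close>.\<close>

definition U :: "(real^'d => real^'d) => real^'d => real^'d" where
 "U f x = (\<Sum>i\<in>UNIV. partial i F (Y (Psi f)) *\<^sub>R grad (\<phi> i) (f x))"

lemma L0: "0 <= L" using \<phi>b by (simp add: C2_bound_def)

lemmas grad_T = C2_grad_T[OF \<phi>2 \<phi>b] and grad_bound = C2_grad_bound[OF \<phi>2 \<phi>b]

lemma grad_measurable: "k : T ==> (%f. ip (grad (\<phi> i) o f) k) : bm TB"
 by (rule seqcont_measurable[OF seqcont_grad[OF \<phi>2 \<phi>b]])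

lemma grad_field: "field (%f. grad (\<phi> i) o f)"
 by (rule fieldI[OF grad_T grad_measurable grad_bound])

lemma Y_measurable [measurable]: "Y : bm P2_borel"
proof (rule borel_measurable_euclidean_space[THEN iffD2], rule ballI)
 fix b :: "real^'m" assume "b : Basis"
 then obtain i where b: "b = axis i 1" by (auto simp: Basis_vec_def)
 have "(%mu. \<integral>x. \<phi> i x \<partial>mu) : bm P2_borel" by (rule measurable_P2_integral[OF C2_measurable[OF \<phi>2 \<phi>b]])
 then show "(%mu. Y mu \<bullet> b) : bm P2_borel" by (simp add: b Y_def inner_axis)
qed

lemma partial_measurable [measurable]: "partial i F : bm borel" "partial i (partial j F) : bm borel" "F : bm borel"
 using C2_funD[OF F2] C1_fun_continuous(2)[OF C2_funD(1)[OF F2]] by (auto intro!: borel_measurable_continuous_onI simp: C1_fun_def)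

lemma U_eq: "U f = (%x. \<Sum>i\<in>UNIV. partial i F (Y (Psi f)) *\<^sub>R (grad (\<phi> i) o f) x)"
 by (simp add: U_def fun_eq_iff)

lemma U_T: "f : T ==> U f : T"
 unfolding U_eq by (intro T_sum T_scale grad_T)

lemma ip_U: assumes "f : T" "k : T" shows "ip (U f) k = (\<Sum>i\<in>UNIV. partial i F (Y (Psi f)) * ip (grad (\<phi> i) o f) k)"
proof -
 have "ip (U f) k = (\<Sum>i\<in>UNIV. ip (%x. partial i F (Y (Psi f)) *\<^sub>R (grad (\<phi> i) o f) x) k)"
  unfolding U_eq by (intro ip_sum_left T_scale grad_T assms)
 then show ?thesis by (simp only: ip_scale_left comp_def)
qed

text \<open>One term per index: \<open>L\<close> bounds the derivative of \<open>F\<close>, and 2 L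
  is the growth constant of the lifted gradients.\<close>

definition "CU = real CARD('m) * (L * (2 * L))"

lemma U_bound: assumes "f : T" shows "nm (U f) <= CU * (1 + nm f)"
proof -
 let ?a = "%I. %x. \<Sum>i\<in>I. partial i F (Y (Psi f)) *\<^sub>R (grad (\<phi> i) o f) x"
 let ?b = "%i. %x. partial i F (Y (Psi f)) *\<^sub>R (grad (\<phi> i) o f) x"
 have "nm (?a I) <= (\<Sum>i\<in>I. L * (2 * L * (1 + nm f)))" if "finite I" for I
  using that
 proof (induction I)
  case (insert i I)
  have "nm (%x. \<Sum>i\<in>insert i I. partial i F (Y (Psi f)) *\<^sub>R (grad (\<phi> i) o f) x) <=
    nm (?b i) + nm (?a I)"
   unfolding sum.insert[OF insert(1,2)] by (intro nm_triangle T_sum T_scale grad_T assms)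
  moreover have "nm (?b i) <= L * (2 * L * (1 + nm f))"
   unfolding nm_scale using F1b grad_bound[OF assms, of i] L0 by (intro mult_mono) (simp_all add: comp_def)
  ultimately show ?case using insert(3) sum.insert[OF insert(1,2), of "%_. L * (2 * L * (1 + nm f))"] by linarith
 qed simp
 from this[of UNIV] show ?thesis unfolding U_eq by (simp add: CU_def mult.assoc)
qed

lemma U_field: "field U"
proof (rule fieldI[OF U_T _ U_bound])
 fix k assume k: "k : T"
 have "(%f. \<Sum>i\<in>UNIV. partial i F (Y (Psi f)) * ip (grad (\<phi> i) o f) k) : bm TB"
  using grad_measurable[OF k] by measurable
 then show "(%f. ip (U f) k) : bm TB"
  by (rule measurable_cong[THEN iffD2, rotated]) (simp add: ip_U[OF _ k])
qed

text \<open>Product rule for \<open>ip (U f) k\<close> along \<open>h\<close>: the inner sum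
  differentiates the coefficient, the last term the gradient of \<phi> i.\<close>

definition dU :: "(real^'d => real^'d) => (real^'d => real^'d) => (real^'d => real^'d) => real" where
 "dU h k f = (\<Sum>i\<in>UNIV. (\<Sum>j\<in>UNIV. partial j (partial i F) (Y (Psi f)) * ip (grad (\<phi> j) o f) h) * ip (grad (\<phi> i) o f) k
  + partial i F (Y (Psi f)) * ip h (hess (\<phi> i) f k))"

lemma deriv_along_U:
 assumes h: "h : T" and k: "k : T"
 shows "deriv_along h (%f. ip (U f) k) (dU h k)"
proof -
 have d: "deriv_along h (%f. \<Sum>i\<in>UNIV. partial i F (Y (Psi f)) * ip (grad (\<phi> i) o f) k) (dU h k)"
  unfolding dU_def Y_def
  by (intro deriv_along_sum deriv_along_mult deriv_along_vec deriv_along_integral[OF \<phi>2 \<phi>b h] deriv_along_grad[OF \<phi>2 \<phi>b h k] C2_funD(2)[OF F2])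
 show ?thesis
 proof (rule deriv_alongI)
  show "(%f. ip (U f) k) : bm TB" using U_field k by (simp add: field_def)
  fix f t assume f: "f : T"
  show "((%s. ip (U (%x. f x + s *\<^sub>R h x)) k) has_real_derivative dU h k (%x. f x + t *\<^sub>R h x)) (at t)"
   using deriv_along_D(1)[OF d f, of t] by (simp add: ip_U[OF T_line[OF f h] k])
 qed (use deriv_along_measurable(2)[OF d] deriv_along_D(2)[OF d] in auto)
qed

definition gen :: "(real^'d => real^'d) => real" where
 "gen f = (\<Sum>i\<in>UNIV. partial i F (Y (Psi f)) * (coeff_a lam B g (\<phi> i) f - ip f (grad (\<phi> i) o f))) +
  (\<Sum>i\<in>UNIV. \<Sum>j\<in>UNIV. partial i (partial j F) (Y (Psi f)) * coeff_b lam B (\<phi> i) (\<phi> j) f)"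

lemma coeff_b_bq: "coeff_b lam B (\<phi> i) (\<phi> j) f = bq (grad (\<phi> i) o f) (grad (\<phi> j) o f)"
 by (simp add: coeff_b_def bq_def)

text \<open>Partial sum of the Gaussian divergence of \<open>U\<close>, the adjoint of the gradient
  for the form; term m comes from partial integration along \<open>B (g m)\<close>. The limit is
  minus \<open>gen\<close>.\<close>

definition SN :: "nat => (real^'d => real^'d) => real" where
 "SN N f = (\<Sum>m<N. ip (U f) (g m) * ip (g m) f - dU (B (g m)) (g m) f)"

lemma SN_eq: 
 "SN N f = (\<Sum>m<N. ip (U f) (g m) * ip f (g m)) -
  (\<Sum>i\<in>UNIV. (\<Sum>j\<in>UNIV. partial j (partial i F) (Y (Psi f)) * (\<Sum>m<N. ip (grad (\<phi> j) o f) (B (g m)) * ip (grad (\<phi> i) o f) (g m)))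
   + partial i F (Y (Psi f)) * (\<Sum>m<N. ip (B (g m)) (hess (\<phi> i) f (g m))))"
proof -
 let ?c = "Y (Psi f)"
 let ?e = "%j. grad (\<phi> j) o f"
 let ?a = "%i m. \<Sum>j\<in>UNIV. partial j (partial i F) ?c * ip (?e j) (B (g m))"
 let ?d = "%i. grad (\<phi> i) o f"
 let ?b = "%i. \<Sum>j\<in>UNIV. partial j (partial i F) ?c * (\<Sum>m<N. ip (?e j) (B (g m)) * ip (?d i) (g m))"
 have "(\<Sum>m<N. dU (B (g m)) (g m) f) = (\<Sum>i\<in>UNIV. \<Sum>m<N. (?a i m) * ip (?d i) (g m)
  + partial i F ?c * ip (B (g m)) (hess (\<phi> i) f (g m)))"
  unfolding dU_def by (rule sum.swap)
 also have "... = (\<Sum>i\<in>UNIV. (?b i)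
   + partial i F ?c * (\<Sum>m<N. ip (B (g m)) (hess (\<phi> i) f (g m))))"
 proof (intro sum.cong refl)
  fix i
  have "(\<Sum>m<N. (?a i m) * ip (?d i) (g m)) =
   (\<Sum>m<N. \<Sum>j\<in>UNIV. partial j (partial i F) ?c * (ip (?e j) (B (g m)) * ip (?d i) (g m)))"
   by (simp add: sum_distrib_right mult.assoc)
  also have "... = (\<Sum>j\<in>UNIV. \<Sum>m<N. partial j (partial i F) ?c * (ip (?e j) (B (g m)) * ip (?d i) (g m)))"
   by (rule sum.swap)
  finally show "(\<Sum>m<N. (?a i m) * ip (?d i) (g m)
    + partial i F ?c * ip (B (g m)) (hess (\<phi> i) f (g m))) =
   (?b i)
   + partial i F ?c * (\<Sum>m<N. ip (B (g m)) (hess (\<phi> i) f (g m)))"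
   by (simp add: sum.distrib sum_distrib_left)
 qed
 finally show ?thesis unfolding SN_def sum_subtractf by (simp add: ip_sym[of _ f])
qed

lemma SN_tendsto: assumes f: "f : T" shows "(%N. SN N f) ~~> - gen f"
proof -
 let ?a = "Y (Psi f)"
 let ?b = "%i. grad (\<phi> i) o f"
 have "(%N. SN N f) ~~> ip (U f) f - (\<Sum>i\<in>UNIV. (\<Sum>j\<in>UNIV. partial j (partial i F) ?a * bq (grad (\<phi> j) o f) (?b i))
   + partial i F ?a * coeff_a lam B g (\<phi> i) f)"
  unfolding SN_eq
  using parseval[OF U_T[OF f] f] bq_sums(1)[OF grad_T[OF f] grad_T[OF f]] coeff_a_sums(1)[OF \<phi>2 \<phi>b f]
  unfolding sums_def by (intro tendsto_intros)
 moreover have "ip (U f) f = (\<Sum>i\<in>UNIV. partial i F ?a * ip f (?b i))"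
  using ip_U[OF f f] by (simp add: ip_sym[of f])
 \<comment> \<open>Renaming the indices adjusts the order of the second partial derivatives to that
   in \<open>gen\<close>.\<close>
 moreover have "(\<Sum>i\<in>UNIV. \<Sum>j\<in>UNIV. partial j (partial i F) ?a * bq (grad (\<phi> j) o f) (?b i)) =
  (\<Sum>i\<in>UNIV. \<Sum>j\<in>UNIV. partial i (partial j F) ?a * bq (?b i) (grad (\<phi> j) o f))"
  by (rule sum.swap)
 ultimately show ?thesis by (simp add: gen_def coeff_b_bq sum.distrib right_diff_distrib sum_subtractf diff_diff_eq add.commute)
qed

definition "CS = CU + (\<Sum>i\<in>(UNIV::'m set). (\<Sum>j\<in>(UNIV::'m set). L * (K * (2 * L) * (2 * L))) + L * (L * K))"

text \<open>Each of the three sums over m is controlled independently of \<open>N\<close>, by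
  Bessel's inequality or by the trace estimate, which gives a majorant of quadratic growth.\<close>

lemma SN_bound: assumes f: "f : T" shows "abs (SN N f) <= CS * (1 + nm f)^2"
proof -
 define r' where "r' = 1 + nm f"
 have r: "1 <= r'" "r' <= r'^2" "1 <= r'^2" "nm f <= r'" by (simp_all add: r'_def power2_eq_square algebra_simps)
 note Ub = U_bound[OF f, folded r'_def] and gb = grad_bound[OF f, folded r'_def]
 have CU0: "0 <= CU" using L0 by (simp add: CU_def)
 have "abs (\<Sum>m<N. ip (U f) (g m) * ip f (g m)) <= nm (U f) * nm f"
  by (rule order_trans[OF sum_abs bessel2[OF U_T[OF f] f]])
 also have "... <= CU * r' * r'" using Ub r CU0 by (intro mult_mono) auto
 finally have 1: "abs (\<Sum>m<N. ip (U f) (g m) * ip f (g m)) <= CU * r'^2" by (simp add: power2_eq_square mult.assoc)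
 let ?a = "%j. grad (\<phi> j) o f"
 let ?b = "%i. grad (\<phi> i) o f"
 let ?d = "Y (Psi f)"
 let ?e = "K * (2 * L) * (2 * L)"
 have 2: "abs (partial j (partial i F) ?d * (\<Sum>m<N. ip (?a j) (B (g m)) * ip (?b i) (g m))) <= L * ?e * r'^2" for i j
 proof -
  have "abs (\<Sum>m<N. ip (?a j) (B (g m)) * ip (?b i) (g m)) <= K * nm (?a j) * nm (?b i)"
   by (rule bq_sums(2)[OF grad_T[OF f] grad_T[OF f]])
  also have "... <= K * (2 * L * r') * (2 * L * r')" using gb K_nonneg L0 r by (intro mult_mono mult_nonneg_nonneg) auto
  finally have "abs (\<Sum>m<N. ip (?a j) (B (g m)) * ip (?b i) (g m)) <= K * (2 * L) * (2 * L) * r'^2" by (simp only: power2_eq_square mult_ac)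
  then have "abs (partial j (partial i F) ?d) * abs (\<Sum>m<N. ip (?a j) (B (g m)) * ip (?b i) (g m)) <= L * (K * (2 * L) * (2 * L) * r'^2)"
   using F2b L0 by (intro mult_mono) auto
  then show ?thesis unfolding abs_mult by (simp add: mult.assoc)
 qed
 let ?c = "%i. \<Sum>m<N. ip (B (g m)) (hess (\<phi> i) f (g m))"
 have 3: "abs (partial i F ?d * (?c i)) <= L * (L * K) * r'^2" for i
 proof -
  have "abs (partial i F ?d * (?c i)) <= L * (L * K)"
   unfolding abs_mult using F1b coeff_a_sums(2)[OF \<phi>2 \<phi>b f] L0 by (intro mult_mono) auto
  also have "... <= L * (L * K) * r'^2" using mult_left_mono[OF r(3), of "L * (L * K)"] L0 K_nonneg by simp
  finally show ?thesis .
 qed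
 have "abs (\<Sum>i\<in>UNIV. (\<Sum>j\<in>UNIV. partial j (partial i F) ?d * (\<Sum>m<N. ip (?a j) (B (g m)) * ip (?b i) (g m)))
   + partial i F ?d * (?c i)) <=
   (\<Sum>i\<in>(UNIV::'m set). (\<Sum>j\<in>(UNIV::'m set). L * ?e * r'^2) + L * (L * K) * r'^2)"
  by (intro order_trans[OF sum_abs sum_mono] order_trans[OF abs_triangle_ineq add_mono] 2 3)
 also have "... = (\<Sum>i\<in>(UNIV::'m set). (\<Sum>j\<in>(UNIV::'m set). L * ?e) + L * (L * K)) * r'^2"
  by (simp only: sum_distrib_right distrib_right)
 finally have "abs (SN N f) <= CS * r'^2" using 1 unfolding SN_eq CS_def distrib_right[of CU] by linarith
 then show ?thesis by (simp only: r'_def)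
qed

lemma SN_measurable: "SN N : bm TB"
proof -
 have [measurable]: "(%f. ip (U f) (g m)) : bm TB" for m using U_field by (simp add: field_def)
 have [measurable]: "dU (B (g m)) (g m) : bm TB" for m
  by (rule deriv_along_measurable(2)[OF deriv_along_U]) (simp_all add: B_T)
 show ?thesis unfolding SN_def[abs_def] by measurable
qed

lemma gen_measurable [measurable]: "gen : bm TB"
proof -
 have "(%f. - gen f) : bm TB"
  by (rule borel_measurable_LIMSEQ_real[OF _ SN_measurable]) (use SN_tendsto in simp)
 then have "(%f. - (- gen f)) : bm TB" by measurable
 then show ?thesis by simp
qed

lemma gen_bound: assumes "f : T" shows "abs (gen f) <= CS * (1 + nm f)^2"
 using LIMSEQ_le_const2[OF tendsto_rabs[OF SN_tendsto[OF assms]], of "CS * (1 + nm f)^2"] SN_bound[OF assms] by auto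

lemma CS_nonneg: "0 <= CS" using order_trans[OF abs_ge_zero gen_bound[OF T_zero]] by simp

text \<open>Partial integration in each of the directions \<open>B g\<^sub>m\<close>, summed over \<open>m < N\<close>; then \<open>N \<rightarrow> \<infinity>\<close>.\<close>

theorem generator_by_parts:
 assumes v: "v : C1b_P2"
 shows "Q U (tgrad v) = - (LINT f|G. gen f * v (Psi f))"
proof -
 obtain Cv where Cv: "!!mu. mu : P2 ==> abs (v mu) <= Cv" using C1b_bounded[OF v] by blast
 have Cv0: "0 <= Cv" using Cv[OF lam] by linarith
 have vb: "abs (v (Psi f)) <= Cv" if "f : T" for f by (rule Cv[OF push_P2[OF that]])
 obtain Ct where Ct: "!!f. f : T ==> nm (tgrad v f) <= Ct" using tgrad(2)[OF v] by blast
 have Ct0: "0 <= Ct" using Ct[OF T_zero] nm_nonneg order_trans by blast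
 have CU0: "0 <= CU" using L0 by (simp add: CU_def)
 note tT = field_T[OF tgrad(1)[OF v]]
 have gn: "nm (g m) = 1" for m using g_ortho[of m m] by (simp add: l2_norm_def)
 have bT: "B (g m) : T" for m by (simp add: B_T)
 have r: "1 <= 1 + nm f" "1 + nm f <= (1 + nm f)^4" "(1 + nm f)^2 <= (1 + nm f)^4" "nm f <= 1 + nm f" for f
  using self_le_power[of "1 + nm f" 4] power_increasing[of 2 4 "1 + nm f"] by auto
 note vm = deriv_along_measurable(1)[OF tgrad(3)[OF v T_zero]]
 have tm: "(%f. ip (tgrad v f) k) : bm TB" if "k : T" for k using tgrad(1)[OF v] that by (simp add: field_def)
 have Um: "(%f. ip (U f) k) : bm TB" if "k : T" for k using U_field that by (simp add: field_def)
 have dm: "dU (B (g m)) (g m) : bm TB" for m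
  by (rule deriv_along_measurable(2)[OF deriv_along_U[OF bT g_T]])
 have Ub: "abs (ip (U f) (g m)) <= CU * (1 + nm f)" if "f : T" for f m
  using ip_bound[OF U_T[OF that] g_T, of m] U_bound[OF that] gn by simp
 have i1: "integrable G (%f. ip (tgrad v f) (B (g m)) * ip (U f) (g m))" for m
 proof (rule growth_integrable[where C="Ct * nm (B (g m)) * CU"])
  show "(%f. ip (tgrad v f) (B (g m)) * ip (U f) (g m)) : bm TB" using tm[OF bT[of m]] Um[OF g_T[of m]] by measurable
  fix f assume f: "f : T"
  have "abs (ip (tgrad v f) (B (g m))) <= Ct * nm (B (g m))"
   by (rule order_trans[OF ip_bound[OF tT[OF f] bT] mult_right_mono[OF Ct[OF f]]]) simp
  then have "abs (ip (tgrad v f) (B (g m))) * abs (ip (U f) (g m)) <= Ct * nm (B (g m)) * (CU * (1 + nm f))"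
   using Ub[OF f, of m] Ct0 by (intro mult_mono) auto
  also have "... <= Ct * nm (B (g m)) * (CU * (1 + nm f)^4)" using Ct0 CU0 r(2) by (intro mult_left_mono) auto
  finally show "abs (ip (tgrad v f) (B (g m)) * ip (U f) (g m)) <= Ct * nm (B (g m)) * CU * (1 + nm f)^4" by (simp add: abs_mult mult.assoc)
 qed
 have i2: "integrable G (%f. v (Psi f) * ip (U f) (g m) * ip (g m) f)" for m
 proof (rule growth_integrable[where C="Cv * CU"])
  show "(%f. v (Psi f) * ip (U f) (g m) * ip (g m) f) : bm TB"
   using vm Um[OF g_T[of m]] measurable_ip(2)[OF g_T[of m]] by measurable
  fix f assume f: "f : T"
  have "abs (ip (g m) f) <= 1 + nm f" using ip_bound[OF g_T f, of m] gn by simp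
  then have "abs (v (Psi f)) * abs (ip (U f) (g m)) * abs (ip (g m) f) <= Cv * (CU * (1 + nm f)) * (1 + nm f)"
   using Ub[OF f, of m] Cv0 CU0 vb[OF f] by (intro mult_mono) auto
  also have "... = Cv * CU * (1 + nm f)^2" by (simp add: power2_eq_square)
  also have "... <= Cv * CU * (1 + nm f)^4" using Cv0 CU0 r(3) by (intro mult_left_mono) auto
  finally show "abs (v (Psi f) * ip (U f) (g m) * ip (g m) f) <= Cv * CU * (1 + nm f)^4" by (simp add: abs_mult)
 qed
 let ?h = "%N. %f. v (Psi f) * SN N f"
 have iSN: "integrable G (?h N)" for N
 proof (rule growth_integrable[where C="Cv * CS"])
  show "(?h N) : bm TB" using vm SN_measurable[of N] by measurable
  fix f assume f: "f : T"
  have "abs (v (Psi f)) * abs (SN N f) <= Cv * (CS * (1 + nm f)^2)" by (intro mult_mono vb SN_bound f Cv0) auto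
  also have "... <= Cv * (CS * (1 + nm f)^4)" using Cv0 CS_nonneg r(3) by (intro mult_left_mono) auto
  finally show "abs (v (Psi f) * SN N f) <= Cv * CS * (1 + nm f)^4" by (simp add: abs_mult mult.assoc)
 qed
 \<comment> \<open>The divergence term with index m is a difference of consecutive
   \<open>SN\<close>, so integrability of the \<open>dU\<close> part follows from that of the
   others.\<close>
 have i3: "integrable G (%f. v (Psi f) * dU (B (g m)) (g m) f)" for m
 proof -
  have "(%f. v (Psi f) * dU (B (g m)) (g m) f) = (%f. v (Psi f) * ip (U f) (g m) * ip (g m) f - (v (Psi f) * SN (Suc m) f - v (Psi f) * SN m f))"
   by (simp add: fun_eq_iff SN_def algebra_simps)
  then show ?thesis using i2 iSN by simp
 qed
 let ?b = "%f m. ip (U f) (g m) * ip (g m) f - dU (B (g m)) (g m) f"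
 let ?c = "%m. LINT f|G. v (Psi f) * ip (U f) (g m) * ip (g m) f"
 let ?e = "%m. LINT f|G. ip (tgrad v f) (B (g m)) * ip (U f) (g m)"
 have ibp: "(?e m) =
   (LINT f|G. v (Psi f) * (?b f m))" for m
 proof -
  have d: "deriv_along (B (g m)) (%f. v (Psi f) * ip (U f) (g m))
    (%f. ip (tgrad v f) (B (g m)) * ip (U f) (g m) + v (Psi f) * dU (B (g m)) (g m) f)"
   by (rule deriv_along_mult[OF tgrad(3)[OF v bT] deriv_along_U[OF bT g_T]])
  have "(LINT f|G. ip (tgrad v f) (B (g m)) * ip (U f) (g m) + v (Psi f) * dU (B (g m)) (g m) f) =
    (?c m)"
   by (rule integration_by_parts[OF g_T _ d]) (use i1 i2 i3 nondegenerate[of m] in \<open>auto simp: bq_def\<close>)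
  then have "(?e m) =
    (?c m) - (LINT f|G. v (Psi f) * dU (B (g m)) (g m) f)" using i1 i3 by simp
  also have "... = (LINT f|G. v (Psi f) * ip (U f) (g m) * ip (g m) f - v (Psi f) * dU (B (g m)) (g m) f)" using i2 i3 by simp
  finally show ?thesis by (simp add: right_diff_distrib mult.assoc)
 qed
 have i4: "integrable G (%f. v (Psi f) * (?b f m))" for m
  using Bochner_Integration.integrable_diff[OF i2[of m] i3[of m]] by (simp add: right_diff_distrib mult.assoc)
 let ?a = "%N f. \<Sum>m<N. ip (tgrad v f) (B (g m)) * ip (U f) (g m)"
 have eq: "(LINT f|G. (?a N f)) = (LINT f|G. v (Psi f) * SN N f)" for N
 proof -
  have "(LINT f|G. (?a N f)) = (\<Sum>m<N. LINT f|G. ip (tgrad v f) (B (g m)) * ip (U f) (g m))"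
   using i1 by (rule Bochner_Integration.integral_sum)
  also have "... = (\<Sum>m<N. LINT f|G. v (Psi f) * (?b f m))" unfolding ibp ..
  also have "... = (LINT f|G. (\<Sum>m<N. v (Psi f) * (?b f m)))"
   using i4 by (rule Bochner_Integration.integral_sum[symmetric])
  finally show ?thesis by (simp add: SN_def sum_distrib_left)
 qed
 have dom: "integrable G (%f. C * (1 + nm f)^2)" if "0 <= C" for C
 proof (rule growth_integrable[where C=C])
  show "(%f. C * (1 + nm f)^2) : bm TB" by measurable
  show "abs (C * (1 + nm f)^2) <= C * (1 + nm f)^4" if "f : T" for f using mult_left_mono[OF r(3)[of f] \<open>0 <= C\<close>] \<open>0 <= C\<close> by simp
 qed
 let ?d = "LINT f|G. v (Psi f) * - gen f"
 let ?i = "LINT f|G. bq (tgrad v f) (U f)"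
 \<comment> \<open>Both sides of the summed identity pass to the limit under majorants of quadratic
   growth that do not depend on \<open>N\<close>.\<close>
 have "(%N. LINT f|G. (?a N f)) ~~> ?i"
 proof (rule integral_dominated_convergence[where w="%f. K * Ct * CU * (1 + nm f)^2"])
  show "(%f. bq (tgrad v f) (U f)) : bm G" using bq_field(1)[OF tgrad(1)[OF v] U_field] by measurable
  show "(%f. \<Sum>m<N. ip (tgrad v f) (B (g m)) * ip (U f) (g m)) : bm G" for N
   using tm[OF bT] Um[OF g_T] by measurable
  show "integrable G (%f. K * Ct * CU * (1 + nm f)^2)" using K_nonneg Ct0 CU0 by (intro dom) simp
  show "AE f in G. (%N. \<Sum>m<N. ip (tgrad v f) (B (g m)) * ip (U f) (g m)) ~~> bq (tgrad v f) (U f)"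
   using bq_sums(1)[OF tT U_T] by (intro AE_I2) (simp add: sums_def)
  show "AE f in G. norm (?a N f) <= K * Ct * CU * (1 + nm f)^2" for N
  proof (rule AE_I2)
   fix f assume "f : space G"
   then have f: "f : T" by simp
   have "abs (\<Sum>m<N. ip (tgrad v f) (B (g m)) * ip (U f) (g m)) <= K * nm (tgrad v f) * nm (U f)" by (rule bq_sums(2)[OF tT[OF f] U_T[OF f]])
   also have "... <= K * Ct * (CU * (1 + nm f))" using K_nonneg Ct[OF f] U_bound[OF f] Ct0 by (intro mult_mono) auto
   also have "... <= K * Ct * (CU * (1 + nm f)^2)" using K_nonneg Ct0 CU0 by (intro mult_left_mono) (auto simp: power2_eq_square algebra_simps)
   finally show "norm (?a N f) <= K * Ct * CU * (1 + nm f)^2" by (simp add: mult.assoc)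
  qed
 qed
 moreover have "(%N. LINT f|G. v (Psi f) * SN N f) ~~> ?d"
 proof (rule integral_dominated_convergence[where w="%f. Cv * CS * (1 + nm f)^2"])
  show "(%f. v (Psi f) * - gen f) : bm G" using vm by measurable
  show "(?h N) : bm G" for N using vm SN_measurable[of N] by measurable
  show "integrable G (%f. Cv * CS * (1 + nm f)^2)" using Cv0 CS_nonneg by (intro dom) simp
  show "AE f in G. (%N. v (Psi f) * SN N f) ~~> v (Psi f) * - gen f"
   using SN_tendsto by (intro AE_I2 tendsto_mult tendsto_const) simp
  show "AE f in G. norm (v (Psi f) * SN N f) <= Cv * CS * (1 + nm f)^2" for N
  proof (rule AE_I2)
   fix f assume "f : space G"
   then have f: "f : T" by simp
   have "abs (v (Psi f)) * abs (SN N f) <= Cv * (CS * (1 + nm f)^2)" by (intro mult_mono vb SN_bound f Cv0) auto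
   then show "norm (v (Psi f) * SN N f) <= Cv * CS * (1 + nm f)^2" by (simp add: abs_mult mult.assoc)
  qed
 qed
 ultimately have "?i = ?d" unfolding eq by (rule LIMSEQ_unique)
 then have "Q (tgrad v) U = - (LINT f|G. gen f * v (Psi f))" by (simp add: Q_def mult.commute)
 then show ?thesis using Q_sym[OF U_field tgrad(1)[OF v]] by simp
qed

end

section \<open>Conditional expectations given the push-forward\<close>

text \<open>The level sets of a simple function are preimages under \<open>h\<close>, which yields
  the factor at once. In general \<open>lim\<close> of these factors is measurable on all of the
  target and has the right value on the range of \<open>h\<close>.\<close>

lemma doob_dynkin:
 fixes q :: "'a => real"
 assumes h: "h : X \<rightarrow> space M" and q: "q : bm (vimage_algebra X h M)"
 shows "EX r:bm M. ALL x:X. r (h x) = q x"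
proof -
 let ?V = "vimage_algebra X h M"
 from borel_measurable_implies_sequence_metric[OF q, of 0] obtain s where
  s0: "ALL i. simple_function ?V (s i)" "ALL x:space ?V. (%i. s i x) ~~> q x"
  by (elim exE conjE) blast
 have "EX r:bm M. ALL x:X. r (h x) = s i x" for i
 proof -
  have s: "simple_function ?V (s i)" using s0 by blast
  have fin: "finite (s i ` X)" using s by (simp add: simple_function_def)
  have "EX A. A : sets M & s i -` {y} \<inter> X = h -` A \<inter> X" for y
  proof -
   have "s i -` {y} \<inter> space ?V : sets ?V" by (rule measurable_sets[OF borel_measurable_simple_function[OF s]]) simp
   then show ?thesis unfolding sets_vimage_algebra2[OF h] by auto
  qed
  then have "ALL y. EX A. A : sets M & s i -` {y} \<inter> X = h -` A \<inter> X" by blast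
  from choice[OF this] obtain A where A0: "ALL y. A y : sets M & s i -` {y} \<inter> X = h -` A y \<inter> X" ..
  note A = conjunct1[OF spec[OF A0]] conjunct2[OF spec[OF A0]]
  have m: "(%z. \<Sum>y\<in>s i ` X. y * indicator (A y) z) : bm M" using A(1) by measurable
  have e: "(\<Sum>y\<in>s i ` X. y * indicator (A y) (h x)) = s i x" if x: "x : X" for x
  proof -
   have "h x : A y \<longleftrightarrow> s i x = y" for y
   proof -
    have "x : s i -` {y} \<inter> X \<longleftrightarrow> x : h -` A y \<inter> X" by (simp only: A(2))
    then show ?thesis using x by auto
   qed
   then have "(\<Sum>y\<in>s i ` X. y * indicator (A y) (h x)) = (\<Sum>y\<in>s i ` X. if s i x = y then y else 0)"
    by (intro sum.cong) (auto simp: indicator_def)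
   then show ?thesis using fin x by simp
  qed
  show ?thesis by (rule bexI[OF _ m]) (intro ballI e)
 qed
 then have "ALL i. EX r. r : bm M & (ALL x:X. r (h x) = s i x)" unfolding Bex_def by (rule allI)
 from choice[OF this] obtain r where r0: "ALL i. r i : bm M & (ALL x:X. r i (h x) = s i x)" ..
 have r: "r i : bm M" "x : X ==> r i (h x) = s i x" for i x
  using r0[rule_format, of i] by blast+
 have "(%z. lim (%i. r i z)) : bm M" using r(1) by (rule borel_measurable_lim_metric)
 moreover have "lim (%i. r i (h x)) = q x" if "x : X" for x
  using s0(2) that r(2)[OF that] by (auto intro!: limI)
 ultimately show ?thesis by (intro bexI[of _ "%z. lim (%i. r i z)"]) auto
qed

context gaussian_space
begin

definition "GF = vimage_algebra (space G) (Psi) P2_borel"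

lemma push_space: "Psi : space G \<rightarrow> space P2_borel" using push_P2 by auto

lemma push_measurable_G: "Psi : measurable G P2_borel" by measurable

lemma subalgebra_GF: "subalgebra G GF"
 unfolding subalgebra_def GF_def sets_vimage_algebra2[OF push_space]
 using measurable_sets[OF push_measurable_G] by auto

sublocale GF: finite_measure_subalgebra G GF
 by (simp add: finite_measure_subalgebra_def finite_measure_subalgebra_axioms_def subalgebra_GF G.finite_measure_axioms)

text \<open>\<open>cond_exp_push\<close> is a choice; the factorisation through the push-forward
  shows that an admissible function exists.\<close>

lemma cond_exp_push:
 "cond_exp_push lam G w : bm P2_borel"
 "AE f in G. cond_exp_push lam G w (Psi f) = real_cond_exp G GF w f"
proof -
 let ?a = "vimage_algebra (space G) (Psi) P2_borel"
 have "real_cond_exp G GF w : bm ?a"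
  using borel_measurable_cond_exp[of G GF w] unfolding GF_def .
 from doob_dynkin[OF push_space this] obtain r where
  r: "r : bm P2_borel" "!!f. f : space G ==> r (Psi f) = real_cond_exp G GF w f" by blast
 have "r : bm P2_borel & (AE f in G. r (Psi f) = real_cond_exp G ?a w f)"
  using r by (auto simp: GF_def)
 from someI[of "%h. h : bm P2_borel & (AE f in G. h (Psi f) = real_cond_exp G ?a w f)", OF this]
 show "cond_exp_push lam G w : bm P2_borel"
  "AE f in G. cond_exp_push lam G w (Psi f) = real_cond_exp G GF w f"
  unfolding cond_exp_push_def GF_def by blast+
qed

text \<open>The weight is a function of the push-forward and hence measurable for \<open>GF\<close>,
  so the conditioning disappears under the integral.\<close>

lemma integral_cond_exp_push:
 assumes r: "r : bm P2_borel" and w: "w : bm TB" and i: "integrable G (%f. r (Psi f) * w f)"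
 shows "integrable G (%f. r (Psi f) * cond_exp_push lam G w (Psi f))"
  "(LINT f|G. r (Psi f) * cond_exp_push lam G w (Psi f)) = (LINT f|G. r (Psi f) * w f)"
proof -
 have rF: "(%f. r (Psi f)) : bm GF"
  unfolding GF_def by (rule measurable_compose[OF measurable_vimage_algebra1[OF push_space] r])
 have wG: "w : bm G" using w by measurable
 note c = GF.real_cond_exp_intg[OF i rF wG]
 note [measurable] = r cond_exp_push(1)[of w]
 let ?a = "%f. r (Psi f) * cond_exp_push lam G w (Psi f)"
 have m: "?a : bm G" by measurable
 have ae: "AE f in G. r (Psi f) * real_cond_exp G GF w f = r (Psi f) * cond_exp_push lam G w (Psi f)"
  using cond_exp_push(2)[of w] by eventually_elim simp
 have m2: "(%f. r (Psi f) * real_cond_exp G GF w f) : bm G" using c(1) by (rule borel_measurable_integrable)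
 show "integrable G ?a"
  using c(1) integrable_cong_AE[OF m2 m ae] by simp
 show "(LINT f|G. r (Psi f) * cond_exp_push lam G w (Psi f)) = (LINT f|G. r (Psi f) * w f)"
  using c(2) integral_cong_AE[OF m2 m ae] by simp
qed

text \<open>Conditional Jensen inequality for the square.\<close>

lemma cond_exp_push_L2:
 assumes w: "w : bm TB" and w2: "integrable G (%f. (w f)^2)"
 shows "cond_exp_push lam G w : L2_fun (image_law lam G)"
proof -
 have wG: "w : bm G" using w by measurable
 have w1: "integrable G w" by (rule G.square_integrable_imp_integrable[OF wG w2])
 have cv: "convex_on UNIV (%x::real. x^2)" by (rule convex_power2)
 have jensen: "AE f in G. (real_cond_exp G GF w f)^2 <= real_cond_exp G GF (%f. (w f)^2) f"
  by (rule GF.real_cond_exp_jensens_inequality(2)[OF w1 _ _ w2 cv]) auto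
 note [measurable] = cond_exp_push(1)[of w]
 let ?a = "%f. (cond_exp_push lam G w (Psi f))^2"
 have "integrable G ?a"
 proof (rule Bochner_Integration.integrable_bound[OF GF.real_cond_exp_int(1)[OF w2]])
  show "?a : bm G" by measurable
  show "AE f in G. norm ((cond_exp_push lam G w (Psi f))^2) <= norm (real_cond_exp G GF (%f. (w f)^2) f)"
   using jensen cond_exp_push(2)[of w] by eventually_elim simp
 qed
 then show ?thesis by (simp add: L2_fun_image_law cond_exp_push(1))
qed

end

section \<open>Approximation of cylinder functions\<close>

text \<open>Unbounded functions are cut off by composition with \<open>t \<mapsto> c sin (t / c)\<close>, \<open>c = n + 1\<close>, which is bounded,
 has bounded derivatives and converges to the identity.\<close>

definition sc :: "nat => real => real" where "sc n t = real (Suc n) * sin (t / real (Suc n))"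

definition cc :: "nat => real => real" where "cc n t = cos (t / real (Suc n))"

lemma sc_deriv: "(sc n has_real_derivative cc n t) (at t)"
proof -
 have "((%t. real (Suc n) * sin (t / real (Suc n))) has_real_derivative real (Suc n) * (cos (t / real (Suc n)) * (1 / real (Suc n)))) (at t)"
  by (intro DERIV_cmult DERIV_chain2[OF DERIV_sin] DERIV_cdivide DERIV_ident)
 then show ?thesis unfolding sc_def[abs_def] cc_def by simp
qed

lemma sc_bounds: "abs (sc n t) <= real (Suc n)" "abs (sc n t) <= abs t" "abs (cc n t) <= 1"
proof -
 have "real (Suc n) * abs (sin (t / real (Suc n))) <= real (Suc n) * 1" by (rule mult_left_mono) auto
 then show "abs (sc n t) <= real (Suc n)" by (simp add: sc_def abs_mult)
 have "real (Suc n) * abs (sin (t / real (Suc n))) <= real (Suc n) * abs (t / real (Suc n))"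
  by (rule mult_left_mono[OF abs_sin_x_le_abs_x]) simp
 also have "... = abs t" by (simp add: abs_divide)
 finally show "abs (sc n t) <= abs t" by (simp add: sc_def abs_mult)
qed (simp add: cc_def)

lemma real_lipschitz_of_derivative:
 fixes h :: "real => real"
 assumes "!!t. (h has_real_derivative h' t) (at t)" "!!t. abs (h' t) <= C"
 shows "abs (h a - h b) <= C * abs (a - b)"
 using lipschitz_of_gradient[of h h' C a b] assms by (simp add: has_field_derivative_def)

lemma sc_lipschitz: "abs (sc n a - sc n b) <= abs (a - b)"
 using real_lipschitz_of_derivative[OF sc_deriv sc_bounds(3), of n a b] by simp

lemma cc_lipschitz: "abs (cc n a - cc n b) <= abs (a - b)"
proof -
 have "abs (cos s - cos r) <= 1 * abs (s - r)" for s r :: real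
  by (rule real_lipschitz_of_derivative[OF DERIV_cos]) simp
 from this[of "a / real (Suc n)" "b / real (Suc n)"]
 have "abs (cc n a - cc n b) <= abs (a - b) / real (Suc n)" by (simp add: cc_def diff_divide_distrib[symmetric] abs_divide)
 also have "... <= abs (a - b)" by (simp add: divide_le_eq mult_le_cancel_left1)
 finally show ?thesis .
qed

lemma cc_tendsto: assumes "t ~~> l" shows "(%n. cc n (t n)) ~~> 1"
proof -
 have "(%n. t n * inverse (real (Suc n))) ~~> l * 0" by (intro tendsto_mult assms LIMSEQ_inverse_real_of_nat)
 then have "(%n. t n / real (Suc n)) ~~> 0" unfolding divide_inverse by simp
 from tendsto_cos[OF this] show ?thesis unfolding cc_def by simp
qed

lemma sc_tendsto: assumes "t ~~> l" shows "(%n. sc n (t n)) ~~> l"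
proof -
 have "((%h. sin (l * h)) has_real_derivative cos (l * 0) * l) (at 0)" by (auto intro!: derivative_eq_intros)
 then have d: "(%h. (sin (l * (0 + h)) - sin (l * 0)) / h) \<midarrow>0\<rightarrow> l" unfolding DERIV_def by simp
 have "(%n. (sin (l * (0 + inverse (real (Suc n)))) - sin (l * 0)) / inverse (real (Suc n))) ~~> l"
  using d[unfolded LIMSEQ_SEQ_conv[symmetric], rule_format, of "%n. inverse (real (Suc n))"] LIMSEQ_inverse_real_of_nat by simp
 then have 1: "(%n. sc n l) ~~> l" by (simp add: sc_def divide_inverse mult.commute)
 have t0: "(%n. abs (t n - l)) ~~> 0" using assms by (simp add: LIM_zero tendsto_rabs_zero)
 have "(%n. sc n (t n) - sc n l) ~~> 0" by (rule tendsto_by_bound[OF _ t0]) (use sc_lipschitz in simp)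
 from tendsto_add[OF this 1] show ?thesis by simp
qed

text \<open>Cutting every coordinate confines the argument to a bounded set, on which the linearly
  growing gradient of \<phi> is bounded.\<close>

definition cut :: "nat => real^'d => real^'d" where "cut n x = (\<chi> k. sc n (x $ k))"

definition cut_grad :: "nat => (real^'d => real) => real^'d => real^'d" where
 "cut_grad n \<phi> x = (\<chi> k. cc n (x $ k) * grad \<phi> (cut n x) $ k)"

lemma cut_norm: "norm (cut n x) <= norm x" "norm (cut n x) <= real CARD('d) * real (Suc n)" for x :: "real^'d"
proof -
 show "norm (cut n x) <= norm x" by (rule norm_le_componentwise_cart) (simp add: cut_def sc_bounds(2))
 show "norm (cut n x) <= real CARD('d) * real (Suc n)" by (rule norm_vec_bound) (simp add: cut_def sc_bounds(1) del: of_nat_Suc)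
qed

lemma cut_lipschitz: "norm (cut n x - cut n y) <= norm (x - y)"
 by (rule norm_le_componentwise_cart) (simp add: cut_def sc_lipschitz)

lemma cut_tendsto: "(%n. cut n x) ~~> x"
proof -
 have "(%n. \<chi> k. sc n (x $ k)) ~~> (\<chi> k. x $ k)" by (intro tendsto_vec_lambda sc_tendsto tendsto_const)
 then show ?thesis by (simp add: cut_def)
qed

lemma cut_derivative: "(cut n has_derivative (%h. \<chi> k. cc n (x $ k) * h $ k)) (at x)"
proof (rule has_derivative_componentwise_within[THEN iffD2], rule ballI)
 fix b :: "real^'a" assume "b : Basis"
 then obtain k where b: "b = axis k 1" by (auto simp: Basis_vec_def)
 have "((%x. sc n (x $ k)) has_derivative (%h. cc n (x $ k) * h $ k)) (at x)"
  by (rule has_derivative_compose[OF bounded_linear_imp_has_derivative[OF bounded_linear_vec_nth]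
    has_field_derivative_imp_has_derivative[OF sc_deriv]])
 then show "((%x. cut n x \<bullet> b) has_derivative (%h. (\<chi> k. cc n (x $ k) * h $ k) \<bullet> b)) (at x)"
  by (simp add: b cut_def inner_axis)
qed

lemma C2_bound_grad: assumes "C2_bound \<phi> L" shows "norm (grad \<phi> x) <= L * (1 + norm x)"
proof -
 have "norm (grad \<phi> x) <= norm (grad \<phi> 0) + norm (grad \<phi> x - grad \<phi> 0)" using norm_triangle_ineq[of "grad \<phi> 0" "grad \<phi> x - grad \<phi> 0"] by simp
 also have "... <= L + L * norm (x - 0)" using assms unfolding C2_bound_def by (intro add_mono) blast+
 finally show ?thesis by (simp add: algebra_simps)
qed

lemma cut_grad_bound: assumes "C2_bound \<phi> L" shows "norm (cut_grad n \<phi> x) <= L * (1 + norm (cut n x))" "norm (cut_grad n \<phi> x) <= L * (1 + norm x)"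
proof -
 have "norm (cut_grad n \<phi> x) <= norm (grad \<phi> (cut n x))"
 proof (rule norm_le_componentwise_cart)
  show "norm (cut_grad n \<phi> x $ k) <= norm (grad \<phi> (cut n x) $ k)" for k
   using mult_right_mono[OF sc_bounds(3)[of n "x $ k"], of "abs (grad \<phi> (cut n x) $ k)"] by (simp add: cut_grad_def abs_mult)
 qed
 also have "... <= L * (1 + norm (cut n x))" by (rule C2_bound_grad[OF assms])
 finally show *: "norm (cut_grad n \<phi> x) <= L * (1 + norm (cut n x))" .
 have "0 <= L" using assms by (simp add: C2_bound_def)
 then have "L * (1 + norm (cut n x)) <= L * (1 + norm x)" using cut_norm(1)[of n x] by (intro mult_left_mono) auto
 then show "norm (cut_grad n \<phi> x) <= L * (1 + norm x)" using * by linarith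
qed

text \<open>By the chain rule the components of \<open>cut_grad\<close> are products of two bounded
  Lipschitz functions.\<close>

lemma smooth_fun_cut:
 fixes \<phi> :: "real^'d => real"
 assumes C2: "C2_fun \<phi>" and bd: "C2_bound \<phi> L"
 shows "EX C L'. smooth_fun (%x. \<phi> (cut n x)) (cut_grad n \<phi>) C L'"
proof -
 have L: "0 <= L" "!!x y. norm (grad \<phi> x - grad \<phi> y) <= L * norm (x - y)" using bd by (auto simp: C2_bound_def)
 define C where "C = L * (1 + real CARD('d) * real (Suc n))"
 have gC: "norm (grad \<phi> (cut n x)) <= C" for x
  unfolding C_def by (rule order_trans[OF C2_bound_grad[OF bd] mult_left_mono[OF _ L(1)]]) (use cut_norm(2)[of n x] in simp)
 have C0: "0 <= C" using order_trans[OF norm_ge_zero gC] .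
 let ?a = "%x y. grad \<phi> (cut n x) - grad \<phi> (cut n y)"
 let ?b = "%x. \<phi> (cut n x)"
 let ?c = "%x y. cut_grad n \<phi> x - cut_grad n \<phi> y"
 have "smooth_fun ?b (cut_grad n \<phi>) C (real CARD('d) * (L + C))"
  unfolding smooth_fun_def
 proof (intro conjI allI)
  fix x y :: "real^'d"
  show "(?b has_derivative (%h. cut_grad n \<phi> x \<bullet> h)) (at x)"
  proof (rule has_derivative_eq_rhs)
   show "(?b has_derivative (%h. grad \<phi> (cut n x) \<bullet> (\<chi> k. cc n (x $ k) * h $ k))) (at x)"
    by (rule has_derivative_compose[OF cut_derivative C1_fun_derivative[OF C2_funD(1)[OF C2]]])
  qed (simp add: fun_eq_iff cut_grad_def inner_vec_def mult_ac)
  show "norm (cut_grad n \<phi> x) <= C"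
   unfolding C_def by (rule order_trans[OF cut_grad_bound(1)[OF bd] mult_left_mono[OF _ L(1)]]) (use cut_norm(2)[of n x] in simp)
  have "abs ((?c x y) $ k) <= (L + C) * norm (x - y)" for k
  proof -
   have "(?c x y) $ k =
    cc n (x $ k) * (?a x y) $ k + (cc n (x $ k) - cc n (y $ k)) * grad \<phi> (cut n y) $ k"
    by (simp add: cut_grad_def algebra_simps)
   moreover have "abs (cc n (x $ k) * (?a x y) $ k) <= 1 * (L * norm (x - y))"
    unfolding abs_mult
   proof (intro mult_mono sc_bounds(3))
    have "abs ((?a x y) $ k) <= L * norm (cut n x - cut n y)"
    by (rule order_trans[OF component_le_norm_cart L(2)])
    also have "... <= L * norm (x - y)" by (rule mult_left_mono[OF cut_lipschitz L(1)])
    finally show "abs ((?a x y) $ k) <= L * norm (x - y)" .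
   qed auto
   moreover have "abs ((cc n (x $ k) - cc n (y $ k)) * grad \<phi> (cut n y) $ k) <= norm (x - y) * C"
    unfolding abs_mult
   proof (intro mult_mono)
    show "abs (cc n (x $ k) - cc n (y $ k)) <= norm (x - y)"
    using order_trans[OF cc_lipschitz component_le_norm_cart[of "x - y" k, simplified]] by simp
    show "abs (grad \<phi> (cut n y) $ k) <= C" by (rule order_trans[OF component_le_norm_cart gC])
   qed auto
   ultimately show ?thesis by (simp add: algebra_simps)
  qed
  from norm_vec_bound[OF this] show "norm (?c x y) <= real CARD('d) * (L + C) * norm (x - y)"
   by (simp add: mult.assoc)
 qed
 then show ?thesis by blast
qed

lemma C2_growth:
 fixes \<phi> :: "real^'d => real"
 assumes C2: "C2_fun \<phi>" and bd: "C2_bound \<phi> L"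
 shows "abs (\<phi> x) <= (abs (\<phi> 0) + 2 * L) * (1 + (norm x)^2)"
proof -
 have L: "0 <= L" "!!x y. norm (grad \<phi> x - grad \<phi> y) <= L * norm (x - y)" "norm (grad \<phi> 0) <= L" using bd by (auto simp: C2_bound_def)
 have 1: "abs (\<phi> (0 + x) - \<phi> 0 - grad \<phi> 0 \<bullet> x) <= L * (norm x)^2"
  by (rule taylor_bound[OF C1_fun_derivative[OF C2_funD(1)[OF C2]] L(2)])
 have 2: "abs (grad \<phi> 0 \<bullet> x) <= L * norm x"
  by (rule order_trans[OF Cauchy_Schwarz_ineq2 mult_right_mono[OF L(3)]]) simp
 have "norm x <= 1 + (norm x)^2" using sum_squares_bound[of 1 "norm x"] norm_ge_zero[of x] by (simp only: power_one mult_1_right)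
 then have 3: "L * norm x <= L * (1 + (norm x)^2)" using L(1) by (rule mult_left_mono)
 have 4: "0 <= abs (\<phi> 0) * (norm x)^2" "0 <= L * (norm x)^2" using L(1) by simp_all
 have e: "(abs (\<phi> 0) + 2 * L) * (1 + (norm x)^2) = abs (\<phi> 0) + 2 * L + abs (\<phi> 0) * (norm x)^2 + 2 * (L * (norm x)^2)"
  "L * (1 + (norm x)^2) = L + L * (norm x)^2" by (simp_all add: algebra_simps)
 show ?thesis using 1 2 3 4 L(1) unfolding e add_0 by linarith
qed

lemma (in gaussian_space) lift_unique:
 assumes u: "!!mu. mu : P2 ==> is_intrinsic_grad u mu (v mu)" "!!mu. mu : P2 ==> is_intrinsic_grad u mu (w mu)" and f: "f : T"
 shows "AE x in lam. lift v f x = lift w f x"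
proof -
 note P = push_P2[OF f]
 have [measurable]: "v (Psi f) : bm borel" "w (Psi f) : bm borel"
  using u[OF P] by (auto simp: is_intrinsic_grad_def tangent_def)
 have "{x : space borel. v (Psi f) x = w (Psi f) x} : sets borel" by measurable
 then have "{x. v (Psi f) x = w (Psi f) x} : sets borel" by simp
 from AE_push[OF f this is_intrinsic_grad_unique[OF P u[OF P]]] show ?thesis by (simp add: lift_def)
qed

lemma (in gaussian_space) growth_square_integrable:
 assumes q: "q : bm TB" and b: "!!f. f : T ==> abs (q f) <= C * (1 + nm f)^2"
 shows "integrable G (%f. (q f)^2)"
proof (rule growth_integrable[where C="C^2"])
 show "(%f. (q f)^2) : bm TB" using q by measurable
 fix f assume "f : T"
 from power_mono[OF b[OF this] abs_ge_zero, of 2] show "abs ((q f)\<^sup>2) <= C^2 * (1 + nm f) ^ 4"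
  by (simp add: power_mult_distrib flip: power_mult)
qed

context cylinder
begin

lemma nm_growth:
 assumes f: "f : T" and X: "X : bm borel" and b: "!!x. norm (X x) <= M * (1 + norm (f x))"
 shows "(norm (X x))^2 <= 2 * M^2 * (1 + (norm (f x))^2)" "integrable lam (%x. 2 * M^2 * (1 + (norm (f x))^2))"
  "(nm X)^2 <= 2 * M^2 * (1 + (nm f)^2)"
proof -
 let ?a = "%x. 1 + (norm (f x))^2"
 show p: "(norm (X x))^2 <= 2 * M^2 * (?a x)" for x
 proof -
  have "(norm (X x))^2 <= (M * (1 + norm (f x)))^2" by (rule power_mono[OF b]) simp
  also have "... = M^2 * (1 + norm (f x))^2" by (simp add: power_mult_distrib)
  also have "... <= M^2 * (2 * (?a x))"
   using sum_squares_bound[of 1 "norm (f x)"] by (intro mult_left_mono) (simp_all add: power2_sum)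
  finally show ?thesis by (simp add: algebra_simps)
 qed
 show i: "integrable lam (%x. 2 * M^2 * (?a x))" using T_integrable[OF f] by simp
 have XT: "X : T" by (rule T_dominated[OF X i p])
 have "(nm X)^2 <= (LINT x|lam. 2 * M^2 * (?a x))"
  unfolding nm_power2_integral by (rule integral_mono[OF T_integrable[OF XT] i p])
 also have "... = 2 * M^2 * (1 + (nm f)^2)"
  unfolding nm_power2_integral using T_integrable[OF f] prob_space by simp
 finally show "(nm X)^2 <= 2 * M^2 * (1 + (nm f)^2)" .
qed

text \<open>Two cut-offs with different purposes: the inner \<open>cut n\<close> makes the gradients
  bounded, the outer \<open>sc n\<close> in \<open>un\<close> makes the values bounded. Together
  they place \<open>un n\<close> in \<open>C1b_P2\<close>.\<close>

definition "yn n mu = (\<chi> i. \<integral>x. \<phi> i (cut n x) \<partial>mu)"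
definition "un n mu = sc n (F (yn n mu))"
definition "vn n mu x = (\<Sum>i\<in>UNIV. ((cc n (F (yn n mu)) *\<^sub>R grad F (yn n mu)) $ i) *\<^sub>R cut_grad n (\<phi> i) x)"

lemma grad_F_bound: "norm (grad F y) <= real CARD('m) * L"
 by (rule norm_vec_bound) (simp add: grad_def F1b)

lemma F_derivative: "(F has_derivative (%h. grad F y \<bullet> h)) (at y)"
 by (rule C1_fun_derivative[OF C2_funD(1)[OF F2]])

lemma un_smooth: "smooth_P2 (un n) (vn n)"
proof -
 have "EX C L'. smooth_fun (%x. \<phi> i (cut n x)) (cut_grad n (\<phi> i)) C L'" for i by (rule smooth_fun_cut[OF \<phi>2 \<phi>b])
 then have s: "smooth_P2 (%mu. \<integral>x. \<phi> i (cut n x) \<partial>mu) (%mu. cut_grad n (\<phi> i))" for i using smooth_P2_integral by blast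
 have Fc: "continuous_on UNIV F" by (rule C1_fun_continuous(2)[OF C2_funD(1)[OF F2]])
 let ?a = "%mu. \<chi> i. \<integral>x. \<phi> i (cut n x) \<partial>mu"
 have "smooth_P2 (%mu. sc n (F (?a mu)))
  (%mu x. \<Sum>i\<in>UNIV. ((cc n (F (?a mu)) *\<^sub>R grad F (?a mu)) $ i) *\<^sub>R cut_grad n (\<phi> i) x)"
 proof (rule smooth_P2_compose[OF s, where DF="%y. cc n (F y) *\<^sub>R grad F y" and F="%y. sc n (F y)" and C="1 * (real CARD('m) * L)"])
  show "((%y. sc n (F y)) has_derivative (%h. (cc n (F y) *\<^sub>R grad F y) \<bullet> h)) (at y)" for y
   using has_derivative_compose[OF F_derivative has_field_derivative_imp_has_derivative[OF sc_deriv]] by simp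
  show "continuous_on UNIV (%y. cc n (F y) *\<^sub>R grad F y)"
   unfolding cc_def using Fc C1_fun_continuous(1)[OF C2_funD(1)[OF F2]] by (intro continuous_intros) auto
  show "norm (cc n (F y) *\<^sub>R grad F y) <= 1 * (real CARD('m) * L)" for y
   unfolding norm_scaleR by (intro mult_mono sc_bounds(3) grad_F_bound) auto
 qed
 then show ?thesis by (simp add: un_def[abs_def] vn_def[abs_def] yn_def[abs_def])
qed

lemma un_C1b: "un n : C1b_P2" and vn_version: "continuous_grad_version (un n) (vn n)"
 using smooth_P2_C1b[OF un_smooth, of n "real (Suc n)"] sc_bounds(1) by (auto simp: un_def simp del: of_nat_Suc)

definition "Cp = (\<Sum>i\<in>UNIV. abs (\<phi> i 0)) + 2 * L"

lemma Cp0: "0 <= Cp" using L0 by (simp add: Cp_def sum_nonneg)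

lemma phi_growth: "abs (\<phi> i x) <= Cp * (1 + (norm x)^2)"
proof -
 have "abs (\<phi> i 0) <= (\<Sum>i\<in>UNIV. abs (\<phi> i 0))" by (rule member_le_sum) auto
 then have "(abs (\<phi> i 0) + 2 * L) * (1 + (norm x)^2) <= Cp * (1 + (norm x)^2)" unfolding Cp_def by (intro mult_right_mono) auto
 then show ?thesis using C2_growth[OF \<phi>2 \<phi>b, of i x] by linarith
qed

lemma phi_cut_growth: "abs (\<phi> i (cut n x)) <= Cp * (1 + (norm x)^2)"
proof -
 have "(norm (cut n x))^2 <= (norm x)^2" by (rule power_mono[OF cut_norm(1)]) simp
 then have "Cp * (1 + (norm (cut n x))^2) <= Cp * (1 + (norm x)^2)" using Cp0 by (intro mult_left_mono) auto
 then show ?thesis using phi_growth[of i "cut n x"] by linarith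
qed

lemma cut_continuous: "continuous_on UNIV (cut n :: real^'d => _)"
 by (rule lipschitz_continuous_vec[where L=1]) (use cut_lipschitz in simp)

lemma phi_continuous: "continuous_on UNIV (\<phi> i)"
 by (rule C1_fun_continuous(2)[OF C2_funD(1)[OF \<phi>2]])

lemma phi_cut_measurable [measurable]: "(%x. \<phi> i (cut n x)) : bm borel" "\<phi> i : bm borel"
 by (intro borel_measurable_continuous_onI continuous_on_compose2[OF phi_continuous cut_continuous] phi_continuous; simp)+

lemma Y_push: "f : T ==> Y (Psi f) = (\<chi> i. \<integral>x. \<phi> i (f x) \<partial>lam)"
 and yn_push: "f : T ==> yn n (Psi f) = (\<chi> i. \<integral>x. \<phi> i (cut n (f x)) \<partial>lam)"
 by (simp_all add: Y_def yn_def integral_push)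

lemma phi_integral_bound:
 assumes f: "f : T" and m: "h : bm borel" and b: "!!x. abs (h x) <= Cp * (1 + (norm x)^2)"
 shows "abs (LINT x|lam. h (f x)) <= Cp * (1 + (nm f)^2)"
proof -
 have i: "integrable lam (%x. Cp * (1 + (norm (f x))^2))" using T_integrable[OF f] by simp
 have hm: "(%x. h (f x)) : bm lam" using T_measurable_lam[OF f] m by measurable
 have hi: "integrable lam (%x. abs (h (f x)))"
  by (rule Bochner_Integration.integrable_bound[OF i]) (use hm b Cp0 in \<open>auto intro!: AE_I2\<close>)
 have "abs (LINT x|lam. h (f x)) <= (\<integral>x. abs (h (f x)) \<partial>lam)" by (rule integral_abs_bound)
 also have "... <= (LINT x|lam. Cp * (1 + (norm (f x))^2))" by (rule integral_mono[OF hi i b])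
 also have "... = Cp * (1 + (nm f)^2)" unfolding nm_power2_integral using T_integrable[OF f] prob_space by simp
 finally show ?thesis .
qed

definition "CF = abs (F 0) + real CARD('m) * L * (real CARD('m) * Cp)"

text \<open>\<open>F\<close> is Lipschitz and its arguments grow quadratically, so the composition
  still grows only quadratically; its square is within reach of the fourth moment.\<close>

lemma F_growth:
 assumes f: "!!i. abs (y $ i) <= Cp * (1 + r^2)" and r: "0 <= r"
 shows "abs (F y) <= CF * (1 + r)^2"
proof -
 have n: "norm y <= real CARD('m) * (Cp * (1 + r^2))" by (rule norm_vec_bound[OF f])
 have "abs (F y - F 0) <= real CARD('m) * L * norm (y - 0)" by (rule lipschitz_of_gradient[OF F_derivative grad_F_bound])
 also have "... <= real CARD('m) * L * (real CARD('m) * (Cp * (1 + r^2)))" using n L0 by (intro mult_left_mono) auto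
 finally have 1: "abs (F y) <= abs (F 0) + real CARD('m) * L * (real CARD('m) * Cp) * (1 + r^2)" by (simp add: mult.assoc)
 have r2: "1 + r^2 <= (1 + r)^2" "1 <= (1 + r)^2" using r by (simp_all add: power2_sum)
 have "real CARD('m) * L * (real CARD('m) * Cp) * (1 + r^2) <= real CARD('m) * L * (real CARD('m) * Cp) * (1 + r)^2"
  using r2 L0 Cp0 by (intro mult_left_mono mult_nonneg_nonneg) auto
 moreover have "abs (F 0) <= abs (F 0) * (1 + r)^2" using mult_left_mono[OF r2(2), of "abs (F 0)"] by simp
 ultimately show ?thesis using 1 unfolding CF_def distrib_right[of "abs (F 0)"] by linarith
qed

lemma u_growth: assumes f: "f : T" shows "abs (F (Y (Psi f))) <= CF * (1 + nm f)^2"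
 by (rule F_growth) (use phi_integral_bound[OF f phi_cut_measurable(2) phi_growth] in \<open>simp_all add: Y_push[OF f]\<close>)

lemma un_growth: assumes f: "f : T" shows "abs (un n (Psi f)) <= CF * (1 + nm f)^2"
proof -
 have "abs (F (yn n (Psi f))) <= CF * (1 + nm f)^2"
  by (rule F_growth) (use phi_integral_bound[OF f phi_cut_measurable(1) phi_cut_growth] in \<open>simp_all add: yn_push[OF f]\<close>)
 then show ?thesis unfolding un_def using sc_bounds(2) order_trans by blast
qed

lemma yn_tendsto: assumes f: "f : T" shows "(%n. yn n (Psi f)) ~~> Y (Psi f)"
 unfolding Y_push[OF f] yn_push[OF f]
proof (intro tendsto_vec_lambda)
 fix i
 show "(%n. \<integral>x. \<phi> i (cut n (f x)) \<partial>lam) ~~> (\<integral>x. \<phi> i (f x) \<partial>lam)"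
 proof (rule integral_dominated_convergence)
  show "(%x. \<phi> i (f x)) : bm lam" "(%x. \<phi> i (cut n (f x))) : bm lam" for n
   using measurable_compose[OF T_measurable_lam[OF f] phi_cut_measurable(1)] measurable_compose[OF T_measurable_lam[OF f] phi_cut_measurable(2)] by auto
  show "integrable lam (%x. Cp * (1 + (norm (f x))^2))" using T_integrable[OF f] by simp
  show "AE x in lam. (%n. \<phi> i (cut n (f x))) ~~> \<phi> i (f x)"
   by (intro AE_I2 continuous_on_tendsto_compose[OF phi_continuous cut_tendsto]) auto
  show "AE x in lam. norm (\<phi> i (cut n (f x))) <= Cp * (1 + (norm (f x))^2)" for n
   using phi_cut_growth by (intro AE_I2) simp
 qed
qed

lemma F_continuous: "continuous_on UNIV F" "continuous_on UNIV (partial i F)"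
 using C1_fun_continuous(2)[OF C2_funD(1)[OF F2]] C2_funD(1)[OF F2] by (auto simp: C1_fun_def)

lemma F_yn_tendsto: assumes f: "f : T" shows "(%n. F (yn n (Psi f))) ~~> F (Y (Psi f))"
 by (rule continuous_on_tendsto_compose[OF F_continuous(1) yn_tendsto[OF f]]) auto

lemma u_L2: "(%mu. F (Y mu)) : L2_fun (image_law lam G)"
proof -
 have m: "(%mu. F (Y mu)) : bm P2_borel" by measurable
 have "(%f. F (Y (Psi f))) : bm TB" by (rule measurable_compose[OF measurable_push m])
 then show ?thesis unfolding L2_fun_image_law using m growth_square_integrable[OF _ u_growth] by blast
qed

lemma un_tendsto: "(%n. LINT f|G. (un n (Psi f) - F (Y (Psi f)))^2) ~~> 0"
proof -
 have m: "(%f. F (Y (Psi f))) : bm G" "(%f. un n (Psi f)) : bm G" for n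
  using C1b_measurable[OF un_C1b[of n]] by measurable
 have CF0: "0 <= CF" using L0 Cp0 by (simp add: CF_def)
 let ?a = "%n f. un n (Psi f) - F (Y (Psi f))"
 have "(%n. LINT f|G. (?a n f)^2) ~~> (LINT f|G. 0)"
 proof (rule integral_dominated_convergence)
  show "(%f. (?a n f)^2) : bm G" for n using m(1) m(2)[of n] by measurable
  show "integrable G (%f. (2 * CF)^2 * (1 + nm f)^4)"
   by (rule growth_integrable[where C="(2 * CF)^2"]) auto
  show "AE f in G. (%n. (?a n f)^2) ~~> 0"
  proof (rule AE_I2)
   fix f assume "f : space G"
   then have f: "f : T" by simp
   have "(%n. (?a n f)^2) ~~> (F (Y (Psi f)) - F (Y (Psi f)))\<^sup>2"
    unfolding un_def by (intro tendsto_intros sc_tendsto F_yn_tendsto[OF f])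
   then show "(%n. (?a n f)^2) ~~> 0" by simp
  qed
  show "AE f in G. norm ((?a n f)^2) <= (2 * CF)^2 * (1 + nm f)^4" for n
  proof (rule AE_I2)
   fix f assume "f : space G"
   then have f: "f : T" by simp
   have "abs (un n (Psi f) - F (Y (Psi f))) <= 2 * CF * (1 + nm f)^2" using un_growth[OF f, of n] u_growth[OF f] by linarith
   then have "abs (un n (Psi f) - F (Y (Psi f)))^2 <= (2 * CF * (1 + nm f)^2)^2" by (rule power_mono) simp
   then show "norm ((?a n f)^2) <= (2 * CF)^2 * (1 + nm f)^4"
    by (simp add: power_mult_distrib flip: power_mult)
  qed
 qed simp
 then show ?thesis by simp
qed

definition "MU = real CARD('m) * (L * L)"

lemma U_pointwise: "norm (U f x) <= MU * (1 + norm (f x))"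
proof -
 have "norm (partial i F (Y (Psi f)) *\<^sub>R grad (\<phi> i) (f x)) <= L * (L * (1 + norm (f x)))" for i
  unfolding norm_scaleR by (intro mult_mono F1b C2_bound_grad[OF \<phi>b] L0) auto
 then have "norm (U f x) <= (\<Sum>i\<in>(UNIV::'m set). L * (L * (1 + norm (f x))))" unfolding U_def by (intro order_trans[OF norm_sum sum_mono])
 then show ?thesis by (simp add: MU_def mult.assoc)
qed

lemma vn_pointwise: "norm (lift (vn n) f x) <= MU * (1 + norm (f x))"
proof -
 have "norm (((cc n y *\<^sub>R grad F z) $ i) *\<^sub>R cut_grad n (\<phi> i) (f x)) <= (1 * L) * (L * (1 + norm (f x)))" for i y z
  unfolding norm_scaleR vector_scaleR_component real_scaleR_def abs_mult
  by (intro mult_mono sc_bounds(3) cut_grad_bound(2)[OF \<phi>b]) (use L0 F1b in \<open>auto simp: grad_def\<close>)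
 then have "norm (lift (vn n) f x) <= (\<Sum>i\<in>(UNIV::'m set). (1 * L) * (L * (1 + norm (f x))))"
  unfolding lift_def vn_def comp_def by (intro order_trans[OF norm_sum sum_mono])
 then show ?thesis by (simp add: MU_def mult.assoc)
qed

text \<open>The cut-off factors tend to 1, and a linear pointwise bound common to all n
  dominates.\<close>

lemma vn_conv: assumes f: "f : T" shows "conv (%n. lift (vn n) f) (U f)"
proof (rule conv_dominated)
 have vm: "lift (vn n) f : bm borel" for n by (rule T_measurable[OF lift_T[OF vn_version f]])
 show "lift (vn n) f : bm borel" for n by (rule vm)
 show Um: "U f : bm borel" by (rule T_measurable[OF U_T[OF f]])
 show "integrable lam (%x. 2 * MU^2 * (1 + (norm (f x))^2))" by (rule nm_growth(2)[OF f Um U_pointwise])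
 show "(norm (U f x))^2 <= 2 * MU^2 * (1 + (norm (f x))^2)" for x by (rule nm_growth(1)[OF f Um U_pointwise])
 show "(norm (lift (vn n) f x))^2 <= 2 * MU^2 * (1 + (norm (f x))^2)" for n x by (rule nm_growth(1)[OF f vm vn_pointwise])
 show "AE x in lam. (%n. lift (vn n) f x) ~~> U f x"
 proof (rule AE_I2)
  fix x
  have c: "(%n. cut_grad n (\<phi> i) (f x)) ~~> grad (\<phi> i) (f x)" for i
  proof -
   have "(%n. grad (\<phi> i) (cut n (f x))) ~~> grad (\<phi> i) (f x)"
    by (rule continuous_on_tendsto_compose[OF C1_fun_continuous(1)[OF C2_funD(1)[OF \<phi>2]] cut_tendsto]) auto
   then have "(%n. \<chi> k. cc n (f x $ k) * grad (\<phi> i) (cut n (f x)) $ k) ~~> (\<chi> k. 1 * grad (\<phi> i) (f x) $ k)"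
    by (intro tendsto_vec_lambda tendsto_mult cc_tendsto[OF tendsto_const] tendsto_vec_nth)
   then show ?thesis by (simp add: cut_grad_def)
  qed
  have p: "(%n. partial i F (yn n (Psi f))) ~~> partial i F (Y (Psi f))" for i
   by (rule continuous_on_tendsto_compose[OF F_continuous(2) yn_tendsto[OF f]]) auto
  have "(%n. \<Sum>i\<in>UNIV. (cc n (F (yn n (Psi f))) * partial i F (yn n (Psi f))) *\<^sub>R cut_grad n (\<phi> i) (f x)) ~~>
   (\<Sum>i\<in>UNIV. (1 * partial i F (Y (Psi f))) *\<^sub>R grad (\<phi> i) (f x))"
   by (intro tendsto_sum tendsto_scaleR tendsto_mult cc_tendsto[OF F_yn_tendsto[OF f]] p c)
  then show "(%n. lift (vn n) f x) ~~> U f x" by (simp add: lift_def vn_def U_def grad_def)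
 qed
qed

text \<open>\<open>tgrad (un n)\<close> rests on a chosen gradient version; replacing it by the
  explicit \<open>vn n\<close> alters the field only on \<open>lam\<close>-null sets and leaves
  \<open>Q\<close> unchanged. Convergence in mean square then passes to the form through the factor
  \<open>K\<close>.\<close>

lemma un_grad_tendsto: "(%n. qn (%f x. tgrad (un n) f x - U f x)) ~~> 0"
proof -
 define X where "X n f x = lift (vn n) f x - U f x" for n f x
 have bdv: "EX C. ALL mu:P2. ALL x. norm (vn n mu x) <= C" for n by (rule smooth_P2D(2)[OF un_smooth])
 have vF: "field (lift (vn n))" for n
 proof -
  obtain C where "!!mu x. mu : P2 ==> norm (vn n mu x) <= C" using bdv by blast
  then show ?thesis by (rule lift_field(1)[OF vn_version])
 qed
 have XF: "field (X n)" for n unfolding X_def by (rule field_diff[OF vF U_field])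
 let ?b = "%n f. %x. tgrad (un n) f x - U f x"
 have e: "Q (%f x. tgrad (un n) f x - U f x) (%f x. tgrad (un n) f x - U f x) = Q (X n) (X n)" for n
  unfolding Q_def
 proof (rule Bochner_Integration.integral_cong[OF refl])
  fix f assume "f : space G"
  then have f: "f : T" by simp
  have "AE x in lam. tgrad (un n) f x = lift (vn n) f x"
   unfolding tgrad_def
   by (rule lift_unique[OF continuous_grad_versionD[OF C1b_grad(1)[OF un_C1b]] continuous_grad_versionD[OF vn_version] f])
  then have a: "AE x in lam. tgrad (un n) f x - U f x = X n f x" by (simp add: X_def)
  have t: "(?b n f) : T" by (rule T_diff[OF field_T[OF tgrad(1)[OF un_C1b] f] U_T[OF f]])
  show "bq (?b n f) (?b n f) = bq (X n f) (X n f)"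
   by (rule bq_cong_AE[OF a a t field_T[OF XF f] t field_T[OF XF f]])
 qed
 have Xm: "(%f. (nm (X n f))^2) : bm TB" for n
  by (rule nm2_measurable) (use XF[of n] in \<open>auto simp: field_def\<close>)
 have Xb: "(nm (X n f))^2 <= 8 * MU^2 * (1 + nm f)^4" if f: "f : T" for n f
 proof -
  have l: "lift (vn n) f : T" by (rule lift_T[OF vn_version f])
  have "nm (X n f) <= nm (lift (vn n) f) + nm (U f)" unfolding X_def by (rule nm_diff_triangle[OF l U_T[OF f]])
  then have "(nm (X n f))^2 <= (nm (lift (vn n) f) + nm (U f))^2" by (rule power_mono) simp
  also have "... <= 2 * (nm (lift (vn n) f))^2 + 2 * (nm (U f))^2" using sum_squares_bound[of "nm (lift (vn n) f)" "nm (U f)"] by (simp add: power2_sum)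
  also have "... <= 2 * (2 * MU^2 * (1 + (nm f)^2)) + 2 * (2 * MU^2 * (1 + (nm f)^2))"
   using nm_growth(3)[OF f T_measurable[OF l] vn_pointwise] nm_growth(3)[OF f T_measurable[OF U_T[OF f]] U_pointwise] by linarith
  also have "... = 8 * MU^2 * (1 + (nm f)^2)" by simp
  also have "... <= 8 * MU^2 * (1 + nm f)^4"
  proof (rule mult_left_mono)
   have "1 + (nm f)^2 <= (1 + nm f)^2" by (simp add: power2_sum)
   also have "... <= (1 + nm f)^4" by (rule power_increasing) auto
   finally show "1 + (nm f)^2 <= (1 + nm f)^4" .
  qed simp
  finally show ?thesis .
 qed
 let ?a = "%X. %n. K * (LINT f|G. (nm (X n f))^2)"
 have "(%n. LINT f|G. (nm (X n f))^2) ~~> (LINT f|G. 0)"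
 proof (rule integral_dominated_convergence)
  show "(%f. (nm (X n f))^2) : bm G" for n using Xm[of n] by measurable
  show "integrable G (%f. 8 * MU^2 * (1 + nm f)^4)" by (rule growth_integrable[where C="8 * MU^2"]) auto
  show "AE f in G. (%n. (nm (X n f))^2) ~~> 0"
  proof (rule AE_I2)
   fix f assume "f : space G"
   then have "(%n. nm (X n f)) ~~> 0" using vn_conv[of f] by (simp add: conv_def X_def[abs_def])
   from tendsto_power[OF this, of 2] show "(%n. (nm (X n f))^2) ~~> 0" by simp
  qed
  show "AE f in G. norm ((nm (X n f))^2) <= 8 * MU^2 * (1 + nm f)^4" for n using Xb by (intro AE_I2) simp
 qed simp
 then have "(?a X) ~~> K * 0" by (intro tendsto_mult tendsto_const) simp
 then have l: "(?a X) ~~> 0" by simp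
 have "(%n. Q (X n) (X n)) ~~> 0"
  by (rule tendsto_by_bound[OF _ l]) (use Q_bound[OF XF] Q_nonneg[OF XF] in simp)
 from tendsto_real_sqrt[OF this] show ?thesis unfolding qn_def e by simp
qed

subsection \<open>The generator\<close>

definition gen_P2 :: "(real^'d) measure => real" where
 "gen_P2 mu = (\<Sum>i\<in>UNIV. partial i F (Y mu) * (cond_exp_push lam G (coeff_a lam B g (\<phi> i)) mu - l2_inner mu (%x. x) (grad (\<phi> i)))) +
  (\<Sum>i\<in>UNIV. \<Sum>j\<in>UNIV. partial i (partial j F) (Y mu) * cond_exp_push lam G (coeff_b lam B (\<phi> i) (\<phi> j)) mu)"

lemma coeff_a_measurable: "coeff_a lam B g (\<phi> i) : bm TB"
proof (rule borel_measurable_LIMSEQ_real)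
 show "(%N. \<Sum>m<N. ip (B (g m)) (hess (\<phi> i) f (g m))) ~~> coeff_a lam B g (\<phi> i) f" if "f : space TB" for f
  using coeff_a_sums(1)[OF \<phi>2 \<phi>b] that by (simp add: sums_def)
 show "(%f. \<Sum>m<N. ip (B (g m)) (hess (\<phi> i) f (g m))) : bm TB" for N
  by (intro borel_measurable_sum seqcont_measurable seqcont_hess[OF \<phi>2 \<phi>b] B_T g_T)
qed

lemma coeff_L2: "integrable G (%f. (coeff_a lam B g (\<phi> i) f)^2)" "integrable G (%f. (coeff_b lam B (\<phi> i) (\<phi> j) f)^2)"
 "coeff_b lam B (\<phi> i) (\<phi> j) : bm TB"
proof -
 show bm: "coeff_b lam B (\<phi> i) (\<phi> j) : bm TB"
  using bq_field(1)[OF grad_field grad_field, of i j] by (simp add: coeff_b_bq[abs_def])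
 show "integrable G (%f. (coeff_a lam B g (\<phi> i) f)^2)"
 proof (rule growth_square_integrable[OF coeff_a_measurable])
  fix f assume f: "f : T"
  have "1 <= (1 + nm f)^2" by (simp add: power2_sum)
  then have "L * K * 1 <= L * K * (1 + nm f)^2" using L0 K_nonneg by (intro mult_left_mono) auto
  then show "abs (coeff_a lam B g (\<phi> i) f) <= L * K * (1 + nm f)^2" using coeff_a_sums(3)[OF \<phi>2 \<phi>b f, of i] by simp
 qed
 show "integrable G (%f. (coeff_b lam B (\<phi> i) (\<phi> j) f)^2)"
 proof (rule growth_square_integrable[OF bm])
  fix f assume f: "f : T"
  have "abs (coeff_b lam B (\<phi> i) (\<phi> j) f) <= K * nm (grad (\<phi> i) o f) * nm (grad (\<phi> j) o f)"
   unfolding coeff_b_bq by (rule bq_bound[OF grad_T[OF f] grad_T[OF f]])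
  also have "... <= K * (2 * L * (1 + nm f)) * (2 * L * (1 + nm f))" using grad_bound[OF f] K_nonneg L0 by (intro mult_mono mult_nonneg_nonneg) auto
  also have "... = K * (2 * L) * (2 * L) * (1 + nm f)^2" by (simp only: power2_eq_square mult_ac)
  finally show "abs (coeff_b lam B (\<phi> i) (\<phi> j) f) <= K * (2 * L) * (2 * L) * (1 + nm f)^2" .
 qed
qed

text \<open>The drift term is already a function of the push-forward and therefore appears
  unconditioned in \<open>gen_P2\<close>.\<close>

lemma id_grad_L2: "(%mu. l2_inner mu (%x. x) (grad (\<phi> i))) : L2_fun (image_law lam G)"
 "f : T ==> l2_inner (Psi f) (%x. x) (grad (\<phi> i)) = ip f (grad (\<phi> i) o f)"
proof -
 have gm: "grad (\<phi> i) : bm borel" by (rule borel_measurable_continuous_onI[OF C1_fun_continuous(1)[OF C2_funD(1)[OF \<phi>2]]])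
 let ?b = "grad (\<phi> i)"
 show e: "l2_inner (Psi f) (%x. x) ?b = ip f (grad (\<phi> i) o f)" if "f : T" for f
  using l2_inner_push[OF that measurable_ident gm] by (simp add: comp_def id_def)
 let ?a = "%mu. l2_inner mu (%x. x) ?b"
 have m: "?a : bm P2_borel"
  unfolding l2_inner_def by (rule measurable_P2_integral) (use gm in measurable)
 have "integrable G (%f. (l2_inner (Psi f) (%x. x) ?b)^2)"
 proof (rule growth_square_integrable[OF measurable_compose[OF measurable_push m]])
  fix f assume f: "f : T"
  have "abs (ip f (grad (\<phi> i) o f)) <= (1 + nm f) * (2 * L * (1 + nm f))"
   by (rule order_trans[OF ip_bound[OF f grad_T[OF f]] mult_mono]) (use grad_bound[OF f] L0 in auto)
  also have "... = 2 * L * (1 + nm f)^2" by (simp only: power2_eq_square mult_ac)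
  finally show "abs (l2_inner (Psi f) (%x. x) ?b) <= 2 * L * (1 + nm f)^2" unfolding e[OF f] .
 qed
 then show "?a : L2_fun (image_law lam G)" using m by (simp add: L2_fun_image_law)
qed

end

context gaussian_space
begin

section \<open>Square integrability of the conditioned expression\<close>

lemma L2_fun_diff:
 assumes "p : L2_fun (image_law lam G)" "r : L2_fun (image_law lam G)"
 shows "(%mu. p mu - r mu) : L2_fun (image_law lam G)"
proof -
 have m: "p : bm P2_borel" "r : bm P2_borel" using assms by (auto simp: L2_fun_image_law)
 have "integrable G (%f. (p (Psi f) - r (Psi f))^2)"
  by (rule L2_square_sum(1)) (use assms m in \<open>auto simp: L2_fun_image_law\<close>)
 then show ?thesis using m by (simp add: L2_fun_image_law)
qed

lemma L2_fun_bounded_mult: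
 assumes r: "r : bm P2_borel" and b: "!!mu. mu : P2 ==> abs (r mu) <= C" and p: "p : L2_fun (image_law lam G)"
 shows "(%mu. r mu * p mu) : L2_fun (image_law lam G)"
proof -
 have pm: "p : bm P2_borel" and p2: "integrable G (%f. (p (Psi f))^2)" using p by (auto simp: L2_fun_image_law)
 let ?a = "%f. r (Psi f) * p (Psi f)"
 have "integrable G (%f. (?a f)^2)"
 proof (rule Bochner_Integration.integrable_bound)
  show "integrable G (%f. C^2 * (p (Psi f))^2)" using p2 by simp
  show "AE f in G. norm ((?a f)^2) <= norm (C^2 * (p (Psi f))^2)"
  proof (rule AE_I2)
   fix f assume "f : space G"
   then have "abs (r (Psi f))^2 <= C^2" using b[OF push_P2, of f] by (intro power_mono) auto
   then have "(r (Psi f))^2 * (p (Psi f))^2 <= C^2 * (p (Psi f))^2" by (intro mult_right_mono) auto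
   then show "norm ((?a f)^2) <= norm (C^2 * (p (Psi f))^2)" by (simp add: power_mult_distrib)
  qed
  show "(%f. (?a f)^2) : bm G" using r pm by measurable
 qed
 then show ?thesis using r pm by (simp add: L2_fun_image_law)
qed

lemma L2_fun_zero: "(%mu. 0) : L2_fun (image_law lam G)"
 by (simp add: L2_fun_image_law)

lemma L2_fun_add:
 assumes p: "p : L2_fun (image_law lam G)" and r: "r : L2_fun (image_law lam G)"
 shows "(%mu. p mu + r mu) : L2_fun (image_law lam G)"
 using L2_fun_diff[OF p L2_fun_diff[OF L2_fun_zero r]] by simp

lemma L2_fun_sum: "(!!i. i : I ==> p i : L2_fun (image_law lam G)) ==> (%mu. \<Sum>i\<in>I. p i mu) : L2_fun (image_law lam G)"
 by (induction I rule: infinite_finite_induct) (auto intro: L2_fun_add L2_fun_zero)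

lemma bounded_L2_integrable:
 fixes r :: "(real^'d) measure => real" and h :: "(real^'d => real^'d) => real"
 assumes r: "r : bm P2_borel" and b: "!!mu. mu : P2 ==> abs (r mu) <= C"
  and h: "h : bm TB" "integrable G (%f. (h f)^2)"
 shows "integrable G (%f. r (Psi f) * h f)"
proof (rule L2_product_bound(1))
 show rm: "(%f. r (Psi f)) : bm G" using r by measurable
 show "integrable G (%f. (r (Psi f))^2)"
 proof (rule G.integrable_const_bound[where B="C^2"])
  show "AE f in G. norm ((r (Psi f))^2) <= C^2"
  proof (rule AE_I2)
   fix f assume "f : space G"
   then have "abs (r (Psi f))^2 <= C^2" using b[OF push_P2, of f] by (intro power_mono) auto
   then show "norm ((r (Psi f))^2) <= C^2" by simp
  qed
 qed (use rm in measurable)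
qed (use h in measurable)

end

context cylinder
begin

lemma gen_P2_L2: "gen_P2 : L2_fun (image_law lam G)"
 unfolding gen_P2_def[abs_def]
 by (intro L2_fun_add L2_fun_sum L2_fun_bounded_mult[where C=L] L2_fun_diff cond_exp_push_L2 coeff_L2 coeff_a_measurable id_grad_L2(1) F1b F2b
   measurable_compose[OF Y_measurable partial_measurable(1)] measurable_compose[OF Y_measurable partial_measurable(2)])

text \<open>\<open>r1\<close> and \<open>r2\<close> combine \<open>v\<close> with the derivatives of
  \<open>F\<close> into bounded functions of the measure. Against such weights each conditional
  expectation may be replaced by its coefficient.\<close>

lemma integral_gen_P2:
 assumes v: "v : C1b_P2"
 shows "(LINT f|G. gen_P2 (Psi f) * v (Psi f)) = (LINT f|G. gen f * v (Psi f))"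
proof -
 obtain Cv where Cv: "!!mu. mu : P2 ==> abs (v mu) <= Cv" using C1b_bounded[OF v] by blast
 define r1 where "r1 i mu = v mu * partial i F (Y mu)" for i mu
 define r2 where "r2 i j mu = v mu * partial i (partial j F) (Y mu)" for i j mu
 note [measurable] = C1b_measurable[OF v]
 have r1m: "r1 i : bm P2_borel" for i unfolding r1_def by measurable
 have r2m: "r2 i j : bm P2_borel" for i j unfolding r2_def by measurable
 have r1b: "abs (r1 i mu) <= Cv * L" and r2b: "abs (r2 i j mu) <= Cv * L" if "mu : P2" for i j mu
  unfolding r1_def r2_def abs_mult using Cv[OF that] F1b F2b by (auto intro!: mult_mono intro: order_trans[OF abs_ge_zero])
 let ?ca = "%i. coeff_a lam B g (\<phi> i)" and ?cb = "%i j. coeff_b lam B (\<phi> i) (\<phi> j)"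
 have ia: "integrable G (%f. r1 i (Psi f) * ?ca i f)" for i
  by (rule bounded_L2_integrable[OF r1m r1b coeff_a_measurable coeff_L2(1)])
 have ib: "integrable G (%f. r2 i j (Psi f) * ?cb i j f)" for i j
  by (rule bounded_L2_integrable[OF r2m r2b coeff_L2(3) coeff_L2(2)])
 note ea = integral_cond_exp_push[OF r1m coeff_a_measurable ia]
 note eb = integral_cond_exp_push[OF r2m coeff_L2(3) ib]
 let ?b = "%i f. grad (\<phi> i) o f"
 have ii: "integrable G (%f. r1 i (Psi f) * ip f (?b i f))" for i
 proof -
  have l: "(%mu. l2_inner mu (%x. x) (grad (\<phi> i))) : bm P2_borel"
   "integrable G (%f. (l2_inner (Psi f) (%x. x) (grad (\<phi> i)))^2)" using id_grad_L2(1)[of i] by (auto simp: L2_fun_image_law)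
  have "integrable G (%f. r1 i (Psi f) * l2_inner (Psi f) (%x. x) (grad (\<phi> i)))"
   by (rule bounded_L2_integrable[OF r1m r1b measurable_compose[OF measurable_push l(1)] l(2)])
  then show ?thesis by (rule Bochner_Integration.integrable_cong[THEN iffD1, OF refl, rotated]) (simp add: id_grad_L2(2))
 qed
 let ?a = "%r1 f. \<Sum>i\<in>UNIV. r1 i (Psi f) * cond_exp_push lam G (?ca i) (Psi f) - r1 i (Psi f) * ip f (?b i f)"
 let ?c = "%r2 f. \<Sum>i\<in>UNIV. \<Sum>j\<in>UNIV. r2 i j (Psi f) * cond_exp_push lam G (?cb i j) (Psi f)"
 let ?d = "%r1 f. \<Sum>i\<in>UNIV. r1 i (Psi f) * ?ca i f - r1 i (Psi f) * ip f (?b i f)"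
 have "(LINT f|G. gen_P2 (Psi f) * v (Psi f)) =
  (LINT f|G. (?a r1 f) +
   (?c r2 f))"
 proof (rule Bochner_Integration.integral_cong[OF refl])
  fix f assume "f : space G"
  then show "gen_P2 (Psi f) * v (Psi f) =
   (?a r1 f) +
   (?c r2 f)"
   by (simp add: gen_P2_def id_grad_L2(2) r1_def r2_def distrib_left distrib_right sum_distrib_left sum_distrib_right right_diff_distrib left_diff_distrib mult_ac)
 qed
 also have "... = (\<Sum>i\<in>UNIV. (LINT f|G. r1 i (Psi f) * cond_exp_push lam G (?ca i) (Psi f)) - (LINT f|G. r1 i (Psi f) * ip f (?b i f))) +
   (\<Sum>i\<in>UNIV. \<Sum>j\<in>UNIV. LINT f|G. r2 i j (Psi f) * cond_exp_push lam G (?cb i j) (Psi f))"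
  using ea(1) eb(1) ii by simp
 also have "... = (\<Sum>i\<in>UNIV. (LINT f|G. r1 i (Psi f) * ?ca i f) - (LINT f|G. r1 i (Psi f) * ip f (?b i f))) +
   (\<Sum>i\<in>UNIV. \<Sum>j\<in>UNIV. LINT f|G. r2 i j (Psi f) * ?cb i j f)"
  unfolding ea(2) eb(2) ..
 also have "... = (LINT f|G. (?d r1 f) +
   (\<Sum>i\<in>UNIV. \<Sum>j\<in>UNIV. r2 i j (Psi f) * ?cb i j f))"
  using ia ib ii by simp
 also have "... = (LINT f|G. gen f * v (Psi f))"
 proof (rule Bochner_Integration.integral_cong[OF refl])
  fix f
  show "(?d r1 f) +
   (\<Sum>i\<in>UNIV. \<Sum>j\<in>UNIV. r2 i j (Psi f) * ?cb i j f) = gen f * v (Psi f)"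
   by (simp add: gen_def r1_def r2_def distrib_left distrib_right sum_distrib_left sum_distrib_right right_diff_distrib left_diff_distrib mult_ac)
 qed
 finally show ?thesis .
qed

theorem cylinder_generator:
 "(%mu. F (Y mu)) : generator_domain lam B G" "AE mu in image_law lam G. generator lam B G (%mu. F (Y mu)) mu = gen_P2 mu"
proof -
 have ibp: "Q U (tgrad v) = - (LINT f|G. gen_P2 (Psi f) * v (Psi f))" if "v : C1b_P2" for v
  unfolding integral_gen_P2[OF that] by (rule generator_by_parts[OF that])
 show "(%mu. F (Y mu)) : generator_domain lam B G" "AE mu in image_law lam G. generator lam B G (%mu. F (Y mu)) mu = gen_P2 mu"
  by (rule generator_criterion[OF u_L2 U_field un_C1b un_tendsto un_grad_tendsto gen_P2_L2 ibp]; assumption)+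
qed

end

text \<open>For the preimage x of \<open>h\<close> one has <h, x> = <A x, x>, which is positive
  unless x vanishes almost everywhere; in that case A x = h would vanish too, against the norm
  1.\<close>

lemma inverse_op_nondegenerate:
 fixes lam :: "(real^'d) measure"
 assumes lam: "lam : P2" and sa: "self_adjoint lam DA A" and sp: "strictly_positive lam DA A" and sj: "surjective_operator lam DA A"
  and h: "h : tangent lam" "l2_inner lam h h = 1"
 shows "0 < l2_inner lam h (inverse_op lam DA A h)"
proof -
 interpret l2_space lam by (rule P2_l2_space[OF lam])
 define x where "x = inverse_op lam DA A h"
 have "EX f. f : DA & (AE x in lam. A f x = h x)" using sj h(1) by (auto simp: surjective_operator_def)
 from someI_ex[OF this] have x: "x : DA" "AE z in lam. A x z = h z" unfolding x_def inverse_op_def by blast+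
 have dd: "densely_defined_operator lam DA A" using sa by (simp add: self_adjoint_def)
 have T: "x : T" "A x : T" using dd x(1) by (auto simp: densely_defined_operator_def)
 let ?a = "%z. 0"
 have "~ (AE z in lam. x z = 0)"
 proof
  assume 0: "AE z in lam. x z = 0"
  have z: "?a : DA" using dd by (simp add: densely_defined_operator_def)
  have scale: "ALL f:DA. ALL c. (%z. c *\<^sub>R f z) : DA & (AE z in lam. A (%z. c *\<^sub>R f z) z = c *\<^sub>R A f z)"
   using dd unfolding densely_defined_operator_def by (elim conjE)
  have cong: "ALL f:DA. ALL g:T. (AE z in lam. f z = g z) --> g : DA & (AE z in lam. A f z = A g z)"
   using dd unfolding densely_defined_operator_def by (elim conjE)
  \<comment> \<open>Homogeneity with factor 0 shows that \<open>A\<close> maps the zero field to 0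
    almost everywhere.\<close>
  have "AE z in lam. A (%z. 0 *\<^sub>R (0 :: real^'d)) z = 0 *\<^sub>R A ?a z"
   by (rule conjunct2[OF spec[OF bspec[OF scale z]]])
  moreover have "AE z in lam. A ?a z = A x z"
  proof -
   have "AE z in lam. 0 = x z" using 0 by eventually_elim simp
   then show ?thesis by (rule conjunct2[OF mp[OF bspec[OF bspec[OF cong z] T(1)]]])
  qed
  ultimately have "AE z in lam. h z = 0" using x(2) by eventually_elim simp
  then have "ip h h = ip ?a ?a" using h(1) by (intro ip_cong_AE) auto
  then show False using h(2) by simp
 qed
 then have "0 < ip (A x) x" using sp x(1) by (simp add: strictly_positive_def)
 also have "ip (A x) x = ip h x" by (rule ip_cong_AE) (use x T h in auto)
 finally show ?thesis by (simp add: x_def)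
qed

theorem theorem3p3:
  fixes lam :: "(real^'d) measure"
    and DA :: "(real^'d \<Rightarrow> real^'d) set"
    and A :: "(real^'d \<Rightarrow> real^'d) \<Rightarrow> real^'d \<Rightarrow> real^'d"
    and G :: "(real^'d \<Rightarrow> real^'d) measure"
    and g :: "nat \<Rightarrow> real^'d \<Rightarrow> real^'d"
    and F :: "real^'m \<Rightarrow> real"
    and \<phi> :: "'m \<Rightarrow> real^'d \<Rightarrow> real"
  defines "B \<equiv> inverse_op lam DA A"
    and "y \<equiv> \<lambda>\<mu>. \<chi> i. (\<integral>x. \<phi> i x \<partial>\<mu>)"
  assumes "lam \<in> P2" and "absolutely_continuous lborel lam"
    and "self_adjoint lam DA A" and "strictly_positive lam DA A"
    and "surjective_operator lam DA A" and "trace_class lam B"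
    and "centered_gaussian lam G" and "has_covariance lam G B"
    and "orthonormal_basis lam g"
    and "C2_fun F" and "\<And>i. C2_fun (\<phi> i)"
    and "\<And>i. bounded (range (partial i F))"
    and "\<And>i j. bounded (range (partial i (partial j F)))"
    and "\<And>i k l. bounded (range (partial k (partial l (\<phi> i))))"
  shows "(\<lambda>\<mu>. F (y \<mu>)) \<in> generator_domain lam B G \<and>
    (AE \<mu> in image_law lam G.
       generator lam B G (\<lambda>\<mu>. F (y \<mu>)) \<mu> =
         (\<Sum>i\<in>UNIV. partial i F (y \<mu>) *
            (cond_exp_push lam G (coeff_a lam B g (\<phi> i)) \<mu> - l2_inner \<mu> (\<lambda>x. x) (grad (\<phi> i)))) +
         (\<Sum>i\<in>UNIV. \<Sum>j\<in>UNIV. partial i (partial j F) (y \<mu>) *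
            cond_exp_push lam G (coeff_b lam B (\<phi> i) (\<phi> j)) \<mu>))"
proof -
 have "EX L. ALL i. C2_bound (\<phi> i) L"
  by (rule uniform_const[OF C2_bound_exists C2_bound_mono]) (use assms in auto)
 then obtain L1 where L1: "!!i. C2_bound (\<phi> i) L1" by blast
 have "EX L. ALL i. ALL z. abs (partial i F z) <= L"
  by (rule uniform_const) (use assms(14) in \<open>auto simp: bounded_iff intro: order_trans\<close>)
 then obtain L2 where L2: "!!i z. abs (partial i F z) <= L2" by blast
 have "EX L. ALL ij. ALL z. abs (partial (fst ij) (partial (snd ij) F) z) <= L"
  by (rule uniform_const) (use assms(15) in \<open>auto simp: bounded_iff intro: order_trans\<close>)
 then obtain L3 where L3: "!!i j z. abs (partial i (partial j F) z) <= L3" by fastforce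
 \<comment> \<open>The maximum serves at once for the bounds on the \<phi> i and on the first and
   second derivatives of \<open>F\<close>, as the locale expects a common constant.\<close>
 define L where "L = max L1 (max L2 L3)"
 have onb: "g n : tangent lam" "l2_inner lam (g n) (g n) = 1" for n
  using assms(11) by (auto simp: orthonormal_basis_def)
 interpret cylinder lam g B G F \<phi> L
 proof
  show "0 < l2_inner lam (g n) (B (g n))" for n
   unfolding B_def by (rule inverse_op_nondegenerate[OF assms(3,5,6,7) onb])
  show "C2_bound (\<phi> i) L" for i by (rule C2_bound_mono[OF L1]) (simp add: L_def)
  show "abs (partial i F z) <= L" for i z using L2[of i z] by (simp add: L_def)
  show "abs (partial i (partial j F) z) <= L" for i j z using L3[of i j z] by (simp add: L_def)
 qed (use assms in auto)
 have "Y = y" by (simp add: fun_eq_iff Y_def y_def)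
 then show ?thesis using cylinder_generator unfolding gen_P2_def by simp
qed

end
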